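(* Let $\xi=(\xi_t)_{t\ge 0}$ be a subordinator in the class $(\mathcal L)$ with Lévy density $g$ and constant $g_0$, realized on the canonical space $(\Omega,\mathcal F,\mathbb P)$ with filtration $(\mathcal F_t)_{t\ge0}$ (see context). Let $m:\mathbb R_+\times\mathbb R_+\to(0,+\infty)$ be measurable, such that $m$ and $1/m$ are bounded and $\mathbb R_+\ni a\mapsto m(s,a)$ is Lipschitz uniformly in $s\ge0$. Consider the stochastic differential equation $$dX_t=m(t,X_{t-})\,d\xi_t,\qquad X_0=0.$$ Then there exists a pathwise-unique solution $X$ of this equation, and the law of $(X,\xi)$ under $\mathbb P$ coincides with the law of $(\xi,\xi^H)$ under $\mathbb P^H$, where $$H(s,x):=\frac{x}{m(s,\xi_{s-})},\qquad s\ge0,\ x\ge0,$$ and $\xi^H$ and $\mathbb P^H$ are associated with $H$ as in the context.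
   Context: $\mathbb R_+=[0,\infty)$. A subordinator is a non-decreasing càdlàg Lévy process $\xi$ with $\xi_0=0$. It is in the class $(\mathcal L)$ if it has zero drift and Lévy measure $\nu(dx)=g(x)\,dx$ on $]0,\infty[$, where $g:\,]0,\infty[\,\to\mathbb R_+$ is measurable, $g>0$, $\int_1^\infty g(x)\,dx<\infty$, and there exist $g_0\ge 0$ and a measurable $\zeta:[0,1]\to\mathbb R$ with $\int_0^1|\zeta(x)|\,dx<\infty$ such that $g(x)=\frac{g_0}{x}+\zeta(x)$ for all $x\in\,]0,1]$. Canonical space: $\Omega$ is the set of non-decreasing càdlàg functions $\omega:[0,\infty)\to\mathbb R_+$ with $\omega(0)=0$, $\xi_t(\omega)=\omega(t)$, $\mathcal F_t=\sigma(\xi_s:s\le t)$, $\mathcal F=\sigma(\xi_s:s\ge0)$, and $\mathbb P$ is the law of the subordinator. $\Delta\xi_s=\xi_s-\xi_{s-}$. Sums and products over $s\le t$ effectively run over the countable set of jump times of $\xi$ in $[0,t]$. For $H$ of the form $H(s,x)=\int_0^xh(s,y)\,dy$ (here $h(s,x)=1/m(s,\xi_{s-})$, constant in $x$), set $\xi^H_t:=\sum_{s\le t}H(s,\Delta\xi_s)$, which here equals $\int_0^t\frac{1}{m(s,\xi_{s-})}\,d\xi_s$, and $$M_t^H:=\exp\left(g_0\int_0^t\log h(s,0)\,ds\right)\prod_{s\le t}\left[h(s,\Delta\xi_s)\cdot\frac{g(H(s,\Delta\xi_s))}{g(\Delta\xi_s)}\right],$$ with the factor in square brackets taken to be $1$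 when $\Delta\xi_s=0$. The process $M^H$ is a positive $(\mathcal F_t,\mathbb P)$-martingale with mean $1$, and $\mathbb P^H$ is the unique probability measure on $(\Omega,\mathcal F)$ with $\mathbb P^H_{|\mathcal F_t}=M^H_t\cdot\mathbb P_{|\mathcal F_t}$ for all $t\ge0$. Integrals against $d\xi$ are pathwise Lebesgue–Stieltjes integrals. *)

theory Defs
  imports "HOL-Probability.Probability"
begin

section \<open>Paths\<close>

text \<open>Time is the half-line \<open>{0..}\<close> inside \<open>real\<close>; values at negative times are irrelevant
  unless stated otherwise.\<close>

definition cadlag :: "(real \<Rightarrow> real) \<Rightarrow> bool" where
  "cadlag x \<longleftrightarrow>
     (\<forall>t\<ge>0. continuous (at_right t) x) \<and> (\<forall>t>0. \<exists>l. (x \<longlongrightarrow> l) (at_left t))"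

definition left_lim :: "(real \<Rightarrow> real) \<Rightarrow> real \<Rightarrow> real" where
  "left_lim x s = Lim (at_left s) x"

definition jump :: "(real \<Rightarrow> real) \<Rightarrow> real \<Rightarrow> real" where
  "jump x s = x s - left_lim x s"

text \<open>A path is extended by \<open>0\<close> to negative times.  Hence it is nondecreasing and right-continuous
  on all of \<open>real\<close>, \<^const>\<open>interval_measure\<close> is its Lebesgue--Stieltjes measure, and
  \<open>left_lim \<omega> 0 = 0\<close>, so that there is no jump at time \<open>0\<close>.\<close>

definition paths :: "(real \<Rightarrow> real) set" where
  "paths = {\<omega>. (\<forall>t<0. \<omega> t = 0) \<and> \<omega> 0 = 0 \<and> cadlag \<omega> \<and> mono_on {0..} \<omega>}"

definition coord :: "real \<Rightarrow> (real \<Rightarrow> real) \<Rightarrow> real" where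
  "coord t \<omega> = \<omega> t"

definition canonical_space :: "(real \<Rightarrow> real) measure" where
  "canonical_space =
     sigma paths {coord s -` A \<inter> paths | s A. 0 \<le> s \<and> A \<in> sets borel}"

definition canonical_filtration :: "real \<Rightarrow> (real \<Rightarrow> real) measure" where
  "canonical_filtration t =
     sigma paths {coord s -` A \<inter> paths | s A. 0 \<le> s \<and> s \<le> t \<and> A \<in> sets borel}"


section \<open>Subordinators\<close>

definition levy_process :: "'a measure \<Rightarrow> (real \<Rightarrow> 'a \<Rightarrow> real) \<Rightarrow> bool" where
  "levy_process M X \<longleftrightarrow>
     prob_space M \<and>
     (\<forall>t\<ge>0. X t \<in> borel_measurable M) \<and>
     (\<forall>\<omega>\<in>space M. X 0 \<omega> = 0 \<and> cadlag (\<lambda>t. X t \<omega>)) \<and>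
     (\<forall>(n::nat) (t::nat \<Rightarrow> real). 0 \<le> t 0 \<and> (\<forall>i<n. t i \<le> t (Suc i)) \<longrightarrow>
        prob_space.indep_vars M (\<lambda>_. borel)
          (\<lambda>i \<omega>. X (t (Suc i)) \<omega> - X (t i) \<omega>) {..<n}) \<and>
     (\<forall>s\<ge>0. \<forall>u\<ge>0. distr M borel (\<lambda>\<omega>. X (s + u) \<omega> - X s \<omega>) = distr M borel (X u))"

definition subordinator :: "'a measure \<Rightarrow> (real \<Rightarrow> 'a \<Rightarrow> real) \<Rightarrow> bool" where
  "subordinator M X \<longleftrightarrow>
     levy_process M X \<and> (\<forall>\<omega>\<in>space M. mono_on {0..} (\<lambda>t. X t \<omega>))"

text \<open>Drift \<open>d\<close> and Levy measure \<open>\<nu>\<close> of a subordinator, through the Levy--Khintchine formula for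
  its Laplace transform.\<close>

definition has_drift_and_levy_measure ::
    "'a measure \<Rightarrow> (real \<Rightarrow> 'a \<Rightarrow> real) \<Rightarrow> real \<Rightarrow> real measure \<Rightarrow> bool" where
  "has_drift_and_levy_measure M X d \<nu> \<longleftrightarrow>
     0 \<le> d \<and> sets \<nu> = sets borel \<and> emeasure \<nu> {..0} = 0 \<and>
     (\<integral>\<^sup>+x. ennreal (min 1 x) \<partial>\<nu>) < \<infinity> \<and>
     (\<forall>t\<ge>0. \<forall>q\<ge>0. (\<integral>\<omega>. exp (- q * X t \<omega>) \<partial>M) =
        exp (- t * (d * q + (\<integral>x. 1 - exp (- q * x) \<partial>\<nu>))))"

definition levy_density_measure :: "(real \<Rightarrow> real) \<Rightarrow> real measure" where
  "levy_density_measure g = density lborel (\<lambda>x. ennreal (g x) * indicator {0<..} x)"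

text \<open>\<open>g0\<close> is determined by \<open>g\<close>, because \<open>1 / x\<close> is not integrable near \<open>0\<close>.\<close>

definition class_L_density :: "(real \<Rightarrow> real) \<Rightarrow> real \<Rightarrow> bool" where
  "class_L_density g g0 \<longleftrightarrow>
     g \<in> borel_measurable (restrict_space borel {0<..}) \<and>
     (\<forall>x>0. g x > 0) \<and>
     set_integrable lborel {1<..} g \<and>
     0 \<le> g0 \<and>
     (\<exists>\<zeta>::real \<Rightarrow> real. \<zeta> \<in> borel_measurable (restrict_space borel {0..1}) \<and>
        set_integrable lborel {0..1} \<zeta> \<and> (\<forall>x\<in>{0<..1}. g x = g0 / x + \<zeta> x))"

definition subordinator_class_L ::
    "'a measure \<Rightarrow> (real \<Rightarrow> 'a \<Rightarrow> real) \<Rightarrow> (real \<Rightarrow> real) \<Rightarrow> real \<Rightarrow> bool" where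
  "subordinator_class_L M X g g0 \<longleftrightarrow>
     subordinator M X \<and> class_L_density g g0 \<and>
     has_drift_and_levy_measure M X 0 (levy_density_measure g)"


section \<open>The transformed process and the transformed measure\<close>

text \<open>The predictable fields \<open>h\<close> and \<open>H\<close> take the path as an explicit first argument:
  \<open>h \<omega> s x\<close> stands for \<open>h(s,x)\<close>, and \<open>H \<omega> s x\<close> is the integral of \<open>h \<omega> s\<close> over \<open>[0,x]\<close>.
  The sum and the product below are unordered, and \<open>jump \<omega> s\<close> vanishes outside a countable set.\<close>

definition xi_H ::
    "((real \<Rightarrow> real) \<Rightarrow> real \<Rightarrow> real \<Rightarrow> real) \<Rightarrow> real \<Rightarrow> (real \<Rightarrow> real) \<Rightarrow> real" where
  "xi_H H t \<omega> = (\<Sum>\<^sub>\<infinity>s\<in>{0..t}. H \<omega> s (jump \<omega> s))"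

definition unordered_prod :: "('a \<Rightarrow> real) \<Rightarrow> 'a set \<Rightarrow> real" where
  "unordered_prod f A = Lim (finite_subsets_at_top A) (\<lambda>F. \<Prod>x\<in>F. f x)"

definition M_H ::
    "(real \<Rightarrow> real) \<Rightarrow> real \<Rightarrow> ((real \<Rightarrow> real) \<Rightarrow> real \<Rightarrow> real \<Rightarrow> real) \<Rightarrow>
     ((real \<Rightarrow> real) \<Rightarrow> real \<Rightarrow> real \<Rightarrow> real) \<Rightarrow> real \<Rightarrow> (real \<Rightarrow> real) \<Rightarrow> real" where
  "M_H g g0 h H t \<omega> =
     exp (g0 * (LINT s:{0..t}|lborel. ln (h \<omega> s 0))) *
     unordered_prod
       (\<lambda>s. if jump \<omega> s = 0 then 1
            else h \<omega> s (jump \<omega> s) * (g (H \<omega> s (jump \<omega> s)) / g (jump \<omega> s)))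
       {0..t}"

definition P_H ::
    "(real \<Rightarrow> real) measure \<Rightarrow> (real \<Rightarrow> real) \<Rightarrow> real \<Rightarrow>
     ((real \<Rightarrow> real) \<Rightarrow> real \<Rightarrow> real \<Rightarrow> real) \<Rightarrow>
     ((real \<Rightarrow> real) \<Rightarrow> real \<Rightarrow> real \<Rightarrow> real) \<Rightarrow> (real \<Rightarrow> real) measure" where
  "P_H P g g0 h H =
     (THE Q. prob_space Q \<and> sets Q = sets canonical_space \<and>
        (\<forall>t\<ge>0. \<forall>A\<in>sets (canonical_filtration t).
           emeasure Q A = (\<integral>\<^sup>+\<omega>\<in>A. ennreal (M_H g g0 h H t \<omega>) \<partial>P)))"


section \<open>The stochastic differential equation\<close>

definition sde_h ::
    "(real \<Rightarrow> real \<Rightarrow> real) \<Rightarrow> (real \<Rightarrow> real) \<Rightarrow> real \<Rightarrow> real \<Rightarrow> real" where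
  "sde_h m \<omega> s x = 1 / m s (left_lim \<omega> s)"

definition sde_H ::
    "(real \<Rightarrow> real \<Rightarrow> real) \<Rightarrow> (real \<Rightarrow> real) \<Rightarrow> real \<Rightarrow> real \<Rightarrow> real" where
  "sde_H m \<omega> s x = x / m s (left_lim \<omega> s)"

lemma sde_H_eq_integral:
  "0 \<le> x \<Longrightarrow> sde_H m \<omega> s x = (LINT y:{0..x}|lborel. sde_h m \<omega> s y)"
  by (simp add: sde_H_def sde_h_def set_lebesgue_integral_def)

text \<open>\<open>X\<close> solves \<open>dX = m(t, X_{t-}) dZ\<close> with \<open>X_0 = 0\<close>.  It takes values in \<open>{0..}\<close>, which is where
  \<open>m\<close> lives.  The driving process \<open>Z\<close> has all its paths in \<^const>\<open>paths\<close>.  Adaptedness of \<open>X\<close> is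
  deliberately left out: uniqueness then holds among the solutions adapted to any filtration.\<close>

definition sde_solution ::
    "'a measure \<Rightarrow> (real \<Rightarrow> real \<Rightarrow> real) \<Rightarrow> (real \<Rightarrow> 'a \<Rightarrow> real) \<Rightarrow> (real \<Rightarrow> 'a \<Rightarrow> real) \<Rightarrow> bool" where
  "sde_solution M m Z X \<longleftrightarrow>
     (\<forall>t\<ge>0. X t \<in> borel_measurable M) \<and>
     (\<forall>\<omega>\<in>space M. cadlag (\<lambda>t. X t \<omega>) \<and> (\<forall>t\<ge>0. 0 \<le> X t \<omega>)) \<and>
     (AE \<omega> in M. X 0 \<omega> = 0 \<and>
        (\<forall>t\<ge>0. X t \<omega> =
           (LINT s:{0<..t}|interval_measure (\<lambda>r. Z r \<omega>). m s (left_lim (\<lambda>r. X r \<omega>) s))))"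

text \<open>The law of a process, on the product \<open>\<sigma>\<close>-algebra over the time set \<open>{0..}\<close>.\<close>

definition process_law ::
    "'a measure \<Rightarrow> (real \<Rightarrow> 'a \<Rightarrow> 'b::topological_space) \<Rightarrow> (real \<Rightarrow> 'b) measure" where
  "process_law M X = distr M (\<Pi>\<^sub>M t\<in>{0..}. borel) (\<lambda>\<omega>. \<lambda>t\<in>{0..}. X t \<omega>)"

end

theory Submission
  imports Defs
begin

text \<open>The equation is solved path by path, which gives an adapted map \<open>sol\<close> on the space of paths whose
  inverse \<open>inv_int\<close> integrates \<open>1 / m(s, \<xi>_{s-})\<close> against \<open>\<xi>\<close>.  As \<open>\<xi>\<close> is a pure jump path,
  \<open>\<xi>\<^sup>H = inv_int \<xi>\<close>, and everything reduces to the claim that \<open>inv_int \<xi>\<close> has the law \<open>P\<close> under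
  \<open>P\<^sup>H\<close>.  Laplace functionals determine laws on path space, so it suffices that
  \<open>E[M\<^sup>H_t exp(- \<integral> q d\<xi>\<^sup>H)] = exp(- \<integral> \<psi>(q(s)) ds)\<close> for all step functions \<open>q \<ge> 0\<close>, where \<open>\<psi>\<close> is the
  Laplace exponent.  The quotient of the two sides is the mean of a compensated product over the
  jumps of \<open>\<phi>(s, x) = h g(h x) / g(x) exp(- q h x)\<close>: its compensator \<open>\<integral> (\<phi> - 1) g dx\<close> equals
  \<open>- \<psi>(q) - g0 ln h\<close>, the logarithm being the Frullani integral of \<open>g0 / x\<close>.  That such a product has
  mean one follows from its pathwise integral equation, from the Mecke formula for the jumps (read off
  from the Laplace functional of the subordinator) and from a Gronwall bound for a majorant.\<close>

section \<open>Paths and their Stieltjes measures\<close>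

text \<open>The Stieltjes measure of the path carries the whole proof: a sum of \<open>f s\<close>
  over jumps is the integral of \<open>f s / jump \<omega> s\<close>, and since the measure depends
  measurably on the path, so do jump sums. The Mecke formula then stands in for stochastic calculus.
  A weight that looks at the path strictly before \<open>s\<close> does not notice a jump inserted
  at \<open>s\<close>, so the mean of a predictably weighted jump sum is the mean of a time integral
  of its compensator. The obstacle in the mean-one claim is integrability: the integral equation of
  the product has terms of both signs, and nothing says in advance that their means are finite. It
  is therefore stated in \<open>ennreal\<close>, with negative terms moved across, and the common
  terms are cancelled only once the majorant has made them finite. Existence of \<open>P_H\<close>
  is proved rather than assumed: the law of the solution has the density \<open>M_H\<close> on every
  \<open>canonical_filtration t\<close>, and the union of these sigma-algebras is an
  intersection-stable generator. Of the two path maps, \<open>sol\<close> after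
  \<open>inv_int\<close> is the identity on every path; that \<open>xi_H\<close> undoes
  \<open>sol\<close> is shown for pure jump paths.\<close>

lemma paths_neg: "\<omega> \<in> paths \<Longrightarrow> t < 0 \<Longrightarrow> \<omega> t = 0"
  and paths_0: "\<omega> \<in> paths \<Longrightarrow> \<omega> 0 = 0"
  and paths_cadlag: "\<omega> \<in> paths \<Longrightarrow> cadlag \<omega>"
  by (auto simp: paths_def)

lemma paths_nonneg: "\<omega> \<in> paths \<Longrightarrow> 0 \<le> \<omega> t"
  using mono_onD[of "{0..}" \<omega> 0 t] by (cases "t < 0") (auto simp: paths_def)

lemma paths_mono: "\<omega> \<in> paths \<Longrightarrow> s \<le> t \<Longrightarrow> \<omega> s \<le> \<omega> t"
  using paths_nonneg[of \<omega> t] paths_neg[of \<omega> s] mono_onD[of "{0..}" \<omega> s t]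
  by (cases "s < 0") (auto simp: paths_def)

lemma cadlag_left_lim: "cadlag x \<Longrightarrow> 0 < t \<Longrightarrow> (x \<longlongrightarrow> left_lim x t) (at_left t)"
  unfolding left_lim_def cadlag_def by (metis tendsto_Lim trivial_limit_at_left_real)

lemma left_lim_eqI: "(x \<longlongrightarrow> l) (at_left t) \<Longrightarrow> left_lim x t = l" for x :: "real \<Rightarrow> real"
  unfolding left_lim_def by (rule tendsto_Lim) auto

text \<open>The paths agree near \<open>s\<close> from the left, so the same numbers are limits of
  both, and \<open>Lim\<close> depends on nothing else; this covers the case that no limit
  exists.\<close>

lemma left_lim_cong:
  assumes "\<And>r. a \<le> r \<Longrightarrow> r < s \<Longrightarrow> x r = y r" "a < s"
  shows "left_lim x s = left_lim y s"
proof -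
  have "eventually (\<lambda>r. x r = y r) (at_left s)"
    unfolding eventually_at_left_field using assms by (intro exI[of _ a]) auto
  then have "(x \<longlongrightarrow> l) (at_left s) \<longleftrightarrow> (y \<longlongrightarrow> l) (at_left s)" for l
    by (intro tendsto_cong) auto
  then show ?thesis unfolding left_lim_def Topological_Spaces.Lim_def by simp
qed

lemma left_lim_paths_nonpos:
  assumes "\<omega> \<in> paths" "s \<le> 0" shows "left_lim \<omega> s = 0"
proof (rule left_lim_eqI, rule tendsto_eventually)
  show "eventually (\<lambda>r. \<omega> r = 0) (at_left s)"
    unfolding eventually_at_left_field using assms paths_neg[OF assms(1)]
    by (intro exI[of _ "s - 1"]) auto
qed

lemma left_lim_paths:
  assumes "\<omega> \<in> paths" shows "(\<omega> \<longlongrightarrow> left_lim \<omega> s) (at_left s)"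
proof (cases "0 < s")
  case True then show ?thesis using cadlag_left_lim paths_cadlag assms by blast
next
  case False
  have "eventually (\<lambda>r. \<omega> r = 0) (at_left s)"
    unfolding eventually_at_left_field using False paths_neg[OF assms]
    by (intro exI[of _ "s - 1"]) auto
  then show ?thesis using left_lim_paths_nonpos[OF assms] False by (simp add: tendsto_eventually)
qed

lemma paths_right:
  assumes "\<omega> \<in> paths" shows "continuous (at_right a) \<omega>"
proof (cases "0 \<le> a")
  case True then show ?thesis using assms by (auto simp: paths_def cadlag_def)
next
  case False
  have "eventually (\<lambda>r. \<omega> r = 0) (at_right a)"
    unfolding eventually_at_right_field using False paths_neg[OF assms]
    by (intro exI[of _ 0]) auto
  then show ?thesis using paths_neg[OF assms, of a] False
    by (simp add: continuous_within tendsto_eventually)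
qed

lemma left_lim_le: "\<omega> \<in> paths \<Longrightarrow> left_lim \<omega> s \<le> \<omega> s"
  using tendsto_upperbound[OF left_lim_paths, of \<omega> "\<omega> s" s]
  by (simp add: eventually_at_left_field) (meson less_imp_le lt_ex paths_mono)

lemma left_lim_ge: "\<omega> \<in> paths \<Longrightarrow> r < s \<Longrightarrow> \<omega> r \<le> left_lim \<omega> s"
  using tendsto_lowerbound[OF left_lim_paths, of \<omega> "\<omega> r" s]
  by (simp add: eventually_at_left_field) (meson less_imp_le paths_mono)

lemma left_lim_nonneg: "\<omega> \<in> paths \<Longrightarrow> 0 \<le> left_lim \<omega> s"
  using left_lim_ge[of \<omega> "s - 1" s] paths_nonneg[of \<omega> "s-1"] by linarith

lemma jump_nonneg: "\<omega> \<in> paths \<Longrightarrow> 0 \<le> jump \<omega> s"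
  using left_lim_le by (simp add: jump_def)

lemma jump_nonpos_time: "\<omega> \<in> paths \<Longrightarrow> s \<le> 0 \<Longrightarrow> jump \<omega> s = 0"
  using left_lim_paths_nonpos[of \<omega> s] paths_neg[of \<omega> s] paths_0[of \<omega>]
  by (cases "s = 0") (auto simp: jump_def)

abbreviation stieltjes :: "(real \<Rightarrow> real) \<Rightarrow> real measure" where
  "stieltjes \<equiv> interval_measure"

lemma emeasure_stieltjes:
  "\<omega> \<in> paths \<Longrightarrow> a \<le> b \<Longrightarrow> emeasure (stieltjes \<omega>) {a<..b} = ennreal (\<omega> b - \<omega> a)"
  by (rule emeasure_interval_measure_Ioc[OF _ paths_mono paths_right])

text \<open>The intervals \<open>{s - 1/n<..s}\<close> shrink to \<open>{s}\<close>, and their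
  masses to the difference between the value and the left limit. That the atoms of the Stieltjes
  measure are the jumps is what lets integrals against the path stand for sums over its
  jumps.\<close>

lemma emeasure_stieltjes_singleton:
  assumes "\<omega> \<in> paths" shows "emeasure (stieltjes \<omega>) {s} = ennreal (jump \<omega> s)"
proof -
  define A where "A n = {s - 1 / Suc n <.. s}" for n :: nat
  have "x = s" if h: "\<forall>n::nat. s - 1 / (1 + real n) < x \<and> x \<le> s" for x
    proof (rule ccontr)
      assume "x \<noteq> s"
      then have "0 < s - x" using h[rule_format, of 0] by auto
      then obtain n where "1 / real (Suc n) < s - x" using reals_Archimedean[of "s - x"]
        by (auto simp: inverse_eq_divide)
      then show False using h[rule_format, of n] by auto
    qed
  then have eq: "{s} = (\<Inter>n. A n)" by (auto simp: A_def)
  have "(\<lambda>n. emeasure (stieltjes \<omega>) (A n)) \<longlonglongrightarrow> emeasure (stieltjes \<omega>) (\<Inter>n. A n)"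
  proof (rule Lim_emeasure_decseq)
    show "decseq A" unfolding decseq_def A_def
    proof (intro allI impI)
      fix m n :: nat assume "m \<le> n"
      then have "1 / real (Suc n) \<le> 1 / real (Suc m)" by (intro divide_left_mono) auto
      then show "{s - 1 / real (Suc n)<..s} \<subseteq> {s - 1 / real (Suc m)<..s}" by auto
    qed
  qed (use emeasure_stieltjes[OF assms] in \<open>auto simp: A_def\<close>)
  moreover have "(\<lambda>n. emeasure (stieltjes \<omega>) (A n)) \<longlonglongrightarrow> ennreal (jump \<omega> s)"
  proof -
    have l: "filterlim (\<lambda>n. s - 1 / real (Suc n)) (at_left s) sequentially"
      using tendsto_diff[OF tendsto_const[of s] LIMSEQ_Suc[OF lim_1_over_n]]
      unfolding filterlim_at by (auto simp del: of_nat_Suc)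
    have "(\<lambda>n. \<omega> s - \<omega> (s - 1 / real (Suc n))) \<longlonglongrightarrow> \<omega> s - left_lim \<omega> s"
      by (intro tendsto_intros filterlim_compose[OF left_lim_paths[OF assms] l])
    then have "(\<lambda>n. ennreal (\<omega> s - \<omega> (s - 1 / real (Suc n)))) \<longlonglongrightarrow> ennreal (jump \<omega> s)"
      unfolding jump_def by (intro tendsto_ennrealI)
    then show ?thesis unfolding A_def by (simp add: emeasure_stieltjes[OF assms] del: of_nat_Suc)
  qed
  ultimately show ?thesis unfolding eq[symmetric] by (rule LIMSEQ_unique)
qed

section \<open>Riemann sums on a uniform grid\<close>

definition grid_left :: "real \<Rightarrow> real \<Rightarrow> real" where
  "grid_left d s = d * (of_int \<lceil>s / d\<rceil> - 1)"

definition grid_right :: "real \<Rightarrow> real \<Rightarrow> real" where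
  "grid_right d s = d * of_int \<lceil>s / d\<rceil>"

lemma grid_left_less: "0 < d \<Longrightarrow> grid_left d s < s"
  and grid_right_ge: "0 < d \<Longrightarrow> s \<le> grid_right d s"
  and grid_left_ge: "0 < d \<Longrightarrow> s - d \<le> grid_left d s"
  and grid_right_le: "0 < d \<Longrightarrow> grid_right d s \<le> s + d"
proof -
  assume d: "0 < d"
  have "d * (of_int \<lceil>s / d\<rceil> - 1) < d * (s / d)" using d by (intro mult_strict_left_mono) linarith+
  then show "grid_left d s < s" using d by (simp add: grid_left_def)
  have "d * (s / d) \<le> d * of_int \<lceil>s / d\<rceil>" using d by (intro mult_left_mono) linarith+
  then show r: "s \<le> grid_right d s" using d by (simp add: grid_right_def)
  have "grid_right d s = grid_left d s + d" by (simp add: grid_left_def grid_right_def algebra_simps)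
  with r \<open>grid_left d s < s\<close> show "s - d \<le> grid_left d s" "grid_right d s \<le> s + d" by auto
qed

lemma grid_cell:
  assumes "0 < d" "s \<in> {d * real i <.. d * (real i + 1)}"
  shows "grid_left d s = d * real i" "grid_right d s = d * (real i + 1)"
proof -
  have "real i < s / d" "s / d \<le> real i + 1"
    using assms by (auto simp: pos_less_divide_eq pos_divide_le_eq mult.commute)
  then have "\<lceil>s / d\<rceil> = int i + 1" by (intro ceiling_unique) auto
  then show "grid_left d s = d * real i" "grid_right d s = d * (real i + 1)"
    by (auto simp: grid_left_def grid_right_def)
qed

text \<open>The cells are open on the left and closed on the right, so \<open>grid_left\<close>
  stays strictly below \<open>s\<close> and picks up left limits, while \<open>grid_right\<close>
  may equal \<open>s\<close>, which suits right-continuous paths.\<close>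

lemma grid_tendsto:
  assumes d: "\<And>n. 0 < d n" "d \<longlonglongrightarrow> 0"
  shows "filterlim (\<lambda>n. grid_left (d n) s) (at_left s) sequentially"
    and "(\<lambda>n. grid_right (d n) s) \<longlonglongrightarrow> s"
proof -
  have "(\<lambda>n. grid_left (d n) s) \<longlonglongrightarrow> s"
  proof (rule tendsto_sandwich)
    show "(\<lambda>n. s - d n) \<longlonglongrightarrow> s" using tendsto_diff[OF tendsto_const d(2), of s] by simp
    show "eventually (\<lambda>n. s - d n \<le> grid_left (d n) s) sequentially"
      "eventually (\<lambda>n. grid_left (d n) s \<le> s) sequentially"
      using grid_left_ge grid_left_less d(1) by (auto simp: less_imp_le)
  qed simp
  then show "filterlim (\<lambda>n. grid_left (d n) s) (at_left s) sequentially"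
    using grid_left_less d(1) by (auto simp: filterlim_at less_imp_neq)
  show "(\<lambda>n. grid_right (d n) s) \<longlonglongrightarrow> s"
  proof (rule tendsto_sandwich[where f="\<lambda>_. s"])
    show "(\<lambda>n. s + d n) \<longlonglongrightarrow> s" using tendsto_add[OF tendsto_const d(2), of s] by simp
    show "eventually (\<lambda>n. grid_right (d n) s \<le> s + d n) sequentially"
      "eventually (\<lambda>n. s \<le> grid_right (d n) s) sequentially"
      using grid_right_ge grid_right_le d(1) by auto
  qed simp
qed

lemma grid_right_tendsto:
  assumes d: "\<And>n. 0 < d n" "d \<longlonglongrightarrow> 0" and x: "continuous (at_right s) x"
  shows "(\<lambda>n. x (grid_right (d n) s)) \<longlonglongrightarrow> x s"
proof -
  have "continuous (at s within {s..}) x" using x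
    by (simp add: continuous_within at_within_Ici_at_right)
  then have "((\<lambda>n. x (grid_right (d n) s)) \<longlonglongrightarrow> x s)"
    by (rule continuous_within_tendsto_compose')
       (use grid_tendsto(2)[OF d] grid_right_ge d(1) in auto)
  then show ?thesis .
qed

lemma grid_left_measurable[measurable]: "grid_left d \<in> borel_measurable borel"
  and grid_right_measurable[measurable]: "grid_right d \<in> borel_measurable borel"
  unfolding grid_left_def[abs_def] grid_right_def[abs_def] by measurable

lemma inverse_Suc_tendsto: "(\<lambda>n. a / real (Suc n)) \<longlonglongrightarrow> 0"
  using tendsto_mult_right_zero[OF LIMSEQ_Suc[OF lim_1_over_n], of a] by (simp del: of_nat_Suc)

lemma grid_Ioc_union:
  assumes "0 < d"
  shows "{0<..d * real n} = (\<Union>i<n. {d * real i <.. d * (real i + 1)})"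
proof (induction n)
  case (Suc n)
  have "{0<..d * real (Suc n)} = {0<..d * real n} \<union> {d * real n <.. d * (real n + 1)}"
    using assms by (subst ivl_disj_un_two(6)) (auto simp: algebra_simps)
  then show ?case by (simp add: Suc lessThan_Suc Un_commute)
qed simp

text \<open>Each \<open>s\<close> lies in one cell, where both grid functions are constant. The
  point of writing a Riemann sum as an integral against the path is that refining the grid becomes a
  pointwise limit, accessible to Fatou's lemma and dominated convergence.\<close>

lemma grid_stieltjes_sum:
  assumes \<omega>: "\<omega> \<in> paths" and d: "0 < d" and f: "\<And>a b. 0 \<le> f a b"
  shows "(\<integral>\<^sup>+s\<in>{0<..d * real n}. ennreal (f (grid_left d s) (grid_right d s)) \<partial>stieltjes \<omega>) =
    ennreal (\<Sum>i<n. f (d * real i) (d * (real i + 1)) * (\<omega> (d * (real i + 1)) - \<omega> (d * real i)))"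
proof -
  have "(\<integral>\<^sup>+s\<in>{0<..d * real n}. ennreal (f (grid_left d s) (grid_right d s)) \<partial>stieltjes \<omega>)
      = (\<integral>\<^sup>+s. (\<Sum>i<n. ennreal (f (d * real i) (d * (real i + 1))) *
                 indicator {d * real i <.. d * (real i + 1)} s) \<partial>stieltjes \<omega>)"
  proof (rule nn_integral_cong)
    fix s
    show "ennreal (f (grid_left d s) (grid_right d s)) * indicator {0<..d * real n} s =
      (\<Sum>i<n. ennreal (f (d * real i) (d * (real i + 1))) * indicator {d * real i <.. d * (real i + 1)} s)"
    proof (cases "s \<in> {0<..d * real n}")
      case True
      then obtain i where i: "i < n" "s \<in> {d * real i <.. d * (real i + 1)}"
        unfolding grid_Ioc_union[OF d] by auto
      have other: "j = i" if "s \<in> {d * real j <.. d * (real j + 1)}" for j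
        using grid_cell(1)[OF d that] grid_cell(1)[OF d i(2)] d by auto
      have ind: "indicator {d * real j <.. d * (real j + 1)} s = (if j = i then 1 else 0 :: ennreal)" for j
        using other[of j] i(2) unfolding indicator_def by (cases "j = i") (simp, metis of_bool_eq(1))
      have "(\<Sum>j<n. ennreal (f (d * real j) (d * (real j + 1))) * indicator {d * real j <.. d * (real j + 1)} s)
        = (\<Sum>j<n. if j = i then ennreal (f (d * real i) (d * (real i + 1))) else 0)"
        unfolding ind by (intro sum.cong refl) auto
      then show ?thesis using True i grid_cell[OF d i(2)] by simp
    next
      case False
      then have "s \<notin> {d * real i <.. d * (real i + 1)}" if "i < n" for i
        unfolding grid_Ioc_union[OF d] using that by auto
      then show ?thesis using False by simp
    qed
  qed
  also have "\<dots> = (\<Sum>i<n. ennreal (f (d * real i) (d * (real i + 1))) * ennreal (\<omega> (d * (real i + 1)) - \<omega> (d * real i)))"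
    using d by (subst nn_integral_sum) (auto simp: nn_integral_cmult_indicator emeasure_stieltjes[OF \<omega>])
  also have "\<dots> = ennreal (\<Sum>i<n. f (d * real i) (d * (real i + 1)) * (\<omega> (d * (real i + 1)) - \<omega> (d * real i)))"
    using d by (subst sum_ennreal[symmetric])
      (auto intro!: sum.cong mult_nonneg_nonneg f simp: ennreal_mult' f paths_mono[OF \<omega>])
  finally show ?thesis .
qed

text \<open>The left limit in the integrand is what makes the inequality hold: it comes from the left
  Riemann sums of a convex function.\<close>

lemma stieltjes_exp_le:
  assumes \<omega>: "\<omega> \<in> paths" and l: "0 \<le> l" and t: "0 \<le> t"
  shows "(\<integral>\<^sup>+s\<in>{0<..t}. ennreal (l * exp (l * left_lim \<omega> s)) \<partial>stieltjes \<omega>) \<le> ennreal (exp (l * \<omega> t) - 1)"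
proof (cases "t = 0")
  case True then show ?thesis by (simp add: l paths_nonneg[OF \<omega>])
next
  case False
  then have t: "0 < t" using t by simp
  define d where "d n = t / real (Suc n)" for n
  have d: "0 < d n" for n using t by (simp add: d_def)
  have d0: "d \<longlonglongrightarrow> 0" unfolding d_def by (rule inverse_Suc_tendsto)
  have dn: "d n * real (Suc n) = t" for n by (simp add: d_def del: of_nat_Suc)
  \<comment> \<open>Fatou's lemma: strictly left grid points turn the path into its left limit, and
    an upper bound is all that is wanted.\<close>
  have "(\<integral>\<^sup>+s\<in>{0<..t}. ennreal (l * exp (l * left_lim \<omega> s)) \<partial>stieltjes \<omega>)
     \<le> liminf (\<lambda>n. \<integral>\<^sup>+s\<in>{0<..t}. ennreal (l * exp (l * \<omega> (grid_left (d n) s))) \<partial>stieltjes \<omega>)"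
  proof -
    have lim: "(\<lambda>n. ennreal (l * exp (l * \<omega> (grid_left (d n) s))) * indicator {0<..t} s) \<longlonglongrightarrow>
       ennreal (l * exp (l * left_lim \<omega> s)) * indicator {0<..t} s" for s
      by (cases "s \<in> {0<..t}") (auto intro!: tendsto_intros filterlim_compose[OF left_lim_paths[OF \<omega>] grid_tendsto(1)[OF d d0]])
    have m: "\<omega> \<in> borel_measurable borel"
      using paths_mono[OF \<omega>] by (intro borel_measurable_mono) (auto simp: mono_def)
    have "(\<integral>\<^sup>+s\<in>{0<..t}. ennreal (l * exp (l * left_lim \<omega> s)) \<partial>stieltjes \<omega>)
      = (\<integral>\<^sup>+s. liminf (\<lambda>n. ennreal (l * exp (l * \<omega> (grid_left (d n) s))) * indicator {0<..t} s) \<partial>stieltjes \<omega>)"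
      by (intro nn_integral_cong) (simp add: lim_imp_Liminf[OF _ lim])
    also have "\<dots> \<le> liminf (\<lambda>n. \<integral>\<^sup>+s\<in>{0<..t}. ennreal (l * exp (l * \<omega> (grid_left (d n) s))) \<partial>stieltjes \<omega>)"
      by (intro nn_integral_liminf) (use m in measurable)
    finally show ?thesis .
  qed
  also have "\<dots> \<le> ennreal (exp (l * \<omega> t) - 1)"
  proof (rule Liminf_le, simp)
    show "eventually (\<lambda>n. (\<integral>\<^sup>+s\<in>{0<..t}. ennreal (l * exp (l * \<omega> (grid_left (d n) s))) \<partial>stieltjes \<omega>) \<le> ennreal (exp (l * \<omega> t) - 1)) sequentially"
    proof (rule always_eventually, rule allI)
      fix n
      let ?x = "\<lambda>i. \<omega> (d n * real i)"
      have "(\<integral>\<^sup>+s\<in>{0<..t}. ennreal (l * exp (l * \<omega> (grid_left (d n) s))) \<partial>stieltjes \<omega>)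
        = ennreal (\<Sum>i<Suc n. l * exp (l * ?x i) * (?x (Suc i) - ?x i))"
        using grid_stieltjes_sum[OF \<omega> d[of n], where f="\<lambda>a b. l * exp (l * \<omega> a)" and n = "Suc n"] l
        by (simp only: dn) (simp add: algebra_simps)
      also have "\<dots> \<le> ennreal (\<Sum>i<Suc n. exp (l * ?x (Suc i)) - exp (l * ?x i))"
      proof (intro ennreal_leI sum_mono)
        fix i
        let ?h = "l * (?x (Suc i) - ?x i)"
        \<comment> \<open>Convexity in the form 1 + h \<le> exp h: a left Riemann term is at most
          the increment of \<open>exp (l * \<omega>)\<close> over its cell, and these increments
          telescope.\<close>
        have "exp (l * ?x i) * (1 + ?h) \<le> exp (l * ?x i) * exp ?h"
          using exp_ge_add_one_self[of ?h] by (intro mult_left_mono) auto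
        also have "\<dots> = exp (l * ?x (Suc i))" by (simp add: exp_add[symmetric] algebra_simps)
        finally show "l * exp (l * ?x i) * (?x (Suc i) - ?x i) \<le> exp (l * ?x (Suc i)) - exp (l * ?x i)"
          by (simp add: algebra_simps)
      qed
      also have "(\<Sum>i<Suc n. exp (l * ?x (Suc i)) - exp (l * ?x i)) = exp (l * \<omega> t) - 1"
        unfolding sum_lessThan_telescope[of "\<lambda>i. exp (l * ?x i)"] using dn[of n] by (simp add: paths_0[OF \<omega>] del: of_nat_Suc)
      finally show "(\<integral>\<^sup>+s\<in>{0<..t}. ennreal (l * exp (l * \<omega> (grid_left (d n) s))) \<partial>stieltjes \<omega>) \<le> ennreal (exp (l * \<omega> t) - 1)" .
    qed
  qed
  finally show ?thesis .
qed

section \<open>Measurability on the canonical space\<close>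

lemma canonical_generator_subset:
  "{coord s -` A \<inter> paths | s A. 0 \<le> s \<and> A \<in> sets borel} \<subseteq> Pow paths"
  "{coord s -` A \<inter> paths | s A. 0 \<le> s \<and> s \<le> t \<and> A \<in> sets borel} \<subseteq> Pow paths"
  by auto

lemma space_canonical_space[simp]: "space canonical_space = paths"
  and space_canonical_filtration[simp]: "space (canonical_filtration t) = paths"
  unfolding canonical_space_def canonical_filtration_def
  by (rule space_measure_of, blast)+

lemma measurable_canonicalI:
  assumes "\<And>x. x \<in> space M \<Longrightarrow> f x \<in> paths" "\<And>t. 0 \<le> t \<Longrightarrow> (\<lambda>x. f x t) \<in> borel_measurable M"
  shows "f \<in> measurable M canonical_space"
  unfolding canonical_space_def
proof (rule measurable_measure_of[OF canonical_generator_subset(1)])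
  fix y assume "y \<in> {coord s -` A \<inter> paths | s A. 0 \<le> s \<and> A \<in> sets borel}"
  then obtain s A where "0 \<le> s" "A \<in> sets borel" "y = coord s -` A \<inter> paths" by auto
  moreover have "f -` (coord s -` A \<inter> paths) \<inter> space M = (\<lambda>x. f x s) -` A \<inter> space M"
    using assms(1) by (auto simp: coord_def)
  ultimately show "f -` y \<inter> space M \<in> sets M"
    using measurable_sets[OF assms(2)] by auto
qed (use assms(1) in auto)

lemma measurable_filtrationI:
  assumes "\<And>x. x \<in> space M \<Longrightarrow> f x \<in> paths"
    "\<And>t. 0 \<le> t \<Longrightarrow> t \<le> T \<Longrightarrow> (\<lambda>x. f x t) \<in> borel_measurable M"
  shows "f \<in> measurable M (canonical_filtration T)"
  unfolding canonical_filtration_def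
proof (rule measurable_measure_of[OF canonical_generator_subset(2)])
  fix y assume "y \<in> {coord s -` A \<inter> paths | s A. 0 \<le> s \<and> s \<le> T \<and> A \<in> sets borel}"
  then obtain s A where "0 \<le> s" "s \<le> T" "A \<in> sets borel" "y = coord s -` A \<inter> paths" by auto
  moreover have "f -` (coord s -` A \<inter> paths) \<inter> space M = (\<lambda>x. f x s) -` A \<inter> space M"
    using assms(1) by (auto simp: coord_def)
  ultimately show "f -` y \<inter> space M \<in> sets M"
    using measurable_sets[OF assms(2)] by auto
qed (use assms(1) in auto)

lemma canonical_eval_measurable: "(\<lambda>\<omega>. \<omega> t) \<in> borel_measurable canonical_space"
proof (cases "0 \<le> t")
  case True
  show ?thesis
  proof (rule measurableI)
    fix A :: "real set" assume "A \<in> sets borel"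
    then have "coord t -` A \<inter> paths \<in> sets canonical_space"
      unfolding canonical_space_def using True by (intro in_measure_of canonical_generator_subset) auto
    then show "(\<lambda>\<omega>. \<omega> t) -` A \<inter> space canonical_space \<in> sets canonical_space"
      by (simp add: coord_def vimage_def)
  qed simp
next
  case False
  then have "(\<lambda>\<omega>. \<omega> t) \<in> borel_measurable canonical_space \<longleftrightarrow> (\<lambda>\<omega>. 0::real) \<in> borel_measurable canonical_space"
    by (intro measurable_cong) (auto simp: paths_neg)
  then show ?thesis by simp
qed

lemma filtration_eval_measurable:
  "0 \<le> s \<Longrightarrow> s \<le> t \<Longrightarrow> (\<lambda>\<omega>. \<omega> s) \<in> borel_measurable (canonical_filtration t)"
proof (rule measurableI)
  fix A :: "real set" assume "0 \<le> s" "s \<le> t" "A \<in> sets borel"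
  then have "coord s -` A \<inter> paths \<in> sets (canonical_filtration t)"
    unfolding canonical_filtration_def by (intro in_measure_of canonical_generator_subset) auto
  then show "(\<lambda>\<omega>. \<omega> s) -` A \<inter> space (canonical_filtration t) \<in> sets (canonical_filtration t)"
    by (simp add: coord_def vimage_def)
qed simp

lemma sets_filtration_subset: "sets (canonical_filtration t) \<subseteq> sets canonical_space"
proof -
  have "(\<lambda>\<omega>. \<omega>) \<in> measurable canonical_space (canonical_filtration t)"
    by (rule measurable_filtrationI) (auto intro: canonical_eval_measurable)
  from measurable_sets[OF this] show ?thesis
    using sets.sets_into_space[of _ "canonical_filtration t"] by (auto simp: Int_absorb2)
qed

text \<open>The ceiling takes countably many values, and for each of them the grid time is a
  constant, so only measurability at fixed times is used. One-sided continuity then carries this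
  over to paths and left limits, as limits along finer grids.\<close>

lemma grid_compose_measurable:
  fixes x :: "real \<Rightarrow> 'a \<Rightarrow> real"
  assumes x: "\<And>r. x r \<in> borel_measurable M"
  shows "(\<lambda>(s, \<omega>). x (grid_right d s) \<omega>) \<in> borel_measurable (borel \<Otimes>\<^sub>M M)"
    and "(\<lambda>(s, \<omega>). x (grid_left d s) \<omega>) \<in> borel_measurable (borel \<Otimes>\<^sub>M M)"
proof -
  have c: "(\<lambda>y :: real \<times> 'a. \<lceil>fst y / d\<rceil>) \<in> measurable (borel \<Otimes>\<^sub>M M) (count_space UNIV)"
    by measurable
  have "(\<lambda>y :: real \<times> 'a. x (d * of_int (i :: int)) (snd y)) \<in> borel_measurable (borel \<Otimes>\<^sub>M M)" for i
    using x by measurable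
  from measurable_compose_countable[OF this c]
  show "(\<lambda>(s, \<omega>). x (grid_right d s) \<omega>) \<in> borel_measurable (borel \<Otimes>\<^sub>M M)"
    by (simp add: grid_right_def case_prod_beta')
  have "(\<lambda>y :: real \<times> 'a. x (d * (of_int (i :: int) - 1)) (snd y)) \<in> borel_measurable (borel \<Otimes>\<^sub>M M)" for i
    using x by measurable
  from measurable_compose_countable[OF this c]
  show "(\<lambda>(s, \<omega>). x (grid_left d s) \<omega>) \<in> borel_measurable (borel \<Otimes>\<^sub>M M)"
    by (simp add: grid_left_def case_prod_beta')
qed

lemma right_continuous_joint_measurable:
  fixes x :: "real \<Rightarrow> 'a \<Rightarrow> real"
  assumes x: "\<And>r. x r \<in> borel_measurable M"
    and c: "\<And>s \<omega>. \<omega> \<in> space M \<Longrightarrow> continuous (at_right s) (\<lambda>r. x r \<omega>)"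
  shows "(\<lambda>(s, \<omega>). x s \<omega>) \<in> borel_measurable (borel \<Otimes>\<^sub>M M)"
proof (rule borel_measurable_LIMSEQ_real)
  show "(\<lambda>n. case y of (s, \<omega>) \<Rightarrow> x (grid_right (1 / real (Suc n)) s) \<omega>) \<longlonglongrightarrow> (case y of (s, \<omega>) \<Rightarrow> x s \<omega>)"
    if "y \<in> space (borel \<Otimes>\<^sub>M M)" for y
    using that by (auto simp: space_pair_measure simp del: of_nat_Suc intro!: grid_right_tendsto[OF _ inverse_Suc_tendsto c])
qed (rule grid_compose_measurable(1)[OF x])

lemma left_limit_joint_measurable:
  fixes x :: "real \<Rightarrow> 'a \<Rightarrow> real"
  assumes x: "\<And>r. x r \<in> borel_measurable M"
    and c: "\<And>s \<omega>. \<omega> \<in> space M \<Longrightarrow> ((\<lambda>r. x r \<omega>) \<longlongrightarrow> y s \<omega>) (at_left s)"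
  shows "(\<lambda>(s, \<omega>). y s \<omega>) \<in> borel_measurable (borel \<Otimes>\<^sub>M M)"
proof (rule borel_measurable_LIMSEQ_real)
  show "(\<lambda>n. case z of (s, \<omega>) \<Rightarrow> x (grid_left (1 / real (Suc n)) s) \<omega>) \<longlonglongrightarrow> (case z of (s, \<omega>) \<Rightarrow> y s \<omega>)"
    if "z \<in> space (borel \<Otimes>\<^sub>M M)" for z
    using that by (auto simp: space_pair_measure simp del: of_nat_Suc
        intro!: filterlim_compose[OF c] grid_tendsto(1)[OF _ inverse_Suc_tendsto])
qed (rule grid_compose_measurable(2)[OF x])

lemma eval_joint_measurable:
  "(\<lambda>(s, \<omega>). \<omega> s) \<in> borel_measurable (borel \<Otimes>\<^sub>M canonical_space)"
  by (rule right_continuous_joint_measurable[OF canonical_eval_measurable])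
     (simp add: paths_right)

lemma left_lim_joint_measurable:
  "(\<lambda>(s, \<omega>). left_lim \<omega> s) \<in> borel_measurable (borel \<Otimes>\<^sub>M canonical_space)"
  by (rule left_limit_joint_measurable[where x="\<lambda>r \<omega>. \<omega> r"])
     (simp_all add: left_lim_paths canonical_eval_measurable)

lemma eval_measurable:
  assumes [measurable]: "s \<in> borel_measurable N" "w \<in> measurable N canonical_space"
  shows "(\<lambda>y. w y (s y)) \<in> borel_measurable N"
proof -
  have "(\<lambda>y. (s y, w y)) \<in> measurable N (borel \<Otimes>\<^sub>M canonical_space)" by measurable
  from measurable_compose[OF this eval_joint_measurable] show ?thesis by simp
qed

lemma left_lim_measurable[measurable (raw)]:
  assumes [measurable]: "s \<in> borel_measurable N" "w \<in> measurable N canonical_space"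
  shows "(\<lambda>y. left_lim (w y) (s y)) \<in> borel_measurable N"
proof -
  have "(\<lambda>y. (s y, w y)) \<in> measurable N (borel \<Otimes>\<^sub>M canonical_space)" by measurable
  from measurable_compose[OF this left_lim_joint_measurable] show ?thesis by simp
qed

lemma jump_measurable[measurable (raw)]:
  assumes [measurable]: "s \<in> borel_measurable N" "w \<in> measurable N canonical_space"
  shows "(\<lambda>y. jump (w y) (s y)) \<in> borel_measurable N"
  unfolding jump_def using eval_measurable[OF assms] by measurable

lemma const_path_measurable: "\<omega> \<in> paths \<Longrightarrow> (\<lambda>_. \<omega>) \<in> measurable N canonical_space"
  by (rule measurable_const) simp

text \<open>The factor \<open>exp (- \<omega> T)\<close> turns the Stieltjes measure on \<open>{0<..T}\<close> into a subprobability,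
  which makes the Giry monad available.\<close>

definition stieltjes_kernel :: "real \<Rightarrow> (real \<Rightarrow> real) \<Rightarrow> real measure" where
  "stieltjes_kernel T \<omega> = density (stieltjes \<omega>) (\<lambda>s. indicator {0<..T} s * ennreal (exp (- \<omega> T)))"

lemma sets_stieltjes_kernel[simp, measurable_cong]: "sets (stieltjes_kernel T \<omega>) = sets borel"
  by (simp add: stieltjes_kernel_def)

lemma nn_integral_stieltjes_kernel:
  assumes [measurable]: "f \<in> borel_measurable borel"
  shows "(\<integral>\<^sup>+s. f s \<partial>stieltjes_kernel T \<omega>) = ennreal (exp (- \<omega> T)) * (\<integral>\<^sup>+s\<in>{0<..T}. f s \<partial>stieltjes \<omega>)"
proof -
  have "(\<integral>\<^sup>+s. f s \<partial>stieltjes_kernel T \<omega>) =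
      (\<integral>\<^sup>+s. ennreal (exp (- \<omega> T)) * (f s * indicator {0<..T} s) \<partial>stieltjes \<omega>)"
    unfolding stieltjes_kernel_def
    by (subst nn_integral_density; (measurable)?) (simp add: ac_simps)
  then show ?thesis by (subst (asm) nn_integral_cmult) auto
qed

lemma emeasure_stieltjes_kernel:
  assumes "A \<in> sets borel"
  shows "emeasure (stieltjes_kernel T \<omega>) A = ennreal (exp (- \<omega> T)) * emeasure (stieltjes \<omega>) (A \<inter> {0<..T})"
proof -
  have [measurable]: "A \<in> sets borel" by fact
  have "emeasure (stieltjes_kernel T \<omega>) A = (\<integral>\<^sup>+s. indicator A s \<partial>stieltjes_kernel T \<omega>)" by simp
  also have "\<dots> = ennreal (exp (- \<omega> T)) * (\<integral>\<^sup>+s. indicator (A \<inter> {0<..T}) s \<partial>stieltjes \<omega>)"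
    by (subst nn_integral_stieltjes_kernel, simp, intro arg_cong2[where f="(*)"] nn_integral_cong)
       (auto split: split_indicator)
  finally show ?thesis by simp
qed

lemma stieltjes_kernel_measurable[measurable]:
  assumes T: "0 \<le> T"
  shows "stieltjes_kernel T \<in> measurable canonical_space (subprob_algebra borel)"
proof (rule measurable_subprob_algebra_generated[where G="range (\<lambda>(a, b). {a<..b::real})" and \<Omega>=UNIV])
  have Ioc: "emeasure (stieltjes_kernel T \<omega>) {a<..b} =
      (if max a 0 \<le> min b T then ennreal (exp (- \<omega> T) * (\<omega> (min b T) - \<omega> (max a 0))) else 0)"
    if "\<omega> \<in> paths" for \<omega> a b
  proof -
    have "{a<..b} \<inter> {0<..T} = {max a 0 <.. min b T}" by auto
    then show ?thesis using that
      by (auto simp: emeasure_stieltjes_kernel emeasure_stieltjes ennreal_mult' simp del: greaterThanAtMost_iff)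
  qed
  have U: "emeasure (stieltjes_kernel T \<omega>) UNIV = ennreal (exp (- \<omega> T) * \<omega> T)" if "\<omega> \<in> paths" for \<omega>
    using that T by (simp add: emeasure_stieltjes_kernel emeasure_stieltjes paths_0 ennreal_mult')
  show "sets borel = sigma_sets UNIV (range (\<lambda>(a, b). {a<..b::real}))"
    by (subst borel_sigma_sets_Ioc) auto
  show "Int_stable (range (\<lambda>(a, b). {a<..b::real}))" by (auto simp: Int_stable_def)
  show "subprob_space (stieltjes_kernel T \<omega>)" if "\<omega> \<in> space canonical_space" for \<omega>
  proof (rule subprob_spaceI)
    \<comment> \<open>The total mass is \<open>y * exp (- y)\<close> with
      \<open>y = \<omega> T\<close>, which is at most 1.\<close>
    have "\<omega> T \<le> exp (\<omega> T)" using exp_ge_add_one_self[of "\<omega> T"] by linarith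
    then have "exp (- \<omega> T) * \<omega> T \<le> exp (- \<omega> T) * exp (\<omega> T)"
      by (intro mult_left_mono) auto
    then show "emeasure (stieltjes_kernel T \<omega>) (space (stieltjes_kernel T \<omega>)) \<le> 1"
      using U[of \<omega>] that by (simp add: stieltjes_kernel_def exp_minus ennreal_le_1)
  qed (simp add: stieltjes_kernel_def)
  show "(\<lambda>\<omega>. emeasure (stieltjes_kernel T \<omega>) A) \<in> borel_measurable canonical_space"
    if A: "A \<in> range (\<lambda>(a, b). {a<..b::real})" for A
  proof -
    obtain a b where "A = {a<..b}" using A by auto
    then have "(\<lambda>\<omega>. emeasure (stieltjes_kernel T \<omega>) A) \<in> borel_measurable canonical_space \<longleftrightarrow>
      (\<lambda>\<omega>. if max a 0 \<le> min b T then ennreal (exp (- \<omega> T) * (\<omega> (min b T) - \<omega> (max a 0))) else 0)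
        \<in> borel_measurable canonical_space"
      by (intro measurable_cong) (simp add: Ioc)
    moreover note canonical_eval_measurable[measurable]
    ultimately show ?thesis by simp
  qed
  have "(\<lambda>\<omega>. emeasure (stieltjes_kernel T \<omega>) UNIV) \<in> borel_measurable canonical_space \<longleftrightarrow>
      (\<lambda>\<omega>. ennreal (exp (- \<omega> T) * \<omega> T)) \<in> borel_measurable canonical_space"
    by (intro measurable_cong) (simp add: U)
  moreover note canonical_eval_measurable[measurable]
  ultimately show "(\<lambda>\<omega>. emeasure (stieltjes_kernel T \<omega>) UNIV) \<in> borel_measurable canonical_space" by simp
qed auto

lemma stieltjes_nn_integral_measurable:
  assumes T: "0 \<le> T" and F: "(\<lambda>(y, s). F y s) \<in> borel_measurable (N \<Otimes>\<^sub>M borel)"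
    and w[measurable]: "w \<in> measurable N canonical_space"
  shows "(\<lambda>y. \<integral>\<^sup>+s\<in>{0<..T}. F y s \<partial>stieltjes (w y)) \<in> borel_measurable N"
proof -
  have [measurable]: "(\<lambda>y. stieltjes_kernel T (w y)) \<in> measurable N (subprob_algebra borel)"
    by (rule measurable_compose[OF w stieltjes_kernel_measurable[OF T]])
  have Fy: "F y \<in> borel_measurable borel" if "y \<in> space N" for y
    using measurable_compose[OF measurable_Pair1' F, of y] that by simp
  \<comment> \<open>Multiplying by \<open>exp (w y T)\<close> undoes the normalisation of the
    kernel, outside the integral and measurably in \<open>y\<close>.\<close>
  have "(\<lambda>y. ennreal (exp (w y T)) * (\<integral>\<^sup>+s. F y s \<partial>stieltjes_kernel T (w y))) \<in> borel_measurable N"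
    using nn_integral_measurable_subprob_algebra2[OF F] eval_measurable[OF _ w, of "\<lambda>_. T"] by measurable
  also have "?this \<longleftrightarrow> ?thesis"
  proof (rule measurable_cong)
    fix y assume "y \<in> space N"
    then show "ennreal (exp (w y T)) * (\<integral>\<^sup>+s. F y s \<partial>stieltjes_kernel T (w y)) = (\<integral>\<^sup>+s\<in>{0<..T}. F y s \<partial>stieltjes (w y))"
      by (simp add: nn_integral_stieltjes_kernel Fy mult.assoc[symmetric] ennreal_mult[symmetric] exp_add[symmetric])
  qed
  finally show ?thesis .
qed

text \<open>Monotone limit over integer horizons. With the horizon removed, an upper time limit that
  depends on \<open>y\<close> can be put into the integrand as an indicator, which is how integrals
  and jump sums up to a variable time are treated.\<close>

lemma stieltjes_nn_integral_measurable_Ioi: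
  assumes F: "(\<lambda>(y, s). F y s) \<in> borel_measurable (N \<Otimes>\<^sub>M borel)"
    and w[measurable]: "w \<in> measurable N canonical_space"
  shows "(\<lambda>y. \<integral>\<^sup>+s\<in>{0<..}. F y s \<partial>stieltjes (w y)) \<in> borel_measurable N"
proof -
  have Fy[measurable]: "F y \<in> borel_measurable borel" if "y \<in> space N" for y
    using measurable_compose[OF measurable_Pair1' F, of y] that by simp
  have "(\<lambda>y. SUP n. \<integral>\<^sup>+s\<in>{0<..real n}. F y s \<partial>stieltjes (w y)) \<in> borel_measurable N"
    by (intro borel_measurable_SUP stieltjes_nn_integral_measurable[OF _ F w]) auto
  also have "?this \<longleftrightarrow> ?thesis"
  proof (rule measurable_cong)
    fix y assume y: "y \<in> space N"
    have "(\<integral>\<^sup>+s\<in>{0<..}. F y s \<partial>stieltjes (w y)) = (\<integral>\<^sup>+s. (SUP n. F y s * indicator {0<..real n} s) \<partial>stieltjes (w y))"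
    proof (rule nn_integral_cong)
      fix s :: real
      obtain n where "s \<le> real n" using real_arch_simple by blast
      then have "indicator {0<..real n} s = (indicator {0<..} s :: ennreal)" by (auto simp: indicator_def)
      then have "F y s * indicator {0<..} s \<le> (SUP n. F y s * indicator {0<..real n} s)"
        by (intro SUP_upper2[of n]) auto
      moreover have "(SUP n. F y s * indicator {0<..real n} s) \<le> F y s * indicator {0<..} s"
        by (intro SUP_least mult_left_mono) (auto simp: indicator_def)
      ultimately show "F y s * indicator {0<..} s = (SUP n. F y s * indicator {0<..real n} s)" by (rule antisym)
    qed
    also have "\<dots> = (SUP n. \<integral>\<^sup>+s\<in>{0<..real n}. F y s \<partial>stieltjes (w y))"
      using Fy[OF y] by (intro nn_integral_monotone_convergence_SUP)
        (auto simp: incseq_def le_fun_def intro!: mult_left_mono split: split_indicator)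
    finally show "(SUP n. \<integral>\<^sup>+s\<in>{0<..real n}. F y s \<partial>stieltjes (w y)) = (\<integral>\<^sup>+s\<in>{0<..}. F y s \<partial>stieltjes (w y))" by simp
  qed
  finally show ?thesis .
qed

section \<open>Multiplicative systems\<close>

lemma mult_system_power:
  assumes mult: "\<And>f g. f \<in> H \<Longrightarrow> g \<in> H \<Longrightarrow> (\<lambda>x. f x * g x) \<in> H"
  shows "f \<in> H \<Longrightarrow> g \<in> H \<Longrightarrow> (\<lambda>x. f x ^ n * g x) \<in> (H :: ('a \<Rightarrow> real) set)"
proof (induction n)
  case (Suc n)
  have "(\<lambda>x. f x * (f x ^ n * g x)) \<in> H" by (rule mult[OF Suc.prems(1) Suc.IH[OF Suc.prems]])
  then show ?case by (simp add: mult.assoc)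
qed simp

text \<open>Moments determine continuous functions: by Weierstrass, \<psi> is uniformly close on
  \<open>{0..1}\<close> to a polynomial, for which the integrals agree term by term. The factor
  \<open>g\<close> and the set \<open>S\<close> carry along whatever has been treated
  before.\<close>

lemma mult_system_continuous:
  fixes f g :: "'a \<Rightarrow> real" and \<psi> :: "real \<Rightarrow> real"
  assumes fin: "finite_measure M" "finite_measure N"
    and sets: "sets N = sets M" and S: "S \<in> sets M"
    and meas: "f \<in> borel_measurable M" "g \<in> borel_measurable M"
    and bd: "AE x in M. f x \<in> {0..1} \<and> g x \<in> {0..1}" "AE x in N. f x \<in> {0..1} \<and> g x \<in> {0..1}"
    and eq: "\<And>n. (LINT x|M. f x ^ n * g x * indicator S x) = (LINT x|N. f x ^ n * g x * indicator S x)"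
    and cont: "continuous_on {0..1} \<psi>" and \<psi>[measurable]: "\<psi> \<in> borel_measurable borel"
  shows "(LINT x|M. \<psi> (f x) * g x * indicator S x) = (LINT x|N. \<psi> (f x) * g x * indicator S x)"
proof (rule ccontr)
  interpret M: finite_measure M by fact
  interpret N: finite_measure N by fact
  have SN: "S \<in> sets N" and measN: "f \<in> borel_measurable N" "g \<in> borel_measurable N"
    using S meas by (auto simp: sets measurable_cong_sets[OF sets refl])
  note [measurable] = S meas SN measN
  let ?I = "\<lambda>\<phi>. (LINT x|M. \<phi> (f x) * g x * indicator S x)"
  let ?J = "\<lambda>\<phi>. (LINT x|N. \<phi> (f x) * g x * indicator S x)"
  assume ne: "?I \<psi> \<noteq> ?J \<psi>"
  have bounded: "\<exists>B. \<forall>y\<in>{0..1}. \<bar>\<phi> y\<bar> \<le> B" if "continuous_on {0..1} \<phi>" for \<phi> :: "real \<Rightarrow> real"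
    using compact_imp_bounded[OF compact_continuous_image[OF that compact_Icc]]
    by (auto simp: bounded_iff)
  have intM: "integrable M (\<lambda>x. \<phi> (f x) * g x * indicator S x)"
    if c: "continuous_on {0..1} \<phi>" and [measurable]: "\<phi> \<in> borel_measurable borel" for \<phi> :: "real \<Rightarrow> real"
  proof -
    obtain B where B: "\<forall>y\<in>{0..1}. \<bar>\<phi> y\<bar> \<le> B" using bounded[OF c] by auto
    then have B0: "0 \<le> B" by (metis abs_ge_zero atLeastAtMost_iff order_refl order_trans zero_le_one)
    show ?thesis
    proof (rule M.integrable_const_bound)
      show "AE x in M. norm (\<phi> (f x) * g x * indicator S x) \<le> B"
        using bd(1)
      proof eventually_elim
        case (elim x)
        then have "\<bar>\<phi> (f x)\<bar> * \<bar>g x\<bar> \<le> B * 1" using B B0 by (intro mult_mono) auto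
        then show ?case using B0 by (simp add: abs_mult indicator_def)
      qed
    qed measurable
  qed
  have intN: "integrable N (\<lambda>x. \<phi> (f x) * g x * indicator S x)"
    if c: "continuous_on {0..1} \<phi>" and [measurable]: "\<phi> \<in> borel_measurable borel" for \<phi> :: "real \<Rightarrow> real"
  proof -
    obtain B where B: "\<forall>y\<in>{0..1}. \<bar>\<phi> y\<bar> \<le> B" using bounded[OF c] by auto
    then have B0: "0 \<le> B" by (metis abs_ge_zero atLeastAtMost_iff order_refl order_trans zero_le_one)
    show ?thesis
    proof (rule N.integrable_const_bound)
      show "AE x in N. norm (\<phi> (f x) * g x * indicator S x) \<le> B"
        using bd(2)
      proof eventually_elim
        case (elim x)
        then have "\<bar>\<phi> (f x)\<bar> * \<bar>g x\<bar> \<le> B * 1" using B B0 by (intro mult_mono) auto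
        then show ?case using B0 by (simp add: abs_mult indicator_def)
      qed
    qed measurable
  qed
  define C where "C = measure M (space M) + measure N (space N) + 1"
  have C: "0 < C" by (simp add: C_def add_nonneg_pos)
  \<comment> \<open>Chosen so that the approximation error, at most \<open>e\<close> times the total
    mass of both measures, is no more than half of the supposed gap; the summand 1 in
    \<open>C\<close> excludes division by zero.\<close>
  define e where "e = \<bar>?I \<psi> - ?J \<psi>\<bar> / (2 * C)"
  have e: "0 < e" using ne C by (simp add: e_def)
  obtain p where p: "real_polynomial_function p" "\<And>y. y \<in> {0..1} \<Longrightarrow> \<bar>\<psi> y - p y\<bar> < e"
    using Stone_Weierstrass_real_polynomial_function[OF compact_Icc cont e] by auto
  obtain a n where pa: "p = (\<lambda>y. \<Sum>i\<le>n. a i * y ^ i)"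
    using p(1) by (auto simp: real_polynomial_function_iff_sum)
  have pc: "continuous_on {0..1} p" and [measurable]: "p \<in> borel_measurable borel"
    unfolding pa by (auto intro!: continuous_intros)
  have "?I p = (\<Sum>i\<le>n. a i * (LINT x|M. f x ^ i * g x * indicator S x))"
    unfolding pa sum_distrib_right mult.assoc
    by (subst Bochner_Integration.integral_sum)
       (auto intro!: integrable_mult_right intM[where \<phi>="\<lambda>y. y ^ i" for i, unfolded mult.assoc] continuous_intros)
  also have "\<dots> = (\<Sum>i\<le>n. a i * (LINT x|N. f x ^ i * g x * indicator S x))" by (simp add: eq)
  also have "\<dots> = ?J p"
    unfolding pa sum_distrib_right mult.assoc
    by (subst Bochner_Integration.integral_sum)
       (auto intro!: integrable_mult_right intN[where \<phi>="\<lambda>y. y ^ i" for i, unfolded mult.assoc] continuous_intros)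
  finally have pp: "?I p = ?J p" .
  have "\<bar>?I \<psi> - ?I p\<bar> = \<bar>LINT x|M. (\<psi> (f x) * g x * indicator S x - p (f x) * g x * indicator S x)\<bar>"
    by (subst Bochner_Integration.integral_diff) (auto intro!: intM cont pc)
  also have "\<dots> \<le> (LINT x|M. e)"
  proof (rule integral_abs_bound[THEN order_trans], rule integral_mono_AE)
    show "AE x in M. \<bar>\<psi> (f x) * g x * indicator S x - p (f x) * g x * indicator S x\<bar> \<le> e"
      using bd(1)
    proof eventually_elim
      case (elim x)
      have "\<bar>\<psi> (f x) - p (f x)\<bar> * g x \<le> e * 1" using elim p(2)[of "f x"] e by (intro mult_mono) auto
      then show ?case using elim e
        by (auto simp: indicator_def left_diff_distrib[symmetric] abs_mult)
    qed
  qed (auto intro!: integrable_abs Bochner_Integration.integrable_diff intM cont pc)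
  finally have 1: "\<bar>?I \<psi> - ?I p\<bar> \<le> e * measure M (space M)" by (simp add: mult.commute)
  have "\<bar>?J \<psi> - ?J p\<bar> = \<bar>LINT x|N. (\<psi> (f x) * g x * indicator S x - p (f x) * g x * indicator S x)\<bar>"
    by (subst Bochner_Integration.integral_diff) (auto intro!: intN cont pc)
  also have "\<dots> \<le> (LINT x|N. e)"
  proof (rule integral_abs_bound[THEN order_trans], rule integral_mono_AE)
    show "AE x in N. \<bar>\<psi> (f x) * g x * indicator S x - p (f x) * g x * indicator S x\<bar> \<le> e"
      using bd(2)
    proof eventually_elim
      case (elim x)
      have "\<bar>\<psi> (f x) - p (f x)\<bar> * g x \<le> e * 1" using elim p(2)[of "f x"] e by (intro mult_mono) auto
      then show ?case using elim e
        by (auto simp: indicator_def left_diff_distrib[symmetric] abs_mult)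
    qed
  qed (auto intro!: integrable_abs Bochner_Integration.integrable_diff intN cont pc)
  finally have 2: "\<bar>?J \<psi> - ?J p\<bar> \<le> e * measure N (space N)" by (simp add: mult.commute)
  have "\<bar>?I \<psi> - ?J \<psi>\<bar> \<le> e * (measure M (space M) + measure N (space N))"
    using 1 2 pp by (simp add: distrib_left)
  also have "\<dots> \<le> e * C" using e by (simp add: C_def)
  also have "\<dots> = \<bar>?I \<psi> - ?J \<psi>\<bar> / 2" using C by (simp add: e_def)
  finally show False using ne by simp
qed

text \<open>The continuous ramps \<psi> n, equal to 0 up to \<open>a\<close> and rising to 1 with
  slope n, converge to the indicator of \<open>{a<..}\<close>. So a factor \<open>f\<close> seen
  only through its powers may be replaced by the event \<open>a < f x\<close>.\<close>

lemma mult_system_indicator: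
  fixes f g :: "'a \<Rightarrow> real"
  assumes fin: "finite_measure M" "finite_measure N"
    and sets: "sets N = sets M" and S: "S \<in> sets M"
    and meas: "f \<in> borel_measurable M" "g \<in> borel_measurable M"
    and bd: "AE x in M. f x \<in> {0..1} \<and> g x \<in> {0..1}" "AE x in N. f x \<in> {0..1} \<and> g x \<in> {0..1}"
    and eq: "\<And>n. (LINT x|M. f x ^ n * g x * indicator S x) = (LINT x|N. f x ^ n * g x * indicator S x)"
  shows "(LINT x|M. g x * indicator ({x\<in>space M. a < f x} \<inter> S) x) = (LINT x|N. g x * indicator ({x\<in>space M. a < f x} \<inter> S) x)"
proof -
  interpret M: finite_measure M by fact
  interpret N: finite_measure N by fact
  have SN: "S \<in> sets N" and measN: "f \<in> borel_measurable N" "g \<in> borel_measurable N"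
    using S meas by (auto simp: sets measurable_cong_sets[OF sets refl])
  note [measurable] = S meas SN measN
  define \<psi> where "\<psi> n y = min 1 (max 0 (real n * (y - a)))" for n y
  have \<psi>: "continuous_on {0..1} (\<psi> n)" "\<psi> n \<in> borel_measurable borel" for n
    unfolding \<psi>_def by (auto intro!: continuous_intros)
  note [measurable] = \<psi>(2)
  have lim: "(\<lambda>n. \<psi> n y) \<longlonglongrightarrow> indicator {a<..} y" for y
  proof (cases "a < y")
    case True
    have "eventually (\<lambda>n. 1 < real n * (y - a)) sequentially"
      using filterlim_tendsto_pos_mult_at_top[OF tendsto_const[of "y - a"] _ filterlim_real_sequentially] True
      by (auto simp: filterlim_at_top_dense mult.commute)
    then have "eventually (\<lambda>n. \<psi> n y = 1) sequentially"
      by eventually_elim (auto simp: \<psi>_def)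
    then show ?thesis using True by (simp add: tendsto_eventually)
  next
    case False
    then have "\<psi> n y = 0" for n by (simp add: \<psi>_def mult_nonneg_nonpos max_absorb1)
    then show ?thesis using False by simp
  qed
  have b: "\<bar>\<psi> n y\<bar> \<le> 1" for n y by (auto simp: \<psi>_def)
  have lM: "(\<lambda>n. LINT x|M. \<psi> n (f x) * g x * indicator S x) \<longlonglongrightarrow> (LINT x|M. indicator {a<..} (f x) * g x * indicator S x)"
  proof (rule integral_dominated_convergence[where w="\<lambda>_. 1"])
    show "AE x in M. norm (\<psi> n (f x) * g x * indicator S x) \<le> 1" for n
      using bd(1) by eventually_elim (auto simp: abs_mult indicator_def intro!: mult_le_one b)
  qed (auto intro!: tendsto_intros lim)
  have lN: "(\<lambda>n. LINT x|N. \<psi> n (f x) * g x * indicator S x) \<longlonglongrightarrow> (LINT x|N. indicator {a<..} (f x) * g x * indicator S x)"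
  proof (rule integral_dominated_convergence[where w="\<lambda>_. 1"])
    show "AE x in N. norm (\<psi> n (f x) * g x * indicator S x) \<le> 1" for n
      using bd(2) by eventually_elim (auto simp: abs_mult indicator_def intro!: mult_le_one b)
  qed (auto intro!: tendsto_intros lim)
  have "(LINT x|M. indicator {a<..} (f x) * g x * indicator S x) = (LINT x|N. indicator {a<..} (f x) * g x * indicator S x)"
    using LIMSEQ_unique[OF lM] lN mult_system_continuous[OF fin sets S meas bd eq \<psi>] by simp
  moreover have "(LINT x|M. indicator {a<..} (f x) * g x * indicator S x) = (LINT x|M. g x * indicator ({x\<in>space M. a < f x} \<inter> S) x)"
    by (intro Bochner_Integration.integral_cong) (auto split: split_indicator)
  moreover have "(LINT x|N. indicator {a<..} (f x) * g x * indicator S x) = (LINT x|N. g x * indicator ({x\<in>space M. a < f x} \<inter> S) x)"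
    using sets_eq_imp_space_eq[OF sets] by (intro Bochner_Integration.integral_cong) (auto split: split_indicator)
  ultimately show ?thesis by simp
qed

text \<open>Monotone class theorem for a multiplicative system, by induction on a finite list of
  conditions \<open>a < f x\<close>. The induction hypothesis keeps an arbitrary further factor from
  \<open>H\<close>; since \<open>H\<close> is closed under products, \<open>f x ^ n * g x\<close> is
  again such a factor, and the next condition can be added. The bounds are asked for almost
  everywhere because exponentials exp(-px) of a jump size are bounded by 1 only on the nonnegative
  half-line.\<close>

theorem mult_system_measure_eq:
  fixes H :: "('a \<Rightarrow> real) set"
  assumes fin: "finite_measure M" "finite_measure N" and sets: "sets N = sets M"
    and one: "(\<lambda>_. 1) \<in> H"
    and mult: "\<And>f g. f \<in> H \<Longrightarrow> g \<in> H \<Longrightarrow> (\<lambda>x. f x * g x) \<in> H"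
    and meas: "\<And>f. f \<in> H \<Longrightarrow> f \<in> borel_measurable M"
    and bd: "\<And>f. f \<in> H \<Longrightarrow> AE x in M. f x \<in> {0..1}" "\<And>f. f \<in> H \<Longrightarrow> AE x in N. f x \<in> {0..1}"
    and eq: "\<And>f. f \<in> H \<Longrightarrow> (LINT x|M. f x) = (LINT x|N. f x)"
    and gen: "sets M = sigma_sets (space M) {{x\<in>space M. a < f x} | f a. f \<in> H}"
  shows "M = N"
proof -
  interpret M: finite_measure M by fact
  interpret N: finite_measure N by fact
  define G where "G = {{x\<in>space M. \<forall>(f, a)\<in>set xs. a < f x} | xs :: (('a \<Rightarrow> real) \<times> real) list. fst ` set xs \<subseteq> H}"
  have *: "{x\<in>space M. \<forall>(f, a)\<in>set xs. a < f x} \<in> sets M \<and>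
     (\<forall>g\<in>H. (LINT x|M. g x * indicator {x\<in>space M. \<forall>(f, a)\<in>set xs. a < f x} x) =
             (LINT x|N. g x * indicator {x\<in>space M. \<forall>(f, a)\<in>set xs. a < f x} x))"
    if "fst ` set xs \<subseteq> H" for xs :: "(('a \<Rightarrow> real) \<times> real) list"
    using that
  proof (induction xs)
    case Nil
    have "(LINT x|N. g x * indicator (space M) x) = (LINT x|N. g x)" for g :: "'a \<Rightarrow> real"
      using sets_eq_imp_space_eq[OF sets] by (intro Bochner_Integration.integral_cong) auto
    moreover have "(LINT x|M. g x * indicator (space M) x) = (LINT x|M. g x)" for g :: "'a \<Rightarrow> real"
      by (intro Bochner_Integration.integral_cong) auto
    ultimately show ?case using eq by simp
  next
    case (Cons y xs)
    obtain f a where y: "y = (f, a)" by force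
    let ?S = "{x\<in>space M. \<forall>(f, a)\<in>set xs. a < f x}"
    have f: "f \<in> H" and xs: "fst ` set xs \<subseteq> H" using Cons.prems y by auto
    have [measurable]: "f \<in> borel_measurable M" by (rule meas[OF f])
    have S: "?S \<in> sets M" using Cons.IH[OF xs] by blast
    have IH: "(LINT x|M. g x * indicator ?S x) = (LINT x|N. g x * indicator ?S x)" if "g \<in> H" for g
      using Cons.IH[OF xs] that by blast
    have eqS: "{x\<in>space M. \<forall>(f, a)\<in>set (y # xs). a < f x} = {x\<in>space M. a < f x} \<inter> ?S"
      by (auto simp: y)
    have "(LINT x|M. g x * indicator ({x\<in>space M. a < f x} \<inter> ?S) x) = (LINT x|N. g x * indicator ({x\<in>space M. a < f x} \<inter> ?S) x)"
      if g: "g \<in> H" for g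
    proof (rule mult_system_indicator[OF fin sets S meas[OF f] meas[OF g]])
      show "AE x in M. f x \<in> {0..1} \<and> g x \<in> {0..1}" "AE x in N. f x \<in> {0..1} \<and> g x \<in> {0..1}"
        by (rule AE_conjI[OF bd(1)[OF f] bd(1)[OF g]], rule AE_conjI[OF bd(2)[OF f] bd(2)[OF g]])
      show "(LINT x|M. f x ^ n * g x * indicator ?S x) = (LINT x|N. f x ^ n * g x * indicator ?S x)" for n
      proof (rule IH)
        show "(\<lambda>x. f x ^ n * g x) \<in> H"
          by (rule mult_system_power[where H=H and f=f and g=g and n=n]) (fact mult, fact f, fact g)
      qed
    qed
    moreover have "{x\<in>space M. a < f x} \<inter> ?S \<in> sets M" by (rule sets.Int[OF _ S]) simp
    ultimately show ?case unfolding eqS by blast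
  qed
  have sub: "G \<subseteq> Pow (space M)" by (auto simp: G_def)
  have setsG: "sets M = sigma_sets (space M) G"
  proof
    show "sets M \<subseteq> sigma_sets (space M) G"
      unfolding gen
    proof (rule sigma_sets_mono')
      show "{{x\<in>space M. a < f x} | f a. f \<in> H} \<subseteq> G"
      proof safe
        fix f a assume "f \<in> H"
        then show "{x\<in>space M. a < f x} \<in> G"
          unfolding G_def by (intro CollectI exI[of _ "[(f, a)]"]) auto
      qed
    qed
    show "sigma_sets (space M) G \<subseteq> sets M"
      using * by (intro sets.sigma_sets_subset) (auto simp: G_def)
  qed
  show ?thesis
  proof (rule measure_eqI_generator_eq[where E=G and \<Omega>="space M" and A="\<lambda>_. space M"])
    show "Int_stable G"
    proof (rule Int_stableI)
      fix A B assume "A \<in> G" "B \<in> G"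
      then obtain xs ys where xs: "fst ` set xs \<subseteq> H" "A = {x\<in>space M. \<forall>(f, a)\<in>set xs. a < f x}"
        and ys: "fst ` set ys \<subseteq> H" "B = {x\<in>space M. \<forall>(f, a)\<in>set ys. a < f x}" unfolding G_def by auto
      show "A \<inter> B \<in> G" unfolding G_def
        by (intro CollectI exI[of _ "xs @ ys"]) (use xs ys in auto)
    qed
    show "emeasure M X = emeasure N X" if XG: "X \<in> G" for X
    proof -
      obtain xs where xs: "fst ` set xs \<subseteq> H" "X = {x\<in>space M. \<forall>(f, a)\<in>set xs. a < f x}"
        using XG unfolding G_def by blast
      have XM: "X \<in> sets M" unfolding xs(2) using *[OF xs(1)] by (rule conjunct1)
      have "(LINT x|M. (\<lambda>_. 1) x * indicator X x) = (LINT x|N. (\<lambda>_. 1 :: real) x * indicator X x)"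
        unfolding xs(2) using *[OF xs(1), THEN conjunct2] one by (rule bspec)
      then show ?thesis
        using XM by (simp add: M.emeasure_eq_measure N.emeasure_eq_measure sets Int_absorb2 sets.sets_into_space)
    qed
    show "range (\<lambda>_. space M) \<subseteq> G" 
    proof -
      have "space M \<in> G" unfolding G_def by (intro CollectI exI[of _ "[]"]) auto
      then show ?thesis by blast
    qed
  qed (use sub setsG sets in auto)
qed

section \<open>Stieltjes integrals of bounded functions\<close>

lemma paths_measurable: "\<omega> \<in> paths \<Longrightarrow> \<omega> \<in> borel_measurable borel"
  by (rule borel_measurable_mono) (auto simp: mono_def paths_mono)

lemma left_lim_paths_measurable:
  assumes "\<omega> \<in> paths" shows "left_lim \<omega> \<in> borel_measurable borel"
  using left_lim_measurable[OF _ const_path_measurable[OF assms], of "\<lambda>s. s" borel] by simp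

lemma jump_paths_measurable:
  assumes "\<omega> \<in> paths" shows "jump \<omega> \<in> borel_measurable borel"
  using jump_measurable[OF _ const_path_measurable[OF assms], of "\<lambda>s. s" borel] by simp

lemma emeasure_stieltjes_Ioo:
  assumes "\<omega> \<in> paths" "0 < s"
  shows "emeasure (stieltjes \<omega>) {0<..<s} = ennreal (left_lim \<omega> s)"
proof -
  have "emeasure (stieltjes \<omega>) {0<..s} = emeasure (stieltjes \<omega>) ({0<..<s} \<union> {s})"
    using assms by (intro arg_cong2[where f=emeasure]) auto
  also have "\<dots> = emeasure (stieltjes \<omega>) {0<..<s} + ennreal (jump \<omega> s)"
    by (subst plus_emeasure[symmetric]) (auto simp: emeasure_stieltjes_singleton assms)
  finally have "ennreal (\<omega> s) = emeasure (stieltjes \<omega>) {0<..<s} + ennreal (jump \<omega> s)"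
    using assms by (simp add: emeasure_stieltjes paths_0)
  also have "ennreal (\<omega> s) = ennreal (left_lim \<omega> s) + ennreal (jump \<omega> s)"
    by (subst ennreal_plus[symmetric]) (use assms in \<open>auto simp: left_lim_nonneg jump_nonneg jump_def left_lim_le\<close>)
  finally show ?thesis by simp
qed

lemma stieltjes_set_integrable:
  fixes F :: "real \<Rightarrow> real"
  assumes \<omega>: "\<omega> \<in> paths" and F[measurable]: "F \<in> borel_measurable borel" and b: "\<And>s. \<bar>F s\<bar> \<le> B"
    and A[measurable]: "A \<in> sets borel" "A \<subseteq> {0<..t}"
  shows "set_integrable (stieltjes \<omega>) A F"
proof -
  have "emeasure (stieltjes \<omega>) A \<le> emeasure (stieltjes \<omega>) {0<..max 0 t}"
    using A by (intro emeasure_mono) (auto simp: max_def)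
  also have "\<dots> < \<infinity>" by (subst emeasure_stieltjes[OF \<omega>]) auto
  finally have "integrable (stieltjes \<omega>) (\<lambda>s. indicator A s *\<^sub>R B)"
    by (intro integrable_scaleR_left integrable_real_indicator) auto
  then show ?thesis unfolding set_integrable_def
    by (rule Bochner_Integration.integrable_bound) (use b in \<open>auto simp: indicator_def intro!: order_trans[OF b]\<close>)
qed

lemma stieltjes_integral_eq_nn:
  fixes F :: "real \<Rightarrow> real"
  assumes F[measurable]: "F \<in> borel_measurable borel" and b: "\<And>s. 0 \<le> F s" and [measurable]: "A \<in> sets borel"
  shows "(LINT s:A|stieltjes \<omega>. F s) = enn2real (\<integral>\<^sup>+s\<in>A. ennreal (F s) \<partial>stieltjes \<omega>)"
  unfolding set_lebesgue_integral_def
  by (subst integral_eq_nn_integral)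
     (auto simp: b indicator_mult_ennreal mult.commute intro!: arg_cong[where f=enn2real] nn_integral_cong split: split_indicator)

lemma nn_stieltjes_eq_integral:
  fixes F :: "real \<Rightarrow> real"
  assumes "\<omega> \<in> paths" "F \<in> borel_measurable borel" "\<And>s. 0 \<le> F s" "\<And>s. F s \<le> B"
    "A \<in> sets borel" "A \<subseteq> {0<..t}"
  shows "(\<integral>\<^sup>+s\<in>A. ennreal (F s) \<partial>stieltjes \<omega>) = ennreal (LINT s:A|stieltjes \<omega>. F s)"
  using stieltjes_set_integrable[of \<omega> F B A t] assms
  unfolding set_integrable_def set_lebesgue_integral_def
  by (subst nn_integral_eq_integral[symmetric])
     (auto simp: intro!: nn_integral_cong split: split_indicator)

definition stint :: "(real \<Rightarrow> real) \<Rightarrow> (real \<Rightarrow> real) \<Rightarrow> real \<Rightarrow> real" where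
  "stint \<omega> F t = (LINT s:{0<..t}|stieltjes \<omega>. F s)"

text \<open>The atom at \<open>t\<close> is left out, so this is the left limit of
  \<open>stint \<omega> F\<close> at \<open>t\<close>, available as an integral before any limit is
  taken.\<close>

definition stint_left :: "(real \<Rightarrow> real) \<Rightarrow> (real \<Rightarrow> real) \<Rightarrow> real \<Rightarrow> real" where
  "stint_left \<omega> F t = (LINT s:{0<..<t}|stieltjes \<omega>. F s)"

lemma stint_cong: "(\<And>s. 0 < s \<Longrightarrow> s \<le> t \<Longrightarrow> F s = G s) \<Longrightarrow> stint \<omega> F t = stint \<omega> G t"
  and stint_left_cong: "(\<And>s. 0 < s \<Longrightarrow> s < t \<Longrightarrow> F s = G s) \<Longrightarrow> stint_left \<omega> F t = stint_left \<omega> G t"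
  unfolding stint_def stint_left_def set_lebesgue_integral_def
  by (auto intro!: Bochner_Integration.integral_cong split: split_indicator)

locale bounded_integrand =
  fixes \<omega> :: "real \<Rightarrow> real" and F :: "real \<Rightarrow> real" and B :: real
  assumes \<omega>: "\<omega> \<in> paths" and F_meas[measurable]: "F \<in> borel_measurable borel"
    and F_nonneg: "\<And>s. 0 \<le> F s" and F_le: "\<And>s. F s \<le> B"
begin

lemma B_nonneg: "0 \<le> B"
  using F_nonneg[of 0] F_le[of 0] by linarith

lemma nn_le: "(\<integral>\<^sup>+s\<in>A. ennreal (F s) \<partial>stieltjes \<omega>) \<le> ennreal B * emeasure (stieltjes \<omega>) A"
  if [measurable]: "A \<in> sets borel" for A
proof -
  have "(\<integral>\<^sup>+s\<in>A. ennreal (F s) \<partial>stieltjes \<omega>) \<le> (\<integral>\<^sup>+s. ennreal B * indicator A s \<partial>stieltjes \<omega>)"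
    by (intro nn_integral_mono mult_right_mono ennreal_leI F_le) auto
  then show ?thesis by (simp add: nn_integral_cmult_indicator)
qed

lemma nn_eq: "(\<integral>\<^sup>+s\<in>A. ennreal (F s) \<partial>stieltjes \<omega>) = ennreal (LINT s:A|stieltjes \<omega>. F s)"
  if "A \<in> sets borel" "A \<subseteq> {0<..t}" for A
  using nn_stieltjes_eq_integral[OF \<omega> F_meas F_nonneg F_le that] .

lemma set_int_nonneg: "0 \<le> (LINT s:A|stieltjes \<omega>. F s)"
  unfolding set_lebesgue_integral_def by (intro integral_nonneg_AE) (auto simp: F_nonneg)

lemma stint_nonneg: "0 \<le> stint \<omega> F t" and stint_left_nonneg: "0 \<le> stint_left \<omega> F t"
  unfolding stint_def stint_left_def by (rule set_int_nonneg)+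

lemma stint_nonpos: "t \<le> 0 \<Longrightarrow> stint \<omega> F t = 0" and stint_left_nonpos: "t \<le> 0 \<Longrightarrow> stint_left \<omega> F t = 0"
  unfolding stint_def stint_left_def by (auto simp: set_lebesgue_integral_def)

lemma nn_Ioc: "0 \<le> a \<Longrightarrow> a \<le> b \<Longrightarrow> (\<integral>\<^sup>+s\<in>{a<..b}. ennreal (F s) \<partial>stieltjes \<omega>) = ennreal (stint \<omega> F b - stint \<omega> F a)"
proof -
  assume ab: "0 \<le> a" "a \<le> b"
  have e: "{0<..b} = {0<..a} \<union> {a<..b}" "{0<..a} \<inter> {a<..b} = {}" using ab by auto
  have "stint \<omega> F b = stint \<omega> F a + (LINT s:{a<..b}|stieltjes \<omega>. F s)"
    unfolding stint_def e(1) using ab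
    by (intro set_integral_Un e(2) stieltjes_set_integrable[OF \<omega> F_meas, where B=B and t=b])
       (auto simp: F_le F_nonneg)
  then show ?thesis using ab nn_eq[of "{a<..b}" b] by (simp add: subset_eq)
qed

lemma stint_mono: "a \<le> b \<Longrightarrow> stint \<omega> F a \<le> stint \<omega> F b"
proof (cases "0 \<le> a")
  case True
  assume "a \<le> b"
  have e: "{0<..b} = {0<..a} \<union> {a<..b}" "{0<..a} \<inter> {a<..b} = {}" using True \<open>a \<le> b\<close> by auto
  have "stint \<omega> F b = stint \<omega> F a + (LINT s:{a<..b}|stieltjes \<omega>. F s)"
    unfolding stint_def e(1) using True
    using \<open>a \<le> b\<close> by (intro set_integral_Un e(2) stieltjes_set_integrable[OF \<omega> F_meas, where B=B and t=b])
       (auto simp: F_le F_nonneg)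
  then show ?thesis using set_int_nonneg by simp
qed (use stint_nonneg in \<open>simp add: stint_nonpos\<close>)

lemma stint_diff_le: "a \<le> b \<Longrightarrow> stint \<omega> F b - stint \<omega> F a \<le> B * (\<omega> b - \<omega> a)"
proof -
  assume ab: "a \<le> b"
  \<comment> \<open>Path and integral vanish up to time 0, so a negative starting time may be moved
    to 0.\<close>
  define a' where "a' = max 0 a"
  have "stint \<omega> F a = stint \<omega> F a'" "\<omega> a = \<omega> a'"
    using stint_nonpos[of a] stint_nonpos[of 0] paths_neg[OF \<omega>, of a] paths_0[OF \<omega>] by (cases "a < 0"; simp add: a'_def)+
  moreover have "stint \<omega> F b - stint \<omega> F a' \<le> B * (\<omega> b - \<omega> a')"
  proof (cases "a' \<le> b")
    case True
    have "ennreal (stint \<omega> F b - stint \<omega> F a') \<le> ennreal B * emeasure (stieltjes \<omega>) {a'<..b}"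
      using nn_Ioc[of a' b] nn_le[of "{a'<..b}"] True by (simp add: a'_def)
    also have "\<dots> = ennreal (B * (\<omega> b - \<omega> a'))"
      using True B_nonneg by (simp add: emeasure_stieltjes[OF \<omega>] ennreal_mult' paths_mono[OF \<omega>])
    finally show ?thesis
      using B_nonneg paths_mono[OF \<omega> True] by (subst (asm) ennreal_le_iff) auto
  next
    case False
    then have "b < 0" "a' = 0" using ab by (auto simp: a'_def max_def split: if_splits)
    then show ?thesis by (simp add: stint_nonpos paths_0[OF \<omega>] paths_neg[OF \<omega>])
  qed
  ultimately show ?thesis by simp
qed

lemma stint_left_split: "stint \<omega> F s = stint_left \<omega> F s + F s * jump \<omega> s" if "0 < s"
proof -
  have e: "{0<..s} = {0<..<s} \<union> {s}" "{0<..<s} \<inter> {s} = {}" using that by auto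
  have "stint \<omega> F s = stint_left \<omega> F s + (LINT r:{s}|stieltjes \<omega>. F r)"
    unfolding stint_def stint_left_def e(1) using that
    by (intro set_integral_Un e(2) stieltjes_set_integrable[OF \<omega> F_meas, where B=B and t=s])
       (auto simp: F_le F_nonneg)
  also have "(LINT r:{s}|stieltjes \<omega>. F r) = F s * jump \<omega> s"
  proof -
    have "(LINT r:{s}|stieltjes \<omega>. F r) = (LINT r:{s}|stieltjes \<omega>. F s)"
      unfolding set_lebesgue_integral_def by (intro Bochner_Integration.integral_cong) (auto split: split_indicator)
    also have "\<dots> = measure (stieltjes \<omega>) {s} * F s"
      by (subst set_integral_const) (auto simp: emeasure_stieltjes_singleton[OF \<omega>])
    finally show ?thesis
      by (simp add: measure_def emeasure_stieltjes_singleton[OF \<omega>] jump_nonneg[OF \<omega>] mult.commute)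
  qed
  finally show ?thesis .
qed

text \<open>The integrand lies between 0 and \<open>B\<close>, so increments of the integral are
  dominated by \<open>B\<close> times those of \<open>\<omega>\<close>. Squeezed in this way, the
  integral inherits its one-sided limits from the path.\<close>

lemma stint_left_bounds:
  assumes "r < s"
  shows "stint \<omega> F r \<le> stint_left \<omega> F s" "stint_left \<omega> F s - stint \<omega> F r \<le> B * (left_lim \<omega> s - \<omega> r)"
proof -
  have "stint \<omega> F r \<le> stint_left \<omega> F s \<and> stint_left \<omega> F s - stint \<omega> F r \<le> B * (left_lim \<omega> s - \<omega> r)"
  proof (cases "0 < s")
    case False
    then show ?thesis using assms left_lim_paths_nonpos[OF \<omega>, of s] paths_neg[OF \<omega>, of r]
      by (simp add: stint_nonpos stint_left_nonpos)
  next
    case True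
    have l: "(\<omega> \<longlongrightarrow> left_lim \<omega> s) (at_left s)" by (rule left_lim_paths[OF \<omega>])
    define X where "X = stint_left \<omega> F s"
    have i: "set_integrable (stieltjes \<omega>) A F" if "A \<in> sets borel" "A \<subseteq> {0<..s}" for A
      using that by (intro stieltjes_set_integrable[OF \<omega> F_meas, where B=B and t=s]) (auto simp: F_le F_nonneg)
    show ?thesis
    proof (cases "0 \<le> r")
      case r: True
      have e: "{0<..<s} = {0<..r} \<union> {r<..<s}" "{0<..r} \<inter> {r<..<s} = {}" using r assms by auto
      have X: "stint_left \<omega> F s = stint \<omega> F r + (LINT u:{r<..<s}|stieltjes \<omega>. F u)"
        unfolding stint_def stint_left_def e(1) using r assms
        by (intro set_integral_Un e(2) i) auto
      have em: "emeasure (stieltjes \<omega>) {r<..<s} = ennreal (left_lim \<omega> s - \<omega> r)"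
      proof -
        have "ennreal (left_lim \<omega> s) = ennreal (\<omega> r) + emeasure (stieltjes \<omega>) {r<..<s}"
          using plus_emeasure[of "{0<..r}" "stieltjes \<omega>" "{r<..<s}", folded e(1)] e(2) r True
          by (simp add: emeasure_stieltjes_Ioo[OF \<omega>] emeasure_stieltjes[OF \<omega>] paths_0[OF \<omega>])
        then have "ennreal (left_lim \<omega> s) - ennreal (\<omega> r) = emeasure (stieltjes \<omega>) {r<..<s}" by simp
        then show ?thesis by (simp add: ennreal_minus paths_nonneg[OF \<omega>])
      qed
      have "{r<..<s} \<subseteq> {0<..s}" using r by auto
      then have "ennreal (LINT u:{r<..<s}|stieltjes \<omega>. F u) \<le> ennreal (B * (left_lim \<omega> s - \<omega> r))"
        using nn_le[of "{r<..<s}"] nn_eq[of "{r<..<s}" s] r B_nonneg em left_lim_ge[OF \<omega> assms]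
        by (simp add: ennreal_mult')
      then have "(LINT u:{r<..<s}|stieltjes \<omega>. F u) \<le> B * (left_lim \<omega> s - \<omega> r)"
        using B_nonneg left_lim_ge[OF \<omega> assms] by (subst (asm) ennreal_le_iff) auto
      then show ?thesis using X set_int_nonneg[of "{r<..<s}"] by auto
    next
      case False
      have "ennreal (stint_left \<omega> F s) \<le> ennreal (B * left_lim \<omega> s)"
        using nn_le[of "{0<..<s}"] nn_eq[of "{0<..<s}" s] B_nonneg emeasure_stieltjes_Ioo[OF \<omega> True] left_lim_nonneg[OF \<omega>]
        by (simp add: ennreal_mult' stint_left_def subset_eq)
      then have "stint_left \<omega> F s \<le> B * left_lim \<omega> s"
        using B_nonneg left_lim_nonneg[OF \<omega>] by (subst (asm) ennreal_le_iff) auto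
      then show ?thesis using False stint_left_nonneg by (simp add: stint_nonpos paths_neg[OF \<omega>])
    qed
  qed
  then show "stint \<omega> F r \<le> stint_left \<omega> F s" "stint_left \<omega> F s - stint \<omega> F r \<le> B * (left_lim \<omega> s - \<omega> r)" by auto
qed

lemma stint_left_le: "stint_left \<omega> F s \<le> B * left_lim \<omega> s"
proof -
  \<comment> \<open>A time before both \<open>s\<close> and 0, where the path and the integral
    vanish.\<close>
  have "stint \<omega> F (min (s - 1) (-1)) = 0" "\<omega> (min (s - 1) (-1)) = 0"
    by (auto simp: stint_nonpos paths_neg[OF \<omega>])
  then show ?thesis using stint_left_bounds(2)[of "min (s - 1) (-1)" s] by simp
qed

lemma stint_tendsto_left: "(stint \<omega> F \<longlongrightarrow> stint_left \<omega> F s) (at_left s)"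
proof (rule tendsto_sandwich)
  show "eventually (\<lambda>r. stint_left \<omega> F s - B * (left_lim \<omega> s - \<omega> r) \<le> stint \<omega> F r) (at_left s)"
    "eventually (\<lambda>r. stint \<omega> F r \<le> stint_left \<omega> F s) (at_left s)"
    unfolding eventually_at_left_field using stint_left_bounds[of _ s] by (auto intro!: exI[of _ "s - 1"] simp: algebra_simps)
  have "((\<lambda>r. stint_left \<omega> F s - B * (left_lim \<omega> s - \<omega> r)) \<longlongrightarrow> stint_left \<omega> F s - B * (left_lim \<omega> s - left_lim \<omega> s)) (at_left s)"
    by (intro tendsto_intros left_lim_paths[OF \<omega>])
  then show "((\<lambda>r. stint_left \<omega> F s - B * (left_lim \<omega> s - \<omega> r)) \<longlongrightarrow> stint_left \<omega> F s) (at_left s)" by simp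
qed simp

lemma left_lim_stint: "left_lim (stint \<omega> F) s = stint_left \<omega> F s"
  by (rule left_lim_eqI[OF stint_tendsto_left])

lemma stint_right: "(stint \<omega> F \<longlongrightarrow> stint \<omega> F s) (at_right s)"
proof (rule tendsto_sandwich)
  show "eventually (\<lambda>r. stint \<omega> F r \<le> stint \<omega> F s + B * (\<omega> r - \<omega> s)) (at_right s)"
    "eventually (\<lambda>r. stint \<omega> F s \<le> stint \<omega> F r) (at_right s)"
    unfolding eventually_at_right_field using stint_diff_le[of s] stint_mono[of s]
    by (auto intro!: exI[of _ "s + 1"] simp: algebra_simps)
  have "((\<lambda>r. stint \<omega> F s + B * (\<omega> r - \<omega> s)) \<longlongrightarrow> stint \<omega> F s + B * (\<omega> s - \<omega> s)) (at_right s)"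
    using paths_right[OF \<omega>, of s] by (intro tendsto_intros) (simp add: continuous_within)
  then show "((\<lambda>r. stint \<omega> F s + B * (\<omega> r - \<omega> s)) \<longlongrightarrow> stint \<omega> F s) (at_right s)" by simp
qed simp

lemma stint_path: "stint \<omega> F \<in> paths"
  unfolding paths_def cadlag_def
  using stint_tendsto_left stint_right by (auto simp: stint_nonpos continuous_within mono_on_def stint_mono)

lemma jump_stint: "jump (stint \<omega> F) s = F s * jump \<omega> s"
proof (cases "0 < s")
  case True then show ?thesis using stint_left_split unfolding jump_def[of "stint \<omega> F"] by (simp add: left_lim_stint)
next
  case False then show ?thesis using jump_nonpos_time[OF \<omega>] jump_nonpos_time[OF stint_path] by simp
qed

text \<open>Half-open intervals determine the measure; one that reaches below 0 is first cut at 0.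
  In this form the associativity of Stieltjes integration is the composition rule for
  densities.\<close>

lemma stieltjes_stint:
  "stieltjes (stint \<omega> F) = density (stieltjes \<omega>) (\<lambda>s. indicator {0<..} s * ennreal (F s))"
proof (rule measure_eqI_generator_eq[where E="range (\<lambda>(a, b). {a<..b::real})" and \<Omega>=UNIV
      and A="\<lambda>n. {- real n <.. real n}"])
  show "Int_stable (range (\<lambda>(a, b). {a<..b::real}))" by (auto simp: Int_stable_def)
  show "emeasure (stieltjes (stint \<omega> F)) X = emeasure (density (stieltjes \<omega>) (\<lambda>s. indicator {0<..} s * ennreal (F s))) X"
    if X: "X \<in> range (\<lambda>(a, b). {a<..b::real})" for X
  proof -
    obtain a b where X: "X = {a<..b}" using X by auto
    define a' where "a' = max 0 a"
    have "emeasure (density (stieltjes \<omega>) (\<lambda>s. indicator {0<..} s * ennreal (F s))) X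
       = (\<integral>\<^sup>+s\<in>{a'<..b}. ennreal (F s) \<partial>stieltjes \<omega>)"
      unfolding X by (subst emeasure_density) (auto simp: a'_def intro!: nn_integral_cong split: split_indicator)
    also have "\<dots> = emeasure (stieltjes (stint \<omega> F)) {a'<..b}"
      by (cases "a' \<le> b") (auto simp: nn_Ioc emeasure_stieltjes[OF stint_path] a'_def)
    also have "\<dots> = emeasure (stieltjes (stint \<omega> F)) X"
    proof (cases "0 \<le> a \<or> b < a")
      case False
      show ?thesis
      proof (cases "0 \<le> b")
        case True then show ?thesis using False unfolding X a'_def
          by (simp add: emeasure_stieltjes[OF stint_path] stint_nonpos)
      next
        case b: False
        then show ?thesis using False unfolding X a'_def
          by (simp add: emeasure_stieltjes[OF stint_path] stint_nonpos)
      qed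
    qed (auto simp: X a'_def max_def)
    finally show ?thesis ..
  qed
  show "sets (stieltjes (stint \<omega> F)) = sigma_sets UNIV (range (\<lambda>(a, b). {a<..b::real}))"
    "sets (density (stieltjes \<omega>) (\<lambda>s. indicator {0<..} s * ennreal (F s))) = sigma_sets UNIV (range (\<lambda>(a, b). {a<..b::real}))"
    by (simp_all, (subst borel_sigma_sets_Ioc, simp)+)
  show "(\<Union>n. {- real n <.. real n}) = (UNIV :: real set)"
  proof -
    have "x \<in> (\<Union>n. {- real n <.. real n})" for x :: real
    proof -
      obtain n where "\<bar>x\<bar> < real n" using reals_Archimedean2 by blast
      then show ?thesis by (auto intro!: exI[of _ n])
    qed
    then show ?thesis by blast
  qed
  show "emeasure (stieltjes (stint \<omega> F)) {- real n <.. real n} \<noteq> \<infinity>" for n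
    by (simp add: emeasure_stieltjes[OF stint_path])
qed auto

text \<open>The bound for closed right ends, taken along times increasing to \<open>s\<close>. The
  open right end is called for because the fixed-point equation for the left limits integrates over
  \<open>{0<..<s}\<close>.\<close>

lemma stieltjes_exp_left_le:
  assumes l: "0 \<le> l"
  shows "(\<integral>\<^sup>+r\<in>{0<..<s}. ennreal (l * exp (l * left_lim \<omega> r)) \<partial>stieltjes \<omega>) \<le> ennreal (exp (l * left_lim \<omega> s))"
proof -
  have [measurable]: "left_lim \<omega> \<in> borel_measurable borel" by (rule left_lim_paths_measurable[OF \<omega>])
  define f where "f r = ennreal (l * exp (l * left_lim \<omega> r))" for r
  have [measurable]: "f \<in> borel_measurable borel" by (simp add: f_def[abs_def])
  define u where "u n = s - 1 / real (Suc n)" for n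
  have u: "incseq u" unfolding incseq_Suc_iff u_def by (auto simp: frac_le)
  have ul: "u n < s" for n by (simp add: u_def del: of_nat_Suc)
  have "(\<integral>\<^sup>+r\<in>{0<..<s}. f r \<partial>stieltjes \<omega>) = (\<integral>\<^sup>+r. (SUP n. f r * indicator {0<..u n} r) \<partial>stieltjes \<omega>)"
  proof (rule nn_integral_cong, rule antisym)
    fix r
    show "f r * indicator {0<..<s} r \<le> (SUP n. f r * indicator {0<..u n} r)"
    proof (cases "0 < r \<and> r < s")
      case True
      then obtain n where "1 / real (Suc n) < s - r" using reals_Archimedean[of "s - r"] by (auto simp: inverse_eq_divide)
      then have "r \<le> u n" by (simp add: u_def)
      then show ?thesis using True by (intro SUP_upper2[of n]) auto
    qed auto
    show "(SUP n. f r * indicator {0<..u n} r) \<le> f r * indicator {0<..<s} r"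
      using ul by (intro SUP_least mult_left_mono) (auto simp: indicator_def intro: order.strict_trans1)
  qed
  also have "\<dots> = (SUP n. \<integral>\<^sup>+r\<in>{0<..u n}. f r \<partial>stieltjes \<omega>)"
    using u by (intro nn_integral_monotone_convergence_SUP)
      (auto simp: incseq_def le_fun_def intro!: mult_left_mono split: split_indicator intro: order_trans)
  also have "\<dots> \<le> ennreal (exp (l * left_lim \<omega> s))"
  proof (rule SUP_least)
    fix n
    show "(\<integral>\<^sup>+r\<in>{0<..u n}. f r \<partial>stieltjes \<omega>) \<le> ennreal (exp (l * left_lim \<omega> s))"
    proof (cases "0 \<le> u n")
      case True
      have "(\<integral>\<^sup>+r\<in>{0<..u n}. f r \<partial>stieltjes \<omega>) \<le> ennreal (exp (l * \<omega> (u n)) - 1)"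
        unfolding f_def by (rule stieltjes_exp_le[OF \<omega> l True])
      also have "\<dots> \<le> ennreal (exp (l * left_lim \<omega> s))"
      proof (rule ennreal_leI)
        have "exp (l * \<omega> (u n)) \<le> exp (l * left_lim \<omega> s)"
          using left_lim_ge[OF \<omega> ul] l by (simp add: mult_left_mono)
        then show "exp (l * \<omega> (u n)) - 1 \<le> exp (l * left_lim \<omega> s)" by linarith
      qed
      finally show ?thesis .
    qed auto
  qed
  finally show ?thesis unfolding f_def .
qed

end

text \<open>Restricted to \<open>{0<..t}\<close>, the two Stieltjes measures agree on half-open
  intervals, whose masses read the paths on \<open>{0..t}\<close> alone. Adaptedness of the solution
  rests on this.\<close>

lemma stint_eq_of_agree:
  fixes F :: "real \<Rightarrow> real"
  assumes "\<omega> \<in> paths" "\<omega>' \<in> paths" "\<And>s. 0 \<le> s \<Longrightarrow> s \<le> t \<Longrightarrow> \<omega> s = \<omega>' s"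
    and F[measurable]: "F \<in> borel_measurable borel" and A[measurable]: "A \<in> sets borel" "A \<subseteq> {0<..t}"
  shows "(LINT s:A|stieltjes \<omega>. F s) = (LINT s:A|stieltjes \<omega>'. F s)"
proof -
  have eq: "density (stieltjes \<omega>) (indicator {0<..t}) = density (stieltjes \<omega>') (indicator {0<..t})"
  proof (rule measure_eqI_generator_eq[where E="range (\<lambda>(a, b). {a<..b::real})" and \<Omega>=UNIV
        and A="\<lambda>n. {- real n <.. real n}"])
    have *: "emeasure (density (stieltjes w) (indicator {0<..t})) {a<..b} =
        (if max 0 a \<le> min b t then ennreal (w (min b t) - w (max 0 a)) else 0)" if "w \<in> paths" for w a b
    proof -
      have "emeasure (density (stieltjes w) (indicator {0<..t})) {a<..b} = emeasure (stieltjes w) {max 0 a<..min b t}"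
        by (subst emeasure_density) (auto simp: nn_integral_indicator[symmetric] simp del: nn_integral_indicator
             intro!: nn_integral_cong split: split_indicator)
      then show ?thesis using that by (auto simp: emeasure_stieltjes simp del: max.bounded_iff)
    qed
    show "emeasure (density (stieltjes \<omega>) (indicator {0<..t})) X = emeasure (density (stieltjes \<omega>') (indicator {0<..t})) X"
      if X: "X \<in> range (\<lambda>(a, b). {a<..b::real})" for X
    proof -
      obtain a b where X: "X = {a<..b}" using X by auto
      have "\<omega> (min b t) = \<omega>' (min b t)" "\<omega> (max 0 a) = \<omega>' (max 0 a)" if "max 0 a \<le> min b t"
        using that assms(3)[of "min b t"] assms(3)[of "max 0 a"] by auto
      then show ?thesis unfolding X by (auto simp: *[OF assms(1)] *[OF assms(2)])
    qed
    show "Int_stable (range (\<lambda>(a, b). {a<..b::real}))" by (auto simp: Int_stable_def)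
    show "sets (density (stieltjes \<omega>) (indicator {0<..t})) = sigma_sets UNIV (range (\<lambda>(a, b). {a<..b::real}))"
      "sets (density (stieltjes \<omega>') (indicator {0<..t})) = sigma_sets UNIV (range (\<lambda>(a, b). {a<..b::real}))"
      by (simp_all, (subst borel_sigma_sets_Ioc, simp)+)
    show "(\<Union>n. {- real n <.. real n}) = (UNIV :: real set)"
    proof -
      have "x \<in> (\<Union>n. {- real n <.. real n})" for x :: real
      proof -
        obtain n where "\<bar>x\<bar> < real n" using reals_Archimedean2 by blast
        then show ?thesis by (auto intro!: exI[of _ n])
      qed
      then show ?thesis by blast
    qed
    show "emeasure (density (stieltjes \<omega>) (indicator {0<..t})) {- real n <.. real n} \<noteq> \<infinity>" for n
      by (simp add: *[OF assms(1)])
  qed auto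
  have d: "(LINT s:A|stieltjes w. F s) = (LINT s|density (stieltjes w) (indicator {0<..t}). indicator A s * F s)" for w
  proof -
    have "(LINT s|density (stieltjes w) (\<lambda>s. ennreal (indicator {0<..t} s)). indicator A s * F s)
      = (LINT s|stieltjes w. indicator {0<..t} s *\<^sub>R (indicator A s * F s))"
      by (rule integral_density) auto
    also have "\<dots> = (LINT s:A|stieltjes w. F s)"
      unfolding set_lebesgue_integral_def using A(2)
      by (intro Bochner_Integration.integral_cong) (auto split: split_indicator)
    finally show ?thesis by (simp add: ennreal_indicator)
  qed
  show ?thesis by (simp add: d eq)
qed

lemma stint_measurable:
  assumes F: "(\<lambda>(y, r). F y r) \<in> borel_measurable (N \<Otimes>\<^sub>M borel)" and F0: "\<And>y r. 0 \<le> F y r"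
    and w[measurable]: "w \<in> measurable N canonical_space" and T[measurable]: "T \<in> borel_measurable N"
  shows "(\<lambda>y. stint (w y) (F y) (T y)) \<in> borel_measurable N"
    and "(\<lambda>y. stint_left (w y) (F y) (T y)) \<in> borel_measurable N"
proof -
  note [measurable] = F
  have Fy: "F y \<in> borel_measurable borel" if "y \<in> space N" for y
    using measurable_compose[OF measurable_Pair1' F, of y] that by simp
  have "(\<lambda>y. enn2real (\<integral>\<^sup>+r\<in>{0<..}. (ennreal (F y r) * indicator {..T y} r) \<partial>stieltjes (w y))) \<in> borel_measurable N"
    using stieltjes_nn_integral_measurable_Ioi[OF _ w, of "\<lambda>y r. ennreal (F y r) * indicator {..T y} r"]
    by (simp add: indicator_def)
  also have "?this \<longleftrightarrow> (\<lambda>y. stint (w y) (F y) (T y)) \<in> borel_measurable N"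
  proof (rule measurable_cong)
    fix y assume "y \<in> space N"
    then show "enn2real (\<integral>\<^sup>+r\<in>{0<..}. (ennreal (F y r) * indicator {..T y} r) \<partial>stieltjes (w y)) = stint (w y) (F y) (T y)"
      unfolding stint_def using Fy F0 by (subst stieltjes_integral_eq_nn)
        (auto intro!: arg_cong[where f=enn2real] nn_integral_cong split: split_indicator)
  qed
  finally show "(\<lambda>y. stint (w y) (F y) (T y)) \<in> borel_measurable N" .
  have "(\<lambda>y. enn2real (\<integral>\<^sup>+r\<in>{0<..}. (ennreal (F y r) * indicator {..<T y} r) \<partial>stieltjes (w y))) \<in> borel_measurable N"
    using stieltjes_nn_integral_measurable_Ioi[OF _ w, of "\<lambda>y r. ennreal (F y r) * indicator {..<T y} r"]
    by (simp add: indicator_def)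
  also have "?this \<longleftrightarrow> (\<lambda>y. stint_left (w y) (F y) (T y)) \<in> borel_measurable N"
  proof (rule measurable_cong)
    fix y assume "y \<in> space N"
    then show "enn2real (\<integral>\<^sup>+r\<in>{0<..}. (ennreal (F y r) * indicator {..<T y} r) \<partial>stieltjes (w y)) = stint_left (w y) (F y) (T y)"
      unfolding stint_left_def using Fy F0 by (subst stieltjes_integral_eq_nn)
        (auto intro!: arg_cong[where f=enn2real] nn_integral_cong split: split_indicator)
  qed
  finally show "(\<lambda>y. stint_left (w y) (F y) (T y)) \<in> borel_measurable N" .
qed

lemma (in bounded_integrand) stint_stint:
  assumes G[measurable]: "G \<in> borel_measurable borel"
  shows "stint (stint \<omega> F) G t = stint \<omega> (\<lambda>s. F s * G s) t"
proof -
  have "stieltjes (stint \<omega> F) = density (stieltjes \<omega>) (\<lambda>s. ennreal (indicator {0<..} s * F s))"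
    unfolding stieltjes_stint by (intro arg_cong[where f="density (stieltjes \<omega>)"] ext) (auto split: split_indicator)
  then have "stint (stint \<omega> F) G t = (LINT s|density (stieltjes \<omega>) (\<lambda>s. ennreal (indicator {0<..} s * F s)). indicator {0<..t} s *\<^sub>R G s)"
    unfolding stint_def set_lebesgue_integral_def by simp
  also have "\<dots> = (LINT s|stieltjes \<omega>. (indicator {0<..} s * F s) *\<^sub>R (indicator {0<..t} s *\<^sub>R G s))"
    by (subst integral_density) (auto simp: F_nonneg)
  also have "\<dots> = stint \<omega> (\<lambda>s. F s * G s) t"
    unfolding stint_def set_lebesgue_integral_def
    by (intro Bochner_Integration.integral_cong) (auto split: split_indicator)
  finally show ?thesis .
qed

text \<open>A measurable functional that does not change when the path is stopped at
  \<open>t\<close> is measurable for \<open>canonical_filtration t\<close>, because stopping is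
  measurable from there into the full canonical space.\<close>

definition stop_path :: "real \<Rightarrow> (real \<Rightarrow> real) \<Rightarrow> real \<Rightarrow> real" where
  "stop_path t \<omega> s = \<omega> (min s t)"

text \<open>The stopped path is the integral of the indicator of \<open>{..t}\<close> against the
  path, so its regularity comes from \<open>stint_path\<close>.\<close>

lemma stop_path_paths:
  assumes \<omega>: "\<omega> \<in> paths" and t: "0 \<le> t" shows "stop_path t \<omega> \<in> paths"
proof -
  interpret bounded_integrand \<omega> "indicator {..t}" 1 by unfold_locales (auto simp: \<omega> indicator_def)
  have "stint \<omega> (indicator {..t}) = stop_path t \<omega>"
  proof
    fix s
    show "stint \<omega> (indicator {..t}) s = stop_path t \<omega> s"
    proof (cases "0 \<le> s")
      case True
      have "{0<..s} \<inter> {..t} = {0<..min s t}" by auto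
      then have "stint \<omega> (indicator {..t}) s = measure (stieltjes \<omega>) {0<..min s t}"
        unfolding stint_def set_lebesgue_integral_def by (simp add: indicator_inter_arith[symmetric])
      then show ?thesis using True t paths_nonneg[OF \<omega>]
        by (simp add: measure_def emeasure_stieltjes[OF \<omega>] paths_0[OF \<omega>] stop_path_def)
    qed (use t in \<open>auto simp: stint_nonpos stop_path_def paths_neg[OF \<omega>]\<close>)
  qed
  then show ?thesis using stint_path by simp
qed

lemma stop_path_measurable:
  assumes t: "0 \<le> t" shows "stop_path t \<in> measurable (canonical_filtration t) canonical_space"
proof (rule measurable_canonicalI)
  fix s :: real assume "0 \<le> s"
  then show "(\<lambda>\<omega>. stop_path t \<omega> s) \<in> borel_measurable (canonical_filtration t)"
    unfolding stop_path_def using t by (intro filtration_eval_measurable) auto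
qed (use stop_path_paths t in auto)

section \<open>The stochastic differential equation, path by path\<close>

locale sde_coeff =
  fixes m :: "real \<Rightarrow> real \<Rightarrow> real" and C D L :: real
  assumes m_meas: "(\<lambda>(s, a). m s a) \<in> borel_measurable (restrict_space borel ({0..} \<times> {0..}))"
    and m_pos: "\<And>s a. 0 \<le> s \<Longrightarrow> 0 \<le> a \<Longrightarrow> 0 < m s a"
    and m_le: "\<And>s a. 0 \<le> s \<Longrightarrow> 0 \<le> a \<Longrightarrow> m s a \<le> C"
    and m_inv_le: "\<And>s a. 0 \<le> s \<Longrightarrow> 0 \<le> a \<Longrightarrow> 1 / m s a \<le> D"
    and m_lip: "\<And>s. 0 \<le> s \<Longrightarrow> L-lipschitz_on {0..} (m s)"
    and L_pos: "0 < L"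
begin

text \<open>Continued constantly across 0 in both arguments, the coefficient keeps its bounds, its
  Lipschitz constant and its measurability on the whole plane, so the iterates can be formed without
  sign conditions.\<close>

definition mp :: "real \<Rightarrow> real \<Rightarrow> real" where
  "mp s a = m (max 0 s) (max 0 a)"

lemma mp_eq: "0 \<le> s \<Longrightarrow> 0 \<le> a \<Longrightarrow> mp s a = m s a"
  by (simp add: mp_def)

lemma mp_pos: "0 < mp s a" and mp_le: "mp s a \<le> C" and mp_inv_le: "1 / mp s a \<le> D"
  unfolding mp_def by (auto intro: m_pos m_le m_inv_le)

lemma C_pos: "0 < C" and D_pos: "0 < D"
  using mp_pos[of 0 0] mp_le[of 0 0] mp_inv_le[of 0 0] less_le_trans
  by (blast, metis less_le_trans zero_less_divide_1_iff)

lemma mp_lip: "\<bar>mp s a - mp s b\<bar> \<le> L * \<bar>a - b\<bar>"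
proof -
  have "\<bar>mp s a - mp s b\<bar> \<le> L * \<bar>max 0 a - max 0 b\<bar>"
    unfolding mp_def using lipschitz_onD[OF m_lip[of "max 0 s"], of "max 0 a" "max 0 b"] by (simp add: dist_real_def)
  also have "\<dots> \<le> L * \<bar>a - b\<bar>" using L_pos by (intro mult_left_mono) auto
  finally show ?thesis .
qed

lemma mp_pair_measurable: "(\<lambda>p. mp (fst p) (snd p)) \<in> borel_measurable (borel \<Otimes>\<^sub>M borel)"
proof -
  have "(\<lambda>p :: real \<times> real. (max 0 (fst p), max 0 (snd p))) \<in> measurable (borel \<Otimes>\<^sub>M borel) (restrict_space borel ({0..} \<times> {0..}))"
    by (rule measurable_restrict_space2) (auto simp: borel_prod[symmetric])
  from measurable_compose[OF this m_meas] show ?thesis by (simp add: mp_def)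
qed

lemma mp_measurable[measurable (raw)]:
  assumes "f \<in> borel_measurable N" "g \<in> borel_measurable N"
  shows "(\<lambda>y. mp (f y) (g y)) \<in> borel_measurable N"
  using measurable_compose[OF measurable_Pair[OF assms] mp_pair_measurable] by simp

lemma mp_integrand:
  assumes "\<omega> \<in> paths" "x \<in> borel_measurable borel"
  shows "bounded_integrand \<omega> (\<lambda>r. mp r (x r)) C"
  using assms by unfold_locales (auto intro: mp_le less_imp_le mp_pos)

lemma inv_mp_integrand:
  assumes "\<omega> \<in> paths" "x \<in> borel_measurable borel"
  shows "bounded_integrand \<omega> (\<lambda>r. 1 / mp r (x r)) D"
  using assms by unfold_locales (auto intro: mp_inv_le less_imp_le mp_pos)

text \<open>The weight \<open>exp (2 * L * left_lim \<omega> s)\<close> makes the iteration a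
  contraction: the Lipschitz bound costs a factor \<open>L\<close>, while integrating
  \<open>2 * L\<close> times the weight over \<open>{0<..<s}\<close> returns at most the weight, so
  one half remains. The contraction is therefore global in time.\<close>

lemma picard_step:
  assumes \<omega>: "\<omega> \<in> paths" and x[measurable]: "x \<in> borel_measurable borel" and y[measurable]: "y \<in> borel_measurable borel"
    and xy: "\<And>r. \<bar>x r - y r\<bar> \<le> k * exp (2 * L * left_lim \<omega> r)" and k: "0 \<le> k"
  shows "\<bar>stint_left \<omega> (\<lambda>r. mp r (x r)) s - stint_left \<omega> (\<lambda>r. mp r (y r)) s\<bar> \<le> k / 2 * exp (2 * L * left_lim \<omega> s)"
proof -
  interpret bounded_integrand \<omega> "\<lambda>r. mp r (x r)" C by (rule mp_integrand[OF \<omega> x])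
  have [measurable]: "left_lim \<omega> \<in> borel_measurable borel" by (rule left_lim_paths_measurable[OF \<omega>])
  have i: "set_integrable (stieltjes \<omega>) {0<..<s} (\<lambda>r. mp r (x r))" "set_integrable (stieltjes \<omega>) {0<..<s} (\<lambda>r. mp r (y r))"
    by (rule stieltjes_set_integrable[OF \<omega>, where B=C and t=s], measurable,
        auto simp: abs_of_pos mp_pos mp_le)+
  have "ennreal \<bar>stint_left \<omega> (\<lambda>r. mp r (x r)) s - stint_left \<omega> (\<lambda>r. mp r (y r)) s\<bar>
      = ennreal (norm (LINT r:{0<..<s}|stieltjes \<omega>. mp r (x r) - mp r (y r)))"
    unfolding stint_left_def by (subst set_integral_diff(2)[OF i]) simp
  also have "\<dots> \<le> (\<integral>\<^sup>+r. ennreal (norm (indicator {0<..<s} r *\<^sub>R (mp r (x r) - mp r (y r)))) \<partial>stieltjes \<omega>)"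
    unfolding set_lebesgue_integral_def
    by (rule integral_norm_bound_ennreal) (use set_integral_diff(1)[OF i] in \<open>simp add: set_integrable_def\<close>)
  also have "\<dots> \<le> (\<integral>\<^sup>+r. ennreal (k / 2) * (ennreal (2 * L * exp (2 * L * left_lim \<omega> r)) * indicator {0<..<s} r) \<partial>stieltjes \<omega>)"
  proof (rule nn_integral_mono)
    fix r
    have "\<bar>mp r (x r) - mp r (y r)\<bar> \<le> L * (k * exp (2 * L * left_lim \<omega> r))"
      using mp_lip[of r "x r" "y r"] xy[of r] L_pos by (meson less_imp_le mult_left_mono order_trans)
    then show "ennreal (norm (indicator {0<..<s} r *\<^sub>R (mp r (x r) - mp r (y r))))
      \<le> ennreal (k / 2) * (ennreal (2 * L * exp (2 * L * left_lim \<omega> r)) * indicator {0<..<s} r)"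
      using k L_pos by (auto simp: ennreal_mult'[symmetric] algebra_simps intro!: ennreal_leI split: split_indicator)
  qed
  also have "\<dots> = ennreal (k / 2) * (\<integral>\<^sup>+r\<in>{0<..<s}. ennreal (2 * L * exp (2 * L * left_lim \<omega> r)) \<partial>stieltjes \<omega>)"
    by (rule nn_integral_cmult) measurable
  also have "\<dots> \<le> ennreal (k / 2) * ennreal (exp (2 * L * left_lim \<omega> s))"
    using stieltjes_exp_left_le[of "2 * L" s] L_pos by (intro mult_left_mono) auto
  finally have "ennreal \<bar>stint_left \<omega> (\<lambda>r. mp r (x r)) s - stint_left \<omega> (\<lambda>r. mp r (y r)) s\<bar> \<le> ennreal (k / 2 * exp (2 * L * left_lim \<omega> s))"
    using k by (subst ennreal_mult') auto
  then show ?thesis using k by (subst (asm) ennreal_le_iff) auto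
qed

text \<open>Linear growth \<open>C * left_lim \<omega> s\<close> fits under the weight because y
  \<le> exp y; this is where the starting constant \<open>C / (2 * L)\<close> of the iteration comes
  from.\<close>

lemma stint_left_exp_bound:
  assumes \<omega>: "\<omega> \<in> paths" and x[measurable]: "x \<in> borel_measurable borel"
  shows "stint_left \<omega> (\<lambda>r. mp r (x r)) s \<le> C / (2 * L) * exp (2 * L * left_lim \<omega> s)"
proof -
  interpret bounded_integrand \<omega> "\<lambda>r. mp r (x r)" C by (rule mp_integrand[OF \<omega> x])
  have "stint_left \<omega> (\<lambda>r. mp r (x r)) s \<le> C / (2 * L) * (2 * L * left_lim \<omega> s)"
    using stint_left_le[of s] L_pos by simp
  also have "\<dots> \<le> C / (2 * L) * exp (2 * L * left_lim \<omega> s)"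
  proof (intro mult_left_mono)
    show "2 * L * left_lim \<omega> s \<le> exp (2 * L * left_lim \<omega> s)"
      using exp_ge_add_one_self[of "2 * L * left_lim \<omega> s"] by linarith
  qed (use L_pos C_pos in auto)
  finally show ?thesis .
qed

text \<open>The iteration runs on the left-limit process \<open>X_{s-}\<close>, which satisfies a closed equation
  with integrals over \<open>{0<..<s}\<close>; no left limits of the iterates have to be taken.\<close>

primrec picard :: "(real \<Rightarrow> real) \<Rightarrow> nat \<Rightarrow> real \<Rightarrow> real" where
  "picard \<omega> 0 = (\<lambda>_. 0)"
| "picard \<omega> (Suc n) = stint_left \<omega> (\<lambda>r. mp r (picard \<omega> n r))"

lemma picard_measurable: "(\<lambda>(s, \<omega>). picard \<omega> n s) \<in> borel_measurable (borel \<Otimes>\<^sub>M canonical_space)"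
proof (induction n)
  case (Suc n)
  have [measurable]: "(\<lambda>y. picard (snd (fst y)) n (snd y)) \<in> borel_measurable ((borel \<Otimes>\<^sub>M canonical_space) \<Otimes>\<^sub>M borel)"
    using measurable_compose[OF _ Suc, of "\<lambda>y. (snd y, snd (fst y))" "(borel \<Otimes>\<^sub>M canonical_space) \<Otimes>\<^sub>M borel"] by simp
  have "(\<lambda>y. stint_left (snd y) (\<lambda>r. mp r (picard (snd y) n r)) (fst y)) \<in> borel_measurable (borel \<Otimes>\<^sub>M canonical_space)"
    by (rule stint_measurable(2)[where F="\<lambda>y r. mp r (picard (snd y) n r)"])
       (auto simp: case_prod_beta' less_imp_le mp_pos)
  then show ?case by (simp add: case_prod_beta')
qed simp

lemma picard_path_measurable: "\<omega> \<in> paths \<Longrightarrow> picard \<omega> n \<in> borel_measurable borel"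
  using measurable_compose[OF measurable_Pair2'[of \<omega> canonical_space borel] picard_measurable[of n]] by simp

lemma picard_diff:
  assumes \<omega>: "\<omega> \<in> paths"
  shows "\<bar>picard \<omega> (Suc n) s - picard \<omega> n s\<bar> \<le> C / (2 * L) * (1 / 2) ^ n * exp (2 * L * left_lim \<omega> s)"
proof (induction n arbitrary: s)
  case 0
  interpret bounded_integrand \<omega> "\<lambda>r. mp r 0" C by (rule mp_integrand[OF \<omega>]) auto
  show ?case using stint_left_exp_bound[OF \<omega>, of "\<lambda>_. 0" s] stint_left_nonneg[of s] by simp
next
  case (Suc n)
  have "\<bar>picard \<omega> (Suc (Suc n)) s - picard \<omega> (Suc n) s\<bar> \<le> (C / (2 * L) * (1 / 2) ^ n) / 2 * exp (2 * L * left_lim \<omega> s)"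
    unfolding picard.simps(2)[of \<omega> "Suc n"] picard.simps(2)[of \<omega> n]
    by (rule picard_step[OF \<omega>]) (use C_pos L_pos Suc picard_path_measurable[OF \<omega>, of n] picard_path_measurable[OF \<omega>, of "Suc n"] in \<open>auto\<close>)
  then show ?case by simp
qed

definition sol_left :: "(real \<Rightarrow> real) \<Rightarrow> real \<Rightarrow> real" where
  "sol_left \<omega> s = lim (\<lambda>n. picard \<omega> n s)"

lemma picard_LIMSEQ:
  assumes \<omega>: "\<omega> \<in> paths" shows "(\<lambda>n. picard \<omega> n s) \<longlonglongrightarrow> sol_left \<omega> s"
proof -
  have "summable (\<lambda>n. picard \<omega> (Suc n) s - picard \<omega> n s)"
  proof (rule summable_comparison_test')
    show "summable (\<lambda>n. C / (2 * L) * (1 / 2) ^ n * exp (2 * L * left_lim \<omega> s))"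
      by (intro summable_mult summable_mult2 summable_geometric) auto
    show "norm (picard \<omega> (Suc n) s - picard \<omega> n s) \<le> C / (2 * L) * (1 / 2) ^ n * exp (2 * L * left_lim \<omega> s)" for n
      using picard_diff[OF \<omega>] by simp
  qed
  then have "(\<lambda>n. \<Sum>i<n. picard \<omega> (Suc i) s - picard \<omega> i s) \<longlonglongrightarrow> (\<Sum>n. picard \<omega> (Suc n) s - picard \<omega> n s)"
    by (rule summable_LIMSEQ)
  then have "(\<lambda>n. picard \<omega> n s) \<longlonglongrightarrow> (\<Sum>n. picard \<omega> (Suc n) s - picard \<omega> n s)"
    unfolding sum_lessThan_telescope[of "\<lambda>i. picard \<omega> i s"] by simp
  then show ?thesis unfolding sol_left_def by (simp add: limI)
qed

lemma sol_left_joint_measurable: "(\<lambda>(s, \<omega>). sol_left \<omega> s) \<in> borel_measurable (borel \<Otimes>\<^sub>M canonical_space)"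
  unfolding sol_left_def case_prod_beta'
  by (rule borel_measurable_lim_metric) (use picard_measurable in \<open>simp add: case_prod_beta'\<close>)

lemma sol_left_measurable: "\<omega> \<in> paths \<Longrightarrow> sol_left \<omega> \<in> borel_measurable borel"
  using measurable_compose[OF measurable_Pair2'[of \<omega> canonical_space borel] sol_left_joint_measurable] by simp

lemma sol_left_eq:
  assumes \<omega>: "\<omega> \<in> paths"
  shows "sol_left \<omega> s = stint_left \<omega> (\<lambda>r. mp r (sol_left \<omega> r)) s"
proof -
  note [measurable] = sol_left_measurable[OF \<omega>] picard_path_measurable[OF \<omega>]
  have "(\<lambda>n. picard \<omega> (Suc n) s) \<longlonglongrightarrow> stint_left \<omega> (\<lambda>r. mp r (sol_left \<omega> r)) s"
    unfolding picard.simps stint_left_def set_lebesgue_integral_def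
  proof (rule integral_dominated_convergence[where w="\<lambda>r. indicator {0<..<s} r *\<^sub>R C"])
    show "integrable (stieltjes \<omega>) (\<lambda>r. indicator {0<..<s} r *\<^sub>R C)"
      using stieltjes_set_integrable[OF \<omega>, of "\<lambda>_. C" C "{0<..<s}" s] C_pos by (simp add: set_integrable_def subset_eq)
    show "AE r in stieltjes \<omega>. (\<lambda>n. indicator {0<..<s} r *\<^sub>R mp r (picard \<omega> n r)) \<longlonglongrightarrow> indicator {0<..<s} r *\<^sub>R mp r (sol_left \<omega> r)"
    proof (intro AE_I2 tendsto_intros)
      fix r
      have "(\<lambda>n. mp r (picard \<omega> n r) - mp r (sol_left \<omega> r)) \<longlonglongrightarrow> 0"
      proof (rule Lim_null_comparison)
        show "eventually (\<lambda>n. norm (mp r (picard \<omega> n r) - mp r (sol_left \<omega> r)) \<le> L * \<bar>picard \<omega> n r - sol_left \<omega> r\<bar>) sequentially"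
          using mp_lip by simp
        show "(\<lambda>n. L * \<bar>picard \<omega> n r - sol_left \<omega> r\<bar>) \<longlonglongrightarrow> 0"
          using picard_LIMSEQ[OF \<omega>, of r] by (auto intro!: tendsto_eq_intros)
      qed
      then show "(\<lambda>n. mp r (picard \<omega> n r)) \<longlonglongrightarrow> mp r (sol_left \<omega> r)"
        by (rule LIM_zero_cancel)
    qed
    show "AE r in stieltjes \<omega>. norm (indicator {0<..<s} r *\<^sub>R mp r (picard \<omega> n r)) \<le> indicator {0<..<s} r *\<^sub>R C" for n
      by (intro AE_I2) (auto simp: indicator_def abs_of_pos mp_pos mp_le)
  qed measurable
  then show ?thesis using LIMSEQ_unique[OF LIMSEQ_Suc[OF picard_LIMSEQ[OF \<omega>]]] by simp
qed

text \<open>Two fixed points lie between 0 and \<open>C / (2 * L)\<close> times the weight, which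
  bounds their distance; applying the contraction \<open>n\<close> times to the pair shrinks that
  distance to 0.\<close>

lemma sol_left_unique:
  assumes \<omega>: "\<omega> \<in> paths" and z: "z \<in> borel_measurable borel"
    and eq: "\<And>s. z s = stint_left \<omega> (\<lambda>r. mp r (z r)) s"
  shows "z = sol_left \<omega>"
proof
  fix s
  interpret z: bounded_integrand \<omega> "\<lambda>r. mp r (z r)" C by (rule mp_integrand[OF \<omega> z])
  interpret y: bounded_integrand \<omega> "\<lambda>r. mp r (sol_left \<omega> r)" C
    by (rule mp_integrand[OF \<omega> sol_left_measurable[OF \<omega>]])
  have *: "\<bar>z s - sol_left \<omega> s\<bar> \<le> C / (2 * L) * (1 / 2) ^ n * exp (2 * L * left_lim \<omega> s)" for n s
  proof (induction n arbitrary: s)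
    case 0
    show ?case
      using stint_left_exp_bound[OF \<omega> z, of s] stint_left_exp_bound[OF \<omega> sol_left_measurable[OF \<omega>], of s]
        z.stint_left_nonneg[of s] y.stint_left_nonneg[of s] eq[of s] sol_left_eq[OF \<omega>, of s] by auto
  next
    case (Suc n)
    have "\<bar>z s - sol_left \<omega> s\<bar> \<le> (C / (2 * L) * (1 / 2) ^ n) / 2 * exp (2 * L * left_lim \<omega> s)"
      unfolding eq[of s] sol_left_eq[OF \<omega>, of s]
      by (rule picard_step[OF \<omega> z sol_left_measurable[OF \<omega>] Suc.IH]) (use C_pos L_pos in auto)
    then show ?case by simp
  qed
  have "(\<lambda>n. C / (2 * L) * (1 / 2) ^ n * exp (2 * L * left_lim \<omega> s)) \<longlonglongrightarrow> C / (2 * L) * 0 * exp (2 * L * left_lim \<omega> s)"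
    by (intro tendsto_intros LIMSEQ_power_zero) auto
  from tendsto_lowerbound[OF this always_eventually[OF allI[OF *]]] show "z s = sol_left \<omega> s" by simp
qed

text \<open>With the left limits already known the integrand is given, so the solution is an
  ordinary integral; that its own left limits are \<open>sol_left \<omega>\<close> is the
  fixed-point equation.\<close>

definition sol :: "(real \<Rightarrow> real) \<Rightarrow> real \<Rightarrow> real" where
  "sol \<omega> = stint \<omega> (\<lambda>r. mp r (sol_left \<omega> r))"

lemma
  assumes \<omega>: "\<omega> \<in> paths"
  shows sol_paths: "sol \<omega> \<in> paths" and left_lim_sol: "left_lim (sol \<omega>) s = sol_left \<omega> s"
    and jump_sol: "jump (sol \<omega>) s = mp s (left_lim (sol \<omega>) s) * jump \<omega> s"
    and sol_eq: "sol \<omega> t = stint \<omega> (\<lambda>r. mp r (left_lim (sol \<omega>) r)) t"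
proof -
  interpret bounded_integrand \<omega> "\<lambda>r. mp r (sol_left \<omega> r)" C
    by (rule mp_integrand[OF \<omega> sol_left_measurable[OF \<omega>]])
  show "sol \<omega> \<in> paths" unfolding sol_def by (rule stint_path)
  show l: "left_lim (sol \<omega>) s = sol_left \<omega> s" for s
    unfolding sol_def left_lim_stint by (rule sol_left_eq[OF \<omega>, symmetric])
  show "sol \<omega> t = stint \<omega> (\<lambda>r. mp r (left_lim (sol \<omega>) r)) t" unfolding l by (simp add: sol_def)
  show "jump (sol \<omega>) s = mp s (left_lim (sol \<omega>) s) * jump \<omega> s" unfolding l unfolding sol_def by (rule jump_stint)
qed

lemma sol_unique:
  assumes \<omega>: "\<omega> \<in> paths" and Y: "cadlag Y"
    and eq: "\<And>t. 0 \<le> t \<Longrightarrow> Y t = (LINT s:{0<..t}|stieltjes \<omega>. mp s (left_lim Y s))"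
    and t: "0 \<le> t"
  shows "Y t = sol \<omega> t"
proof -
  \<comment> \<open>A solution is unconstrained at negative times, so its left limit at
    \<open>s \<le> 0\<close> is arbitrary; 0 is the value that the fixed-point equation prescribes
    there.\<close>
  define z where "z s = (if 0 < s then left_lim Y s else 0)" for s
  have "((\<lambda>r. if r < 0 then 0 else Y r) \<longlongrightarrow> z s) (at_left s)" for s
  proof (cases "0 < s")
    case True
    have "eventually (\<lambda>r. (if r < 0 then 0 else Y r) = Y r) (at_left s)"
      unfolding eventually_at_left_field using True by (intro exI[of _ 0]) auto
    from tendsto_cong[OF this] show ?thesis using cadlag_left_lim[OF Y True] True by (simp add: z_def)
  next
    case False
    have "eventually (\<lambda>r. (if r < 0 then 0 else Y r) = 0) (at_left s)"
      unfolding eventually_at_left_field using False by (intro exI[of _ "s - 1"]) auto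
    then show ?thesis using False by (simp add: z_def tendsto_eventually)
  qed
  \<comment> \<open>A one-point parameter space reduces measurability of a single path to the joint
    statement.\<close>
  then have "(\<lambda>(s, u :: unit). z s) \<in> borel_measurable (borel \<Otimes>\<^sub>M count_space UNIV)"
    by (intro left_limit_joint_measurable[where x="\<lambda>r _. if r < 0 then 0 else Y r"]) auto
  from measurable_compose[OF measurable_Pair2'[of "()"] this] have z[measurable]: "z \<in> borel_measurable borel" by simp
  interpret bounded_integrand \<omega> "\<lambda>r. mp r (z r)" C by (rule mp_integrand[OF \<omega> z])
  have Yt: "Y t = stint \<omega> (\<lambda>r. mp r (z r)) t" if "0 \<le> t" for t
  proof -
    have "Y t = stint \<omega> (\<lambda>r. mp r (left_lim Y r)) t" using eq[OF that] by (simp add: stint_def)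
    also have "\<dots> = stint \<omega> (\<lambda>r. mp r (z r)) t" by (rule stint_cong) (simp add: z_def)
    finally show ?thesis .
  qed
  have "z s = stint_left \<omega> (\<lambda>r. mp r (z r)) s" for s
  proof (cases "0 < s")
    case True
    then have "z s = left_lim (stint \<omega> (\<lambda>r. mp r (z r))) s"
      using left_lim_cong[of 0 s Y "stint \<omega> (\<lambda>r. mp r (z r))"] Yt by (simp add: z_def)
    then show ?thesis by (simp add: left_lim_stint)
  next
    case False
    then have "stint_left \<omega> (\<lambda>r. mp r (z r)) s = 0" by (intro stint_left_nonpos) simp
    then show ?thesis using False by (simp add: z_def)
  qed
  from sol_left_unique[OF \<omega> z this] have "z = sol_left \<omega>" .
  then show ?thesis using Yt[OF t] by (simp add: sol_def)
qed

definition inv_int :: "(real \<Rightarrow> real) \<Rightarrow> real \<Rightarrow> real" where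
  "inv_int \<omega> = stint \<omega> (\<lambda>r. 1 / mp r (left_lim \<omega> r))"

lemma inv_int_paths: "\<omega> \<in> paths \<Longrightarrow> inv_int \<omega> \<in> paths"
  unfolding inv_int_def by (rule bounded_integrand.stint_path[OF inv_mp_integrand[OF _ left_lim_paths_measurable]])

lemma stint_one: "\<omega> \<in> paths \<Longrightarrow> stint \<omega> (\<lambda>_. 1) t = \<omega> t"
  by (cases "0 \<le> t") (auto simp: stint_def set_lebesgue_integral_def measure_def emeasure_stieltjes paths_0 paths_neg paths_nonneg)

text \<open>Integrating \<open>mp\<close> against \<open>inv_int \<omega>\<close> cancels the
  density \<open>1 / mp\<close>, so \<omega> itself solves the equation driven by
  \<open>inv_int \<omega>\<close>, and uniqueness applies. A continuous part of \<omega> is treated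
  along with the jumps, hence the identity on every path.\<close>

lemma sol_inv_int:
  assumes \<omega>: "\<omega> \<in> paths" shows "sol (inv_int \<omega>) = \<omega>"
proof
  fix t
  interpret bounded_integrand \<omega> "\<lambda>r. 1 / mp r (left_lim \<omega> r)" D
    by (rule inv_mp_integrand[OF \<omega> left_lim_paths_measurable[OF \<omega>]])
  note [measurable] = left_lim_paths_measurable[OF \<omega>]
  show "sol (inv_int \<omega>) t = \<omega> t"
  proof (cases "0 \<le> t")
    case True
    have "\<omega> t = sol (inv_int \<omega>) t"
    proof (rule sol_unique[OF inv_int_paths[OF \<omega>] paths_cadlag[OF \<omega>] _ True])
      fix t
      have "(LINT s:{0<..t}|stieltjes (inv_int \<omega>). mp s (left_lim \<omega> s)) = stint (inv_int \<omega>) (\<lambda>s. mp s (left_lim \<omega> s)) t"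
        by (simp add: stint_def)
      also have "\<dots> = stint \<omega> (\<lambda>s. 1 / mp s (left_lim \<omega> s) * mp s (left_lim \<omega> s)) t"
        unfolding inv_int_def by (rule stint_stint) measurable
      also have "\<dots> = stint \<omega> (\<lambda>_. 1) t"
        using mp_pos by (intro stint_cong) (simp add: less_imp_neq[THEN not_sym])
      finally show "\<omega> t = (LINT s:{0<..t}|stieltjes (inv_int \<omega>). mp s (left_lim \<omega> s))"
        by (simp add: stint_one[OF \<omega>])
    qed
    then show ?thesis by simp
  qed (simp add: paths_neg[OF \<omega>] paths_neg[OF sol_paths[OF inv_int_paths[OF \<omega>]]])
qed

lemma jump_inv_int:
  assumes \<omega>: "\<omega> \<in> paths" shows "jump (inv_int \<omega>) s = jump \<omega> s / mp s (left_lim \<omega> s)"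
  unfolding inv_int_def
  using bounded_integrand.jump_stint[OF inv_mp_integrand[OF \<omega> left_lim_paths_measurable[OF \<omega>]]] by simp

lemma sol_measurable: "sol \<in> measurable canonical_space canonical_space"
proof (rule measurable_canonicalI)
  fix t
  have [measurable]: "(\<lambda>y. sol_left (fst y) (snd y)) \<in> borel_measurable (canonical_space \<Otimes>\<^sub>M borel)"
    using measurable_compose[OF _ sol_left_joint_measurable, of "\<lambda>y. (snd y, fst y)" "canonical_space \<Otimes>\<^sub>M borel"] by simp
  have "(\<lambda>\<omega>. stint \<omega> (\<lambda>r. mp r (sol_left \<omega> r)) t) \<in> borel_measurable canonical_space"
    by (rule stint_measurable(1)[where F="\<lambda>\<omega> r. mp r (sol_left \<omega> r)" and w="\<lambda>\<omega>. \<omega>" and T="\<lambda>_. t"])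
       (auto simp: case_prod_beta' less_imp_le mp_pos)
  then show "(\<lambda>\<omega>. sol \<omega> t) \<in> borel_measurable canonical_space" by (simp add: sol_def)
qed (simp add: sol_paths)

lemma inv_int_measurable: "inv_int \<in> measurable canonical_space canonical_space"
proof (rule measurable_canonicalI)
  fix t
  have "(\<lambda>\<omega>. stint \<omega> (\<lambda>r. 1 / mp r (left_lim \<omega> r)) t) \<in> borel_measurable canonical_space"
    by (rule stint_measurable(1)[where F="\<lambda>\<omega> r. 1 / mp r (left_lim \<omega> r)" and w="\<lambda>\<omega>. \<omega>" and T="\<lambda>_. t"])
       (auto simp: case_prod_beta' less_imp_le mp_pos)
  then show "(\<lambda>\<omega>. inv_int \<omega> t) \<in> borel_measurable canonical_space" by (simp add: inv_int_def)
qed (simp add: inv_int_paths)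

text \<open>Non-anticipation passes from one iterate to the next: up to \<open>t\<close> each
  integrates earlier values against a measure that sees the path on \<open>{0..t}\<close>
  only.\<close>

lemma picard_stop:
  assumes \<omega>: "\<omega> \<in> paths" and t: "0 \<le> t"
  shows "s \<le> t \<Longrightarrow> picard (stop_path t \<omega>) n s = picard \<omega> n s"
proof (induction n arbitrary: s)
  case (Suc n)
  have "picard (stop_path t \<omega>) (Suc n) s = stint_left (stop_path t \<omega>) (\<lambda>r. mp r (picard \<omega> n r)) s"
    using Suc by (simp, intro stint_left_cong) simp
  also have "\<dots> = picard \<omega> (Suc n) s"
    unfolding stint_left_def picard.simps using \<omega> t Suc.prems picard_path_measurable[OF \<omega>, of n]
    by (intro stint_eq_of_agree[where t=t] stop_path_paths) (auto simp: stop_path_def)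
  finally show ?case .
qed simp

lemma sol_stop:
  assumes \<omega>: "\<omega> \<in> paths" and t: "0 \<le> t" and s: "s \<le> t"
  shows "sol (stop_path t \<omega>) s = sol \<omega> s"
proof -
  have "sol_left (stop_path t \<omega>) r = sol_left \<omega> r" if "r \<le> t" for r
    using picard_stop[OF \<omega> t that] by (simp add: sol_left_def)
  then have "sol (stop_path t \<omega>) s = stint (stop_path t \<omega>) (\<lambda>r. mp r (sol_left \<omega> r)) s"
    using s unfolding sol_def by (intro stint_cong) simp
  also have "\<dots> = sol \<omega> s"
    unfolding stint_def sol_def using \<omega> t s sol_left_measurable[OF \<omega>]
    by (intro stint_eq_of_agree[where t=t] stop_path_paths) (auto simp: stop_path_def)
  finally show ?thesis .
qed

text \<open>Up to time \<open>t\<close> the solution is unchanged by stopping the path at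
  \<open>t\<close>, and stopping is measurable from \<open>canonical_filtration t\<close>.\<close>

lemma sol_adapted: "0 \<le> t \<Longrightarrow> sol \<in> measurable (canonical_filtration t) (canonical_filtration t)"
proof (rule measurable_filtrationI)
  fix s assume t: "0 \<le> t" and s: "0 \<le> s" "s \<le> t"
  have "(\<lambda>\<omega>. sol (stop_path t \<omega>) s) \<in> borel_measurable (canonical_filtration t)"
    using measurable_compose[OF stop_path_measurable[OF t] measurable_compose[OF sol_measurable canonical_eval_measurable]] .
  also have "?this \<longleftrightarrow> (\<lambda>\<omega>. sol \<omega> s) \<in> borel_measurable (canonical_filtration t)"
    by (rule measurable_cong) (use t s in \<open>simp add: sol_stop\<close>)
  finally show "(\<lambda>\<omega>. sol \<omega> s) \<in> borel_measurable (canonical_filtration t)" .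
qed (simp add: sol_paths)

lemma sol_component_adapted: "0 \<le> t \<Longrightarrow> (\<lambda>\<omega>. sol \<omega> t) \<in> borel_measurable (canonical_filtration t)"
  using measurable_compose[OF sol_adapted filtration_eval_measurable] by simp

theorem sol_is_sde_solution:
  assumes M: "sets M = sets canonical_space"
  shows "sde_solution M m coord (\<lambda>t \<omega>. sol \<omega> t)"
    and "sde_solution M m coord Y \<Longrightarrow> AE \<omega> in M. \<forall>t\<ge>0. Y t \<omega> = sol \<omega> t"
proof -
  have sp: "space M = paths" using sets_eq_imp_space_eq[OF M] by simp
  have co: "(\<lambda>r. coord r \<omega>) = \<omega>" for \<omega> by (auto simp: coord_def)
  have eq: "sol \<omega> t = (LINT s:{0<..t}|stieltjes \<omega>. m s (left_lim (sol \<omega>) s))" if "\<omega> \<in> paths" for \<omega> t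
  proof -
    have "sol \<omega> t = stint \<omega> (\<lambda>r. m r (left_lim (sol \<omega>) r)) t"
      unfolding sol_eq[OF that, of t] using that by (intro stint_cong) (simp add: mp_eq left_lim_nonneg sol_paths)
    then show ?thesis by (simp add: stint_def)
  qed
  show "sde_solution M m coord (\<lambda>t \<omega>. sol \<omega> t)"
    unfolding sde_solution_def co
  proof (intro conjI allI impI ballI AE_I2)
    show "(\<lambda>\<omega>. sol \<omega> t) \<in> borel_measurable M" for t
      using measurable_compose[OF sol_measurable canonical_eval_measurable[of t]] by (simp add: measurable_cong_sets[OF M refl])
    fix \<omega> and t :: real assume "\<omega> \<in> space M"
    then have \<omega>: "\<omega> \<in> paths" by (simp add: sp)
    show "cadlag (\<lambda>t. sol \<omega> t)" "0 \<le> sol \<omega> t" "sol \<omega> 0 = 0"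
      using paths_cadlag[OF sol_paths[OF \<omega>]] paths_nonneg[OF sol_paths[OF \<omega>]] paths_0[OF sol_paths[OF \<omega>]] by auto
    show "sol \<omega> t = (LINT s:{0<..t}|stieltjes \<omega>. m s (left_lim (\<lambda>r. sol \<omega> r) s))"
      using eq[OF \<omega>, of t] by simp
  qed
  assume Y: "sde_solution M m coord Y"
  then have ae: "AE \<omega> in M. Y 0 \<omega> = 0 \<and> (\<forall>t\<ge>0. Y t \<omega> = (LINT s:{0<..t}|stieltjes \<omega>. m s (left_lim (\<lambda>r. Y r \<omega>) s)))"
    and pos: "\<And>\<omega>. \<omega> \<in> paths \<Longrightarrow> cadlag (\<lambda>t. Y t \<omega>) \<and> (\<forall>t\<ge>0. 0 \<le> Y t \<omega>)"
    unfolding sde_solution_def co by (auto simp: sp)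
  show "AE \<omega> in M. \<forall>t\<ge>0. Y t \<omega> = sol \<omega> t"
    using ae AE_space[of M]
  proof eventually_elim
    case (elim \<omega>)
    then have \<omega>: "\<omega> \<in> paths" by (simp add: sp)
    \<comment> \<open>Nonnegativity is what allows \<open>m\<close> to be exchanged for its
      extension \<open>mp\<close>; it is claimed for positive times only, as the values of
      \<open>Y\<close> before 0 are arbitrary.\<close>
    have nn: "0 \<le> left_lim (\<lambda>r. Y r \<omega>) s" if "0 < s" for s
    proof (rule tendsto_lowerbound)
      show "((\<lambda>r. Y r \<omega>) \<longlongrightarrow> left_lim (\<lambda>r. Y r \<omega>) s) (at_left s)" by (rule cadlag_left_lim) (use pos \<omega> that in auto)
      show "eventually (\<lambda>r. 0 \<le> Y r \<omega>) (at_left s)"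
        unfolding eventually_at_left_field using pos \<omega> that by (intro exI[of _ 0]) auto
    qed simp
    show ?case
    proof (intro allI impI)
      fix t :: real assume "0 \<le> t"
      show "Y t \<omega> = sol \<omega> t"
      proof (rule sol_unique[OF \<omega> _ _ \<open>0 \<le> t\<close>])
        fix t :: real assume "0 \<le> t"
        then have "Y t \<omega> = stint \<omega> (\<lambda>s. m s (left_lim (\<lambda>r. Y r \<omega>) s)) t" using elim by (simp add: stint_def)
        also have "\<dots> = stint \<omega> (\<lambda>s. mp s (left_lim (\<lambda>r. Y r \<omega>) s)) t"
          by (intro stint_cong) (simp add: mp_eq nn)
        finally show "Y t \<omega> = (LINT s:{0<..t}|stieltjes \<omega>. mp s (left_lim (\<lambda>r. Y r \<omega>) s))" by (simp add: stint_def)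
      qed (use pos \<omega> in auto)
    qed
  qed
qed

end

section \<open>Laplace functionals of subordinators\<close>

definition lin_fun :: "(real \<times> real) list \<Rightarrow> (real \<Rightarrow> real) \<Rightarrow> real" where
  "lin_fun xs \<omega> = (\<Sum>(c, u)\<leftarrow>xs. c * \<omega> u)"

text \<open>The step function \<open>q\<close> with \<open>lin_fun xs \<omega> = \<integral> q d\<omega>\<close>.\<close>

definition level :: "(real \<times> real) list \<Rightarrow> real \<Rightarrow> real" where
  "level xs s = (\<Sum>(c, u)\<leftarrow>xs. c * indicator {..u} s)"

lemma lin_fun_simps[simp]:
  "lin_fun [] \<omega> = 0" "lin_fun ((c, u) # xs) \<omega> = c * \<omega> u + lin_fun xs \<omega>" "lin_fun (xs @ ys) \<omega> = lin_fun xs \<omega> + lin_fun ys \<omega>"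
  by (auto simp: lin_fun_def)

lemma level_simps[simp]:
  "level [] s = 0" "level ((c, u) # xs) s = c * indicator {..u} s + level xs s" "level (xs @ ys) s = level xs s + level ys s"
  by (auto simp: level_def)

lemma level_measurable[measurable]: "level xs \<in> borel_measurable borel"
  by (induction xs) (auto simp: level_def[abs_def])

lemma lin_fun_measurable[measurable]: "lin_fun xs \<in> borel_measurable canonical_space"
proof (induction xs)
  case (Cons y xs)
  obtain c u where "y = (c, u)" by force
  then show ?case using Cons canonical_eval_measurable[of u] unfolding lin_fun_def by simp
qed (simp add: lin_fun_def)

definition good_list :: "(real \<times> real) list \<Rightarrow> bool" where
  "good_list xs \<longleftrightarrow> (\<forall>(c, u)\<in>set xs. 0 \<le> c \<and> 0 \<le> u)"

lemma good_list_simps[simp]: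
  "good_list []" "good_list ((c, u) # xs) \<longleftrightarrow> 0 \<le> c \<and> 0 \<le> u \<and> good_list xs" "good_list (xs @ ys) \<longleftrightarrow> good_list xs \<and> good_list ys"
  by (auto simp: good_list_def)

lemma level_nonneg: "good_list xs \<Longrightarrow> 0 \<le> level xs s"
  by (induction xs) (auto simp: indicator_def)

lemma level_le: "good_list xs \<Longrightarrow> level xs s \<le> (\<Sum>(c, u)\<leftarrow>xs. c)"
  by (induction xs) (auto simp: indicator_def)

lemma lin_fun_nonneg: "good_list xs \<Longrightarrow> \<omega> \<in> paths \<Longrightarrow> 0 \<le> lin_fun xs \<omega>"
  by (induction xs) (auto simp: paths_nonneg)

lemma good_list_bounded: "\<exists>R\<ge>0. \<forall>(c, u)\<in>set xs. u \<le> (R :: real)"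
proof (induction xs)
  case (Cons y xs)
  then obtain R where R: "R \<ge> 0" "\<forall>(c, u)\<in>set xs. u \<le> R" by auto
  then show ?case by (intro exI[of _ "max R (snd y)"]) (auto simp: le_max_iff_disj split: prod.splits)
qed auto

lemma level_eq_0: "(\<And>c u. (c, u) \<in> set xs \<Longrightarrow> u < s) \<Longrightarrow> level xs s = 0"
proof (induction xs)
  case (Cons y xs)
  obtain c u where y: "y = (c, u)" by force
  have "u < s" using Cons.prems[of c u] y by simp
  moreover have "level xs s = 0" by (rule Cons.IH) (use Cons.prems in auto)
  ultimately show ?case by (simp add: y)
qed simp

lemma level_cong: "(\<And>c u. (c, u) \<in> set xs \<Longrightarrow> s \<le> u \<longleftrightarrow> r \<le> u) \<Longrightarrow> level xs s = level xs r"
proof (induction xs)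
  case (Cons y xs)
  then show ?case by (cases y) (force simp: indicator_def)
qed simp

lemma mono_chain: "(\<And>i. i < n \<Longrightarrow> t i \<le> t (Suc i)) \<Longrightarrow> i \<le> j \<Longrightarrow> j \<le> n \<Longrightarrow> t i \<le> (t j :: real)"
proof (induction j)
  case (Suc j)
  then show ?case by (cases "i = Suc j") (auto intro: order_trans)
qed simp

text \<open>The level is a left-continuous step function whose breaks are the times in the list. One
  partition serves all functions \<open>f\<close> of the level at once, later the identity and
  \<open>psi\<close>; \<open>f 0 = 0\<close> takes care of times beyond the last break.\<close>

lemma level_partition:
  assumes "\<And>c u. (c, u) \<in> set xs \<Longrightarrow> 0 \<le> u"
  shows "\<exists>n t. t 0 = 0 \<and> (\<forall>i<n. t i \<le> t (Suc i)) \<and> (\<forall>i\<le>n. t i = 0 \<or> t i \<in> snd ` set xs) \<and>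
    (\<forall>f s. f 0 = (0::real) \<longrightarrow> 0 < s \<longrightarrow>
      f (level xs s) = (\<Sum>j<n. f (level xs (t (Suc j))) * indicator {t j<..t (Suc j)} s))"
proof -
  define T where "T = sorted_list_of_set (insert 0 (snd ` set xs))"
  define n where "n = length T - 1"
  define t where "t i = T ! i" for i
  have setT: "set T = insert 0 (snd ` set xs)" and st: "sorted T"
    unfolding T_def by (rule set_sorted_list_of_set, simp, rule sorted_sorted_list_of_set)
  then have ne: "T \<noteq> []" by auto
  have len: "length T = Suc n" using ne by (simp add: n_def)
  have "t 0 \<in> set T" using ne by (simp add: t_def)
  then have t0: "0 \<le> t 0" using setT assms by auto
  obtain k where k: "k < length T" "T ! k = 0" using setT by (metis in_set_conv_nth insertI1)
  have "t 0 \<le> 0" using sorted_nth_mono[OF st, of 0 k] k by (simp add: t_def)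
  then have t0: "t 0 = 0" using t0 by simp
  have mono: "t i \<le> t j" if "i \<le> j" "j \<le> n" for i j
    using sorted_nth_mono[OF st that(1)] that(2) len by (simp add: t_def)
  have 4: "f (level xs s) = (\<Sum>j<n. f (level xs (t (Suc j))) * indicator {t j<..t (Suc j)} s)"
    if f: "f 0 = (0::real)" and s: "0 < s" for f s
  proof (cases "s \<le> t n")
    case True
    \<comment> \<open>The first break at or after \<open>s\<close>; it is not break 0, so
      \<open>s\<close> lies in the cell ending there.\<close>
    define j where "j = (LEAST j. s \<le> t j)"
    have j1: "s \<le> t j" unfolding j_def using True by (rule LeastI)
    have jn: "j \<le> n" unfolding j_def using True by (rule Least_le)
    have "j \<noteq> 0" using j1 s t0 by (metis not_less)
    then obtain i where i: "j = Suc i" using not0_implies_Suc by blast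
    have i1: "t i < s" using not_less_Least[of i "\<lambda>j. s \<le> t j"] i unfolding j_def by simp
    have lev: "level xs s = level xs (t (Suc i))"
    proof (rule level_cong)
      fix c u assume "(c, u) \<in> set xs"
      then have "u \<in> set T" using setT by force
      then obtain l where l: "l < length T" "u = t l" unfolding t_def by (metis in_set_conv_nth)
      show "s \<le> u \<longleftrightarrow> t (Suc i) \<le> u"
      proof
        assume "s \<le> u"
        then have "j \<le> l" using l unfolding j_def by (simp add: Least_le)
        then show "t (Suc i) \<le> u" using mono[of j l] l len i by simp
      qed (use j1 i in auto)
    qed
    have other: "k = i" if "k < n" "t k < s" "s \<le> t (Suc k)" for k
    proof (rule antisym)
      show "i \<le> k" using that unfolding j_def[symmetric] using Least_le[of "\<lambda>j. s \<le> t j" "Suc k"] i by (simp add: j_def)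
      show "k \<le> i"
      proof (rule ccontr)
        assume "\<not> k \<le> i"
        then have "t j \<le> t k" using i that(1) by (intro mono) auto
        then show False using j1 that by simp
      qed
    qed
    have "(\<Sum>k<n. f (level xs (t (Suc k))) * indicator {t k<..t (Suc k)} s) = (\<Sum>k<n. if k = i then f (level xs s) else 0)"
    proof (intro sum.cong refl)
      fix k assume k: "k \<in> {..<n}"
      show "f (level xs (t (Suc k))) * indicator {t k<..t (Suc k)} s = (if k = i then f (level xs s) else 0)"
      proof (cases "k = i")
        case True
        then have "s \<in> {t k<..t (Suc k)}" using i1 j1 i by simp
        then show ?thesis using True lev by simp
      next
        case False
        then have "s \<notin> {t k<..t (Suc k)}" using other[of k] k by auto
        then show ?thesis using False by simp
      qed
    qed
    then show ?thesis using i jn by simp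
  next
    case False
    have "level xs s = 0"
    proof (rule level_eq_0)
      fix c u assume "(c, u) \<in> set xs"
      then have "u \<in> set T" using setT by force
      then obtain l where l: "l < length T" "u = t l" unfolding t_def by (metis in_set_conv_nth)
      then show "u < s" using mono[of l n] len False by simp
    qed
    moreover have "indicator {t k<..t (Suc k)} s = (0::real)" if "k < n" for k
      using mono[of "Suc k" n] that False by (auto simp: indicator_def)
    ultimately show ?thesis using f by simp
  qed
  have "t i = 0 \<or> t i \<in> snd ` set xs" if "i \<le> n" for i
    using nth_mem[of i T] that len setT by (auto simp: t_def)
  then show ?thesis using t0 mono 4 by (intro exI[of _ n] exI[of _ t]) auto
qed

lemma lin_fun_eq_stint:
  assumes \<omega>: "\<omega> \<in> paths" and u: "\<And>c u. (c, u) \<in> set xs \<Longrightarrow> 0 \<le> u \<and> u \<le> R"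
  shows "set_integrable (stieltjes \<omega>) {0<..R} (level xs)" "stint \<omega> (level xs) R = lin_fun xs \<omega>"
proof -
  have "set_integrable (stieltjes \<omega>) {0<..R} (level xs) \<and> stint \<omega> (level xs) R = lin_fun xs \<omega>"
    using u
  proof (induction xs)
    case Nil
    then show ?case by (simp add: stint_def set_integrable_def level_def)
  next
    case (Cons y xs)
    obtain c u where y: "y = (c, u)" by force
    have cu: "0 \<le> u" "u \<le> R" using Cons.prems[of c u] y by auto
    have e: "level (y # xs) = (\<lambda>s. c * indicator {..u} s + level xs s)" by (auto simp: y)
    have R: "{0<..R} \<inter> {..u} = {0<..u}" using cu by auto
    have ind: "indicator {0<..R} s *\<^sub>R (c * indicator {..u} s) = c * indicator {0<..u} s" for s
      using R by (auto simp: indicator_def)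
    have i: "set_integrable (stieltjes \<omega>) {0<..R} (\<lambda>s. c * indicator {..u} s)"
      unfolding set_integrable_def ind
      by (intro integrable_mult_right integrable_real_indicator) (simp_all add: emeasure_stieltjes[OF \<omega>] cu)
    have v: "(LINT s:{0<..R}|stieltjes \<omega>. c * indicator {..u} s) = c * \<omega> u"
      unfolding set_lebesgue_integral_def ind
      by (simp add: measure_def emeasure_stieltjes[OF \<omega>] cu paths_0[OF \<omega>] paths_nonneg[OF \<omega>])
    have IH: "set_integrable (stieltjes \<omega>) {0<..R} (level xs)" "stint \<omega> (level xs) R = lin_fun xs \<omega>"
      using Cons by auto
    have "set_integrable (stieltjes \<omega>) {0<..R} (level (y # xs))" unfolding e by (rule set_integral_add(1)[OF i IH(1)])
    moreover have "stint \<omega> (level (y # xs)) R = lin_fun (y # xs) \<omega>"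
      using IH(2) v unfolding e stint_def set_integral_add(2)[OF i IH(1)] by (simp add: y)
    ultimately show ?case by blast
  qed
  then show "set_integrable (stieltjes \<omega>) {0<..R} (level xs)" "stint \<omega> (level xs) R = lin_fun xs \<omega>" by auto
qed

text \<open>Inserts an additional jump of size \<open>x\<close> at time \<open>s\<close>: the
  operation by which the Mecke formula compares a path seen from one of its jumps with an
  independent path.\<close>

definition shift_path :: "real \<Rightarrow> real \<Rightarrow> (real \<Rightarrow> real) \<Rightarrow> real \<Rightarrow> real" where
  "shift_path s x \<omega> t = \<omega> t + x * indicator {s..} t"

lemma shift_path_paths:
  assumes \<omega>: "\<omega> \<in> paths" and s: "0 < s" and x: "0 \<le> x"
  shows "shift_path s x \<omega> \<in> paths"
proof -
  have r: "((\<lambda>r. indicator {s..} r :: real) \<longlongrightarrow> indicator {s..} t) (at_right t)" for t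
  proof (rule tendsto_eventually)
    show "eventually (\<lambda>r. indicator {s..} r = (indicator {s..} t :: real)) (at_right t)"
      unfolding eventually_at_right_field
    proof (cases "s \<le> t")
      case True
      then show "\<exists>b>t. \<forall>y>t. y < b \<longrightarrow> indicator {s..} y = (indicator {s..} t :: real)"
        by (intro exI[of _ "t + 1"]) auto
    next
      case False
      then show "\<exists>b>t. \<forall>y>t. y < b \<longrightarrow> indicator {s..} y = (indicator {s..} t :: real)"
        by (intro exI[of _ s]) auto
    qed
  qed
  have l: "\<exists>l. ((\<lambda>r. indicator {s..} r :: real) \<longlongrightarrow> l) (at_left t)" for t
  proof -
    have "eventually (\<lambda>r. indicator {s..} r = (indicator {..<t} s :: real)) (at_left t)"
      unfolding eventually_at_left_field
    proof (cases "s < t")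
      case True
      then show "\<exists>b<t. \<forall>y>b. y < t \<longrightarrow> indicator {s..} y = (indicator {..<t} s :: real)"
        by (intro exI[of _ s]) auto
    next
      case False
      then show "\<exists>b<t. \<forall>y>b. y < t \<longrightarrow> indicator {s..} y = (indicator {..<t} s :: real)"
        by (intro exI[of _ "t - 1"]) auto
    qed
    then show ?thesis by (blast intro: tendsto_eventually)
  qed
  have "continuous (at_right t) (shift_path s x \<omega>)" for t
    unfolding shift_path_def[abs_def] using paths_right[OF \<omega>, of t] r[of t]
    by (auto simp: continuous_within intro!: tendsto_intros)
  moreover have "\<exists>l. (shift_path s x \<omega> \<longlongrightarrow> l) (at_left t)" for t
  proof -
    obtain l' where "((\<lambda>r. indicator {s..} r :: real) \<longlongrightarrow> l') (at_left t)" using l[of t] by auto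
    then have "((\<lambda>r. \<omega> r + x * indicator {s..} r) \<longlongrightarrow> left_lim \<omega> t + x * l') (at_left t)"
      by (intro tendsto_intros left_lim_paths[OF \<omega>])
    then show ?thesis unfolding shift_path_def[abs_def] by blast
  qed
  moreover have "mono_on {0..} (shift_path s x \<omega>)"
    using x by (auto simp: mono_on_def shift_path_def indicator_def intro!: paths_mono[OF \<omega>] add_increasing2)
  ultimately show ?thesis
    using s by (auto simp: paths_def cadlag_def) (auto simp: shift_path_def paths_neg[OF \<omega>] paths_0[OF \<omega>])
qed

lemma shift_path_before: "r < s \<Longrightarrow> shift_path s x \<omega> r = \<omega> r"
  by (simp add: shift_path_def)

text \<open>The inserted jump becomes visible only at time \<open>s\<close> itself. The case
  \<open>r = s\<close> is the one that matters, since the coefficient of the equation reads the left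
  limit at the jump time.\<close>

lemma left_lim_shift_path: "r \<le> s \<Longrightarrow> left_lim (shift_path s x \<omega>) r = left_lim \<omega> r"
  by (rule left_lim_cong[of "r - 1"]) (auto simp: shift_path_before)

lemma jump_shift_path: "r < s \<Longrightarrow> jump (shift_path s x \<omega>) r = jump \<omega> r"
  by (simp add: jump_def left_lim_shift_path shift_path_before)

lemma lin_fun_shift_path: "lin_fun xs (shift_path s x \<omega>) = lin_fun xs \<omega> + x * level xs s"
  by (induction xs) (auto simp: shift_path_def indicator_def algebra_simps)

text \<open>Truncating \<open>s\<close> and \<open>x\<close> makes the map total on the product space.\<close>

lemma shift_path_measurable:
  "(\<lambda>(s, x, \<omega>). if 0 < s \<and> 0 \<le> x then shift_path s x \<omega> else \<omega>)
    \<in> measurable (borel \<Otimes>\<^sub>M borel \<Otimes>\<^sub>M canonical_space) canonical_space"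
proof (rule measurable_canonicalI)
  fix y :: "real \<times> real \<times> (real \<Rightarrow> real)" assume "y \<in> space (borel \<Otimes>\<^sub>M borel \<Otimes>\<^sub>M canonical_space)"
  then show "(case y of (s, x, \<omega>) \<Rightarrow> if 0 < s \<and> 0 \<le> x then shift_path s x \<omega> else \<omega>) \<in> paths"
    by (auto simp: space_pair_measure shift_path_paths)
next
  fix t :: real
  have [measurable]: "(\<lambda>y :: real \<times> real \<times> (real \<Rightarrow> real). (snd (snd y)) t) \<in> borel_measurable (borel \<Otimes>\<^sub>M borel \<Otimes>\<^sub>M canonical_space)"
    by (rule measurable_compose[OF measurable_compose[OF measurable_snd measurable_snd] canonical_eval_measurable])
  have "(\<lambda>y. if 0 < fst y \<and> 0 \<le> fst (snd y) then snd (snd y) t + fst (snd y) * (if fst y \<le> t then 1 else 0) else snd (snd y) t)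
     \<in> borel_measurable (borel \<Otimes>\<^sub>M borel \<Otimes>\<^sub>M canonical_space)" by measurable
  also have "(\<lambda>y :: real \<times> real \<times> (real \<Rightarrow> real). if 0 < fst y \<and> 0 \<le> fst (snd y) then snd (snd y) t + fst (snd y) * (if fst y \<le> t then 1 else 0) else snd (snd y) t)
     = (\<lambda>y. (case y of (s, x, \<omega>) \<Rightarrow> if 0 < s \<and> 0 \<le> x then shift_path s x \<omega> else \<omega>) t)"
    by (auto simp: fun_eq_iff shift_path_def indicator_def)
  finally show "(\<lambda>y. (case y of (s, x, \<omega>) \<Rightarrow> if 0 < s \<and> 0 \<le> x then shift_path s x \<omega> else \<omega>) t)
     \<in> borel_measurable (borel \<Otimes>\<^sub>M borel \<Otimes>\<^sub>M canonical_space)" .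
qed

locale levy_class_L =
  fixes P :: "(real \<Rightarrow> real) measure" and g :: "real \<Rightarrow> real" and g0 :: real
  assumes sets_P: "sets P = sets canonical_space"
    and class_L: "subordinator_class_L P coord g g0"
begin

lemma levy: "levy_process P coord" and dens: "class_L_density g g0"
  and drift: "has_drift_and_levy_measure P coord 0 (levy_density_measure g)"
  using class_L by (auto simp: subordinator_class_L_def subordinator_def)

lemma space_P: "space P = paths"
  using sets_eq_imp_space_eq[OF sets_P] by simp

sublocale prob_space P using levy by (simp add: levy_process_def)

lemma measurable_P: "f \<in> measurable canonical_space M \<Longrightarrow> f \<in> measurable P M"
  by (simp add: measurable_cong_sets[OF sets_P refl])

definition gp :: "real \<Rightarrow> real" where "gp x = indicator {0<..} x * g x"

lemma gp_measurable[measurable]: "gp \<in> borel_measurable borel"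
  using dens unfolding class_L_density_def
  by (subst (asm) borel_measurable_restrict_space_iff) (auto simp: gp_def[abs_def])

lemma gp_nonneg: "0 \<le> gp x" and gp_pos: "0 < x \<Longrightarrow> 0 < gp x" and gp_eq: "0 < x \<Longrightarrow> gp x = g x" and gp_0: "x \<le> 0 \<Longrightarrow> gp x = 0"
  using dens unfolding class_L_density_def gp_def by (auto simp: indicator_def less_imp_le)

lemma levy_measure_eq: "levy_density_measure g = density lborel (\<lambda>x. ennreal (gp x))"
  unfolding levy_density_measure_def gp_def
  by (intro arg_cong[where f="density lborel"] ext) (auto simp: indicator_def)

lemma gp_min_integrable: "integrable lborel (\<lambda>x. gp x * min 1 x)"
proof (rule integrableI_nonneg)
  show "AE x in lborel. 0 \<le> gp x * min 1 x"
    using gp_nonneg gp_0 by (intro AE_I2) (metis linorder_le_less_linear min_def mult_nonneg_nonneg mult_zero_left order_less_imp_le order_refl zero_le_one)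
  have "(\<integral>\<^sup>+x. ennreal (gp x * min 1 x) \<partial>lborel) = (\<integral>\<^sup>+x. ennreal (min 1 x) \<partial>levy_density_measure g)"
    unfolding levy_measure_eq by (subst nn_integral_density) (auto simp: ennreal_mult' gp_nonneg)
  also have "\<dots> < \<infinity>" using drift by (simp add: has_drift_and_levy_measure_def)
  finally show "(\<integral>\<^sup>+x. ennreal (gp x * min 1 x) \<partial>lborel) < \<infinity>" .
qed measurable

lemma one_minus_exp_le: "0 \<le> q \<Longrightarrow> 0 \<le> x \<Longrightarrow> 1 - exp (- q * x) \<le> max 1 q * min 1 (x::real)"
proof -
  assume q: "0 \<le> q" and x: "0 \<le> x"
  have "1 - exp (- q * x) \<le> q * x" using exp_ge_add_one_self[of "- q * x"] by simp
  also have "\<dots> \<le> max 1 q * x" using x by (intro mult_right_mono) auto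
  finally have 1: "1 - exp (- q * x) \<le> max 1 q * x" .
  have "1 - exp (- q * x) \<le> 1" by simp
  also have "\<dots> \<le> max 1 q * 1" by simp
  finally show ?thesis using 1 by (auto simp: min_def)
qed

definition psi :: "real \<Rightarrow> real" where "psi q = (LINT x|lborel. gp x * (1 - exp (- q * x)))"

lemma psi_integrable: "0 \<le> q \<Longrightarrow> integrable lborel (\<lambda>x. gp x * (1 - exp (- q * x)))"
proof (rule Bochner_Integration.integrable_bound[OF integrable_mult_right[OF gp_min_integrable, of "max 1 q"]])
  assume q: "0 \<le> q"
  show "AE x in lborel. norm (gp x * (1 - exp (- q * x))) \<le> norm (max 1 q * (gp x * min 1 x))"
  proof (rule AE_I2)
    fix x
    show "norm (gp x * (1 - exp (- q * x))) \<le> norm (max 1 q * (gp x * min 1 x))"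
    proof (cases "0 < x")
      case True
      then have "gp x * (1 - exp (- q * x)) \<le> gp x * (max 1 q * min 1 x)" using q
        by (intro mult_left_mono one_minus_exp_le gp_nonneg) auto
      moreover have "0 \<le> 1 - exp (- q * x)" using q True by simp
      then have "0 \<le> gp x * (1 - exp (- q * x))" using gp_nonneg by (intro mult_nonneg_nonneg) auto
      ultimately have "\<bar>gp x * (1 - exp (- q * x))\<bar> \<le> max 1 q * (gp x * min 1 x)" by (simp add: algebra_simps)
      then show ?thesis by simp
    qed (simp add: gp_0)
  qed
qed measurable

lemma psi_0[simp]: "psi 0 = 0" by (simp add: psi_def)

lemma psi_mono: "0 \<le> p \<Longrightarrow> p \<le> q \<Longrightarrow> psi p \<le> psi q"
  unfolding psi_def
proof (intro integral_mono psi_integrable)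
  fix x :: real assume "0 \<le> p" "p \<le> q"
  then show "gp x * (1 - exp (- p * x)) \<le> gp x * (1 - exp (- q * x))"
    by (cases "0 < x") (auto intro!: mult_left_mono simp: gp_nonneg gp_0 mult_right_mono)
qed auto

lemma psi_nonneg: "0 \<le> q \<Longrightarrow> 0 \<le> psi q"
  using psi_mono[of 0 q] by simp

lemma psi_mono_measurable: "(\<lambda>q. psi (max 0 q)) \<in> borel_measurable borel"
  by (rule borel_measurable_mono) (auto simp: mono_def intro!: psi_mono)

lemma psi_comp_measurable:
  assumes [measurable]: "f \<in> borel_measurable M" and "\<And>x. 0 \<le> f x"
  shows "(\<lambda>x. psi (f x)) \<in> borel_measurable M"
proof -
  have "(\<lambda>x. psi (max 0 (f x))) \<in> borel_measurable M"
    using measurable_compose[OF assms(1) psi_mono_measurable] .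
  then show ?thesis using assms(2) by (simp add: max_absorb2)
qed

text \<open>Splits off exp(-qx) from the difference of two Laplace exponents. With
  \<open>p = 1\<close> it identifies the integral over jump sizes on the right of the Mecke formula
  with an increment of \<open>psi\<close>.\<close>

lemma psi_diff:
  assumes "0 \<le> q" "0 \<le> p"
  shows "integrable lborel (\<lambda>x. gp x * (exp (- q * x) * (1 - exp (- p * x))))"
    "psi (q + p) - psi q = (LINT x|lborel. gp x * (exp (- q * x) * (1 - exp (- p * x))))"
proof -
  have e: "gp x * (exp (- q * x) * (1 - exp (- p * x))) = gp x * (1 - exp (- (q + p) * x)) - gp x * (1 - exp (- q * x))" for x
    by (simp add: algebra_simps exp_add[symmetric] exp_diff exp_minus field_simps)
  show "integrable lborel (\<lambda>x. gp x * (exp (- q * x) * (1 - exp (- p * x))))"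
    unfolding e using Bochner_Integration.integrable_diff[OF psi_integrable[of "q + p"] psi_integrable[of q]] assms by simp
  show "psi (q + p) - psi q = (LINT x|lborel. gp x * (exp (- q * x) * (1 - exp (- p * x))))"
    unfolding e psi_def using Bochner_Integration.integral_diff[OF psi_integrable[of "q + p"] psi_integrable[of q]] assms by simp
qed

lemma laplace_marginal: "0 \<le> t \<Longrightarrow> 0 \<le> q \<Longrightarrow> (LINT \<omega>|P. exp (- q * \<omega> t)) = exp (- t * psi q)"
proof -
  assume "0 \<le> t" "0 \<le> q"
  then have "(LINT \<omega>|P. exp (- q * \<omega> t)) = exp (- t * (LINT x|levy_density_measure g. 1 - exp (- q * x)))"
    using drift by (simp add: has_drift_and_levy_measure_def coord_def)
  also have "(LINT x|levy_density_measure g. 1 - exp (- q * x)) = psi q"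
    unfolding levy_measure_eq psi_def by (subst integral_density) (auto simp: gp_nonneg)
  finally show ?thesis .
qed

lemma laplace_increment:
  assumes "0 \<le> s" "s \<le> t" "0 \<le> q"
  shows "(LINT \<omega>|P. exp (- q * (\<omega> t - \<omega> s))) = exp (- (t - s) * psi q)"
proof -
  have d: "distr P borel (\<lambda>\<omega>. coord (s + (t - s)) \<omega> - coord s \<omega>) = distr P borel (coord (t - s))"
    using levy assms unfolding levy_process_def by (metis diff_ge_0_iff_ge)
  have m: "(\<lambda>\<omega>. coord u \<omega>) \<in> borel_measurable P" for u
    unfolding coord_def by (rule measurable_P[OF canonical_eval_measurable])
  note [measurable] = m
  have "(LINT \<omega>|P. exp (- q * (\<omega> t - \<omega> s))) = (LINT x|distr P borel (\<lambda>\<omega>. coord (s + (t - s)) \<omega> - coord s \<omega>). exp (- q * x))"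
    by (subst integral_distr, measurable) (simp add: coord_def)
  also have "\<dots> = (LINT \<omega>|P. exp (- q * \<omega> (t - s)))"
    unfolding d using m[of "t - s"] by (subst integral_distr) (auto simp: coord_def[abs_def])
  finally show ?thesis using laplace_marginal[of "t - s" q] assms by simp
qed

lemma laplace_chain:
  fixes t :: "nat \<Rightarrow> real" and q :: "nat \<Rightarrow> real"
  assumes t0: "0 \<le> t 0" and t: "\<And>i. i < n \<Longrightarrow> t i \<le> t (Suc i)" and q: "\<And>i. i < n \<Longrightarrow> 0 \<le> q i"
  shows "(LINT \<omega>|P. exp (- (\<Sum>i<n. q i * (\<omega> (t (Suc i)) - \<omega> (t i))))) = exp (- (\<Sum>i<n. (t (Suc i) - t i) * psi (q i)))"
proof -
  have m: "(\<lambda>\<omega>. coord u \<omega>) \<in> borel_measurable P" for u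
    unfolding coord_def by (rule measurable_P[OF canonical_eval_measurable])
  note [measurable] = m
  have ti: "0 \<le> t i" "t i \<le> t (Suc i)" if "i < n" for i
    using mono_chain[of n t 0 i] t t0 that by force+
  have "indep_vars (\<lambda>_. borel) (\<lambda>i \<omega>. coord (t (Suc i)) \<omega> - coord (t i) \<omega>) {..<n}"
    using levy t0 t unfolding levy_process_def by blast
  from indep_vars_compose2[OF this, of "\<lambda>i x. exp (- q i * x)" "\<lambda>_. borel"]
  have ind: "indep_vars (\<lambda>_. borel) (\<lambda>i \<omega>. exp (- q i * (\<omega> (t (Suc i)) - \<omega> (t i)))) {..<n}"
    by (simp add: coord_def)
  have "(LINT \<omega>|P. exp (- (\<Sum>i<n. q i * (\<omega> (t (Suc i)) - \<omega> (t i))))) = (LINT \<omega>|P. (\<Prod>i<n. exp (- q i * (\<omega> (t (Suc i)) - \<omega> (t i)))))"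
    by (simp add: exp_sum[symmetric] sum_negf)
  also have "\<dots> = (\<Prod>i<n. LINT \<omega>|P. exp (- q i * (\<omega> (t (Suc i)) - \<omega> (t i))))"
  proof (rule indep_vars_lebesgue_integral[OF _ ind])
    fix i assume i: "i \<in> {..<n}"
    show "integrable P (\<lambda>\<omega>. exp (- q i * (\<omega> (t (Suc i)) - \<omega> (t i))))"
    proof (rule integrable_const_bound[where B=1])
      show "AE \<omega> in P. norm (exp (- q i * (\<omega> (t (Suc i)) - \<omega> (t i)))) \<le> 1"
      proof (rule AE_I2)
        fix \<omega> assume "\<omega> \<in> space P"
        then have "0 \<le> q i * (\<omega> (t (Suc i)) - \<omega> (t i))"
          using q[of i] ti[of i] i paths_mono[of \<omega> "t i" "t (Suc i)"] by (simp add: space_P)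
        then show "norm (exp (- q i * (\<omega> (t (Suc i)) - \<omega> (t i)))) \<le> 1" by simp
      qed
      show "(\<lambda>\<omega>. exp (- q i * (\<omega> (t (Suc i)) - \<omega> (t i)))) \<in> borel_measurable P"
        using m[of "t i"] m[of "t (Suc i)"] unfolding coord_def by measurable
    qed
  qed simp
  also have "\<dots> = (\<Prod>i<n. exp (- (t (Suc i) - t i) * psi (q i)))"
    using ti q by (intro prod.cong refl laplace_increment) auto
  also have "\<dots> = exp (\<Sum>i<n. - (t (Suc i) - t i) * psi (q i))" by (simp add: exp_sum)
  also have "(\<Sum>i<n. - (t (Suc i) - t i) * psi (q i)) = - (\<Sum>i<n. (t (Suc i) - t i) * psi (q i))"
    unfolding sum_negf[symmetric] by (intro sum.cong refl) (simp add: algebra_simps)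
  finally show ?thesis .
qed

lemma laplace_lin_fun:
  assumes u: "\<And>c u. (c, u) \<in> set xs \<Longrightarrow> 0 \<le> u \<and> u \<le> R" and R: "0 \<le> R"
    and pos: "\<And>s. 0 < s \<Longrightarrow> 0 \<le> level xs s"
  shows "set_integrable lborel {0<..R} (\<lambda>s. psi (level xs s))"
    "(LINT \<omega>|P. exp (- lin_fun xs \<omega>)) = exp (- (LINT s:{0<..R}|lborel. psi (level xs s)))"
proof -
  obtain n t where t: "t 0 = 0" "\<And>i. i < n \<Longrightarrow> t i \<le> t (Suc i)" "\<And>i. i \<le> n \<Longrightarrow> t i = 0 \<or> t i \<in> snd ` set xs"
    and part: "\<And>f s. f 0 = (0::real) \<Longrightarrow> 0 < s \<Longrightarrow> f (level xs s) = (\<Sum>j<n. f (level xs (t (Suc j))) * indicator {t j<..t (Suc j)} s)"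
    using level_partition[of xs] u by blast
  \<comment> \<open>A cell ending at 0 is empty, and the level at 0 may be negative; the indicator
    sets the value there to 0.\<close>
  define q where "q j = level xs (t (Suc j)) * indicator {0<..} (t (Suc j))" for j
  have part': "f (level xs s) = (\<Sum>j<n. f (q j) * indicator {t j<..t (Suc j)} s)" if "f 0 = (0::real)" "0 < s" for f s
  proof -
    have "f (level xs (t (Suc j))) * indicator {t j<..t (Suc j)} s = f (q j) * indicator {t j<..t (Suc j)} s" if "j < n" for j
      using \<open>0 < s\<close> by (auto simp: q_def indicator_def)
    then have "(\<Sum>j<n. f (level xs (t (Suc j))) * indicator {t j<..t (Suc j)} s) = (\<Sum>j<n. f (q j) * indicator {t j<..t (Suc j)} s)"
      by (intro sum.cong refl) auto
    with part[of f s, OF that] show ?thesis by (rule trans)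
  qed
  have tR: "t i \<le> R" "0 \<le> t i" if "i \<le> n" for i using t(3)[OF that] u R by force+
  have q0: "0 \<le> q j" for j using pos by (auto simp: q_def indicator_def)
  have I: "{0<..R} \<inter> {t j<..t (Suc j)} = {t j<..t (Suc j)}" if "j < n" for j
    using tR[of j] tR[of "Suc j"] that by auto
  have ind: "indicator {0<..R} s *\<^sub>R f (level xs s) = (\<Sum>j<n. f (q j) * indicator {t j<..t (Suc j)} s)" if "f 0 = (0::real)" for f s
  proof (cases "s \<in> {0<..R}")
    case True then show ?thesis using part'[of f s] that by simp
  next
    case False
    then have "indicator {t j<..t (Suc j)} s = (0::real)" if "j < n" for j
      using I[OF that] by (auto simp: indicator_def)
    then show ?thesis using False by simp
  qed
  have "lin_fun xs \<omega> = (\<Sum>j<n. q j * (\<omega> (t (Suc j)) - \<omega> (t j)))" if \<omega>: "\<omega> \<in> paths" for \<omega>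
  proof -
    have "lin_fun xs \<omega> = stint \<omega> (level xs) R" using lin_fun_eq_stint(2)[OF \<omega> u] by simp
    also have "\<dots> = (LINT s|stieltjes \<omega>. (\<Sum>j<n. q j * indicator {t j<..t (Suc j)} s))"
      unfolding stint_def set_lebesgue_integral_def using ind[of "\<lambda>x. x"] by simp
    also have "\<dots> = (\<Sum>j<n. q j * measure (stieltjes \<omega>) {t j<..t (Suc j)})"
      using t(2) by (subst Bochner_Integration.integral_sum) (auto intro!: integrable_mult_right integrable_real_indicator simp: emeasure_stieltjes[OF \<omega>])
    also have "\<dots> = (\<Sum>j<n. q j * (\<omega> (t (Suc j)) - \<omega> (t j)))"
      using t(2) by (intro sum.cong refl) (auto simp: measure_def emeasure_stieltjes[OF \<omega>] paths_mono[OF \<omega>])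
    finally show ?thesis .
  qed
  then have "(LINT \<omega>|P. exp (- lin_fun xs \<omega>)) = (LINT \<omega>|P. exp (- (\<Sum>j<n. q j * (\<omega> (t (Suc j)) - \<omega> (t j)))))"
    by (intro Bochner_Integration.integral_cong) (auto simp: space_P)
  also have "\<dots> = exp (- (\<Sum>i<n. (t (Suc i) - t i) * psi (q i)))"
    by (rule laplace_chain) (use t q0 in auto)
  also have "(\<Sum>i<n. (t (Suc i) - t i) * psi (q i)) = (LINT s|lborel. (\<Sum>j<n. psi (q j) * indicator {t j<..t (Suc j)} s))"
    using t(2) by (subst Bochner_Integration.integral_sum) (auto intro!: integrable_mult_right integrable_real_indicator sum.cong simp: mult.commute)
  also have "\<dots> = (LINT s:{0<..R}|lborel. psi (level xs s))"
    unfolding set_lebesgue_integral_def using ind[of psi] by simp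
  finally show "(LINT \<omega>|P. exp (- lin_fun xs \<omega>)) = exp (- (LINT s:{0<..R}|lborel. psi (level xs s)))" .
  show "set_integrable lborel {0<..R} (\<lambda>s. psi (level xs s))"
    unfolding set_integrable_def ind[of psi, OF psi_0] using t(2)
    by (intro Bochner_Integration.integrable_sum integrable_mult_right integrable_real_indicator) auto
qed

end

section \<open>The Mecke formula\<close>

text \<open>\<open>kap x\<close> is \<open>(1 - e^{-x}) / x\<close> with its continuous extension at \<open>0\<close>; the value at \<open>0\<close> is what
  detects a possible continuous part of the path.\<close>

definition kap :: "real \<Rightarrow> real" where "kap x = (if x = 0 then 1 else (1 - exp (- x)) / x)"

lemma kap_measurable[measurable]: "kap \<in> borel_measurable borel"
  unfolding kap_def[abs_def] by measurable

lemma kap_pos: "0 < kap x"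
  by (cases "x = 0"; cases "0 < x") (auto simp: kap_def divide_neg_neg)

lemma kap_mult: "kap x * x = 1 - exp (- x)"
  by (simp add: kap_def)

lemma kap_le: "0 \<le> x \<Longrightarrow> kap x \<le> 1"
  using exp_ge_add_one_self[of "- x"] by (auto simp: kap_def divide_le_eq)

lemma isCont_kap: "isCont kap x"
proof (cases "x = 0")
  case True
  have "((\<lambda>x. 1 - exp (- x)) has_real_derivative 1) (at 0)"
    by (auto intro!: derivative_eq_intros)
  then have "((\<lambda>h. (1 - exp (- h)) / h) \<longlongrightarrow> 1) (at (0::real))" by (simp add: DERIV_def)
  then have "(kap \<longlongrightarrow> 1) (at 0)"
    by (rule Lim_transform_eventually) (auto simp: kap_def eventually_at_filter)
  then show ?thesis using True by (simp add: isCont_def kap_def)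
next
  case False
  have "isCont (\<lambda>x. (1 - exp (- x)) / x) x" using False by (intro continuous_intros) auto
  moreover have "eventually (\<lambda>y. (1 - exp (- y)) / y = kap y) (nhds x)"
    using t1_space_nhds[OF False] by eventually_elim (auto simp: kap_def)
  ultimately show ?thesis by (simp add: isCont_cong)
qed

lemma exp_minus_bounds: "0 \<le> y \<Longrightarrow> exp (- y) - 1 + y \<in> {0..(y::real)\<^sup>2}"
proof -
  assume y: "0 \<le> y"
  have "exp (- y) \<le> 1 / (1 + y)"
    using exp_ge_add_one_self[of y] y by (simp add: exp_minus inverse_eq_divide frac_le)
  also have "\<dots> = 1 - y + y\<^sup>2 / (1 + y)" using y by (simp add: field_simps power2_eq_square)
  also have "y\<^sup>2 / (1 + y) \<le> y\<^sup>2 / 1" using y by (intro divide_left_mono) auto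
  finally show ?thesis using exp_ge_add_one_self[of "- y"] by simp
qed

lemma exp_minus_diff_bound:
  assumes "0 \<le> y" "0 \<le> z"
  shows "\<bar>(exp (- y) - exp (- z)) - (z - y)\<bar> \<le> y\<^sup>2 + (z::real)\<^sup>2"
  using exp_minus_bounds[OF assms(1)] exp_minus_bounds[OF assms(2)] zero_le_power2[of y] zero_le_power2[of z]
  by auto

lemma set_integral_grid:
  fixes f :: "real \<Rightarrow> real"
  assumes d: "0 < d"
  shows "set_integrable lborel {0<..d * real n} f \<Longrightarrow>
    (\<Sum>i<n. LINT s:{d * real i<..d * (real i + 1)}|lborel. f s) = (LINT s:{0<..d * real n}|lborel. f s)"
proof (induction n)
  case (Suc n)
  define c where "c = d * real n"
  have c: "0 \<le> c" "d * (real n + 1) = c + d" "d * real (Suc n) = c + d" using d by (auto simp: c_def algebra_simps)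
  have e: "{0<..d * real (Suc n)} = {0<..d * real n} \<union> {d * real n<..d * (real n + 1)}"
    "{0<..d * real n} \<inter> {d * real n<..d * (real n + 1)} = {}"
    using d c(1) unfolding c(2,3) c_def[symmetric] by auto
  have i: "set_integrable lborel {0<..d * real n} f" "set_integrable lborel {d * real n<..d * (real n + 1)} f"
    by (rule set_integrable_subset[OF Suc.prems]; use e(1) in auto)+
  show ?case using Suc.IH[OF i(1)] by (simp add: e(1) set_integral_Un[OF e(2) i] del: of_nat_Suc)
qed (simp add: set_lebesgue_integral_def)

context levy_class_L
begin

lemma psi_level_integrable:
  assumes xs: "good_list xs" and p: "0 \<le> p" and A[measurable]: "A \<in> sets borel" "A \<subseteq> {0<..R}"
  shows "set_integrable lborel A (\<lambda>s. psi (level xs s + p))"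
proof -
  let ?B = "psi ((\<Sum>(c, u)\<leftarrow>xs. c) + p)"
  have [measurable]: "(\<lambda>s. psi (level xs s + p)) \<in> borel_measurable borel"
    by (rule psi_comp_measurable) (use level_nonneg[OF xs] p in \<open>auto\<close>)
  have "emeasure lborel A \<le> emeasure lborel {0<..max 0 R}" using A by (intro emeasure_mono) (auto simp: max_def)
  also have "\<dots> < \<infinity>" by simp
  finally have "integrable lborel (\<lambda>s. indicator A s *\<^sub>R ?B)"
    by (intro integrable_scaleR_left integrable_real_indicator) auto
  then show ?thesis unfolding set_integrable_def
  proof (rule Bochner_Integration.integrable_bound)
    have "\<bar>psi (level xs s + p)\<bar> \<le> \<bar>?B\<bar>" for s
      using psi_mono[of "level xs s + p" "(\<Sum>(c, u)\<leftarrow>xs. c) + p"] psi_nonneg[of "level xs s + p"] level_nonneg[OF xs] level_le[OF xs] p by simp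
    then show "AE s in lborel. norm (indicator A s *\<^sub>R psi (level xs s + p)) \<le> norm (indicator A s *\<^sub>R ?B)"
      by (intro AE_I2) (auto simp: indicator_def)
  qed measurable
qed

definition Psi :: "(real \<times> real) list \<Rightarrow> real \<Rightarrow> real" where
  "Psi xs R = (LINT s:{0<..R}|lborel. psi (level xs s))"

lemma laplace_good:
  assumes xs: "good_list xs" and R: "0 \<le> R" "\<And>c u. (c, u) \<in> set xs \<Longrightarrow> u \<le> R"
  shows "(LINT \<omega>|P. exp (- lin_fun xs \<omega>)) = exp (- Psi xs R)"
  unfolding Psi_def
  by (rule laplace_lin_fun(2)) (use xs R level_nonneg[OF xs] in \<open>auto simp: good_list_def\<close>)

text \<open>The coefficients \<open>p\<close> at \<open>b\<close> and \<open>- p\<close> at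
  \<open>a\<close> raise the level by \<open>p\<close> on \<open>{a<..b}\<close> and nowhere else
  among positive times, so only the integral over this cell changes.\<close>

lemma laplace_cell:
  assumes xs: "good_list xs" and R: "0 \<le> R" "\<And>c u. (c, u) \<in> set xs \<Longrightarrow> u \<le> R"
    and p: "0 \<le> p" and ab: "0 \<le> a" "a \<le> b" "b \<le> R"
  shows "(LINT \<omega>|P. exp (- (lin_fun xs \<omega> + p * (\<omega> b - \<omega> a)))) =
    exp (- Psi xs R) * exp (- (LINT s:{a<..b}|lborel. psi (level xs s + p) - psi (level xs s)))"
proof -
  define ys where "ys = (p, b) # (- p, a) # xs"
  have lin: "lin_fun ys \<omega> = lin_fun xs \<omega> + p * (\<omega> b - \<omega> a)" for \<omega> by (simp add: ys_def algebra_simps)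
  have lev: "level ys s = level xs s + p * indicator {a<..b} s" for s
    using ab by (auto simp: ys_def indicator_def)
  have sub: "{a<..b} \<subseteq> {0<..R}" using ab by auto
  have i: "set_integrable lborel {0<..R} (\<lambda>s. psi (level xs s))" "set_integrable lborel {a<..b} (\<lambda>s. psi (level xs s + p) - psi (level xs s))"
    using sub psi_level_integrable[OF xs order_refl, of "{0<..R}" R] psi_level_integrable[OF xs p, of "{a<..b}" R]
      psi_level_integrable[OF xs order_refl, of "{a<..b}" R] ab by (auto intro!: set_integral_diff)
  have ind: "indicator {0<..R} s *\<^sub>R psi (level ys s) =
    indicator {0<..R} s *\<^sub>R psi (level xs s) + indicator {a<..b} s *\<^sub>R (psi (level xs s + p) - psi (level xs s))" for s
    using ab by (auto simp: lev indicator_def)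
  have "(LINT \<omega>|P. exp (- (lin_fun xs \<omega> + p * (\<omega> b - \<omega> a)))) = (LINT \<omega>|P. exp (- lin_fun ys \<omega>))" by (simp add: lin)
  also have "\<dots> = exp (- (LINT s:{0<..R}|lborel. psi (level ys s)))"
    by (rule laplace_lin_fun(2)) (use xs R ab p level_nonneg[OF xs] in \<open>auto simp: lev good_list_def, auto simp: ys_def\<close>)
  also have "(LINT s:{0<..R}|lborel. psi (level ys s)) = Psi xs R + (LINT s:{a<..b}|lborel. psi (level xs s + p) - psi (level xs s))"
    unfolding Psi_def set_lebesgue_integral_def ind
    by (rule Bochner_Integration.integral_add) (use i in \<open>simp_all add: set_integrable_def\<close>)
  finally show ?thesis by (simp add: exp_add[symmetric])
qed

lemma lin_exp_integrable: "good_list xs \<Longrightarrow> integrable P (\<lambda>\<omega>. exp (- lin_fun xs \<omega>))"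
  by (rule integrable_const_bound[where B=1])
     (use measurable_P[OF lin_fun_measurable] in \<open>auto intro!: AE_I2 lin_fun_nonneg simp: space_P\<close>)

text \<open>After division by exp(-Psi) a cell contributes exp(-Y p) - exp(-Y (p+1)), where both
  exponents are at most \<open>B\<close> times the width of the cell. Replacing the difference by Y
  (p+1) - Y p costs the square of this per cell, hence O(1/n) in total, and the linear terms add up
  to the integral.\<close>

lemma mecke_laplace_limit:
  assumes xs: "good_list xs" and R: "0 \<le> R" "\<And>c u. (c, u) \<in> set xs \<Longrightarrow> u \<le> R"
    and p: "0 \<le> p" and a: "0 < a" "a \<le> R"
  shows "(\<lambda>n. \<Sum>i<Suc n. (LINT \<omega>|P. exp (- (lin_fun xs \<omega> + p * (\<omega> (a / Suc n * (real i + 1)) - \<omega> (a / Suc n * real i)))))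
     - (LINT \<omega>|P. exp (- (lin_fun xs \<omega> + (p + 1) * (\<omega> (a / Suc n * (real i + 1)) - \<omega> (a / Suc n * real i))))))
   \<longlonglongrightarrow> exp (- Psi xs R) * (LINT s:{0<..a}|lborel. psi (level xs s + (p + 1)) - psi (level xs s + p))"
proof -
  define d where "d n = a / real (Suc n)" for n
  define l where "l = level xs"
  define Y where "Y p n i = (LINT s:{d n * real i<..d n * (real i + 1)}|lborel. psi (l s + p) - psi (l s))" for p n i
  \<comment> \<open>\<open>psi\<close> at a bound for all arguments that occur: the full sum of
    coefficients plus \<open>p + 1\<close>.\<close>
  define B where "B = psi ((\<Sum>(c, u)\<leftarrow>xs. c) + (p + 1))"
  define J where "J = (LINT s:{0<..a}|lborel. psi (l s + (p + 1)) - psi (l s + p))"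
  have d: "0 < d n" "d n * real (Suc n) = a" for n using a by (auto simp: d_def simp del: of_nat_Suc)
  have l0: "0 \<le> l s" for s by (simp add: l_def level_nonneg[OF xs])
  have B: "0 \<le> B" unfolding B_def using level_nonneg[OF xs, of 0] level_le[OF xs, of 0] p by (intro psi_nonneg) auto
  have cell: "0 \<le> d n * real i" "d n * real i \<le> d n * (real i + 1)" "d n * (real i + 1) \<le> a" if "i < Suc n" for n i
  proof -
    have "d n * (real i + 1) \<le> d n * real (Suc n)" using that d(1)[of n] by (intro mult_left_mono) auto
    then show "d n * (real i + 1) \<le> a" using d(2) by simp
  qed (use d(1)[of n] in auto)
  have int: "set_integrable lborel A (\<lambda>s. psi (l s + q))" if "0 \<le> q" "A \<in> sets borel" "A \<subseteq> {0<..a}" for q A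
    unfolding l_def by (rule psi_level_integrable[OF xs that])
  have sub: "{d n * real i<..d n * (real i + 1)} \<subseteq> {0<..a}" if "i < Suc n" for n i
    using cell[OF that] by auto
  have Yb: "0 \<le> Y q n i \<and> Y q n i \<le> B * d n" if q: "0 \<le> q" "q \<le> p + 1" and i: "i < Suc n" for q n i
  proof
    have b: "0 \<le> psi (l s + q) - psi (l s)" "psi (l s + q) - psi (l s) \<le> B" for s
    proof -
      show "0 \<le> psi (l s + q) - psi (l s)" using psi_mono[of "l s" "l s + q"] l0[of s] q by simp
      have "psi (l s + q) \<le> B" unfolding B_def using level_le[OF xs, of s] l0[of s] q by (intro psi_mono) (auto simp: l_def)
      then show "psi (l s + q) - psi (l s) \<le> B" using psi_nonneg[OF l0[of s]] by simp
    qed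
    have si: "set_integrable lborel {d n * real i<..d n * (real i + 1)} (\<lambda>s. psi (l s + q) - psi (l s))"
      using int[OF q(1) _ sub[OF i]] int[OF order_refl _ sub[OF i]] by (auto intro!: set_integral_diff)
    show "0 \<le> Y q n i" unfolding Y_def set_lebesgue_integral_def
      by (intro integral_nonneg_AE AE_I2) (use b in \<open>auto simp: indicator_def\<close>)
    have "integrable lborel (indicator {d n * real i<..d n * (real i + 1)} :: real \<Rightarrow> real)"
      using d(1)[of n] by (intro integrable_real_indicator) auto
    then have ci: "set_integrable lborel {d n * real i<..d n * (real i + 1)} (\<lambda>s. B)"
      unfolding set_integrable_def by (simp add: integrable_mult_left)
    have "Y q n i \<le> (LINT s:{d n * real i<..d n * (real i + 1)}|lborel. B)"
      unfolding Y_def by (rule set_integral_mono[OF si ci]) (use b in auto)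
    also have "\<dots> = B * d n"
      using d(1)[of n] by (subst set_integral_const) (auto simp: algebra_simps)
    finally show "Y q n i \<le> B * d n" .
  qed
  have E: "(LINT \<omega>|P. exp (- (lin_fun xs \<omega> + q * (\<omega> (d n * (real i + 1)) - \<omega> (d n * real i))))) = exp (- Psi xs R) * exp (- Y q n i)"
    if "0 \<le> q" "i < Suc n" for q n i
    unfolding Y_def l_def by (rule laplace_cell[OF xs R that(1)]) (use cell[OF that(2)] a in auto)
  have sumYY: "(\<Sum>i<Suc n. Y (p + 1) n i - Y p n i) = J" for n
  proof -
    have "(\<Sum>i<Suc n. Y (p + 1) n i - Y p n i) = (\<Sum>i<Suc n. LINT s:{d n * real i<..d n * (real i + 1)}|lborel. psi (l s + (p + 1)) - psi (l s + p))"
    proof (rule sum.cong[OF refl])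
      fix i assume "i \<in> {..<Suc n}"
      then have i: "i < Suc n" by simp
      have "set_integrable lborel {d n * real i<..d n * (real i + 1)} (\<lambda>s. psi (l s + q) - psi (l s))" if "0 \<le> q" for q
        using int[OF that _ sub[OF i]] int[OF order_refl _ sub[OF i]] by (auto intro!: set_integral_diff)
      from set_integral_diff(2)[OF this this, of "p + 1" p]
      show "Y (p + 1) n i - Y p n i = (LINT s:{d n * real i<..d n * (real i + 1)}|lborel. psi (l s + (p + 1)) - psi (l s + p))"
        using p unfolding Y_def by simp
    qed
    also have "\<dots> = (LINT s:{0<..d n * real (Suc n)}|lborel. psi (l s + (p + 1)) - psi (l s + p))"
      by (rule set_integral_grid[OF d(1)]) (use p d(2) int[of "p + 1" "{0<..a}"] int[of p "{0<..a}"] in \<open>auto intro!: set_integral_diff\<close>)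
    finally show ?thesis by (simp only: d(2) J_def)
  qed
  have "(\<lambda>n. (\<Sum>i<Suc n. exp (- Y p n i) - exp (- Y (p + 1) n i)) - J) \<longlonglongrightarrow> 0"
  proof (rule Lim_null_comparison)
    show "(\<lambda>n. (2 * (B * a)\<^sup>2) / real (Suc n)) \<longlonglongrightarrow> 0" by (rule inverse_Suc_tendsto)
    show "eventually (\<lambda>n. norm ((\<Sum>i<Suc n. exp (- Y p n i) - exp (- Y (p + 1) n i)) - J) \<le> (2 * (B * a)\<^sup>2) / real (Suc n)) sequentially"
    proof (rule always_eventually, rule allI)
      fix n
      have "norm ((\<Sum>i<Suc n. exp (- Y p n i) - exp (- Y (p + 1) n i)) - J)
          = \<bar>\<Sum>i<Suc n. (exp (- Y p n i) - exp (- Y (p + 1) n i)) - (Y (p + 1) n i - Y p n i)\<bar>"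
        unfolding sumYY[of n, symmetric] sum_subtractf[symmetric] by simp
      also have "\<dots> \<le> (\<Sum>i<Suc n. \<bar>(exp (- Y p n i) - exp (- Y (p + 1) n i)) - (Y (p + 1) n i - Y p n i)\<bar>)"
        by (rule sum_abs)
      also have "\<dots> \<le> (\<Sum>i<Suc n. 2 * (B * d n)\<^sup>2)"
      proof (rule sum_mono)
        fix i assume "i \<in> {..<Suc n}"
        then have y: "0 \<le> Y p n i" "Y p n i \<le> B * d n" "0 \<le> Y (p + 1) n i" "Y (p + 1) n i \<le> B * d n"
          using Yb[of p i n] Yb[of "p + 1" i n] p by auto
        show "\<bar>(exp (- Y p n i) - exp (- Y (p + 1) n i)) - (Y (p + 1) n i - Y p n i)\<bar> \<le> 2 * (B * d n)\<^sup>2"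
          using exp_minus_diff_bound[OF y(1) y(3)] power_mono[OF y(2) y(1), of 2] power_mono[OF y(4) y(3), of 2] by linarith
      qed
      also have "\<dots> = (2 * (B * a)\<^sup>2) / real (Suc n)"
        by (simp add: d_def power2_eq_square field_simps del: of_nat_Suc)
      finally show "norm ((\<Sum>i<Suc n. exp (- Y p n i) - exp (- Y (p + 1) n i)) - J) \<le> (2 * (B * a)\<^sup>2) / real (Suc n)" .
    qed
  qed
  then have "(\<lambda>n. exp (- Psi xs R) * (\<Sum>i<Suc n. exp (- Y p n i) - exp (- Y (p + 1) n i))) \<longlonglongrightarrow> exp (- Psi xs R) * J"
    by (rule tendsto_mult[OF tendsto_const LIM_zero_cancel])
  moreover have "(\<Sum>i<Suc n. (LINT \<omega>|P. exp (- (lin_fun xs \<omega> + p * (\<omega> (d n * (real i + 1)) - \<omega> (d n * real i)))))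
     - (LINT \<omega>|P. exp (- (lin_fun xs \<omega> + (p + 1) * (\<omega> (d n * (real i + 1)) - \<omega> (d n * real i))))))
    = exp (- Psi xs R) * (\<Sum>i<Suc n. exp (- Y p n i) - exp (- Y (p + 1) n i))" for n
    unfolding sum_distrib_left
  proof (rule sum.cong[OF refl])
    fix i assume "i \<in> {..<Suc n}"
    then have i: "i < Suc n" by simp
    show "(LINT \<omega>|P. exp (- (lin_fun xs \<omega> + p * (\<omega> (d n * (real i + 1)) - \<omega> (d n * real i)))))
       - (LINT \<omega>|P. exp (- (lin_fun xs \<omega> + (p + 1) * (\<omega> (d n * (real i + 1)) - \<omega> (d n * real i)))))
       = exp (- Psi xs R) * (exp (- Y p n i) - exp (- Y (p + 1) n i))"
      unfolding E[OF p i] E[OF add_nonneg_nonneg[OF p zero_le_one] i] by (simp add: right_diff_distrib)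
  qed
  ultimately show ?thesis unfolding J_def l_def d_def by (simp only:)
qed

text \<open>On a cell with increment y, exp(-py)(1 - exp(-y)) equals exp(-py) kap(y) y, so the sum
  over cells is a Stieltjes integral and tends to the inner integral on the left; its weighted mean
  is a difference of Laplace transforms with known limit. The hypothesis \<open>dom\<close> supplies
  the domination.\<close>

lemma mecke_laplace:
  assumes xs: "good_list xs" and R: "0 \<le> R" "\<And>c u. (c, u) \<in> set xs \<Longrightarrow> u \<le> R"
    and p: "0 \<le> p" and a: "0 < a" "a \<le> T" and T: "T \<le> R" and dom: "\<And>\<omega>. \<omega> \<in> paths \<Longrightarrow> \<omega> T \<le> lin_fun xs \<omega>"
  shows "(\<integral>\<^sup>+\<omega>. ennreal (exp (- lin_fun xs \<omega>)) *
      (\<integral>\<^sup>+s\<in>{0<..a}. ennreal (exp (- p * jump \<omega> s) * kap (jump \<omega> s)) \<partial>stieltjes \<omega>) \<partial>P)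
    = ennreal (exp (- Psi xs R) * (LINT s:{0<..a}|lborel. psi (level xs s + (p + 1)) - psi (level xs s + p)))"
proof -
  define d where "d n = a / real (Suc n)" for n
  define r where "r y = exp (- p * y) * kap y" for y
  define dl where "dl n i \<omega> = \<omega> (d n * (real i + 1)) - \<omega> (d n * real i)" for n i and \<omega> :: "real \<Rightarrow> real"
  define Z where "Z n \<omega> = (\<Sum>i<Suc n. exp (- p * dl n i \<omega>) * (1 - exp (- dl n i \<omega>)))" for n \<omega>
  have d: "0 < d n" "d n * real (Suc n) = a" for n using a by (auto simp: d_def simp del: of_nat_Suc)
  have d0: "d \<longlonglongrightarrow> 0" unfolding d_def by (rule inverse_Suc_tendsto)
  have r0: "0 < r y" for y by (simp add: r_def kap_pos)
  have r1: "r y \<le> 1" if "0 \<le> y" for y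
  proof -
    have "r y \<le> 1 * 1" unfolding r_def using that p kap_pos[of y] by (intro mult_mono kap_le) auto
    then show ?thesis by simp
  qed
  have [measurable]: "r \<in> borel_measurable borel" unfolding r_def[abs_def] by measurable
  have dl0: "0 \<le> dl n i \<omega>" if "\<omega> \<in> paths" for n i \<omega>
    unfolding dl_def using paths_mono[OF that, of "d n * real i" "d n * (real i + 1)"] d(1)[of n] by simp
  have Zterm: "0 \<le> exp (- p * dl n i \<omega>) * (1 - exp (- dl n i \<omega>)) \<and> exp (- p * dl n i \<omega>) * (1 - exp (- dl n i \<omega>)) \<le> dl n i \<omega>"
    if "\<omega> \<in> paths" for n i \<omega>
  proof -
    have "exp (- p * dl n i \<omega>) * (1 - exp (- dl n i \<omega>)) \<le> 1 * dl n i \<omega>"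
      using dl0[OF that, of n i] p exp_ge_add_one_self[of "- dl n i \<omega>"] by (intro mult_mono) auto
    then show ?thesis using dl0[OF that, of n i] by simp
  qed
  have Zb: "0 \<le> Z n \<omega> \<and> Z n \<omega> \<le> \<omega> a" if "\<omega> \<in> paths" for n \<omega>
  proof
    show "0 \<le> Z n \<omega>" unfolding Z_def using Zterm[OF that] by (intro sum_nonneg) auto
    have "Z n \<omega> \<le> (\<Sum>i<Suc n. dl n i \<omega>)" unfolding Z_def using Zterm[OF that] by (intro sum_mono) auto
    also have "\<dots> = (\<Sum>i<Suc n. \<omega> (d n * real (Suc i)) - \<omega> (d n * real i))" by (simp add: dl_def add.commute)
    also have "\<dots> = \<omega> a" unfolding sum_lessThan_telescope[of "\<lambda>i. \<omega> (d n * real i)"] using d(2)[of n] by (simp add: paths_0[OF that] del: of_nat_Suc)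
    finally show "Z n \<omega> \<le> \<omega> a" .
  qed
  have Zlim: "(\<lambda>n. ennreal (Z n \<omega>)) \<longlonglongrightarrow> (\<integral>\<^sup>+s\<in>{0<..a}. ennreal (r (jump \<omega> s)) \<partial>stieltjes \<omega>)" if \<omega>: "\<omega> \<in> paths" for \<omega>
  proof -
    note [measurable] = paths_measurable[OF \<omega>] jump_paths_measurable[OF \<omega>]
    have "(\<lambda>n. \<integral>\<^sup>+s\<in>{0<..a}. ennreal (r (\<omega> (grid_right (d n) s) - \<omega> (grid_left (d n) s))) \<partial>stieltjes \<omega>)
      \<longlonglongrightarrow> (\<integral>\<^sup>+s\<in>{0<..a}. ennreal (r (jump \<omega> s)) \<partial>stieltjes \<omega>)"
    proof (rule nn_integral_dominated_convergence[where w="indicator {0<..a}"])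
      show "AE s in stieltjes \<omega>. ennreal (r (\<omega> (grid_right (d n) s) - \<omega> (grid_left (d n) s))) * indicator {0<..a} s \<le> indicator {0<..a} s" for n
      proof (rule AE_I2)
        fix s
        have "\<omega> (grid_left (d n) s) \<le> \<omega> (grid_right (d n) s)"
          by (rule paths_mono[OF \<omega>]) (use grid_left_less[OF d(1), of n s] grid_right_ge[OF d(1), of s n] in linarith)
        then show "ennreal (r (\<omega> (grid_right (d n) s) - \<omega> (grid_left (d n) s))) * indicator {0<..a} s \<le> indicator {0<..a} s"
          using r1[of "\<omega> (grid_right (d n) s) - \<omega> (grid_left (d n) s)"] by (auto simp: indicator_def ennreal_le_1)
      qed
      show "AE s in stieltjes \<omega>. (\<lambda>n. ennreal (r (\<omega> (grid_right (d n) s) - \<omega> (grid_left (d n) s))) * indicator {0<..a} s)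
          \<longlonglongrightarrow> ennreal (r (jump \<omega> s)) * indicator {0<..a} s"
      proof (rule AE_I2)
        fix s
        have "(\<lambda>n. \<omega> (grid_right (d n) s) - \<omega> (grid_left (d n) s)) \<longlonglongrightarrow> jump \<omega> s"
          unfolding jump_def by (intro tendsto_diff grid_right_tendsto[OF d(1) d0 paths_right[OF \<omega>]]
             filterlim_compose[OF left_lim_paths[OF \<omega>] grid_tendsto(1)[OF d(1) d0]])
        moreover have "isCont r (jump \<omega> s)" unfolding r_def[abs_def] by (intro continuous_intros isCont_kap)
        ultimately have "(\<lambda>n. r (\<omega> (grid_right (d n) s) - \<omega> (grid_left (d n) s))) \<longlonglongrightarrow> r (jump \<omega> s)"
          by (rule isCont_tendsto_compose[rotated])
        then show "(\<lambda>n. ennreal (r (\<omega> (grid_right (d n) s) - \<omega> (grid_left (d n) s))) * indicator {0<..a} s)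
          \<longlonglongrightarrow> ennreal (r (jump \<omega> s)) * indicator {0<..a} s"
          by (cases "s \<in> {0<..a}") (auto intro: tendsto_ennrealI)
      qed
      show "(\<integral>\<^sup>+s. indicator {0<..a} s \<partial>stieltjes \<omega>) < \<infinity>" using a by (simp add: emeasure_stieltjes[OF \<omega>])
    qed measurable
    moreover have "(\<integral>\<^sup>+s\<in>{0<..a}. ennreal (r (\<omega> (grid_right (d n) s) - \<omega> (grid_left (d n) s))) \<partial>stieltjes \<omega>) = ennreal (Z n \<omega>)" for n
    proof -
      have "r y * y = exp (- p * y) * (1 - exp (- y))" for y by (simp add: r_def kap_mult mult.assoc)
      then show ?thesis
        using grid_stieltjes_sum[OF \<omega> d(1)[of n], where f="\<lambda>a b. r (\<omega> b - \<omega> a)" and n="Suc n"] r0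
        unfolding d(2) Z_def dl_def by (simp add: less_imp_le)
    qed
    ultimately show ?thesis by simp
  qed
  have mdl: "(\<lambda>\<omega>. dl n i \<omega>) \<in> borel_measurable P" for n i
    unfolding dl_def by (intro borel_measurable_diff measurable_P canonical_eval_measurable)
  note [measurable] = mdl measurable_P[OF lin_fun_measurable]
  have "(\<lambda>n. \<integral>\<^sup>+\<omega>. ennreal (exp (- lin_fun xs \<omega>)) * ennreal (Z n \<omega>) \<partial>P) \<longlonglongrightarrow>
     (\<integral>\<^sup>+\<omega>. ennreal (exp (- lin_fun xs \<omega>)) * (\<integral>\<^sup>+s\<in>{0<..a}. ennreal (r (jump \<omega> s)) \<partial>stieltjes \<omega>) \<partial>P)"
  proof (rule nn_integral_dominated_convergence[where w="\<lambda>_. 1"])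
    show "AE \<omega> in P. ennreal (exp (- lin_fun xs \<omega>)) * ennreal (Z n \<omega>) \<le> 1" for n
    proof (rule AE_I2)
      fix \<omega> assume "\<omega> \<in> space P"
      then have \<omega>: "\<omega> \<in> paths" by (simp add: space_P)
      \<comment> \<open>The sum is at most \<omega> T, hence at most exp(\<omega> T), and the factor
        exp(- lin_fun) is small enough to bring the product below 1.\<close>
      have "Z n \<omega> \<le> \<omega> T" using Zb[OF \<omega>, of n] paths_mono[OF \<omega> a(2)] by auto
      also have "\<dots> \<le> exp (\<omega> T)" using exp_ge_add_one_self[of "\<omega> T"] by linarith
      also have "\<dots> \<le> exp (lin_fun xs \<omega>)" using dom[OF \<omega>] by simp
      finally have "exp (- lin_fun xs \<omega>) * Z n \<omega> \<le> 1" by (simp add: exp_minus field_simps)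
      then show "ennreal (exp (- lin_fun xs \<omega>)) * ennreal (Z n \<omega>) \<le> 1" by (simp add: ennreal_mult''[symmetric] Zb[OF \<omega>] ennreal_le_1)
    qed
    show "AE \<omega> in P. (\<lambda>n. ennreal (exp (- lin_fun xs \<omega>)) * ennreal (Z n \<omega>)) \<longlonglongrightarrow>
      ennreal (exp (- lin_fun xs \<omega>)) * (\<integral>\<^sup>+s\<in>{0<..a}. ennreal (r (jump \<omega> s)) \<partial>stieltjes \<omega>)"
      by (intro AE_I2 ennreal_tendsto_cmult Zlim) (auto simp: space_P)
    have "(\<lambda>\<omega>. \<integral>\<^sup>+s\<in>{0<..a}. ennreal (r (jump \<omega> s)) \<partial>stieltjes \<omega>) \<in> borel_measurable canonical_space"
      by (rule stieltjes_nn_integral_measurable[where w="\<lambda>\<omega>. \<omega>"]) (use a in \<open>auto simp: case_prod_beta'\<close>)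
    from measurable_P[OF this]
    show "(\<lambda>\<omega>. ennreal (exp (- lin_fun xs \<omega>)) * (\<integral>\<^sup>+s\<in>{0<..a}. ennreal (r (jump \<omega> s)) \<partial>stieltjes \<omega>)) \<in> borel_measurable P"
      by measurable
  qed (auto simp: Z_def emeasure_space_1)
  moreover have "(\<integral>\<^sup>+\<omega>. ennreal (exp (- lin_fun xs \<omega>)) * ennreal (Z n \<omega>) \<partial>P) =
     ennreal (\<Sum>i<Suc n. (LINT \<omega>|P. exp (- (lin_fun xs \<omega> + p * dl n i \<omega>))) - (LINT \<omega>|P. exp (- (lin_fun xs \<omega> + (p + 1) * dl n i \<omega>))))" for n
  proof -
    have i: "integrable P (\<lambda>\<omega>. exp (- (lin_fun xs \<omega> + q * dl n i \<omega>)))" if "0 \<le> q" for q i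
    proof (rule integrable_const_bound[where B=1])
      have "0 \<le> lin_fun xs \<omega> + q * dl n i \<omega>" if "\<omega> \<in> paths" for \<omega>
        using \<open>0 \<le> q\<close> dl0[OF that] lin_fun_nonneg[OF xs that] by (intro add_nonneg_nonneg mult_nonneg_nonneg) auto
      then show "AE \<omega> in P. norm (exp (- (lin_fun xs \<omega> + q * dl n i \<omega>))) \<le> 1"
        unfolding real_norm_def abs_exp_cancel exp_le_one_iff neg_le_0_iff_le by (intro AE_I2) (simp only: space_P)
    qed measurable
    have e: "exp (- lin_fun xs \<omega>) * Z n \<omega> = (\<Sum>i<Suc n. exp (- (lin_fun xs \<omega> + p * dl n i \<omega>)) - exp (- (lin_fun xs \<omega> + (p + 1) * dl n i \<omega>)))" for \<omega>
      unfolding Z_def sum_distrib_left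
      by (intro sum.cong refl) (simp add: exp_add exp_minus exp_diff field_simps)
    have "(\<integral>\<^sup>+\<omega>. ennreal (exp (- lin_fun xs \<omega>)) * ennreal (Z n \<omega>) \<partial>P) = (\<integral>\<^sup>+\<omega>. ennreal (exp (- lin_fun xs \<omega>) * Z n \<omega>) \<partial>P)"
      by (intro nn_integral_cong) (simp add: ennreal_mult' )
    also have "\<dots> = ennreal (LINT \<omega>|P. exp (- lin_fun xs \<omega>) * Z n \<omega>)"
    proof (rule nn_integral_eq_integral)
      show "integrable P (\<lambda>\<omega>. exp (- lin_fun xs \<omega>) * Z n \<omega>)"
        unfolding e using i p by (intro Bochner_Integration.integrable_sum Bochner_Integration.integrable_diff) auto
      show "AE \<omega> in P. 0 \<le> exp (- lin_fun xs \<omega>) * Z n \<omega>"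
        using Zb by (intro AE_I2 mult_nonneg_nonneg) (auto simp: space_P)
    qed
    also have "(LINT \<omega>|P. exp (- lin_fun xs \<omega>) * Z n \<omega>) = (\<Sum>i<Suc n. (LINT \<omega>|P. exp (- (lin_fun xs \<omega> + p * dl n i \<omega>)) - exp (- (lin_fun xs \<omega> + (p + 1) * dl n i \<omega>))))"
      unfolding e using i p by (intro Bochner_Integration.integral_sum Bochner_Integration.integrable_diff) auto
    also have "\<dots> = (\<Sum>i<Suc n. (LINT \<omega>|P. exp (- (lin_fun xs \<omega> + p * dl n i \<omega>))) - (LINT \<omega>|P. exp (- (lin_fun xs \<omega> + (p + 1) * dl n i \<omega>))))"
      using i p by (intro sum.cong refl Bochner_Integration.integral_diff) auto
    finally show ?thesis .
  qed
  moreover have "(\<lambda>n. ennreal (\<Sum>i<Suc n. (LINT \<omega>|P. exp (- (lin_fun xs \<omega> + p * dl n i \<omega>))) - (LINT \<omega>|P. exp (- (lin_fun xs \<omega> + (p + 1) * dl n i \<omega>)))))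
    \<longlonglongrightarrow> ennreal (exp (- Psi xs R) * (LINT s:{0<..a}|lborel. psi (level xs s + (p + 1)) - psi (level xs s + p)))"
    unfolding dl_def d_def by (intro tendsto_ennrealI mecke_laplace_limit[OF xs R p a(1)]) (use a T in auto)
  ultimately show ?thesis unfolding r_def by (auto intro: LIMSEQ_unique)
qed

end

lemma nn_integral_distr':
  "T \<in> measurable M N \<Longrightarrow> f \<in> borel_measurable N \<Longrightarrow> (\<integral>\<^sup>+y. f y \<partial>distr M N T) = (\<integral>\<^sup>+x. f (T x) \<partial>M)"
  by (rule nn_integral_distr) (simp_all add: measurable_cong_sets[OF sets_distr refl])

section \<open>The two sides of the Mecke formula as finite measures\<close>

context levy_class_L
begin

abbreviation mark_space :: "(real \<times> real \<times> (real \<Rightarrow> real)) measure" where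
  "mark_space \<equiv> borel \<Otimes>\<^sub>M borel \<Otimes>\<^sub>M canonical_space"

text \<open>Left side of the Mecke formula as a measure on times, sizes and paths. Integration
  against the path weights a jump by its size and also retains times without a jump; the factor
  exp(- \<omega> T) in the kernel makes the mass finite.\<close>

definition jump_law :: "real \<Rightarrow> (real \<times> real \<times> (real \<Rightarrow> real)) measure" where
  "jump_law T = P \<bind> (\<lambda>\<omega>. distr (stieltjes_kernel T \<omega>) mark_space (\<lambda>s. (s, jump \<omega> s, \<omega>)))"

lemma jump_law_kernel:
  assumes "0 \<le> T"
  shows "(\<lambda>\<omega>. distr (stieltjes_kernel T \<omega>) mark_space (\<lambda>s. (s, jump \<omega> s, \<omega>))) \<in> measurable P (subprob_algebra mark_space)"
proof (rule measurable_P, rule measurable_distr2[where M=borel])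
  show "(\<lambda>(\<omega>, s). (s, jump \<omega> s, \<omega>)) \<in> measurable (canonical_space \<Otimes>\<^sub>M borel) mark_space"
    unfolding case_prod_beta' by measurable
qed (use assms in measurable)

lemma sets_jump_law[simp]: "0 \<le> T \<Longrightarrow> sets (jump_law T) = sets mark_space"
  unfolding jump_law_def using not_empty by (intro sets_bind) auto

lemma subprob_jump_law: "0 \<le> T \<Longrightarrow> subprob_space (jump_law T)"
  unfolding jump_law_def
  by (rule subprob_space_bind[OF _ jump_law_kernel]) (auto intro: prob_space_imp_subprob_space prob_space_axioms)

lemma nn_integral_jump_law:
  assumes T: "0 \<le> T" and F[measurable]: "F \<in> borel_measurable mark_space"
  shows "(\<integral>\<^sup>+y. F y \<partial>jump_law T) =
    (\<integral>\<^sup>+\<omega>. ennreal (exp (- \<omega> T)) * (\<integral>\<^sup>+s\<in>{0<..T}. F (s, jump \<omega> s, \<omega>) \<partial>stieltjes \<omega>) \<partial>P)"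
proof -
  have "(\<integral>\<^sup>+y. F y \<partial>jump_law T) = (\<integral>\<^sup>+\<omega>. (\<integral>\<^sup>+y. F y \<partial>distr (stieltjes_kernel T \<omega>) mark_space (\<lambda>s. (s, jump \<omega> s, \<omega>))) \<partial>P)"
    unfolding jump_law_def by (rule nn_integral_bind[OF F jump_law_kernel[OF T]])
  also have "\<dots> = (\<integral>\<^sup>+\<omega>. ennreal (exp (- \<omega> T)) * (\<integral>\<^sup>+s\<in>{0<..T}. F (s, jump \<omega> s, \<omega>) \<partial>stieltjes \<omega>) \<partial>P)"
  proof (rule nn_integral_cong)
    fix \<omega> assume "\<omega> \<in> space P"
    then have \<omega>: "\<omega> \<in> paths" by (simp add: space_P)
    have m[measurable]: "(\<lambda>s. (s, jump \<omega> s, \<omega>)) \<in> measurable borel mark_space"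
      by (intro measurable_Pair jump_paths_measurable[OF \<omega>] const_path_measurable[OF \<omega>]) simp
    show "(\<integral>\<^sup>+y. F y \<partial>distr (stieltjes_kernel T \<omega>) mark_space (\<lambda>s. (s, jump \<omega> s, \<omega>))) =
      ennreal (exp (- \<omega> T)) * (\<integral>\<^sup>+s\<in>{0<..T}. F (s, jump \<omega> s, \<omega>) \<partial>stieltjes \<omega>)"
      using nn_integral_distr'[OF m[folded measurable_cong_sets[OF sets_stieltjes_kernel[of T \<omega>] refl]] F]
        nn_integral_stieltjes_kernel[OF measurable_compose[OF m F]] by (rule trans)
  qed
  finally show ?thesis .
qed

text \<open>Right side of the same formula: a time, a size and a path drawn independently, with the
  jump inserted. The factor \<open>x\<close> matches the size weighting in \<open>jump_law\<close>,
  and \<open>exp (- x) * exp (- \<omega> T)\<close> is the exponential weight of the path after the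
  insertion, whose value at \<open>T\<close> has grown by \<open>x\<close>.\<close>

definition mark_law :: "real \<Rightarrow> (real \<times> real \<times> (real \<Rightarrow> real)) measure" where
  "mark_law T = distr (density lborel (indicator {0<..T}) \<Otimes>\<^sub>M
      (density lborel (\<lambda>x. ennreal (x * exp (- x) * gp x)) \<Otimes>\<^sub>M density P (\<lambda>\<omega>. ennreal (exp (- \<omega> T)))))
    mark_space (\<lambda>(s, x, \<omega>). (s, x, if 0 < s \<and> 0 \<le> x then shift_path s x \<omega> else \<omega>))"

lemma x_exp_le: "x * exp (- x) \<le> min 1 (x::real)" if "0 \<le> x"
proof -
  have "x * exp (- x) \<le> x * 1" using that by (intro mult_left_mono) auto
  moreover have "x * exp (- x) \<le> exp x * exp (- x)" using exp_ge_add_one_self[of x] by (intro mult_right_mono) (linarith, simp)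
  ultimately show ?thesis by (simp add: exp_minus)
qed

lemma finite_mark_components:
  "finite_measure (density lborel (\<lambda>x. ennreal (x * exp (- x) * gp x)))"
  "finite_measure (density P (\<lambda>\<omega>. ennreal (exp (- \<omega> T))))"
  "finite_measure (density lborel (indicator {0<..T} :: real \<Rightarrow> ennreal))"
proof -
  show "finite_measure (density lborel (\<lambda>x. ennreal (x * exp (- x) * gp x)))"
  proof (rule finite_measureI)
    have "emeasure (density lborel (\<lambda>x. ennreal (x * exp (- x) * gp x))) UNIV = (\<integral>\<^sup>+x. ennreal (x * exp (- x) * gp x) \<partial>lborel)"
      by (subst emeasure_density) auto
    also have "\<dots> \<le> (\<integral>\<^sup>+x. ennreal (gp x * min 1 x) \<partial>lborel)"
    proof (intro nn_integral_mono ennreal_leI)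
      fix x show "x * exp (- x) * gp x \<le> gp x * min 1 x"
        using x_exp_le[of x] gp_nonneg[of x] by (cases "0 < x") (auto simp: gp_0 mult.commute[of "gp x"] intro!: mult_right_mono)
    qed
    also have "\<dots> < \<infinity>"
    proof -
      have "AE x in lborel. 0 \<le> gp x * min 1 x"
        by (rule AE_I2) (metis gp_0 gp_nonneg linorder_le_less_linear min_def mult_nonneg_nonneg mult_zero_left order_less_imp_le order_refl zero_le_one)
      then show ?thesis using nn_integral_eq_integral[OF gp_min_integrable] by simp
    qed
    finally show "emeasure (density lborel (\<lambda>x. ennreal (x * exp (- x) * gp x))) (space (density lborel (\<lambda>x. ennreal (x * exp (- x) * gp x)))) \<noteq> \<infinity>" by simp
  qed
  show "finite_measure (density P (\<lambda>\<omega>. ennreal (exp (- \<omega> T))))"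
  proof (rule finite_measureI)
    have [measurable]: "(\<lambda>\<omega>. \<omega> T) \<in> borel_measurable P" by (rule measurable_P[OF canonical_eval_measurable])
    have "emeasure (density P (\<lambda>\<omega>. ennreal (exp (- \<omega> T)))) (space P) = (\<integral>\<^sup>+\<omega>. ennreal (exp (- \<omega> T)) * indicator (space P) \<omega> \<partial>P)"
      by (subst emeasure_density) auto
    also have "\<dots> \<le> (\<integral>\<^sup>+\<omega>. 1 \<partial>P)" by (intro nn_integral_mono) (auto simp: space_P paths_nonneg ennreal_le_1)
    finally show "emeasure (density P (\<lambda>\<omega>. ennreal (exp (- \<omega> T)))) (space (density P (\<lambda>\<omega>. ennreal (exp (- \<omega> T))))) \<noteq> \<infinity>"
      by (simp add: emeasure_space_1 top_unique le_less_trans[OF _ ennreal_one_less_top, THEN less_imp_neq] order.strict_implies_not_eq)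
  qed
  show "finite_measure (density lborel (indicator {0<..T} :: real \<Rightarrow> ennreal))"
    by (rule finite_measureI, subst emeasure_density; cases "0 \<le> T"; simp)
qed

lemma mark_map_measurable:
  "(\<lambda>(s, x, \<omega>). (s, x, if 0 < s \<and> 0 \<le> x then shift_path s x \<omega> else \<omega>)) \<in> measurable
    (density lborel (indicator {0<..T}) \<Otimes>\<^sub>M
      (density lborel (\<lambda>x. ennreal (x * exp (- x) * gp x)) \<Otimes>\<^sub>M density P (\<lambda>\<omega>. ennreal (exp (- \<omega> T))))) mark_space"
proof -
  have s: "sets (density lborel (indicator {0<..T} :: real \<Rightarrow> ennreal) \<Otimes>\<^sub>M
      (density lborel (\<lambda>x. ennreal (x * exp (- x) * gp x)) \<Otimes>\<^sub>M density P (\<lambda>\<omega>. ennreal (exp (- \<omega> T))))) = sets mark_space"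
    by (intro sets_pair_measure_cong) (auto simp: sets_P)
  have "(\<lambda>y. (fst y, fst (snd y), (\<lambda>(s, x, \<omega>). if 0 < s \<and> 0 \<le> x then shift_path s x \<omega> else \<omega>) y)) \<in> measurable mark_space mark_space"
    using shift_path_measurable by measurable
  then show ?thesis unfolding measurable_cong_sets[OF s refl] by (simp add: case_prod_beta')
qed

lemma sets_mark_law[simp]: "sets (mark_law T) = sets mark_space"
  by (simp add: mark_law_def)

lemma finite_mark_law: "finite_measure (mark_law T)"
proof -
  interpret A: finite_measure "density lborel (indicator {0<..T} :: real \<Rightarrow> ennreal)" by (rule finite_mark_components)
  interpret B: finite_measure "density lborel (\<lambda>x. ennreal (x * exp (- x) * gp x))" by (rule finite_mark_components)
  interpret C: finite_measure "density P (\<lambda>\<omega>. ennreal (exp (- \<omega> T)))" by (rule finite_mark_components)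
  have BC: "finite_measure (density lborel (\<lambda>x. ennreal (x * exp (- x) * gp x)) \<Otimes>\<^sub>M density P (\<lambda>\<omega>. ennreal (exp (- \<omega> T))))"
    by (rule finite_measure_pair_measure; unfold_locales)
  have "finite_measure (density lborel (indicator {0<..T} :: real \<Rightarrow> ennreal) \<Otimes>\<^sub>M
     (density lborel (\<lambda>x. ennreal (x * exp (- x) * gp x)) \<Otimes>\<^sub>M density P (\<lambda>\<omega>. ennreal (exp (- \<omega> T)))))"
    by (rule finite_measure_pair_measure[OF BC]; unfold_locales)
  then show ?thesis unfolding mark_law_def by (rule finite_measure.finite_measure_distr[OF _ mark_map_measurable])
qed

lemma nn_integral_mark_law:
  assumes F[measurable]: "F \<in> borel_measurable mark_space"
  shows "(\<integral>\<^sup>+y. F y \<partial>mark_law T) = (\<integral>\<^sup>+s\<in>{0<..T}. (\<integral>\<^sup>+x. ennreal (x * exp (- x) * gp x) *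
     (\<integral>\<^sup>+\<omega>. ennreal (exp (- \<omega> T)) * F (s, x, shift_path s x \<omega>) \<partial>P) \<partial>lborel) \<partial>lborel)"
proof -
  let ?A = "density lborel (indicator {0<..T} :: real \<Rightarrow> ennreal)"
  let ?B = "density lborel (\<lambda>x. ennreal (x * exp (- x) * gp x))"
  let ?C = "density P (\<lambda>\<omega>. ennreal (exp (- \<omega> T)))"
  define f where "f = (\<lambda>(s, x, \<omega>). (s, x, if 0 < s \<and> 0 \<le> x then shift_path s x \<omega> else \<omega>))"
  interpret A: finite_measure ?A by (rule finite_mark_components)
  interpret B: finite_measure ?B by (rule finite_mark_components)
  interpret C: finite_measure ?C by (rule finite_mark_components)
  interpret BC: finite_measure "?B \<Otimes>\<^sub>M ?C" by (rule finite_measure_pair_measure; unfold_locales)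
  have f[measurable]: "f \<in> measurable (?A \<Otimes>\<^sub>M (?B \<Otimes>\<^sub>M ?C)) mark_space" unfolding f_def by (rule mark_map_measurable)
  have [measurable]: "(\<lambda>\<omega>. \<omega> T) \<in> borel_measurable P" by (rule measurable_P[OF canonical_eval_measurable])
  have Ff: "(\<lambda>y. F (f y)) \<in> borel_measurable (?A \<Otimes>\<^sub>M (?B \<Otimes>\<^sub>M ?C))" by measurable
  have sAB: "sets (?A \<Otimes>\<^sub>M (?B \<Otimes>\<^sub>M ?C)) = sets (lborel \<Otimes>\<^sub>M (lborel \<Otimes>\<^sub>M P))"
    by (intro sets_pair_measure_cong) auto
  have Ff': "(\<lambda>(s, x, \<omega>). F (f (s, x, \<omega>))) \<in> borel_measurable (lborel \<Otimes>\<^sub>M (lborel \<Otimes>\<^sub>M P))"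
    using Ff unfolding measurable_cong_sets[OF sAB refl] by (simp add: case_prod_beta')
  have m3: "(\<lambda>\<omega>. F (f (s, x, \<omega>))) \<in> borel_measurable P" for s x
  proof -
    have "(\<lambda>\<omega>. (s, x, \<omega>)) \<in> measurable P (lborel \<Otimes>\<^sub>M (lborel \<Otimes>\<^sub>M P))" by simp
    from measurable_compose[OF this Ff'] show ?thesis by simp
  qed
  have "(\<lambda>y. F (f (fst (fst y), snd (fst y), snd y))) \<in> borel_measurable ((lborel \<Otimes>\<^sub>M lborel) \<Otimes>\<^sub>M P)"
    using measurable_compose[OF _ Ff', of "\<lambda>y. (fst (fst y), snd (fst y), snd y)" "(lborel \<Otimes>\<^sub>M lborel) \<Otimes>\<^sub>M P"] by simp
  then have "(\<lambda>(y, \<omega>). ennreal (exp (- \<omega> T)) * F (f (fst y, snd y, \<omega>))) \<in> borel_measurable ((lborel \<Otimes>\<^sub>M lborel) \<Otimes>\<^sub>M P)"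
    unfolding case_prod_beta'
  proof (intro borel_measurable_times_ennreal)
    have "(\<lambda>\<omega>. ennreal (exp (- \<omega> T))) \<in> borel_measurable P" by measurable
    from measurable_compose[OF measurable_snd this]
    show "(\<lambda>y. ennreal (exp (- snd y T))) \<in> borel_measurable ((lborel \<Otimes>\<^sub>M lborel) \<Otimes>\<^sub>M P)" .
  qed
  from borel_measurable_nn_integral[OF this]
  have I: "(\<lambda>(s, x). \<integral>\<^sup>+\<omega>. ennreal (exp (- \<omega> T)) * F (f (s, x, \<omega>)) \<partial>P) \<in> borel_measurable (lborel \<Otimes>\<^sub>M lborel)"
    by (simp add: case_prod_beta')
  have m2: "(\<lambda>x. \<integral>\<^sup>+\<omega>. ennreal (exp (- \<omega> T)) * F (f (s, x, \<omega>)) \<partial>P) \<in> borel_measurable lborel" for s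
    using measurable_compose[OF measurable_Pair1' I, of s] by simp
  have m1: "(\<lambda>s. \<integral>\<^sup>+x. ennreal (x * exp (- x) * gp x) * (\<integral>\<^sup>+\<omega>. ennreal (exp (- \<omega> T)) * F (f (s, x, \<omega>)) \<partial>P) \<partial>lborel) \<in> borel_measurable lborel"
  proof (rule lborel.borel_measurable_nn_integral)
    have "(\<lambda>y. ennreal (snd y * exp (- snd y) * gp (snd y))) \<in> borel_measurable (lborel \<Otimes>\<^sub>M lborel)" by measurable
    from borel_measurable_times_ennreal[OF this I]
    show "(\<lambda>(s, x). ennreal (x * exp (- x) * gp x) * (\<integral>\<^sup>+\<omega>. ennreal (exp (- \<omega> T)) * F (f (s, x, \<omega>)) \<partial>P)) \<in> borel_measurable (lborel \<Otimes>\<^sub>M lborel)"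
      by (simp add: case_prod_beta')
  qed
  have "(\<integral>\<^sup>+y. F y \<partial>mark_law T) = (\<integral>\<^sup>+y. F (f y) \<partial>(?A \<Otimes>\<^sub>M (?B \<Otimes>\<^sub>M ?C)))"
    unfolding mark_law_def f_def[symmetric] by (rule nn_integral_distr'[OF f F])
  also have "\<dots> = (\<integral>\<^sup>+s. (\<integral>\<^sup>+z. F (f (s, z)) \<partial>(?B \<Otimes>\<^sub>M ?C)) \<partial>?A)"
    using BC.nn_integral_fst[OF Ff] by simp
  also have "\<dots> = (\<integral>\<^sup>+s. (\<integral>\<^sup>+x. (\<integral>\<^sup>+\<omega>. F (f (s, x, \<omega>)) \<partial>?C) \<partial>?B) \<partial>?A)"
  proof (rule nn_integral_cong)
    fix s
    have "(\<lambda>z. F (f (s, z))) \<in> borel_measurable (?B \<Otimes>\<^sub>M ?C)"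
      by (rule measurable_compose[OF measurable_Pair1' Ff]) simp
    from C.nn_integral_fst[OF this] show "(\<integral>\<^sup>+z. F (f (s, z)) \<partial>(?B \<Otimes>\<^sub>M ?C)) = (\<integral>\<^sup>+x. (\<integral>\<^sup>+\<omega>. F (f (s, x, \<omega>)) \<partial>?C) \<partial>?B)"
      by simp
  qed
  also have "\<dots> = (\<integral>\<^sup>+s. (\<integral>\<^sup>+x. (\<integral>\<^sup>+\<omega>. ennreal (exp (- \<omega> T)) * F (f (s, x, \<omega>)) \<partial>P) \<partial>?B) \<partial>?A)"
    using m3 by (intro nn_integral_cong nn_integral_density) auto
  also have "\<dots> = (\<integral>\<^sup>+s. (\<integral>\<^sup>+x. ennreal (x * exp (- x) * gp x) * (\<integral>\<^sup>+\<omega>. ennreal (exp (- \<omega> T)) * F (f (s, x, \<omega>)) \<partial>P) \<partial>lborel) \<partial>?A)"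
    using m2 by (intro nn_integral_cong nn_integral_density) auto
  also have "\<dots> = (\<integral>\<^sup>+s. indicator {0<..T} s * (\<integral>\<^sup>+x. ennreal (x * exp (- x) * gp x) * (\<integral>\<^sup>+\<omega>. ennreal (exp (- \<omega> T)) * F (f (s, x, \<omega>)) \<partial>P) \<partial>lborel) \<partial>lborel)"
    using m1 by (intro nn_integral_density) auto
  also have "\<dots> = (\<integral>\<^sup>+s\<in>{0<..T}. (\<integral>\<^sup>+x. ennreal (x * exp (- x) * gp x) *
     (\<integral>\<^sup>+\<omega>. ennreal (exp (- \<omega> T)) * F (s, x, shift_path s x \<omega>) \<partial>P) \<partial>lborel) \<partial>lborel)"
  proof (rule nn_integral_cong)
    fix s
    have "(\<integral>\<^sup>+x. ennreal (x * exp (- x) * gp x) * (\<integral>\<^sup>+\<omega>. ennreal (exp (- \<omega> T)) * F (f (s, x, \<omega>)) \<partial>P) \<partial>lborel)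
       = (\<integral>\<^sup>+x. ennreal (x * exp (- x) * gp x) * (\<integral>\<^sup>+\<omega>. ennreal (exp (- \<omega> T)) * F (s, x, shift_path s x \<omega>) \<partial>P) \<partial>lborel)" if "0 < s"
    proof (rule nn_integral_cong)
      fix x
      \<comment> \<open>Sizes \<open>x \<le> 0\<close> have density 0, so the guard in the map
        disappears.\<close>
      show "ennreal (x * exp (- x) * gp x) * (\<integral>\<^sup>+\<omega>. ennreal (exp (- \<omega> T)) * F (f (s, x, \<omega>)) \<partial>P)
        = ennreal (x * exp (- x) * gp x) * (\<integral>\<^sup>+\<omega>. ennreal (exp (- \<omega> T)) * F (s, x, shift_path s x \<omega>) \<partial>P)"
        using that by (cases "0 < x") (auto simp: f_def gp_0)
    qed
    then show "indicator {0<..T} s * (\<integral>\<^sup>+x. ennreal (x * exp (- x) * gp x) * (\<integral>\<^sup>+\<omega>. ennreal (exp (- \<omega> T)) * F (f (s, x, \<omega>)) \<partial>P) \<partial>lborel) =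
      (\<integral>\<^sup>+x. ennreal (x * exp (- x) * gp x) * (\<integral>\<^sup>+\<omega>. ennreal (exp (- \<omega> T)) * F (s, x, shift_path s x \<omega>) \<partial>P) \<partial>lborel) * indicator {0<..T} s"
      by (cases "s \<in> {0<..T}") auto
  qed
  finally show ?thesis .
qed

end

section \<open>Comparison of the two measures on test functions\<close>

context levy_class_L
begin

definition test_funs :: "(real \<times> real \<times> (real \<Rightarrow> real) \<Rightarrow> real) set" where
  "test_funs = {\<lambda>y. indicator A (fst y) * exp (- p * fst (snd y)) * exp (- lin_fun xs (snd (snd y))) | A p xs.
     (A = UNIV \<or> A \<in> range atMost) \<and> 0 \<le> p \<and> good_list xs}"

lemma test_funs_measurable: "f \<in> test_funs \<Longrightarrow> f \<in> borel_measurable mark_space"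
  unfolding test_funs_def by auto

lemma test_funs_mult: "f \<in> test_funs \<Longrightarrow> h \<in> test_funs \<Longrightarrow> (\<lambda>y. f y * h y) \<in> test_funs"
proof -
  assume "f \<in> test_funs" "h \<in> test_funs"
  then obtain A p xs B q ys where f: "f = (\<lambda>y. indicator A (fst y) * exp (- p * fst (snd y)) * exp (- lin_fun xs (snd (snd y))))"
    "A = UNIV \<or> A \<in> range atMost" "0 \<le> p" "good_list xs"
    and h: "h = (\<lambda>y. indicator B (fst y) * exp (- q * fst (snd y)) * exp (- lin_fun ys (snd (snd y))))"
    "B = UNIV \<or> B \<in> range atMost" "0 \<le> q" "good_list ys" unfolding test_funs_def by blast
  have AB: "A \<inter> B = UNIV \<or> A \<inter> B \<in> range atMost"
  proof (cases "A = UNIV \<or> B = UNIV")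
    case False
    then obtain a b where "A = {..a}" "B = {..b}" using f(2) h(2) by auto
    then have "A \<inter> B = {..min a b}" by auto
    then show ?thesis by blast
  qed (use f(2) h(2) in auto)
  have "(\<lambda>y. f y * h y) = (\<lambda>y. indicator (A \<inter> B) (fst y) * exp (- (p + q) * fst (snd y)) * exp (- lin_fun (xs @ ys) (snd (snd y))))"
    by (auto simp: f(1) h(1) fun_eq_iff indicator_def exp_add[symmetric] algebra_simps)
  then show ?thesis unfolding test_funs_def using AB f h
    by (intro CollectI exI[of _ "A \<inter> B"] exI[of _ "p + q"] exI[of _ "xs @ ys"]) auto
qed

text \<open>Every coordinate is recovered from test functions: the time through the rays
  \<open>{..a}\<close>, the size and the values of the path as minus the logarithm of
  exponentials.\<close>

lemma sets_mark_generated: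
  "sets mark_space = sigma_sets (space mark_space) {{y\<in>space mark_space. a < f y} | f a. f \<in> test_funs}"
proof -
  define G where "G = {{y\<in>space mark_space. a < f y} | f a. f \<in> test_funs}"
  define S where "S = sigma (space mark_space) G"
  have GP: "G \<subseteq> Pow (space mark_space)" by (auto simp: G_def)
  have sS: "space S = space mark_space" "sets S = sigma_sets (space mark_space) G"
    unfolding S_def using GP by auto
  have m: "f \<in> borel_measurable S" if "f \<in> test_funs" for f
  proof (rule borel_measurable_iff_greater[THEN iffD2], rule allI)
    fix a
    have "{y\<in>space mark_space. a < f y} \<in> G" unfolding G_def using that by blast
    then show "{y\<in>space S. a < f y} \<in> sets S" unfolding sS by (rule sigma_sets.Basic)
  qed
  have t: "(\<lambda>y. indicator A (fst y) * exp (- p * fst (snd y)) * exp (- lin_fun xs (snd (snd y)))) \<in> borel_measurable S"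
    if "A = UNIV \<or> A \<in> range atMost" "0 \<le> p" "good_list xs" for A p xs
    using that by (intro m) (auto simp: test_funs_def)
  have 1: "fst \<in> borel_measurable S"
  proof (rule borel_measurable_iff_le[THEN iffD2], rule allI)
    fix a
    have [measurable]: "(\<lambda>y. indicator {..a} (fst y) :: real) \<in> borel_measurable S" using t[of "{..a}" 0 "[]"] by simp
    have "{y\<in>space S. fst y \<le> a} = {y\<in>space S. (indicator {..a} (fst y) :: real) = 1}" by (auto simp: indicator_def)
    also have "\<dots> \<in> sets S" by measurable
    finally show "{y\<in>space S. fst y \<le> a} \<in> sets S" .
  qed
  have 2: "(\<lambda>y. fst (snd y)) \<in> borel_measurable S"
  proof -
    have "(\<lambda>y. exp (- fst (snd y))) \<in> borel_measurable S" using t[of UNIV 1 "[]"] by simp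
    then have "(\<lambda>y. - ln (exp (- fst (snd y)))) \<in> borel_measurable S" by measurable
    then show ?thesis by (simp only: ln_exp minus_minus)
  qed
  have 3: "(\<lambda>y. snd (snd y)) \<in> measurable S canonical_space"
  proof (rule measurable_canonicalI)
    fix u :: real assume u: "0 \<le> u"
    have "(\<lambda>y. exp (- snd (snd y) u)) \<in> borel_measurable S" using t[of UNIV 0 "[(1, u)]"] u by simp
    from borel_measurable_uminus[OF borel_measurable_ln[OF this]]
    show "(\<lambda>y. snd (snd y) u) \<in> borel_measurable S" by (simp only: ln_exp minus_minus)
  qed (auto simp: sS space_pair_measure)
  have "(\<lambda>y. (fst y, fst (snd y), snd (snd y))) \<in> measurable S mark_space"
    by (intro measurable_Pair 1 2 3)
  then have id: "(\<lambda>y. y) \<in> measurable S mark_space" by simp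
  have "sets mark_space \<subseteq> sets S"
  proof
    fix X assume X: "X \<in> sets mark_space"
    have "(\<lambda>y. y) -` X \<inter> space S = X" using sets.sets_into_space[OF X] by (auto simp: sS)
    then show "X \<in> sets S" using measurable_sets[OF id X] by simp
  qed
  moreover have "sigma_sets (space mark_space) G \<subseteq> sets mark_space"
  proof (rule sets.sigma_sets_subset, rule subsetI)
    fix X assume "X \<in> G"
    then obtain f a where "f \<in> test_funs" "X = {y\<in>space mark_space. a < f y}" unfolding G_def by blast
    then show "X \<in> sets mark_space" using borel_measurable_iff_greater[THEN iffD1, OF test_funs_measurable] by blast
  qed
  ultimately show ?thesis unfolding sS(2) G_def by (rule antisym)
qed

abbreviation kap_weight :: "real \<times> real \<times> (real \<Rightarrow> real) \<Rightarrow> ennreal" where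
  "kap_weight y \<equiv> ennreal (kap (fst (snd y)))"

text \<open>Both sides reduce to exp(-Psi) times an integral of increments of \<open>psi\<close>. On
  the side of the path, \<open>kap\<close> turns the mass of a jump into 1 - exp(-jump), a form
  within reach of Laplace transforms; on the other side \<open>kap x * x\<close> is 1 - exp(-x), and
  the inserted jump adds \<open>x\<close> times the level to the functional.\<close>

lemma test_common_value:
  assumes T: "0 < T" and A: "A \<inter> {0<..T} = {0<..a}" "0 \<le> a" "a \<le> T" and [measurable]: "A \<in> sets borel"
    and p: "0 \<le> p" and xs: "good_list xs"
  shows "(\<integral>\<^sup>+y. kap_weight y * ennreal (indicator A (fst y) * exp (- p * fst (snd y)) * exp (- lin_fun xs (snd (snd y)))) \<partial>jump_law T)
    = (\<integral>\<^sup>+y. kap_weight y * ennreal (indicator A (fst y) * exp (- p * fst (snd y)) * exp (- lin_fun xs (snd (snd y)))) \<partial>mark_law T)"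
proof -
  \<comment> \<open>The factor exp(- \<omega> T) common to both measures is absorbed into the
    functional. The new entry also provides the domination of \<omega> T that
    \<open>mecke_laplace\<close> asks for.\<close>
  define ys where "ys = (1, T) # xs"
  have ys: "good_list ys" using xs T by (simp add: ys_def)
  obtain R where R: "R \<ge> 0" "\<forall>(c, u)\<in>set ys. u \<le> R" using good_list_bounded[of ys] by auto
  then have TR: "T \<le> R" by (auto simp: ys_def)
  have R2: "\<And>c u. (c, u) \<in> set ys \<Longrightarrow> u \<le> R" using R by auto
  have dom: "\<omega> T \<le> lin_fun ys \<omega>" if "\<omega> \<in> paths" for \<omega> using lin_fun_nonneg[OF xs that] by (simp add: ys_def)
  define I where "I = (LINT s:{0<..a}|lborel. psi (level ys s + (p + 1)) - psi (level ys s + p))"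
  have ind: "indicator A s * indicator {0<..T} s = (indicator {0<..a} s :: ennreal)" for s
    unfolding indicator_inter_arith[symmetric] A(1) ..
  have mem: "s \<in> A \<and> s \<in> {0<..T} \<longleftrightarrow> s \<in> {0<..a}" for s
    unfolding A(1)[symmetric] by (rule Int_iff[symmetric])
  have "(\<integral>\<^sup>+y. kap_weight y * ennreal (indicator A (fst y) * exp (- p * fst (snd y)) * exp (- lin_fun xs (snd (snd y)))) \<partial>jump_law T)
    = (\<integral>\<^sup>+\<omega>. ennreal (exp (- \<omega> T)) * (\<integral>\<^sup>+s\<in>{0<..T}. (ennreal (kap (jump \<omega> s)) * ennreal (indicator A s * exp (- p * jump \<omega> s) * exp (- lin_fun xs \<omega>))) \<partial>stieltjes \<omega>) \<partial>P)"
    using T by (subst nn_integral_jump_law) auto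
  also have "\<dots> = (\<integral>\<^sup>+\<omega>. ennreal (exp (- lin_fun ys \<omega>)) * (\<integral>\<^sup>+s\<in>{0<..a}. ennreal (exp (- p * jump \<omega> s) * kap (jump \<omega> s)) \<partial>stieltjes \<omega>) \<partial>P)"
  proof (rule nn_integral_cong)
    fix \<omega> assume "\<omega> \<in> space P"
    then have \<omega>: "\<omega> \<in> paths" by (simp add: space_P)
    note [measurable] = jump_paths_measurable[OF \<omega>]
    have "(\<integral>\<^sup>+s\<in>{0<..T}. (ennreal (kap (jump \<omega> s)) * ennreal (indicator A s * exp (- p * jump \<omega> s) * exp (- lin_fun xs \<omega>))) \<partial>stieltjes \<omega>)
      = (\<integral>\<^sup>+s. ennreal (exp (- lin_fun xs \<omega>)) * (ennreal (exp (- p * jump \<omega> s) * kap (jump \<omega> s)) * indicator {0<..a} s) \<partial>stieltjes \<omega>)"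
      unfolding ind[symmetric] using kap_pos
      by (intro nn_integral_cong) (auto simp: ennreal_mult'[symmetric] less_imp_le indicator_def ac_simps)
    also have "\<dots> = ennreal (exp (- lin_fun xs \<omega>)) * (\<integral>\<^sup>+s\<in>{0<..a}. ennreal (exp (- p * jump \<omega> s) * kap (jump \<omega> s)) \<partial>stieltjes \<omega>)"
      by (rule nn_integral_cmult) measurable
    finally show "ennreal (exp (- \<omega> T)) * (\<integral>\<^sup>+s\<in>{0<..T}. (ennreal (kap (jump \<omega> s)) * ennreal (indicator A s * exp (- p * jump \<omega> s) * exp (- lin_fun xs \<omega>))) \<partial>stieltjes \<omega>)
      = ennreal (exp (- lin_fun ys \<omega>)) * (\<integral>\<^sup>+s\<in>{0<..a}. ennreal (exp (- p * jump \<omega> s) * kap (jump \<omega> s)) \<partial>stieltjes \<omega>)"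
      by (simp add: ys_def mult.assoc[symmetric] ennreal_mult'[symmetric] exp_add[symmetric])
  qed
  also have "\<dots> = ennreal (exp (- Psi ys R) * I)"
  proof (cases "a = 0")
    case True then show ?thesis by (simp add: I_def set_lebesgue_integral_def)
  next
    case False
    then show ?thesis unfolding I_def using mecke_laplace[OF ys R(1) R2 p _ A(3) TR dom] A(2) by simp
  qed
  finally have L: "(\<integral>\<^sup>+y. kap_weight y * ennreal (indicator A (fst y) * exp (- p * fst (snd y)) * exp (- lin_fun xs (snd (snd y)))) \<partial>jump_law T)
    = ennreal (exp (- Psi ys R) * I)" .
  have E: "(\<integral>\<^sup>+\<omega>. ennreal (exp (- lin_fun ys \<omega>)) \<partial>P) = ennreal (exp (- Psi ys R))"
    using nn_integral_eq_integral[OF lin_exp_integrable[OF ys]] laplace_good[OF ys R(1) R2] by simp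
  have [measurable]: "lin_fun ys \<in> borel_measurable P" by (rule measurable_P[OF lin_fun_measurable])
  have "(\<integral>\<^sup>+y. kap_weight y * ennreal (indicator A (fst y) * exp (- p * fst (snd y)) * exp (- lin_fun xs (snd (snd y)))) \<partial>mark_law T)
     = (\<integral>\<^sup>+s\<in>{0<..T}. (\<integral>\<^sup>+x. ennreal (x * exp (- x) * gp x) *
     (\<integral>\<^sup>+\<omega>. ennreal (exp (- \<omega> T)) * (ennreal (kap x) * ennreal (indicator A s * exp (- p * x) * exp (- lin_fun xs (shift_path s x \<omega>)))) \<partial>P) \<partial>lborel) \<partial>lborel)"
    by (subst nn_integral_mark_law) auto
  also have "\<dots> = (\<integral>\<^sup>+s. ennreal (exp (- Psi ys R)) * (ennreal (psi (level ys s + (p + 1)) - psi (level ys s + p)) * indicator {0<..a} s) \<partial>lborel)"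
  proof (rule nn_integral_cong)
    fix s
    show "(\<integral>\<^sup>+x. ennreal (x * exp (- x) * gp x) *
     (\<integral>\<^sup>+\<omega>. ennreal (exp (- \<omega> T)) * (ennreal (kap x) * ennreal (indicator A s * exp (- p * x) * exp (- lin_fun xs (shift_path s x \<omega>)))) \<partial>P) \<partial>lborel) * indicator {0<..T} s
     = ennreal (exp (- Psi ys R)) * (ennreal (psi (level ys s + (p + 1)) - psi (level ys s + p)) * indicator {0<..a} s)"
    proof (cases "s \<in> {0<..a}")
      case False
      then have "indicator A s = (0::real) \<or> indicator {0<..T} s = (0::ennreal)"
        using mem[of s] by (metis indicator_simps(2))
      then show ?thesis using False by auto
    next
      case True
      then have sA: "s \<in> A" "s \<in> {0<..T}" using mem[of s] by blast+
      define q where "q = level ys s + p"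
      have q0: "0 \<le> q" using level_nonneg[OF ys, of s] p by (simp add: q_def)
      have lv: "level ys s = 1 + level xs s" using sA by (simp add: ys_def)
      have "(\<integral>\<^sup>+x. ennreal (x * exp (- x) * gp x) *
         (\<integral>\<^sup>+\<omega>. ennreal (exp (- \<omega> T)) * (ennreal (kap x) * ennreal (indicator A s * exp (- p * x) * exp (- lin_fun xs (shift_path s x \<omega>)))) \<partial>P) \<partial>lborel)
         = (\<integral>\<^sup>+x. ennreal (exp (- Psi ys R)) * ennreal (gp x * (exp (- q * x) * (1 - exp (- 1 * x)))) \<partial>lborel)"
      proof (rule nn_integral_cong)
        fix x
        show "ennreal (x * exp (- x) * gp x) *
         (\<integral>\<^sup>+\<omega>. ennreal (exp (- \<omega> T)) * (ennreal (kap x) * ennreal (indicator A s * exp (- p * x) * exp (- lin_fun xs (shift_path s x \<omega>)))) \<partial>P)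
         = ennreal (exp (- Psi ys R)) * ennreal (gp x * (exp (- q * x) * (1 - exp (- 1 * x))))"
        proof (cases "0 < x")
          case x: True
          have "(\<integral>\<^sup>+\<omega>. ennreal (exp (- \<omega> T)) * (ennreal (kap x) * ennreal (indicator A s * exp (- p * x) * exp (- lin_fun xs (shift_path s x \<omega>)))) \<partial>P)
            = (\<integral>\<^sup>+\<omega>. ennreal (kap x * exp (- (p + level xs s) * x)) * ennreal (exp (- lin_fun ys \<omega>)) \<partial>P)"
            using sA kap_pos[of x] by (intro nn_integral_cong)
              (simp add: ennreal_mult'[symmetric] ennreal_mult[symmetric] less_imp_le lin_fun_shift_path ys_def exp_add[symmetric] exp_diff exp_minus field_simps)
          also have "\<dots> = ennreal (kap x * exp (- (p + level xs s) * x)) * ennreal (exp (- Psi ys R))"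
            unfolding E[symmetric] by (rule nn_integral_cmult) measurable
          finally have *: "(\<integral>\<^sup>+\<omega>. ennreal (exp (- \<omega> T)) * (ennreal (kap x) * ennreal (indicator A s * exp (- p * x) * exp (- lin_fun xs (shift_path s x \<omega>)))) \<partial>P)
            = ennreal (kap x * exp (- (p + level xs s) * x)) * ennreal (exp (- Psi ys R))" .
          \<comment> \<open>The factor exp(-x) of \<open>mark_law\<close> is the contribution of the
            entry (1, T) to the level.\<close>
          have r: "x * exp (- x) * gp x * (kap x * exp (- (p + level xs s) * x)) = gp x * (exp (- q * x) * (1 - exp (- 1 * x)))"
          proof -
            have "exp (- x) * exp (- (p + level xs s) * x) = exp (- q * x)"
              by (simp add: q_def lv exp_add[symmetric] algebra_simps)
            moreover have "x * kap x = 1 - exp (- 1 * x)" using kap_mult[of x] by (simp add: mult.commute)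
            ultimately show ?thesis by (metis (no_types, opaque_lifting) mult.assoc mult.commute)
          qed
          show ?thesis unfolding * r[symmetric] using x kap_pos[of x] gp_nonneg[of x]
            by (simp add: ennreal_mult[symmetric] less_imp_le mult.assoc[symmetric])
        qed (simp add: gp_0)
      qed
      also have "\<dots> = ennreal (exp (- Psi ys R)) * (\<integral>\<^sup>+x. ennreal (gp x * (exp (- q * x) * (1 - exp (- 1 * x)))) \<partial>lborel)"
        by (rule nn_integral_cmult) measurable
      also have "(\<integral>\<^sup>+x. ennreal (gp x * (exp (- q * x) * (1 - exp (- 1 * x)))) \<partial>lborel) = ennreal (psi (q + 1) - psi q)"
      proof -
        have "0 \<le> gp x * (exp (- q * x) * (1 - exp (- 1 * x)))" for x
          using gp_nonneg[of x] by (cases "0 < x") (auto simp: gp_0)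
        then show ?thesis using psi_diff[OF q0 zero_le_one] by (subst nn_integral_eq_integral) auto
      qed
      finally show ?thesis using True sA by (simp add: q_def add.assoc)
    qed
  qed
  also have "\<dots> = ennreal (exp (- Psi ys R)) * (\<integral>\<^sup>+s\<in>{0<..a}. ennreal (psi (level ys s + (p + 1)) - psi (level ys s + p)) \<partial>lborel)"
  proof (rule nn_integral_cmult)
    have "(\<lambda>s. psi (level ys s + q)) \<in> borel_measurable borel" if "0 \<le> q" for q
      by (rule psi_comp_measurable) (use level_nonneg[OF ys] that in auto)
    from this[of p] this[of "p + 1"] p
    show "(\<lambda>s. ennreal (psi (level ys s + (p + 1)) - psi (level ys s + p)) * indicator {0<..a} s) \<in> borel_measurable lborel"
      by simp
  qed
  also have "(\<integral>\<^sup>+s\<in>{0<..a}. ennreal (psi (level ys s + (p + 1)) - psi (level ys s + p)) \<partial>lborel) = ennreal I"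
  proof -
    have si: "set_integrable lborel {0<..a} (\<lambda>s. psi (level ys s + (p + 1)) - psi (level ys s + p))"
      using p A by (intro set_integral_diff psi_level_integrable[OF ys, where R=a]) auto
    have nn: "0 \<le> psi (level ys s + (p + 1)) - psi (level ys s + p)" for s
      using psi_mono[of "level ys s + p" "level ys s + (p + 1)"] level_nonneg[OF ys, of s] p by simp
    have "(\<integral>\<^sup>+s\<in>{0<..a}. ennreal (psi (level ys s + (p + 1)) - psi (level ys s + p)) \<partial>lborel)
      = (\<integral>\<^sup>+s. ennreal (indicator {0<..a} s *\<^sub>R (psi (level ys s + (p + 1)) - psi (level ys s + p))) \<partial>lborel)"
      by (intro nn_integral_cong) (auto simp: indicator_def)
    then show ?thesis unfolding I_def set_lebesgue_integral_def
      using si nn by (subst nn_integral_eq_integral[symmetric]) (auto simp: set_integrable_def indicator_def)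
  qed
  finally show ?thesis unfolding L by (simp add: ennreal_mult')
qed

text \<open>On the product space the size coordinate ranges over all reals, and test functions and
  \<open>kap\<close> are bounded by 1 only where it is nonnegative.\<close>

lemma AE_jump_law_nonneg: "0 \<le> T \<Longrightarrow> AE y in jump_law T. 0 \<le> fst (snd y)"
proof -
  assume T: "0 \<le> T"
  have z: "(\<integral>\<^sup>+s\<in>{0<..T}. indicator {..<0} (jump \<omega> s) \<partial>stieltjes \<omega>) = 0" if "\<omega> \<in> space P" for \<omega>
  proof -
    have "indicator {..<0} (jump \<omega> s) = (0::ennreal)" for s
      using jump_nonneg[of \<omega> s] that by (auto simp: indicator_def space_P)
    then show ?thesis by simp
  qed
  have "(\<integral>\<^sup>+y. indicator {..<0} (fst (snd y)) \<partial>jump_law T) = (0::ennreal)"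
    using T by (subst nn_integral_jump_law) (simp_all add: z cong: nn_integral_cong)
  then have "AE y in jump_law T. indicator {..<0} (fst (snd y)) = (0::ennreal)"
    by (subst (asm) nn_integral_0_iff_AE) (auto simp: measurable_cong_sets[OF sets_jump_law[OF T] refl])
  then show ?thesis by eventually_elim (auto simp: indicator_def split: if_splits)
qed

lemma AE_mark_law_nonneg: "AE y in mark_law T. 0 \<le> fst (snd y)"
proof -
  have z: "ennreal (x * exp (- x) * gp x) * (\<integral>\<^sup>+\<omega>. ennreal (exp (- \<omega> T)) * indicator {..<0} x \<partial>P) = 0" for x
    by (cases "0 < x") (auto simp: gp_0)
  have "(\<lambda>y. indicator {..<0} (fst (snd y))) \<in> borel_measurable mark_space" by measurable
  from nn_integral_mark_law[OF this, of T]
  have "(\<integral>\<^sup>+y. indicator {..<0} (fst (snd y)) \<partial>mark_law T) = (0::ennreal)"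
    unfolding fst_conv snd_conv z by simp
  then have "AE y in mark_law T. indicator {..<0} (fst (snd y)) = (0::ennreal)"
    by (subst (asm) nn_integral_0_iff_AE) (auto simp: measurable_cong_sets[OF sets_mark_law refl])
  then show ?thesis by eventually_elim (auto simp: indicator_def split: if_splits)
qed

lemma finite_density_kap:
  assumes "finite_measure M" and s: "sets M = sets mark_space" and "AE y in M. 0 \<le> fst (snd y)"
  shows "finite_measure (density M kap_weight)"
proof -
  interpret finite_measure M by fact
  note [measurable_cong] = s
  show ?thesis
  proof (rule finite_measureI)
    have "emeasure (density M kap_weight) (space (density M kap_weight)) = (\<integral>\<^sup>+y. kap_weight y * indicator (space M) y \<partial>M)"
      by (subst emeasure_density) auto
    also have "\<dots> \<le> (\<integral>\<^sup>+y. 1 \<partial>M)"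
    proof (rule nn_integral_mono_AE)
      show "AE y in M. kap_weight y * indicator (space M) y \<le> 1"
        using assms(3) by eventually_elim (auto simp: indicator_def kap_le ennreal_le_1)
    qed
    finally show "emeasure (density M kap_weight) (space (density M kap_weight)) \<noteq> \<infinity>"
      by (simp add: top_unique) (metis emeasure_finite top_unique)
  qed
qed

text \<open>The comparison is made with the weight \<open>kap\<close> still in place: it is at most
  1 on nonnegative sizes, so both measures stay finite, and it is strictly positive, so it can be
  divided out afterwards.\<close>

lemma jump_law_eq_mark_law:
  assumes T: "0 < T" shows "density (jump_law T) kap_weight = density (mark_law T) kap_weight"
proof (rule mult_system_measure_eq[where H=test_funs])
  have sJ: "sets (jump_law T) = sets mark_space" using T by simp
  note [measurable_cong] = sJ sets_mark_law
  interpret J: subprob_space "jump_law T" using subprob_jump_law T by simp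
  have aeJ: "AE y in jump_law T. 0 \<le> fst (snd y)" using AE_jump_law_nonneg T by simp
  show "finite_measure (density (jump_law T) kap_weight)"
    by (rule finite_density_kap[OF _ sJ aeJ]) unfold_locales
  show "finite_measure (density (mark_law T) kap_weight)"
    by (rule finite_density_kap[OF finite_mark_law sets_mark_law AE_mark_law_nonneg])
  show "sets (density (mark_law T) kap_weight) = sets (density (jump_law T) kap_weight)" using sJ by simp
  show "(\<lambda>_. 1) \<in> test_funs" unfolding test_funs_def
    by (intro CollectI exI[of _ UNIV] exI[of _ 0] exI[of _ "[]"]) auto
  show "(\<lambda>y. f y * h y) \<in> test_funs" if "f \<in> test_funs" "h \<in> test_funs" for f h by (rule test_funs_mult[OF that])
  show "f \<in> borel_measurable (density (jump_law T) kap_weight)" if "f \<in> test_funs" for f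
    using test_funs_measurable[OF that] by (simp add: measurable_cong_sets[OF sJ refl])
  have spM: "space (mark_law T) = space mark_space" "space (jump_law T) = space mark_space"
    using sets_eq_imp_space_eq[OF sets_mark_law] sets_eq_imp_space_eq[OF sJ] by auto
  have b: "f y \<in> {0..1}" if f: "f \<in> test_funs" and y: "y \<in> space mark_space" "0 \<le> fst (snd y)" for f y
  proof -
    obtain A p xs where f: "f = (\<lambda>y. indicator A (fst y) * exp (- p * fst (snd y)) * exp (- lin_fun xs (snd (snd y))))"
      "0 \<le> p" "good_list xs" using f unfolding test_funs_def by blast
    have "exp (- p * fst (snd y)) \<le> 1" "exp (- lin_fun xs (snd (snd y))) \<le> 1"
      using f y lin_fun_nonneg[OF f(3), of "snd (snd y)"] by (auto simp: space_pair_measure)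
    then show ?thesis unfolding f(1) by (auto simp: indicator_def intro: mult_le_one)
  qed
  show "AE y in density (jump_law T) kap_weight. f y \<in> {0..1}" if "f \<in> test_funs" for f
  proof (subst AE_density)
    show "AE y in jump_law T. 0 < kap_weight y \<longrightarrow> f y \<in> {0..1}"
      using aeJ AE_space by eventually_elim (use b[OF that] spM in auto)
  qed measurable
  show "AE y in density (mark_law T) kap_weight. f y \<in> {0..1}" if "f \<in> test_funs" for f
  proof (subst AE_density)
    show "AE y in mark_law T. 0 < kap_weight y \<longrightarrow> f y \<in> {0..1}"
      using AE_mark_law_nonneg AE_space by eventually_elim (use b[OF that] spM in auto)
  qed measurable
  show "(LINT y|density (jump_law T) kap_weight. f y) = (LINT y|density (mark_law T) kap_weight. f y)"
    if f: "f \<in> test_funs" for f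
  proof -
    obtain A p xs where f: "f = (\<lambda>y. indicator A (fst y) * exp (- p * fst (snd y)) * exp (- lin_fun xs (snd (snd y))))"
      and A: "A = UNIV \<or> A \<in> range atMost" and p: "0 \<le> p" and xs: "good_list xs" using f unfolding test_funs_def by blast
    have [measurable]: "A \<in> sets borel" using A by auto
    obtain a where a: "A \<inter> {0<..T} = {0<..a}" "0 \<le> a" "a \<le> T"
    proof (cases "A = UNIV")
      case True then show ?thesis using that[of T] T by simp
    next
      case False
      then obtain b where "A = {..b}" using A by auto
      then have "A \<inter> {0<..T} = {0<..max 0 (min b T)}" by auto
      then show ?thesis using that[of "max 0 (min b T)"] T by simp
    qed
    have [measurable]: "f \<in> borel_measurable mark_space" by (rule test_funs_measurable) fact
    have f0: "0 \<le> f y" for y by (simp add: f)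
    have "(LINT y|density (jump_law T) kap_weight. f y) = enn2real (\<integral>\<^sup>+y. ennreal (f y) \<partial>density (jump_law T) kap_weight)"
      by (rule integral_eq_nn_integral) (auto simp: f0)
    also have "(\<integral>\<^sup>+y. ennreal (f y) \<partial>density (jump_law T) kap_weight) = (\<integral>\<^sup>+y. kap_weight y * ennreal (f y) \<partial>jump_law T)"
      by (rule nn_integral_density) measurable
    also have "\<dots> = (\<integral>\<^sup>+y. kap_weight y * ennreal (f y) \<partial>mark_law T)"
      unfolding f by (rule test_common_value[OF T a _ p xs]) measurable
    also have "\<dots> = (\<integral>\<^sup>+y. ennreal (f y) \<partial>density (mark_law T) kap_weight)"
      by (rule nn_integral_density[symmetric]) measurable
    also have "enn2real \<dots> = (LINT y|density (mark_law T) kap_weight. f y)"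
      by (rule integral_eq_nn_integral[symmetric]) (auto simp: f0)
    finally show ?thesis .
  qed
  show "sets (density (jump_law T) kap_weight) = sigma_sets (space (density (jump_law T) kap_weight))
     {{y\<in>space (density (jump_law T) kap_weight). a < f y} | f a. f \<in> test_funs}"
    using sets_mark_generated by (simp add: sJ spM)
qed

theorem mecke:
  assumes T: "0 < T" and F[measurable]: "F \<in> borel_measurable mark_space"
  shows "(\<integral>\<^sup>+\<omega>. (\<integral>\<^sup>+s\<in>{0<..T}. F (s, jump \<omega> s, \<omega>) \<partial>stieltjes \<omega>) \<partial>P) =
    (\<integral>\<^sup>+s\<in>{0<..T}. (\<integral>\<^sup>+x. ennreal (x * gp x) * (\<integral>\<^sup>+\<omega>. F (s, x, shift_path s x \<omega>) \<partial>P) \<partial>lborel) \<partial>lborel)"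
proof -
  \<comment> \<open>Divides \<open>F\<close> by \<open>kap\<close> and by the exponential weight of
    the path, so that the equality of the weighted measures yields the unweighted formula.\<close>
  define F' where "F' y = ennreal (exp (snd (snd y) T) / kap (fst (snd y))) * F y" for y
  have ev: "(\<lambda>y :: real \<times> real \<times> (real \<Rightarrow> real). snd (snd y) T) \<in> borel_measurable mark_space"
    by (rule measurable_compose[OF measurable_compose[OF measurable_snd measurable_snd] canonical_eval_measurable])
  then have F'[measurable]: "F' \<in> borel_measurable mark_space" unfolding F'_def[abs_def] by measurable
  have kF: "kap_weight y * F' y = ennreal (exp (snd (snd y) T)) * F y" for y
    using kap_pos[of "fst (snd y)"]
    by (simp add: F'_def mult.assoc[symmetric] ennreal_mult[symmetric] less_imp_le)
  have m: "(\<lambda>y. ennreal (exp (snd (snd y) T)) * F y) \<in> borel_measurable mark_space" using ev by measurable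
  have T0: "0 \<le> T" using T by simp
  have "(\<integral>\<^sup>+y. kap_weight y * F' y \<partial>jump_law T) = (\<integral>\<^sup>+y. F' y \<partial>density (jump_law T) kap_weight)"
    using T0 by (intro nn_integral_density[symmetric]) (simp_all add: measurable_cong_sets[OF sets_jump_law[OF T0] refl])
  also have "\<dots> = (\<integral>\<^sup>+y. kap_weight y * F' y \<partial>mark_law T)"
    unfolding jump_law_eq_mark_law[OF T]
    by (intro nn_integral_density) (simp_all add: measurable_cong_sets[OF sets_mark_law refl])
  finally have eq: "(\<integral>\<^sup>+y. ennreal (exp (snd (snd y) T)) * F y \<partial>jump_law T) = (\<integral>\<^sup>+y. ennreal (exp (snd (snd y) T)) * F y \<partial>mark_law T)"
    unfolding kF .
  have "(\<integral>\<^sup>+y. ennreal (exp (snd (snd y) T)) * F y \<partial>jump_law T) = (\<integral>\<^sup>+\<omega>. (\<integral>\<^sup>+s\<in>{0<..T}. F (s, jump \<omega> s, \<omega>) \<partial>stieltjes \<omega>) \<partial>P)"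
    unfolding nn_integral_jump_law[OF T0 m] fst_conv snd_conv
  proof (rule nn_integral_cong)
    fix \<omega> assume "\<omega> \<in> space P"
    then have \<omega>: "\<omega> \<in> paths" by (simp add: space_P)
    have "(\<lambda>s. (s, jump \<omega> s, \<omega>)) \<in> measurable borel mark_space"
      by (intro measurable_Pair jump_paths_measurable[OF \<omega>] const_path_measurable[OF \<omega>]) simp
    from measurable_compose[OF this F]
    have Fs: "(\<lambda>s. F (s, jump \<omega> s, \<omega>) * indicator {0<..T} s) \<in> borel_measurable (stieltjes \<omega>)" by measurable
    have "(\<integral>\<^sup>+s\<in>{0<..T}. (ennreal (exp (\<omega> T)) * F (s, jump \<omega> s, \<omega>)) \<partial>stieltjes \<omega>) =
      ennreal (exp (\<omega> T)) * (\<integral>\<^sup>+s\<in>{0<..T}. F (s, jump \<omega> s, \<omega>) \<partial>stieltjes \<omega>)"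
      unfolding mult.assoc by (rule nn_integral_cmult[OF Fs])
    then show "ennreal (exp (- \<omega> T)) * (\<integral>\<^sup>+s\<in>{0<..T}. (ennreal (exp (\<omega> T)) * F (s, jump \<omega> s, \<omega>)) \<partial>stieltjes \<omega>) =
      (\<integral>\<^sup>+s\<in>{0<..T}. F (s, jump \<omega> s, \<omega>) \<partial>stieltjes \<omega>)"
      by (simp add: mult.assoc[symmetric] ennreal_mult[symmetric] exp_add[symmetric])
  qed
  moreover have "(\<integral>\<^sup>+y. ennreal (exp (snd (snd y) T)) * F y \<partial>mark_law T) =
    (\<integral>\<^sup>+s\<in>{0<..T}. (\<integral>\<^sup>+x. ennreal (x * gp x) * (\<integral>\<^sup>+\<omega>. F (s, x, shift_path s x \<omega>) \<partial>P) \<partial>lborel) \<partial>lborel)"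
    unfolding nn_integral_mark_law[OF m] fst_conv snd_conv
  proof (rule nn_integral_cong)
    fix s
    have "(\<integral>\<^sup>+x. ennreal (x * exp (- x) * gp x) * (\<integral>\<^sup>+\<omega>. ennreal (exp (- \<omega> T)) * (ennreal (exp (shift_path s x \<omega> T)) * F (s, x, shift_path s x \<omega>)) \<partial>P) \<partial>lborel)
      = (\<integral>\<^sup>+x. ennreal (x * gp x) * (\<integral>\<^sup>+\<omega>. F (s, x, shift_path s x \<omega>) \<partial>P) \<partial>lborel)" if s: "s \<in> {0<..T}"
    proof (rule nn_integral_cong)
      fix x
      show "ennreal (x * exp (- x) * gp x) * (\<integral>\<^sup>+\<omega>. ennreal (exp (- \<omega> T)) * (ennreal (exp (shift_path s x \<omega> T)) * F (s, x, shift_path s x \<omega>)) \<partial>P)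
        = ennreal (x * gp x) * (\<integral>\<^sup>+\<omega>. F (s, x, shift_path s x \<omega>) \<partial>P)"
      proof (cases "0 < x")
        case x: True
        have Fs: "(\<lambda>\<omega>. F (s, x, shift_path s x \<omega>)) \<in> borel_measurable P"
        proof -
          have "(\<lambda>\<omega>. (s, x, \<omega>)) \<in> measurable canonical_space mark_space" by simp
          from measurable_compose[OF this shift_path_measurable]
          have "shift_path s x \<in> measurable canonical_space canonical_space" using s x by simp
          then have "(\<lambda>\<omega>. (s, x, shift_path s x \<omega>)) \<in> measurable canonical_space mark_space" by simp
          from measurable_P[OF measurable_compose[OF this F]] show ?thesis .
        qed
        have "(\<integral>\<^sup>+\<omega>. ennreal (exp (- \<omega> T)) * (ennreal (exp (shift_path s x \<omega> T)) * F (s, x, shift_path s x \<omega>)) \<partial>P)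
          = (\<integral>\<^sup>+\<omega>. ennreal (exp x) * F (s, x, shift_path s x \<omega>) \<partial>P)"
          using s by (intro nn_integral_cong) (simp add: shift_path_def mult.assoc[symmetric] ennreal_mult[symmetric] exp_add[symmetric])
        also have "\<dots> = ennreal (exp x) * (\<integral>\<^sup>+\<omega>. F (s, x, shift_path s x \<omega>) \<partial>P)"
          by (rule nn_integral_cmult[OF Fs])
        finally have *: "(\<integral>\<^sup>+\<omega>. ennreal (exp (- \<omega> T)) * (ennreal (exp (shift_path s x \<omega> T)) * F (s, x, shift_path s x \<omega>)) \<partial>P)
          = ennreal (exp x) * (\<integral>\<^sup>+\<omega>. F (s, x, shift_path s x \<omega>) \<partial>P)" .
        have e: "x * exp (- x) * gp x * exp x = x * gp x" by (simp add: exp_minus)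
        have "ennreal (x * exp (- x) * gp x) * ennreal (exp x) = ennreal (x * gp x)"
          using x gp_nonneg[of x] by (subst ennreal_mult[symmetric]) (auto simp: e)
        then show ?thesis unfolding * by (simp add: mult.assoc[symmetric])
      qed (simp add: gp_0)
    qed
    then show "(\<integral>\<^sup>+x. ennreal (x * exp (- x) * gp x) * (\<integral>\<^sup>+\<omega>. ennreal (exp (- \<omega> T)) * (ennreal (exp (shift_path s x \<omega> T)) * F (s, x, shift_path s x \<omega>)) \<partial>P) \<partial>lborel) * indicator {0<..T} s
      = (\<integral>\<^sup>+x. ennreal (x * gp x) * (\<integral>\<^sup>+\<omega>. F (s, x, shift_path s x \<omega>) \<partial>P) \<partial>lborel) * indicator {0<..T} s"
      by (cases "s \<in> {0<..T}") auto
  qed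
  ultimately show ?thesis using eq by simp
qed

end

section \<open>Sums over jumps\<close>

definition jumps :: "(real \<Rightarrow> real) \<Rightarrow> real \<Rightarrow> real set" where
  "jumps \<omega> t = {s\<in>{0<..t}. jump \<omega> s \<noteq> 0}"

lemma countable_jumps: assumes \<omega>: "\<omega> \<in> paths" shows "countable (jumps \<omega> t)"
proof (rule countable_subset)
  show "countable {s. \<not> isCont \<omega> s}" by (rule mono_ctble_discont) (auto simp: mono_def paths_mono[OF \<omega>])
  show "jumps \<omega> t \<subseteq> {s. \<not> isCont \<omega> s}"
  proof
    fix s assume s: "s \<in> jumps \<omega> t"
    have "jump \<omega> s = 0" if "isCont \<omega> s"
    proof -
      have "(\<omega> \<longlongrightarrow> \<omega> s) (at_left s)" using that by (simp add: isCont_def filterlim_at_split)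
      from left_lim_eqI[OF this] show ?thesis by (simp add: jump_def)
    qed
    then show "s \<in> {s. \<not> isCont \<omega> s}" using s by (auto simp: jumps_def)
  qed
qed

text \<open>An integral for the counting measure rather than \<open>infsum\<close>: values may be
  infinite, and monotonicity and the exchange with other integrals apply at once.\<close>

definition jump_sum :: "(real \<Rightarrow> real) \<Rightarrow> real \<Rightarrow> (real \<Rightarrow> ennreal) \<Rightarrow> ennreal" where
  "jump_sum \<omega> t f = (\<integral>\<^sup>+s. f s \<partial>count_space (jumps \<omega> t))"

text \<open>Writing the integrand as a sum of multiples of \<open>indicator {r}\<close> over the
  countably many jump times r lets sum and integral be exchanged, and each atom has the jump as its
  mass.\<close>

lemma jump_sum_eq_stieltjes:
  assumes \<omega>: "\<omega> \<in> paths" and f[measurable]: "f \<in> borel_measurable borel"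
  shows "(\<integral>\<^sup>+s\<in>{0<..t}. (if jump \<omega> s = 0 then 0 else f s) \<partial>stieltjes \<omega>) = jump_sum \<omega> t (\<lambda>s. f s * ennreal (jump \<omega> s))"
proof -
  have "(\<integral>\<^sup>+s\<in>{0<..t}. (if jump \<omega> s = 0 then 0 else f s) \<partial>stieltjes \<omega>) = (\<integral>\<^sup>+s. (\<integral>\<^sup>+r. f r * indicator {r} s \<partial>count_space (jumps \<omega> t)) \<partial>stieltjes \<omega>)"
  proof (rule nn_integral_cong)
    fix s
    have "(\<integral>\<^sup>+r. f r * indicator {r} s \<partial>count_space (jumps \<omega> t)) = (\<integral>\<^sup>+r. f s * indicator {s} r \<partial>count_space (jumps \<omega> t))"
      by (intro nn_integral_cong) (auto split: split_indicator)
    also have "\<dots> = f s * indicator (jumps \<omega> t) s"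
    proof (cases "s \<in> jumps \<omega> t")
      case True
      then show ?thesis by (subst nn_integral_cmult_indicator) auto
    next
      case False
      then have "(\<integral>\<^sup>+r. f s * indicator {s} r \<partial>count_space (jumps \<omega> t)) = (\<integral>\<^sup>+r. 0 \<partial>count_space (jumps \<omega> t))"
        by (intro nn_integral_cong) (auto split: split_indicator)
      then show ?thesis using False by simp
    qed
    finally show "(if jump \<omega> s = 0 then 0 else f s) * indicator {0<..t} s = (\<integral>\<^sup>+r. f r * indicator {r} s \<partial>count_space (jumps \<omega> t))"
      by (auto simp: jumps_def indicator_def)
  qed
  also have "\<dots> = (\<integral>\<^sup>+r. (\<integral>\<^sup>+s. f r * indicator {r} s \<partial>stieltjes \<omega>) \<partial>count_space (jumps \<omega> t))"
    by (rule nn_integral_count_space_nn_integral[OF countable_jumps[OF \<omega>]]) measurable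
  also have "\<dots> = jump_sum \<omega> t (\<lambda>s. f s * ennreal (jump \<omega> s))"
    unfolding jump_sum_def by (intro nn_integral_cong) (simp add: nn_integral_cmult_indicator emeasure_stieltjes_singleton[OF \<omega>])
  finally show ?thesis .
qed

text \<open>Division by the jump size cancels the mass of the atom. A sum over jumps thus becomes an
  integral against the path, which is how it inherits measurability and the Mecke formula.\<close>

lemma jump_sum_as_integral:
  assumes \<omega>: "\<omega> \<in> paths" and [measurable]: "f \<in> borel_measurable borel"
  shows "jump_sum \<omega> t f = (\<integral>\<^sup>+s\<in>{0<..t}. (if jump \<omega> s = 0 then 0 else f s / ennreal (jump \<omega> s)) \<partial>stieltjes \<omega>)"
proof -
  note [measurable] = jump_paths_measurable[OF \<omega>]
  have "(\<integral>\<^sup>+s\<in>{0<..t}. (if jump \<omega> s = 0 then 0 else f s / ennreal (jump \<omega> s)) \<partial>stieltjes \<omega>) =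
    jump_sum \<omega> t (\<lambda>s. f s / ennreal (jump \<omega> s) * ennreal (jump \<omega> s))"
    by (rule jump_sum_eq_stieltjes[OF \<omega>]) measurable
  also have "\<dots> = jump_sum \<omega> t f"
    unfolding jump_sum_def
  proof (rule nn_integral_cong)
    fix s assume "s \<in> space (count_space (jumps \<omega> t))"
    then have "0 < jump \<omega> s" using jump_nonneg[OF \<omega>, of s] by (auto simp: jumps_def)
    then show "f s / ennreal (jump \<omega> s) * ennreal (jump \<omega> s) = f s"
      by (simp add: ennreal_divide_times ennreal_divide_self)
  qed
  finally show ?thesis ..
qed

lemma jump_sum_measurable:
  assumes F[measurable]: "(\<lambda>(y, s). F y s) \<in> borel_measurable (N \<Otimes>\<^sub>M borel)"
    and w[measurable]: "w \<in> measurable N canonical_space" and u[measurable]: "u \<in> borel_measurable N"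
  shows "(\<lambda>y. jump_sum (w y) (u y) (F y)) \<in> borel_measurable N"
proof -
  have "(\<lambda>y. \<integral>\<^sup>+s\<in>{0<..}. ((if jump (w y) s = 0 \<or> u y < s then 0 else F y s / ennreal (jump (w y) s))) \<partial>stieltjes (w y)) \<in> borel_measurable N"
  proof (rule stieltjes_nn_integral_measurable_Ioi[OF _ w])
    have [measurable]: "(\<lambda>z. F (fst z) (snd z)) \<in> borel_measurable (N \<Otimes>\<^sub>M borel)" using F by (simp add: case_prod_beta')
    show "(\<lambda>(y, s). if jump (w y) s = 0 \<or> u y < s then 0 else F y s / ennreal (jump (w y) s)) \<in> borel_measurable (N \<Otimes>\<^sub>M borel)"
      unfolding case_prod_beta' by measurable
  qed
  also have "?this \<longleftrightarrow> ?thesis"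
  proof (rule measurable_cong)
    fix y assume y: "y \<in> space N"
    have wy: "w y \<in> paths" using measurable_space[OF w y] by simp
    have Fy: "F y \<in> borel_measurable borel"
      using measurable_compose[OF measurable_Pair1'[OF y] F] by simp
    show "(\<integral>\<^sup>+s\<in>{0<..}. ((if jump (w y) s = 0 \<or> u y < s then 0 else F y s / ennreal (jump (w y) s))) \<partial>stieltjes (w y)) = jump_sum (w y) (u y) (F y)"
      unfolding jump_sum_as_integral[OF wy Fy] by (intro nn_integral_cong) (auto split: split_indicator)
  qed
  finally show ?thesis .
qed

text \<open>The Stieltjes measure is carried by its atoms: the path has no continuous part.\<close>

definition pure_jump :: "(real \<Rightarrow> real) \<Rightarrow> bool" where
  "pure_jump \<omega> \<longleftrightarrow> (AE s in stieltjes \<omega>. 0 < s \<longrightarrow> jump \<omega> s \<noteq> 0)"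

lemma pure_jump_nn_integral:
  assumes \<omega>: "\<omega> \<in> paths" and p: "pure_jump \<omega>" and f: "f \<in> borel_measurable borel"
  shows "(\<integral>\<^sup>+s\<in>{0<..t}. f s \<partial>stieltjes \<omega>) = jump_sum \<omega> t (\<lambda>s. f s * ennreal (jump \<omega> s))"
proof -
  have "(\<integral>\<^sup>+s\<in>{0<..t}. f s \<partial>stieltjes \<omega>) = (\<integral>\<^sup>+s\<in>{0<..t}. (if jump \<omega> s = 0 then 0 else f s) \<partial>stieltjes \<omega>)"
  proof (rule nn_integral_cong_AE)
    show "AE s in stieltjes \<omega>. f s * indicator {0<..t} s = (if jump \<omega> s = 0 then 0 else f s) * indicator {0<..t} s"
      using p unfolding pure_jump_def by eventually_elim (auto split: split_indicator)
  qed
  also have "\<dots> = jump_sum \<omega> t (\<lambda>s. f s * ennreal (jump \<omega> s))" by (rule jump_sum_eq_stieltjes[OF \<omega> f])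
  finally show ?thesis .
qed

context levy_class_L
begin

text \<open>The Mecke formula for the indicator of jump size 0: on the right the size 0 has weight
  \<open>x * gp x = 0\<close>, so the path gives no mass to times without a jump. A continuous part
  would appear on the left exactly there, which is why the formula is proved for the whole path
  measure and not for its jumps alone.\<close>

lemma AE_pure_jump: "AE \<omega> in P. pure_jump \<omega>"
proof -
  have m: "(\<lambda>y. indicator {0} (fst (snd y))) \<in> borel_measurable mark_space" by measurable
  have "AE \<omega> in P. (\<integral>\<^sup>+s\<in>{0<..real (Suc n)}. indicator {0} (jump \<omega> s) \<partial>stieltjes \<omega>) = 0" for n
  proof -
    have "ennreal (x * gp x) * (\<integral>\<^sup>+\<omega>. indicator {0} x \<partial>P) = 0" for x by (cases "x = 0") auto
    then have "(\<integral>\<^sup>+\<omega>. (\<integral>\<^sup>+s\<in>{0<..real (Suc n)}. indicator {0} (jump \<omega> s) \<partial>stieltjes \<omega>) \<partial>P) = 0"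
      using mecke[OF _ m, of "real (Suc n)"] by (simp only: fst_conv snd_conv) simp
    moreover have "(\<lambda>\<omega>. \<integral>\<^sup>+s\<in>{0<..real (Suc n)}. indicator {0} (jump \<omega> s) \<partial>stieltjes \<omega>) \<in> borel_measurable P"
      by (rule measurable_P, rule stieltjes_nn_integral_measurable[where w="\<lambda>\<omega>. \<omega>"]) (auto simp: case_prod_beta')
    ultimately show ?thesis by (simp add: nn_integral_0_iff_AE)
  qed
  then have "AE \<omega> in P. \<forall>n. (\<integral>\<^sup>+s\<in>{0<..real (Suc n)}. indicator {0} (jump \<omega> s) \<partial>stieltjes \<omega>) = 0"
    unfolding AE_all_countable by blast
  with AE_space show ?thesis
  proof eventually_elim
    case (elim \<omega>)
    then have \<omega>: "\<omega> \<in> paths" by (simp add: space_P)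
    note [measurable] = jump_paths_measurable[OF \<omega>]
    have "AE s in stieltjes \<omega>. indicator {0} (jump \<omega> s) * indicator {0<..real (Suc n)} s = (0::ennreal)" for n
      using elim(2) by (subst nn_integral_0_iff_AE[symmetric]) auto
    then have "AE s in stieltjes \<omega>. \<forall>n. indicator {0} (jump \<omega> s) * indicator {0<..real (Suc n)} s = (0::ennreal)"
      unfolding AE_all_countable by blast
    then show ?case unfolding pure_jump_def
    proof eventually_elim
      case (elim s)
      show ?case
      proof (intro impI notI)
        assume "0 < s" "jump \<omega> s = 0"
        moreover obtain n where "s \<le> real n" using real_arch_simple by blast
        ultimately have "s \<in> {0<..real (Suc n)}" by auto
        then show False using elim[rule_format, of n] \<open>jump \<omega> s = 0\<close> by simp
      qed
    qed
  qed
qed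

text \<open>The general formula applied to \<open>F\<close> divided by the jump size; the division
  removes the size weighting on both sides.\<close>

theorem mecke_jump_sum:
  assumes T: "0 < T" and F[measurable]: "F \<in> borel_measurable mark_space"
  shows "(\<integral>\<^sup>+\<omega>. jump_sum \<omega> T (\<lambda>s. F (s, jump \<omega> s, \<omega>)) \<partial>P) =
    (\<integral>\<^sup>+s\<in>{0<..T}. (\<integral>\<^sup>+x. ennreal (gp x) * (\<integral>\<^sup>+\<omega>. F (s, x, shift_path s x \<omega>) \<partial>P) \<partial>lborel) \<partial>lborel)"
proof -
  define F' where "F' y = (if fst (snd y) = 0 then 0 else F y / ennreal (fst (snd y)))" for y
  have F'[measurable]: "F' \<in> borel_measurable mark_space" unfolding F'_def[abs_def] by measurable
  have "(\<integral>\<^sup>+\<omega>. jump_sum \<omega> T (\<lambda>s. F (s, jump \<omega> s, \<omega>)) \<partial>P) = (\<integral>\<^sup>+\<omega>. (\<integral>\<^sup>+s\<in>{0<..T}. F' (s, jump \<omega> s, \<omega>) \<partial>stieltjes \<omega>) \<partial>P)"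
  proof (rule nn_integral_cong)
    fix \<omega> assume "\<omega> \<in> space P"
    then have \<omega>: "\<omega> \<in> paths" by (simp add: space_P)
    have "(\<lambda>s. (s, jump \<omega> s, \<omega>)) \<in> measurable borel mark_space"
      by (intro measurable_Pair jump_paths_measurable[OF \<omega>] const_path_measurable[OF \<omega>]) simp
    from measurable_compose[OF this F]
    show "jump_sum \<omega> T (\<lambda>s. F (s, jump \<omega> s, \<omega>)) = (\<integral>\<^sup>+s\<in>{0<..T}. F' (s, jump \<omega> s, \<omega>) \<partial>stieltjes \<omega>)"
      by (simp add: jump_sum_as_integral[OF \<omega>] F'_def cong: if_cong)
  qed
  also have "\<dots> = (\<integral>\<^sup>+s\<in>{0<..T}. (\<integral>\<^sup>+x. ennreal (x * gp x) * (\<integral>\<^sup>+\<omega>. F' (s, x, shift_path s x \<omega>) \<partial>P) \<partial>lborel) \<partial>lborel)"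
    by (rule mecke[OF T F'])
  also have "\<dots> = (\<integral>\<^sup>+s\<in>{0<..T}. (\<integral>\<^sup>+x. ennreal (gp x) * (\<integral>\<^sup>+\<omega>. F (s, x, shift_path s x \<omega>) \<partial>P) \<partial>lborel) \<partial>lborel)"
  proof (rule nn_integral_cong)
    fix s
    have "ennreal (x * gp x) * (\<integral>\<^sup>+\<omega>. F' (s, x, shift_path s x \<omega>) \<partial>P) = ennreal (gp x) * (\<integral>\<^sup>+\<omega>. F (s, x, shift_path s x \<omega>) \<partial>P)"
      if s: "s \<in> {0<..T}" for x
    proof (cases "0 < x")
      case x: True
      have Fs: "(\<lambda>\<omega>. F (s, x, shift_path s x \<omega>)) \<in> borel_measurable P"
      proof -
        have "(\<lambda>\<omega>. (s, x, \<omega>)) \<in> measurable canonical_space mark_space" by simp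
        from measurable_compose[OF this shift_path_measurable]
        have "shift_path s x \<in> measurable canonical_space canonical_space" using s x by simp
        then have "(\<lambda>\<omega>. (s, x, shift_path s x \<omega>)) \<in> measurable canonical_space mark_space" by simp
        from measurable_P[OF measurable_compose[OF this F]] show ?thesis .
      qed
      have "(\<integral>\<^sup>+\<omega>. F' (s, x, shift_path s x \<omega>) \<partial>P) = (\<integral>\<^sup>+\<omega>. F (s, x, shift_path s x \<omega>) \<partial>P) / ennreal x"
        using x Fs by (simp add: F'_def nn_integral_divide)
      moreover have "ennreal (x * gp x) = ennreal (gp x) * ennreal x"
        using x gp_nonneg[of x] by (simp add: ennreal_mult mult.commute)
      moreover have "ennreal x * (I / ennreal x) = I" for I
        using x by (metis ennreal_divide_times ennreal_divide_self ennreal_less_top ennreal_less_zero_iff infinity_ennreal_def less_irrefl mult.commute mult.right_neutral ennreal_top_neq_zero)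
      ultimately show ?thesis by (simp add: mult.assoc)
    qed (simp add: gp_0)
    then show "(\<integral>\<^sup>+x. ennreal (x * gp x) * (\<integral>\<^sup>+\<omega>. F' (s, x, shift_path s x \<omega>) \<partial>P) \<partial>lborel) * indicator {0<..T} s =
      (\<integral>\<^sup>+x. ennreal (gp x) * (\<integral>\<^sup>+\<omega>. F (s, x, shift_path s x \<omega>) \<partial>P) \<partial>lborel) * indicator {0<..T} s"
      by (cases "s \<in> {0<..T}") auto
  qed
  finally show ?thesis .
qed

end

section \<open>A product formula along a countable set of jump times\<close>

definition cum :: "(real \<Rightarrow> real) \<Rightarrow> real \<Rightarrow> real" where
  "cum c t = (LINT s:{0<..t}|lborel. c s)"

lemma bounded_set_integrable_lborel:
  fixes f :: "real \<Rightarrow> real"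
  assumes [measurable]: "f \<in> borel_measurable borel" and b: "\<And>s. s \<in> {a<..b} \<Longrightarrow> \<bar>f s\<bar> \<le> B"
  shows "set_integrable lborel {a<..b} f"
proof -
  have "emeasure lborel {a<..b} < \<infinity>" by (cases "a \<le> b") auto
  then have "integrable lborel (\<lambda>s. indicator {a<..b} s *\<^sub>R B)"
    by (intro integrable_scaleR_left integrable_real_indicator) auto
  then show ?thesis unfolding set_integrable_def
  proof (rule Bochner_Integration.integrable_bound)
    show "AE s in lborel. norm (indicator {a<..b} s *\<^sub>R f s) \<le> norm (indicator {a<..b} s *\<^sub>R B)"
    proof (rule AE_I2)
      fix s
      show "norm (indicator {a<..b} s *\<^sub>R f s) \<le> norm (indicator {a<..b} s *\<^sub>R B)"
        using b[of s] by (cases "s \<in> {a<..b}") auto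
    qed
  qed measurable
qed

lemma cum_diff:
  assumes c: "c \<in> borel_measurable borel" "\<And>s. \<bar>c s\<bar> \<le> K" and st: "0 \<le> s" "s \<le> t"
  shows "cum c t - cum c s = (LINT r:{s<..t}|lborel. c r)"
proof -
  have e: "{0<..t} = {0<..s} \<union> {s<..t}" "{0<..s} \<inter> {s<..t} = {}" using st by auto
  have "cum c t = cum c s + (LINT r:{s<..t}|lborel. c r)"
    unfolding cum_def e(1) by (intro set_integral_Un e(2) bounded_set_integrable_lborel[OF c(1), where B=K] c(2))
  then show ?thesis by simp
qed

lemma set_integral_lborel_bound:
  fixes f :: "real \<Rightarrow> real"
  assumes f: "f \<in> borel_measurable borel" "\<And>s. s \<in> {a<..b} \<Longrightarrow> \<bar>f s\<bar> \<le> B" and ab: "a \<le> b"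
  shows "\<bar>LINT s:{a<..b}|lborel. f s\<bar> \<le> B * (b - a)"
proof -
  have "norm (LINT s:{a<..b}|lborel. f s) \<le> (LINT s:{a<..b}|lborel. B)"
    unfolding set_lebesgue_integral_def
  proof (rule integral_norm_bound[THEN order_trans], rule integral_mono)
    have i: "integrable lborel (\<lambda>s. indicator {a<..b} s *\<^sub>R f s)"
      using bounded_set_integrable_lborel[OF f] by (simp add: set_integrable_def)
    then show "integrable lborel (\<lambda>s. norm (indicator {a<..b} s *\<^sub>R f s))" by (rule integrable_norm)
    show "integrable lborel (\<lambda>s. indicator {a<..b} s *\<^sub>R B)"
      using bounded_set_integrable_lborel[of "\<lambda>_. B" a b "\<bar>B\<bar>"] by (simp add: set_integrable_def)
  qed (use f(2) in \<open>auto simp: indicator_def\<close>)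
  also have "\<dots> = B * (b - a)" using ab by (subst set_integral_const) auto
  finally show ?thesis by simp
qed

lemma cum_bound:
  assumes "c \<in> borel_measurable borel" "\<And>s. \<bar>c s\<bar> \<le> K" "0 \<le> s" "s \<le> t"
  shows "\<bar>cum c t - cum c s\<bar> \<le> K * (t - s)"
  unfolding cum_diff[OF assms] by (rule set_integral_lborel_bound) (use assms in auto)

lemma cum_0[simp]: "cum c 0 = 0" by (simp add: cum_def set_lebesgue_integral_def)

lemma cum_le:
  assumes "c \<in> borel_measurable borel" "\<And>s. \<bar>c s\<bar> \<le> K" "0 \<le> t"
  shows "\<bar>cum c t\<bar> \<le> K * t"
  using cum_bound[OF assms(1,2) order_refl assms(3)] by simp

lemma cum_measurable:
  assumes c[measurable]: "c \<in> borel_measurable borel"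
  shows "cum c \<in> borel_measurable borel"
proof -
  have "cum c = (\<lambda>t. LINT s|lborel. indicator {0<..} s * indicator {..t} s * c s)"
    unfolding cum_def set_lebesgue_integral_def
    by (intro ext Bochner_Integration.integral_cong) (auto split: split_indicator)
  moreover have "(\<lambda>t. LINT s|lborel. indicator {0<..} s * indicator {..t} s * c s) \<in> borel_measurable borel"
    by (rule lborel.borel_measurable_lebesgue_integral) (simp add: indicator_def case_prod_beta')
  ultimately show ?thesis by simp
qed

text \<open>Over n equal steps the increments add up to at most C (t - s)^2 / n.\<close>

lemma quadratic_increments_const:
  fixes D :: "real \<Rightarrow> real"
  assumes st: "s \<le> t" and q: "\<And>r v. s \<le> r \<Longrightarrow> r \<le> v \<Longrightarrow> v \<le> t \<Longrightarrow> \<bar>D v - D r\<bar> \<le> C * (v - r)\<^sup>2"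
  shows "D t = D s"
proof -
  have *: "\<bar>D t - D s\<bar> \<le> (C * (t - s)\<^sup>2) / real (Suc n)" for n
  proof -
    define h where "h = (t - s) / real (Suc n)"
    have h: "0 \<le> h" "h * real (Suc n) = t - s" using st by (auto simp: h_def simp del: of_nat_Suc)
    have "D t - D s = (\<Sum>i<Suc n. D (s + h * real (Suc i)) - D (s + h * real i))"
      unfolding sum_lessThan_telescope[of "\<lambda>i. D (s + h * real i)"] h(2) by simp
    then have "\<bar>D t - D s\<bar> \<le> (\<Sum>i<Suc n. \<bar>D (s + h * real (Suc i)) - D (s + h * real i)\<bar>)"
      by (simp only: sum_abs)
    also have "\<dots> \<le> (\<Sum>i<Suc n. C * h\<^sup>2)"
    proof (rule sum_mono)
      fix i assume "i \<in> {..<Suc n}"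
      then have "h * real (Suc i) \<le> h * real (Suc n)" using h(1) by (intro mult_left_mono) auto
      then have "s + h * real (Suc i) \<le> t" using h(2) by linarith
      moreover have "(s + h * real (Suc i)) - (s + h * real i) = h" by (simp add: algebra_simps)
      ultimately show "\<bar>D (s + h * real (Suc i)) - D (s + h * real i)\<bar> \<le> C * h\<^sup>2"
        using q[of "s + h * real i" "s + h * real (Suc i)"] h(1) by (simp add: mult_left_mono)
    qed
    also have "\<dots> = (C * (t - s)\<^sup>2) / real (Suc n)"
      by (simp add: h_def power2_eq_square field_simps del: of_nat_Suc)
    finally show ?thesis .
  qed
  have "\<bar>D t - D s\<bar> \<le> 0"
    by (rule tendsto_lowerbound[OF inverse_Suc_tendsto[of "C * (t - s)\<^sup>2"]]) (use * in auto)
  then show ?thesis by simp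
qed

lemma exp_minus_lipschitz:
  fixes a b M :: real assumes "exp (- a) \<le> M" "exp (- b) \<le> M"
  shows "\<bar>exp (- a) - exp (- b)\<bar> \<le> M * \<bar>a - b\<bar>"
proof -
  have *: "exp (- a) - exp (- b) \<le> M * (b - a)" if "a \<le> b" "exp (- a) \<le> M" for a b :: real
  proof -
    have "exp (- a) - exp (- b) = exp (- a) * (1 - exp (- (b - a)))" by (simp add: right_diff_distrib exp_add[symmetric])
    also have "\<dots> \<le> M * (b - a)"
    proof (rule mult_mono)
      show "1 - exp (- (b - a)) \<le> b - a" using exp_ge_add_one_self[of "- (b - a)"] by linarith
      show "0 \<le> M" using that(2) exp_gt_zero[of "- a"] by linarith
    qed (use that in auto)
    finally show ?thesis .
  qed
  show ?thesis using *[of a b] *[of b a] assms by (cases "a \<le> b") (auto simp: abs_if)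
qed

text \<open>First-order expansion with the same quadratic bound in both directions; \<open>M\<close>
  bounds the exponential at whichever end is larger.\<close>

lemma exp_minus_taylor:
  fixes a b M :: real assumes "exp (- a) \<le> M" "exp (- b) \<le> M"
  shows "\<bar>exp (- b) - exp (- a) + exp (- a) * (b - a)\<bar> \<le> M * (b - a)\<^sup>2"
proof (cases "a \<le> b")
  case True
  have "exp (- b) = exp (- a) * exp (- (b - a))" by (simp add: exp_add[symmetric])
  then have "exp (- b) - exp (- a) + exp (- a) * (b - a) = exp (- a) * (exp (- (b - a)) - 1 + (b - a))"
    by (simp add: algebra_simps)
  moreover have "0 \<le> exp (- (b - a)) - 1 + (b - a)" "exp (- (b - a)) - 1 + (b - a) \<le> (b - a)\<^sup>2"
    using exp_minus_bounds[of "b - a"] True by auto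
  ultimately have "\<bar>exp (- b) - exp (- a) + exp (- a) * (b - a)\<bar> = exp (- a) * (exp (- (b - a)) - 1 + (b - a))"
    by simp
  also have "\<dots> \<le> M * (b - a)\<^sup>2"
  proof (rule mult_mono)
    show "0 \<le> M" using assms(1) exp_gt_zero[of "- a"] by linarith
  qed (use assms(1) exp_minus_bounds[of "b - a"] True in auto)
  finally show ?thesis .
next
  case False
  define w where "w = a - b"
  have w: "0 < w" using False by (simp add: w_def)
  have ea: "exp (- a) = exp (- b) * exp (- w)" by (simp add: w_def exp_add[symmetric])
  \<comment> \<open>With \<open>a = b + w\<close> the remainder is exp(-b)(1 - z), and z lies
    between 1 - w^2 and 1.\<close>
  define z where "z = exp (- w) * (1 + w)"
  have "z \<le> exp (- w) * exp w"
    unfolding z_def using exp_ge_add_one_self[of w] by (intro mult_left_mono) auto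
  then have z1: "z \<le> 1" by (simp add: exp_minus)
  have "(1 - w) * (1 + w) \<le> z"
    unfolding z_def using exp_ge_add_one_self[of "- w"] w by (intro mult_right_mono) auto
  then have z2: "1 - z \<le> w\<^sup>2" by (simp add: power2_eq_square algebra_simps)
  have "exp (- b) - exp (- a) + exp (- a) * (b - a) = exp (- b) * (1 - z)"
    unfolding ea z_def by (simp add: w_def algebra_simps)
  then have "\<bar>exp (- b) - exp (- a) + exp (- a) * (b - a)\<bar> = exp (- b) * (1 - z)" using z1 by simp
  also have "\<dots> \<le> M * w\<^sup>2"
  proof (rule mult_mono)
    show "0 \<le> M" using assms(2) exp_gt_zero[of "- b"] by linarith
  qed (use assms(2) z1 z2 in auto)
  finally show ?thesis by (simp add: w_def power2_commute)
qed

text \<open>The defect of the integral equation is \<open>O((v - r)\<^sup>2)\<close> over \<open>{r<..v}\<close>; this replaces the chain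
  rule for absolutely continuous functions.\<close>

lemma exp_cum_eq:
  assumes c: "c \<in> borel_measurable borel" "\<And>s. \<bar>c s\<bar> \<le> K" and st: "0 \<le> s" "s \<le> t"
  shows "exp (- cum c t) = exp (- cum c s) - (LINT r:{s<..t}|lborel. exp (- cum c r) * c r)"
proof -
  have K: "0 \<le> K" using c(2)[of 0] by simp
  define F where "F r = exp (- cum c r)" for r
  define M where "M = exp (K * t)"
  have M0: "0 \<le> M" by (simp add: M_def)
  have [measurable]: "F \<in> borel_measurable borel" unfolding F_def[abs_def] using cum_measurable[OF c(1)] by measurable
  note [measurable] = c(1)
  have FM: "0 < F r" "F r \<le> M" if "0 \<le> r" "r \<le> t" for r
  proof -
    have "K * r \<le> K * t" using that K by (intro mult_left_mono) auto
    then have "- cum c r \<le> K * t" using cum_le[OF c that(1)] by linarith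
    then show "F r \<le> M" by (simp add: F_def M_def)
  qed (simp add: F_def)
  define D where "D r = F r + (LINT u:{s<..r}|lborel. F u * c u)" for r
  have Fc: "\<bar>F u * c u\<bar> \<le> M * K" if "0 \<le> u" "u \<le> t" for u
    unfolding abs_mult using FM[OF that] c(2)[of u] K by (intro mult_mono) auto
  have "D t = D s"
  proof (rule quadratic_increments_const[OF st(2)])
    fix r v assume rv: "s \<le> r" "r \<le> v" "v \<le> t"
    have r0: "0 \<le> r" using st rv by simp
    have y: "cum c v - cum c r = (LINT u:{r<..v}|lborel. c u)" by (rule cum_diff[OF c r0 rv(2)])
    have e: "{s<..v} = {s<..r} \<union> {r<..v}" "{s<..r} \<inter> {r<..v} = {}" using rv by auto
    have iFc: "set_integrable lborel {a<..b} (\<lambda>u. F u * c u)" if "0 \<le> a" "b \<le> t" for a b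
      by (rule bounded_set_integrable_lborel[where B="M * K"]) (use Fc that in auto)
    have ic: "set_integrable lborel {r<..v} (\<lambda>u. F r * c u)"
      by (rule set_integrable_mult_right) (rule bounded_set_integrable_lborel[OF c(1) c(2)])
    have "(LINT u:{s<..v}|lborel. F u * c u) = (LINT u:{s<..r}|lborel. F u * c u) + (LINT u:{r<..v}|lborel. F u * c u)"
      unfolding e(1) using rv st by (intro set_integral_Un e(2) iFc) auto
    moreover have "(LINT u:{r<..v}|lborel. (F u - F r) * c u) = (LINT u:{r<..v}|lborel. F u * c u) - F r * (cum c v - cum c r)"
      unfolding left_diff_distrib y using set_integral_diff(2)[OF iFc[OF r0 rv(3)] ic] by simp
    ultimately have DD: "D v - D r = (F v - F r + F r * (cum c v - cum c r)) + (LINT u:{r<..v}|lborel. (F u - F r) * c u)"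
      by (simp add: D_def)
    have "\<bar>F v - F r + F r * (cum c v - cum c r)\<bar> \<le> M * (cum c v - cum c r)\<^sup>2"
      unfolding F_def by (rule exp_minus_taylor) (use FM[of r] FM[of v] r0 rv in \<open>auto simp: F_def\<close>)
    also have "\<dots> \<le> M * (K * (v - r))\<^sup>2"
    proof (intro mult_left_mono M0)
      have "\<bar>cum c v - cum c r\<bar>\<^sup>2 \<le> (K * (v - r))\<^sup>2" by (intro power_mono cum_bound[OF c r0 rv(2)]) auto
      then show "(cum c v - cum c r)\<^sup>2 \<le> (K * (v - r))\<^sup>2" by simp
    qed
    finally have A: "\<bar>F v - F r + F r * (cum c v - cum c r)\<bar> \<le> M * (K * (v - r))\<^sup>2" .
    have "\<bar>LINT u:{r<..v}|lborel. (F u - F r) * c u\<bar> \<le> (M * (K * (v - r)) * K) * (v - r)"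
    proof (rule set_integral_lborel_bound)
      fix u assume u: "u \<in> {r<..v}"
      have "\<bar>F u - F r\<bar> \<le> M * \<bar>cum c u - cum c r\<bar>"
        unfolding F_def by (rule exp_minus_lipschitz) (use FM[of r] FM[of u] r0 rv u in \<open>auto simp: F_def\<close>)
      also have "\<dots> \<le> M * (K * (v - r))"
      proof (intro mult_left_mono M0)
        have "\<bar>cum c u - cum c r\<bar> \<le> K * (u - r)" using u by (intro cum_bound[OF c r0]) auto
        also have "\<dots> \<le> K * (v - r)" using u K by (intro mult_left_mono) auto
        finally show "\<bar>cum c u - cum c r\<bar> \<le> K * (v - r)" .
      qed
      finally show "\<bar>(F u - F r) * c u\<bar> \<le> M * (K * (v - r)) * K"
        unfolding abs_mult using c(2)[of u] M0 K rv by (intro mult_mono) auto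
    qed (use rv in auto)
    then have B: "\<bar>LINT u:{r<..v}|lborel. (F u - F r) * c u\<bar> \<le> M * (K * (v - r))\<^sup>2"
      by (simp add: power2_eq_square algebra_simps)
    have "\<bar>D v - D r\<bar> \<le> 2 * (M * (K * (v - r))\<^sup>2)" unfolding DD using A B by linarith
    then show "\<bar>D v - D r\<bar> \<le> (2 * M * K\<^sup>2) * (v - r)\<^sup>2" by (simp add: power_mult_distrib mult.assoc)
  qed
  then show ?thesis by (simp add: D_def F_def set_lebesgue_integral_def algebra_simps)
qed

text \<open>Induction on the largest time \<open>m\<close>. Up to \<open>m\<close> nothing changes,
  since the products run over times strictly before the current one; after \<open>m\<close> the
  product is constant, and the integral of exp(-cum c) c over \<open>{m<..t}\<close> is a difference
  of exponentials by \<open>exp_cum_eq\<close>.\<close>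

lemma finite_product_formula:
  fixes u c :: "real \<Rightarrow> real"
  assumes c: "c \<in> borel_measurable borel" "\<And>s. \<bar>c s\<bar> \<le> K" and t: "0 \<le> t"
  shows "finite J \<Longrightarrow> J \<subseteq> {0<..t} \<Longrightarrow>
    exp (- cum c t) * (\<Prod>s\<in>J. 1 + u s) = 1 + (\<Sum>s\<in>J. exp (- cum c s) * (\<Prod>r\<in>{r\<in>J. r < s}. 1 + u r) * u s)
      - (LINT r:{0<..t}|lborel. exp (- cum c r) * (\<Prod>q\<in>{q\<in>J. q < r}. 1 + u q) * c r)"
proof (induction J rule: finite_linorder_max_induct)
  case empty
  show ?case using exp_cum_eq[OF c order_refl t] by simp
next
  case (insert m J)
  have m: "0 < m" "m \<le> t" and J: "J \<subseteq> {0<..t}" using insert.prems by auto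
  have mJ: "m \<notin> J" using insert.hyps by auto
  define Pr where "Pr J r = (\<Prod>q\<in>{q\<in>J. q < r}. 1 + u q)" for J r
  define p where "p = (\<Prod>s\<in>J. 1 + u s)"
  have Pm: "Pr (insert m J) r = Pr J r" if "r \<le> m" for r
  proof -
    have "{q \<in> insert m J. q < r} = {q\<in>J. q < r}" using that by auto
    then show ?thesis by (simp add: Pr_def)
  qed
  have Pg: "Pr (insert m J) r = (1 + u m) * p" "Pr J r = p" if "m < r" for r
  proof -
    have "{q\<in>J. q < r} = J" "{q \<in> insert m J. q < r} = insert m J" using insert.hyps(2) that by auto
    then show "Pr (insert m J) r = (1 + u m) * p" "Pr J r = p"
      using insert.hyps(1) mJ by (auto simp: Pr_def p_def)
  qed
  have PJm: "Pr J m = p"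
  proof -
    have "{q\<in>J. q < m} = J" using insert.hyps(2) by auto
    then show ?thesis by (simp add: Pr_def p_def)
  qed
  have mPr[measurable]: "Pr J \<in> borel_measurable borel" if "finite J" for J
  proof -
    have "Pr J = (\<lambda>r. \<Prod>q\<in>J. if q < r then 1 + u q else 1)"
      using that unfolding Pr_def by (intro ext) (auto simp: prod.If_cases intro!: prod.cong)
    then show ?thesis by simp
  qed
  note [measurable] = cum_measurable[OF c(1)] c(1)
  define f where "f J r = exp (- cum c r) * Pr J r * c r" for J r
  have fm: "f J \<in> borel_measurable borel" if "finite J" for J unfolding f_def[abs_def] using mPr[OF that] by measurable
  have Prb: "\<bar>Pr J r\<bar> \<le> (\<Prod>q\<in>J. 1 + \<bar>u q\<bar>)" if "finite J" for J r
  proof -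
    have "\<bar>Pr J r\<bar> = (\<Prod>q\<in>{q\<in>J. q < r}. \<bar>1 + u q\<bar>)" by (simp add: Pr_def abs_prod)
    also have "\<dots> \<le> (\<Prod>q\<in>{q\<in>J. q < r}. 1 + \<bar>u q\<bar>)" by (intro prod_mono) auto
    also have "\<dots> \<le> (\<Prod>q\<in>J. 1 + \<bar>u q\<bar>)" using that by (intro prod_mono2) auto
    finally show ?thesis .
  qed
  have fi: "set_integrable lborel {a<..b} (f J)" if ab: "0 \<le> a" "b \<le> t" and "finite J" for a b J
  proof (rule bounded_set_integrable_lborel[OF fm[OF \<open>finite J\<close>]])
    fix r assume r: "r \<in> {a<..b}"
    have K: "0 \<le> K" using c(2)[of 0] by simp
    have "K * r \<le> K * t" using r ab K by (intro mult_left_mono) auto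
    then have "- cum c r \<le> K * t" using cum_le[OF c, of r] r ab by auto
    then show "\<bar>f J r\<bar> \<le> exp (K * t) * (\<Prod>q\<in>J. 1 + \<bar>u q\<bar>) * K"
      unfolding f_def abs_mult using Prb[OF \<open>finite J\<close>, of r] c(2)[of r] K by (intro mult_mono) (auto intro: prod_nonneg)
  qed
  have e: "{0<..t} = {0<..m} \<union> {m<..t}" "{0<..m} \<inter> {m<..t} = {}" using m by auto
  have split: "(LINT r:{0<..t}|lborel. f J r) = (LINT r:{0<..m}|lborel. f J r) + (LINT r:{m<..t}|lborel. f J r)"
    if "finite J" for J unfolding e(1) using m that by (intro set_integral_Un e(2) fi) auto
  have 1: "(LINT r:{0<..m}|lborel. f (insert m J) r) = (LINT r:{0<..m}|lborel. f J r)"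
    by (intro set_lebesgue_integral_cong) (auto simp: f_def Pm)
  define I where "I = (LINT r:{m<..t}|lborel. exp (- cum c r) * c r)"
  have I: "I = exp (- cum c m) - exp (- cum c t)" using exp_cum_eq[OF c _ m(2)] m by (simp add: I_def)
  have 2: "(LINT r:{m<..t}|lborel. f (insert m J) r) = (1 + u m) * p * I"
  proof -
    have "(LINT r:{m<..t}|lborel. f (insert m J) r) = (LINT r:{m<..t}|lborel. ((1 + u m) * p) * (exp (- cum c r) * c r))"
      by (intro set_lebesgue_integral_cong) (auto simp: f_def Pg)
    then show ?thesis by (simp add: I_def)
  qed
  have 3: "(LINT r:{m<..t}|lborel. f J r) = p * I"
  proof -
    have "(LINT r:{m<..t}|lborel. f J r) = (LINT r:{m<..t}|lborel. p * (exp (- cum c r) * c r))"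
      by (intro set_lebesgue_integral_cong) (auto simp: f_def Pg)
    then show ?thesis by (simp add: I_def)
  qed
  have int: "(LINT r:{0<..t}|lborel. f (insert m J) r) = (LINT r:{0<..t}|lborel. f J r) + u m * p * I"
    unfolding split[OF finite.insertI[OF insert.hyps(1)]] split[OF insert.hyps(1)] 1 2 3 by (simp add: algebra_simps)
  have sum: "(\<Sum>s\<in>insert m J. exp (- cum c s) * Pr (insert m J) s * u s) = exp (- cum c m) * p * u m + (\<Sum>s\<in>J. exp (- cum c s) * Pr J s * u s)"
  proof -
    have "(\<Sum>s\<in>J. exp (- cum c s) * Pr (insert m J) s * u s) = (\<Sum>s\<in>J. exp (- cum c s) * Pr J s * u s)"
      using insert.hyps(2) by (intro sum.cong refl) (simp add: Pm less_imp_le)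
    then show ?thesis using insert.hyps(1) mJ by (simp add: Pm PJm)
  qed
  have IH: "exp (- cum c t) * p = 1 + (\<Sum>s\<in>J. exp (- cum c s) * Pr J s * u s) - (LINT r:{0<..t}|lborel. f J r)"
    using insert.IH[OF J] by (simp add: Pr_def p_def f_def)
  have "exp (- cum c t) * (\<Prod>s\<in>insert m J. 1 + u s) = exp (- cum c t) * p + u m * p * exp (- cum c t)"
    using insert.hyps(1) mJ by (simp add: p_def algebra_simps)
  also have "\<dots> = 1 + (\<Sum>s\<in>insert m J. exp (- cum c s) * Pr (insert m J) s * u s) - (LINT r:{0<..t}|lborel. f (insert m J) r)"
    unfolding int sum IH I by (simp add: algebra_simps)
  finally show ?case unfolding Pr_def f_def .
qed

lemma integral_count_space_indicator:
  fixes g :: "'a \<Rightarrow> real"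
  assumes "finite F" "F \<subseteq> J"
  shows "(LINT s|count_space J. indicator F s * g s) = sum g F"
proof -
  have "{s\<in>J. indicator F s * g s \<noteq> 0} = {s\<in>F. g s \<noteq> 0}" using assms by (auto simp: indicator_def)
  then have "(LINT s|count_space J. indicator F s * g s) = (\<Sum>s\<in>{s\<in>F. g s \<noteq> 0}. indicator F s * g s)"
    using assms by (subst lebesgue_integral_count_space_finite_support) auto
  also have "\<dots> = sum g F" using assms(1) by (intro sum.mono_neutral_cong_left) auto
  finally show ?thesis .
qed

text \<open>Summability leaves only finitely many terms above 1/2 in absolute value, and on the
  others the logarithm is bounded by \<open>2 * \<bar>u s\<bar>\<close>.\<close>

lemma integrable_ln_one_plus:
  fixes u :: "'a \<Rightarrow> real"
  assumes u: "integrable (count_space J) u" and pos: "\<And>s. s \<in> J \<Longrightarrow> -1 < u s"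
  shows "integrable (count_space J) (\<lambda>s. ln (1 + u s))"
proof -
  define A where "A = {s\<in>J. 1 / 2 < \<bar>u s\<bar>}"
  have "emeasure (count_space J) A \<le> (\<integral>\<^sup>+s. ennreal (2 * \<bar>u s\<bar>) \<partial>count_space J)"
  proof -
    have "emeasure (count_space J) A = (\<integral>\<^sup>+s. indicator A s \<partial>count_space J)"
      by (rule nn_integral_indicator[symmetric]) (auto simp: A_def)
    also have "\<dots> \<le> (\<integral>\<^sup>+s. ennreal (2 * \<bar>u s\<bar>) \<partial>count_space J)"
      by (intro nn_integral_mono) (auto simp: A_def indicator_def)
    finally show ?thesis .
  qed
  also have "\<dots> = (\<integral>\<^sup>+s. ennreal (norm (2 * u s)) \<partial>count_space J)" by (simp add: abs_mult)
  also have "\<dots> < \<infinity>" using integrable_mult_right[OF u, of 2] unfolding integrable_iff_bounded by blast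
  finally have eA: "emeasure (count_space J) A < \<infinity>" .
  have fA: "finite A"
  proof (rule ccontr)
    assume "infinite A"
    then have "emeasure (count_space J) A = \<infinity>" by (intro emeasure_count_space_infinite) (auto simp: A_def)
    then show False using eA by simp
  qed
  have 1: "integrable (count_space J) (\<lambda>s. indicator A s * ln (1 + u s))"
  proof (rule integrableI_bounded)
    have "(\<integral>\<^sup>+s. ennreal (norm (indicator A s * ln (1 + u s))) \<partial>count_space J) = (\<Sum>s | s \<in> J \<and> 0 < ennreal (norm (indicator A s * ln (1 + u s))). ennreal (norm (indicator A s * ln (1 + u s))))"
      by (rule nn_integral_count_space, rule finite_subset[OF _ fA]) (auto simp: indicator_def)
    also have "\<dots> < \<infinity>" by (simp add: ennreal_sum_less_top)
    finally show "(\<integral>\<^sup>+s. ennreal (norm (indicator A s * ln (1 + u s))) \<partial>count_space J) < \<infinity>" .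
  qed simp
  have 2: "integrable (count_space J) (\<lambda>s. indicator (- A) s * ln (1 + u s))"
  proof (rule Bochner_Integration.integrable_bound[OF integrable_mult_right[OF u, of 2]])
    show "AE s in count_space J. norm (indicator (- A) s * ln (1 + u s)) \<le> norm (2 * u s)"
    proof (rule AE_I2)
      fix s assume "s \<in> space (count_space J)"
      then have s: "s \<in> J" by simp
      show "norm (indicator (- A) s * ln (1 + u s)) \<le> norm (2 * u s)"
      proof (cases "s \<in> A")
        case False
        then have h: "\<bar>u s\<bar> \<le> 1 / 2" using s by (auto simp: A_def)
        have "ln (1 + u s) \<le> u s" using pos[OF s] by (intro ln_add_one_self_le_self2) auto
        moreover have "- ln (1 + u s) \<le> 2 * \<bar>u s\<bar>"
        proof -
          have "- ln (1 + u s) = ln (1 / (1 + u s))" using pos[OF s] by (simp add: ln_div)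
          also have "\<dots> \<le> 1 / (1 + u s) - 1" using pos[OF s] by (intro ln_le_minus_one) auto
          also have "\<dots> = (- u s) / (1 + u s)" using pos[OF s] by (simp add: field_simps)
          also have "\<dots> \<le> \<bar>u s\<bar> / (1 / 2)" using h by (intro frac_le) auto
          finally show ?thesis by simp
        qed
        ultimately show ?thesis using False by (auto simp: abs_if)
      qed simp
    qed
  qed simp
  have "integrable (count_space J) (\<lambda>s. indicator A s * ln (1 + u s) + indicator (- A) s * ln (1 + u s))"
    using 1 2 by (rule Bochner_Integration.integrable_add)
  also have "(\<lambda>s. indicator A s * ln (1 + u s) + indicator (- A) s * ln (1 + u s)) = (\<lambda>s. ln (1 + u s))"
    by (auto simp: indicator_def)
  finally show ?thesis .
qed

text \<open>Limit of the finite formula along an exhaustion of \<open>J\<close>. The products are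
  exponentials of sums of logarithms, so absolute summability of the logarithms gives a bound
  uniform in the exhaustion, and every term converges by domination. \<open>V r\<close> is the
  product strictly before \<open>r\<close>, hence predictable when \<open>u\<close> comes from a
  path.\<close>

theorem countable_product_formula:
  fixes u c :: "real \<Rightarrow> real"
  assumes J: "countable J" "J \<subseteq> {0<..t}" and t: "0 \<le> t"
    and u: "integrable (count_space J) u" and pos: "\<And>s. s \<in> J \<Longrightarrow> -1 < u s"
    and c: "c \<in> borel_measurable borel" "\<And>s. \<bar>c s\<bar> \<le> K"
  defines "V \<equiv> \<lambda>r. exp ((LINT s|count_space J. indicator {..<r} s * ln (1 + u s)) - cum c r)"
  shows "exp ((LINT s|count_space J. ln (1 + u s)) - cum c t) =
      1 + (LINT s|count_space J. V s * u s) - (LINT r:{0<..t}|lborel. V r * c r)"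
    and "integrable (count_space J) (\<lambda>s. V s * u s)"
    and "set_integrable lborel {0<..t} (\<lambda>r. V r * c r)"
    and "\<And>r. 0 \<le> r \<Longrightarrow> r \<le> t \<Longrightarrow> V r \<le> exp ((LINT s|count_space J. \<bar>ln (1 + u s)\<bar>) + K * t)"
    and "V \<in> borel_measurable borel"
proof -
  note ln = integrable_ln_one_plus[OF u pos]
  have pos1: "0 < 1 + u s" if "s \<in> J" for s using pos[OF that] by linarith
  have K: "0 \<le> K" using c(2)[of 0] by simp
  define B where "B = exp ((LINT s|count_space J. \<bar>ln (1 + u s)\<bar>) + K * t)"
  have cumK: "- cum c r \<le> K * t" if "0 \<le> r" "r \<le> t" for r
  proof -
    have "K * r \<le> K * t" using that K by (intro mult_left_mono) auto
    then show ?thesis using cum_le[OF c that(1)] by linarith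
  qed
  have lb: "(LINT s|count_space J. i s * ln (1 + u s)) \<le> (LINT s|count_space J. \<bar>ln (1 + u s)\<bar>)"
    if i: "\<And>s. i s \<in> {0..1}" for i :: "real \<Rightarrow> real"
  proof (rule integral_mono)
    have b: "\<bar>i s * ln (1 + u s)\<bar> \<le> \<bar>ln (1 + u s)\<bar>" for s
      using i[of s] by (simp add: abs_mult mult_left_le_one_le)
    show "integrable (count_space J) (\<lambda>s. i s * ln (1 + u s))"
      by (rule Bochner_Integration.integrable_bound[OF ln]) (use b in auto)
    show "i s * ln (1 + u s) \<le> \<bar>ln (1 + u s)\<bar>" for s using b[of s] by linarith
  qed (use ln in auto)
  \<comment> \<open>The intersection covers empty \<open>J\<close>, where the enumeration returns an
    arbitrary value.\<close>
  define F where "F n = J \<inter> from_nat_into J ` {..<n}" for n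
  have fF: "finite (F n)" and FJ: "F n \<subseteq> J" for n by (auto simp: F_def)
  have Fev: "eventually (\<lambda>n. s \<in> F n) sequentially" if "s \<in> J" for s
  proof -
    have "s \<in> F n" if "to_nat_on J s < n" for n
      using from_nat_into_to_nat_on[OF J(1) \<open>s \<in> J\<close>] that \<open>s \<in> J\<close> unfolding F_def by (metis IntI imageI lessThan_iff)
    then show ?thesis unfolding eventually_sequentially by (intro exI[of _ "Suc (to_nat_on J s)"]) auto
  qed
  have Flim: "(\<lambda>n. indicator (F n) s * x) \<longlonglongrightarrow> x" if "s \<in> J" for s and x :: real
    by (rule tendsto_eventually, rule eventually_mono[OF Fev[OF that]]) simp
  define Vn where "Vn n r = exp (- cum c r) * (\<Prod>q\<in>{q\<in>F n. q < r}. 1 + u q)" for n r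
  have Vn: "Vn n r = exp ((LINT s|count_space J. (indicator (F n) s * indicator {..<r} s) * ln (1 + u s)) - cum c r)" for n r
  proof -
    have "(LINT s|count_space J. (indicator (F n) s * indicator {..<r} s) * ln (1 + u s)) = (\<Sum>s\<in>F n. indicator {..<r} s * ln (1 + u s))"
      using integral_count_space_indicator[OF fF[of n] FJ[of n], of "\<lambda>s. indicator {..<r} s * ln (1 + u s)"] by (simp add: mult.assoc)
    also have "\<dots> = (\<Sum>s\<in>{q\<in>F n. q < r}. ln (1 + u s))"
      using fF by (intro sum.mono_neutral_cong_right) (auto simp: indicator_def)
    also have "exp \<dots> = (\<Prod>q\<in>{q\<in>F n. q < r}. 1 + u q)"
      using fF[of n] FJ[of n] pos1 by (subst exp_sum) (auto intro!: prod.cong simp: subset_eq)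
    finally show ?thesis by (simp add: Vn_def exp_diff exp_minus field_simps)
  qed
  have VnB: "0 < Vn n r" "Vn n r \<le> B" if "0 \<le> r" "r \<le> t" for n r
  proof -
    have "(LINT s|count_space J. (indicator (F n) s * indicator {..<r} s) * ln (1 + u s)) \<le> (LINT s|count_space J. \<bar>ln (1 + u s)\<bar>)"
      by (rule lb) (auto simp: indicator_def)
    then show "Vn n r \<le> B" unfolding Vn B_def using cumK[OF that] by simp
  qed (simp add: Vn)
  have Vlim: "(\<lambda>n. Vn n r) \<longlonglongrightarrow> V r" for r
    unfolding Vn V_def
  proof (intro tendsto_exp tendsto_diff tendsto_const integral_dominated_convergence[where w="\<lambda>s. \<bar>ln (1 + u s)\<bar>"])
    show "integrable (count_space J) (\<lambda>s. \<bar>ln (1 + u s)\<bar>)" using ln by simp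
    show "AE s in count_space J. (\<lambda>n. indicator (F n) s * indicator {..<r} s * ln (1 + u s)) \<longlonglongrightarrow> indicator {..<r} s * ln (1 + u s)"
      using Flim by (intro AE_I2) (simp add: mult.assoc)
    show "AE s in count_space J. norm (indicator (F n) s * indicator {..<r} s * ln (1 + u s)) \<le> \<bar>ln (1 + u s)\<bar>" for n
      by (intro AE_I2) (auto simp: indicator_def)
  qed auto
  have VB: "V r \<le> B" if "0 \<le> r" "r \<le> t" for r
    by (rule LIMSEQ_le_const2[OF Vlim]) (use VnB[OF that] in auto)
  then show "\<And>r. 0 \<le> r \<Longrightarrow> r \<le> t \<Longrightarrow> V r \<le> exp ((LINT s|count_space J. \<bar>ln (1 + u s)\<bar>) + K * t)" unfolding B_def .
  have V0: "0 \<le> V r" for r by (simp add: V_def)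
  have Vnm: "Vn n \<in> borel_measurable borel" for n
  proof -
    have "Vn n = (\<lambda>r. exp (- cum c r) * (\<Prod>q\<in>F n. if q < r then 1 + u q else 1))"
      unfolding Vn_def using fF[of n] by (intro ext) (auto simp: prod.If_cases intro!: prod.cong)
    then show ?thesis using cum_measurable[OF c(1)] by simp
  qed
  show Vm: "V \<in> borel_measurable borel" by (rule borel_measurable_LIMSEQ_real[OF Vlim Vnm])
  note [measurable] = Vm Vnm c(1)
  show iu: "integrable (count_space J) (\<lambda>s. V s * u s)"
  proof (rule Bochner_Integration.integrable_bound[OF integrable_mult_right[OF u, of B]])
    show "AE s in count_space J. norm (V s * u s) \<le> norm (B * u s)"
    proof (rule AE_I2)
      fix s assume "s \<in> space (count_space J)"
      then have "0 \<le> s" "s \<le> t" using J(2) by auto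
      from VB[OF this] V0[of s] have "\<bar>V s\<bar> * \<bar>u s\<bar> \<le> \<bar>B\<bar> * \<bar>u s\<bar>" by (intro mult_right_mono) auto
      then show "norm (V s * u s) \<le> norm (B * u s)" by (simp add: abs_mult)
    qed
  qed simp
  show "set_integrable lborel {0<..t} (\<lambda>r. V r * c r)"
  proof (rule bounded_set_integrable_lborel[where B="B * K"])
    fix r assume "r \<in> {0<..t}"
    then show "\<bar>V r * c r\<bar> \<le> B * K" using VB[of r] V0[of r] c(2)[of r] K by (auto simp: abs_mult intro!: mult_mono)
  qed measurable
  have eq: "exp ((LINT s|count_space J. indicator (F n) s * ln (1 + u s)) - cum c t) =
     1 + (LINT s|count_space J. indicator (F n) s * (Vn n s * u s)) - (LINT r:{0<..t}|lborel. Vn n r * c r)" for n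
  proof -
    have "exp ((LINT s|count_space J. indicator (F n) s * ln (1 + u s)) - cum c t) = exp (- cum c t) * (\<Prod>s\<in>F n. 1 + u s)"
    proof -
      have "exp (\<Sum>s\<in>F n. ln (1 + u s)) = (\<Prod>s\<in>F n. 1 + u s)"
        using fF[of n] FJ[of n] pos1 by (subst exp_sum) (auto intro!: prod.cong simp: subset_eq)
      then show ?thesis unfolding integral_count_space_indicator[OF fF FJ] by (simp add: exp_diff exp_minus field_simps)
    qed
    also have "\<dots> = 1 + (\<Sum>s\<in>F n. Vn n s * u s) - (LINT r:{0<..t}|lborel. Vn n r * c r)"
      unfolding Vn_def using finite_product_formula[OF c t fF[of n], of u] FJ[of n] J(2) by (simp add: subset_trans)
    finally show ?thesis unfolding integral_count_space_indicator[OF fF FJ] .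
  qed
  have L1: "(\<lambda>n. exp ((LINT s|count_space J. indicator (F n) s * ln (1 + u s)) - cum c t)) \<longlonglongrightarrow> exp ((LINT s|count_space J. ln (1 + u s)) - cum c t)"
  proof (intro tendsto_exp tendsto_diff tendsto_const integral_dominated_convergence[where w="\<lambda>s. \<bar>ln (1 + u s)\<bar>"])
    show "integrable (count_space J) (\<lambda>s. \<bar>ln (1 + u s)\<bar>)" using ln by simp
    show "AE s in count_space J. (\<lambda>n. indicator (F n) s * ln (1 + u s)) \<longlonglongrightarrow> ln (1 + u s)"
      using Flim by (intro AE_I2) simp
    show "AE s in count_space J. norm (indicator (F n) s * ln (1 + u s)) \<le> \<bar>ln (1 + u s)\<bar>" for n
      by (intro AE_I2) (auto simp: indicator_def)
  qed auto
  have L2: "(\<lambda>n. LINT s|count_space J. indicator (F n) s * (Vn n s * u s)) \<longlonglongrightarrow> (LINT s|count_space J. V s * u s)"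
  proof (rule integral_dominated_convergence[where w="\<lambda>s. B * \<bar>u s\<bar>"])
    show "integrable (count_space J) (\<lambda>s. B * \<bar>u s\<bar>)" using u by simp
    show "AE s in count_space J. (\<lambda>n. indicator (F n) s * (Vn n s * u s)) \<longlonglongrightarrow> V s * u s"
    proof (rule AE_I2)
      fix s assume "s \<in> space (count_space J)"
      then have "(\<lambda>n. (indicator (F n) s * 1) * (Vn n s * u s)) \<longlonglongrightarrow> 1 * (V s * u s)"
        by (intro tendsto_mult Vlim tendsto_const Flim) simp
      then show "(\<lambda>n. indicator (F n) s * (Vn n s * u s)) \<longlonglongrightarrow> V s * u s" by simp
    qed
    show "AE s in count_space J. norm (indicator (F n) s * (Vn n s * u s)) \<le> B * \<bar>u s\<bar>" for n
    proof (rule AE_I2)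
      fix s assume "s \<in> space (count_space J)"
      then have "0 \<le> s" "s \<le> t" using J(2) by auto
      from VnB[OF this, of n] have "\<bar>Vn n s\<bar> * \<bar>u s\<bar> \<le> B * \<bar>u s\<bar>" by (intro mult_right_mono) auto
      then show "norm (indicator (F n) s * (Vn n s * u s)) \<le> B * \<bar>u s\<bar>"
        by (auto simp: abs_mult indicator_def B_def)
    qed
  qed auto
  have L3: "(\<lambda>n. LINT r:{0<..t}|lborel. Vn n r * c r) \<longlonglongrightarrow> (LINT r:{0<..t}|lborel. V r * c r)"
    unfolding set_lebesgue_integral_def
  proof (rule integral_dominated_convergence[where w="\<lambda>r. indicator {0<..t} r *\<^sub>R (B * K)"])
    show "integrable lborel (\<lambda>r. indicator {0<..t} r *\<^sub>R (B * K))"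
      using bounded_set_integrable_lborel[of "\<lambda>_. B * K" 0 t "\<bar>B * K\<bar>"] by (simp add: set_integrable_def)
    show "AE r in lborel. norm (indicator {0<..t} r *\<^sub>R (Vn n r * c r)) \<le> indicator {0<..t} r *\<^sub>R (B * K)" for n
    proof (rule AE_I2)
      fix r
      show "norm (indicator {0<..t} r *\<^sub>R (Vn n r * c r)) \<le> indicator {0<..t} r *\<^sub>R (B * K)"
        using VnB[of r n] c(2)[of r] K by (auto simp: abs_mult indicator_def intro!: mult_mono)
    qed
  qed (auto intro!: tendsto_intros Vlim AE_I2)
  show "exp ((LINT s|count_space J. ln (1 + u s)) - cum c t) =
      1 + (LINT s|count_space J. V s * u s) - (LINT r:{0<..t}|lborel. V r * c r)"
    by (rule LIMSEQ_unique[OF L1]) (unfold eq, intro tendsto_diff tendsto_add tendsto_const L2 L3)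
qed

section \<open>The exponential martingale\<close>

lemma jump_sum_before:
  assumes "r \<le> t"
  shows "jump_sum \<omega> t (\<lambda>s. f s * indicator {..<r} s) = jump_sum \<omega> r (\<lambda>s. f s * indicator {..<r} s)"
  unfolding jump_sum_def using assms
  by (subst (1 2) nn_integral_count_space_indicator) (auto simp: jumps_def intro!: nn_integral_cong split: split_indicator)

lemma jump_sum_mono_time: "s \<le> t \<Longrightarrow> jump_sum \<omega> s f \<le> jump_sum \<omega> t f"
  unfolding jump_sum_def
  by (subst (1 2) nn_integral_count_space_indicator) (auto simp: jumps_def intro!: nn_integral_mono split: split_indicator)

lemma jump_sum_mono: "(\<And>s. s \<in> jumps \<omega> t \<Longrightarrow> f s \<le> h s) \<Longrightarrow> jump_sum \<omega> t f \<le> jump_sum \<omega> t h"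
  unfolding jump_sum_def by (intro nn_integral_mono) auto

text \<open>Sums over times strictly before \<open>s\<close> ignore the jump inserted at
  \<open>s\<close>; this makes the left versions of the product predictable in the sense of the
  compensation formula.\<close>

lemma jump_sum_shift:
  assumes "\<And>r. r < s \<Longrightarrow> f r = h r"
  shows "jump_sum (shift_path s x \<omega>) s (\<lambda>r. f r * indicator {..<s} r) = jump_sum \<omega> s (\<lambda>r. h r * indicator {..<s} r)"
  unfolding jump_sum_def
  by (subst (1 2) nn_integral_count_space_indicator)
     (auto simp: jumps_def jump_shift_path assms intro!: nn_integral_cong split: split_indicator)

text \<open>\<open>ph s a x\<close> is the factor contributed by a jump of size \<open>x\<close> at time \<open>s\<close> from the level \<open>a\<close>.\<close>

locale exp_field = levy_class_L +
  fixes ph :: "real \<Rightarrow> real \<Rightarrow> real \<Rightarrow> real" and K :: real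
  assumes ph_meas: "(\<lambda>(s, a, x). ph s a x) \<in> borel_measurable (borel \<Otimes>\<^sub>M borel \<Otimes>\<^sub>M borel)"
    and ph_pos: "\<And>s a x. 0 < ph s a x"
    and ph_int: "\<And>s a. integrable lborel (\<lambda>x. gp x * (ph s a x - 1))"
    and ph_le: "\<And>s a. (LINT x|lborel. gp x * \<bar>ph s a x - 1\<bar>) \<le> K"
    and K_pos: "0 < K"
begin

lemma ph_measurable[measurable (raw)]:
  assumes "f \<in> borel_measurable N" "h \<in> borel_measurable N" "k \<in> borel_measurable N"
  shows "(\<lambda>y. ph (f y) (h y) (k y)) \<in> borel_measurable N"
  using measurable_compose[OF measurable_Pair[OF assms(1) measurable_Pair[OF assms(2,3)]] ph_meas] by simp

lemma ph_abs_int: "integrable lborel (\<lambda>x. gp x * \<bar>ph s a x - 1\<bar>)"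
  using integrable_abs[OF ph_int[of s a]] by (simp add: abs_mult gp_nonneg)

lemma part_int:
  "integrable lborel (\<lambda>x. gp x * max 0 (ph s a x - 1))" "integrable lborel (\<lambda>x. gp x * max 0 (1 - ph s a x))"
  by (rule Bochner_Integration.integrable_bound[OF ph_abs_int[of s a]];
      auto simp: abs_mult gp_nonneg intro!: AE_I2 mult_left_mono)+

text \<open>Upward and downward compensator are kept apart because their means must be compared as
  \<open>ennreal\<close> values before any of them is known to be finite.\<close>

definition comp_up :: "real \<Rightarrow> real \<Rightarrow> real" where "comp_up s a = (LINT x|lborel. gp x * max 0 (ph s a x - 1))"
definition comp_down :: "real \<Rightarrow> real \<Rightarrow> real" where "comp_down s a = (LINT x|lborel. gp x * max 0 (1 - ph s a x))"
definition comp_rate :: "real \<Rightarrow> real \<Rightarrow> real" where "comp_rate s a = (LINT x|lborel. gp x * (ph s a x - 1))"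

lemma comp_up_nonneg: "0 \<le> comp_up s a" and comp_down_nonneg: "0 \<le> comp_down s a"
  unfolding comp_up_def comp_down_def by (auto intro!: integral_nonneg_AE AE_I2 mult_nonneg_nonneg gp_nonneg)

lemma comp_rate_eq: "comp_rate s a = comp_up s a - comp_down s a"
  unfolding comp_up_def comp_down_def comp_rate_def
  by (subst Bochner_Integration.integral_diff[symmetric, OF part_int])
     (auto intro!: Bochner_Integration.integral_cong simp: max_def algebra_simps)

lemma comp_up_comp_down_le: "comp_up s a + comp_down s a \<le> K"
proof -
  have "comp_up s a + comp_down s a = (LINT x|lborel. gp x * \<bar>ph s a x - 1\<bar>)"
    unfolding comp_up_def comp_down_def
    by (subst Bochner_Integration.integral_add[symmetric, OF part_int])
       (auto intro!: Bochner_Integration.integral_cong simp: max_def algebra_simps)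
  then show ?thesis using ph_le by simp
qed

lemma comp_rate_le: "\<bar>comp_rate s a\<bar> \<le> K"
  using comp_rate_eq[of s a] comp_up_comp_down_le[of s a] comp_up_nonneg[of s a] comp_down_nonneg[of s a] by linarith

lemma nn_parts:
  "(\<integral>\<^sup>+x. ennreal (gp x) * ennreal (max 0 (ph s a x - 1)) \<partial>lborel) = ennreal (comp_up s a)"
  "(\<integral>\<^sup>+x. ennreal (gp x) * ennreal (max 0 (1 - ph s a x)) \<partial>lborel) = ennreal (comp_down s a)"
  "(\<integral>\<^sup>+x. ennreal (gp x) * ennreal \<bar>ph s a x - 1\<bar> \<partial>lborel) \<le> ennreal K"
proof -
  show "(\<integral>\<^sup>+x. ennreal (gp x) * ennreal (max 0 (ph s a x - 1)) \<partial>lborel) = ennreal (comp_up s a)"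
    unfolding comp_up_def by (subst nn_integral_eq_integral[symmetric, OF part_int(1)])
      (auto intro!: AE_I2 mult_nonneg_nonneg gp_nonneg nn_integral_cong simp: ennreal_mult gp_nonneg)
  show "(\<integral>\<^sup>+x. ennreal (gp x) * ennreal (max 0 (1 - ph s a x)) \<partial>lborel) = ennreal (comp_down s a)"
    unfolding comp_down_def by (subst nn_integral_eq_integral[symmetric, OF part_int(2)])
      (auto intro!: AE_I2 mult_nonneg_nonneg gp_nonneg nn_integral_cong simp: ennreal_mult gp_nonneg)
  have "(\<integral>\<^sup>+x. ennreal (gp x) * ennreal \<bar>ph s a x - 1\<bar> \<partial>lborel) = (\<integral>\<^sup>+x. ennreal (gp x * \<bar>ph s a x - 1\<bar>) \<partial>lborel)"
    by (intro nn_integral_cong) (simp add: ennreal_mult gp_nonneg)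
  also have "\<dots> = ennreal (LINT x|lborel. gp x * \<bar>ph s a x - 1\<bar>)"
    by (rule nn_integral_eq_integral[OF ph_abs_int]) (auto intro!: AE_I2 mult_nonneg_nonneg gp_nonneg)
  also have "\<dots> \<le> ennreal K" by (intro ennreal_leI ph_le)
  finally show "(\<integral>\<^sup>+x. ennreal (gp x) * ennreal \<bar>ph s a x - 1\<bar> \<partial>lborel) \<le> ennreal K" .
qed

lemma comp_up_measurable[measurable (raw)]:
  assumes [measurable]: "f \<in> borel_measurable N" "h \<in> borel_measurable N"
  shows "(\<lambda>y. comp_up (f y) (h y)) \<in> borel_measurable N" "(\<lambda>y. comp_down (f y) (h y)) \<in> borel_measurable N" "(\<lambda>y. comp_rate (f y) (h y)) \<in> borel_measurable N"
  unfolding comp_up_def comp_down_def comp_rate_def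
  by (rule lborel.borel_measurable_lebesgue_integral, simp add: case_prod_beta')+

text \<open>The jump inserted by the Mecke formula is invisible to \<open>W s\<close> and to the
  left limit at \<open>s\<close>, so the integral over sizes can be carried out for a fixed path.
  This is the compensation formula for the point process of jumps.\<close>

lemma compensator:
  assumes T: "0 < T" and W: "(\<lambda>(s, \<omega>). W s \<omega>) \<in> borel_measurable (borel \<Otimes>\<^sub>M canonical_space)"
    and pred: "\<And>s x \<omega>. 0 < s \<Longrightarrow> 0 < x \<Longrightarrow> \<omega> \<in> paths \<Longrightarrow> W s (shift_path s x \<omega>) = W s \<omega>"
    and v: "(\<lambda>(s, a, x). v s a x) \<in> borel_measurable (borel \<Otimes>\<^sub>M borel \<Otimes>\<^sub>M borel)"
  shows "(\<integral>\<^sup>+\<omega>. jump_sum \<omega> T (\<lambda>s. W s \<omega> * ennreal (v s (left_lim \<omega> s) (jump \<omega> s))) \<partial>P) =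
    (\<integral>\<^sup>+s\<in>{0<..T}. (\<integral>\<^sup>+\<omega>. W s \<omega> * (\<integral>\<^sup>+x. ennreal (gp x) * ennreal (v s (left_lim \<omega> s) x) \<partial>lborel) \<partial>P) \<partial>lborel)"
proof -
  have W': "(\<lambda>y. W (f y) (w y)) \<in> borel_measurable N" if "f \<in> borel_measurable N" "w \<in> measurable N canonical_space" for f w and N :: "'z measure"
    using measurable_compose[OF measurable_Pair[OF that] W] by simp
  have v': "(\<lambda>y. v (f y) (h y) (k y)) \<in> borel_measurable N" if "f \<in> borel_measurable N" "h \<in> borel_measurable N" "k \<in> borel_measurable N" for f h k and N :: "'z measure"
    using measurable_compose[OF measurable_Pair[OF that(1) measurable_Pair[OF that(2,3)]] v] by simp
  define F where "F y = W (fst y) (snd (snd y)) * ennreal (v (fst y) (left_lim (snd (snd y)) (fst y)) (fst (snd y)))" for y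
  have "(\<lambda>y. left_lim (snd (snd y)) (fst y)) \<in> borel_measurable mark_space" by measurable
  then have F: "F \<in> borel_measurable mark_space"
    unfolding F_def[abs_def] by (intro borel_measurable_times_ennreal W' measurable_compose[OF v' measurable_ennreal]) measurable
  have "(\<integral>\<^sup>+\<omega>. jump_sum \<omega> T (\<lambda>s. F (s, jump \<omega> s, \<omega>)) \<partial>P) =
    (\<integral>\<^sup>+s\<in>{0<..T}. (\<integral>\<^sup>+x. ennreal (gp x) * (\<integral>\<^sup>+\<omega>. F (s, x, shift_path s x \<omega>) \<partial>P) \<partial>lborel) \<partial>lborel)"
    by (rule mecke_jump_sum[OF T F])
  also have "\<dots> = (\<integral>\<^sup>+s\<in>{0<..T}. (\<integral>\<^sup>+\<omega>. W s \<omega> * (\<integral>\<^sup>+x. ennreal (gp x) * ennreal (v s (left_lim \<omega> s) x) \<partial>lborel) \<partial>P) \<partial>lborel)"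
  proof (rule nn_integral_cong)
    fix s
    interpret pair_sigma_finite lborel P ..
    have lm: "(\<lambda>y. left_lim (snd y) s) \<in> borel_measurable (lborel \<Otimes>\<^sub>M P)"
      using measurable_compose[OF measurable_snd measurable_P[OF left_lim_measurable[OF measurable_const[of s borel] measurable_ident_sets[OF refl]]]] by simp
    have mW: "(\<lambda>\<omega>. W s \<omega>) \<in> borel_measurable P"
      using measurable_P[OF W'[OF measurable_const[of s borel] measurable_ident_sets[OF refl]]] by simp
    have mv: "(\<lambda>y. v s (left_lim (snd y) s) (fst y)) \<in> borel_measurable (lborel \<Otimes>\<^sub>M P)"
      by (rule v'[OF _ lm]) auto
    have mg: "(\<lambda>(x, \<omega>). ennreal (gp x) * (W s \<omega> * ennreal (v s (left_lim \<omega> s) x))) \<in> borel_measurable (lborel \<Otimes>\<^sub>M P)"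
      unfolding case_prod_beta'
      by (intro borel_measurable_times_ennreal measurable_compose[OF measurable_snd mW] measurable_compose[OF mv measurable_ennreal]) measurable
    have "(\<integral>\<^sup>+x. ennreal (gp x) * (\<integral>\<^sup>+\<omega>. F (s, x, shift_path s x \<omega>) \<partial>P) \<partial>lborel) =
       (\<integral>\<^sup>+\<omega>. W s \<omega> * (\<integral>\<^sup>+x. ennreal (gp x) * ennreal (v s (left_lim \<omega> s) x) \<partial>lborel) \<partial>P)" if s: "0 < s"
    proof -
      have "(\<integral>\<^sup>+x. ennreal (gp x) * (\<integral>\<^sup>+\<omega>. F (s, x, shift_path s x \<omega>) \<partial>P) \<partial>lborel)
        = (\<integral>\<^sup>+x. (\<integral>\<^sup>+\<omega>. ennreal (gp x) * (W s \<omega> * ennreal (v s (left_lim \<omega> s) x)) \<partial>P) \<partial>lborel)"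
      proof (rule nn_integral_cong)
        fix x
        show "ennreal (gp x) * (\<integral>\<^sup>+\<omega>. F (s, x, shift_path s x \<omega>) \<partial>P) = (\<integral>\<^sup>+\<omega>. ennreal (gp x) * (W s \<omega> * ennreal (v s (left_lim \<omega> s) x)) \<partial>P)"
        proof (cases "0 < x")
          case True
          have "(\<lambda>\<omega>. W s \<omega> * ennreal (v s (left_lim \<omega> s) x)) \<in> borel_measurable P"
            using measurable_compose[OF measurable_Pair1'[of x lborel P] mv] mW by simp
          moreover have "(\<integral>\<^sup>+\<omega>. F (s, x, shift_path s x \<omega>) \<partial>P) = (\<integral>\<^sup>+\<omega>. W s \<omega> * ennreal (v s (left_lim \<omega> s) x) \<partial>P)"
            using True s by (intro nn_integral_cong) (simp add: F_def pred space_P left_lim_shift_path)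
          ultimately show ?thesis by (simp add: nn_integral_cmult)
        qed (simp add: gp_0)
      qed
      also have "\<dots> = (\<integral>\<^sup>+\<omega>. (\<integral>\<^sup>+x. ennreal (gp x) * (W s \<omega> * ennreal (v s (left_lim \<omega> s) x)) \<partial>lborel) \<partial>P)"
        by (rule Fubini'[OF mg, symmetric])
      also have "\<dots> = (\<integral>\<^sup>+\<omega>. W s \<omega> * (\<integral>\<^sup>+x. ennreal (gp x) * ennreal (v s (left_lim \<omega> s) x) \<partial>lborel) \<partial>P)"
      proof (rule nn_integral_cong)
        fix \<omega> assume "\<omega> \<in> space P"
        have "(\<lambda>x. v s (left_lim \<omega> s) x) \<in> borel_measurable lborel"
          by (rule v') auto
        then show "(\<integral>\<^sup>+x. ennreal (gp x) * (W s \<omega> * ennreal (v s (left_lim \<omega> s) x)) \<partial>lborel) = W s \<omega> * (\<integral>\<^sup>+x. ennreal (gp x) * ennreal (v s (left_lim \<omega> s) x) \<partial>lborel)"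
          by (subst nn_integral_cmult[symmetric]) (auto intro!: nn_integral_cong simp: ac_simps)
      qed
      finally show ?thesis .
    qed
    then show "(\<integral>\<^sup>+x. ennreal (gp x) * (\<integral>\<^sup>+\<omega>. F (s, x, shift_path s x \<omega>) \<partial>P) \<partial>lborel) * indicator {0<..T} s =
       (\<integral>\<^sup>+\<omega>. W s \<omega> * (\<integral>\<^sup>+x. ennreal (gp x) * ennreal (v s (left_lim \<omega> s) x) \<partial>lborel) \<partial>P) * indicator {0<..T} s"
      by (cases "s \<in> {0<..T}") auto
  qed
  finally show ?thesis by (simp add: F_def)
qed

definition rel_jump :: "(real \<Rightarrow> real) \<Rightarrow> real \<Rightarrow> real" where
  "rel_jump \<omega> s = ph s (left_lim \<omega> s) (jump \<omega> s) - 1"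

lemma rel_jump_measurable[measurable (raw)]:
  assumes [measurable]: "f \<in> borel_measurable N" "w \<in> measurable N canonical_space"
  shows "(\<lambda>y. rel_jump (w y) (f y)) \<in> borel_measurable N"
  unfolding rel_jump_def by measurable

lemma rel_jump_gt: "-1 < rel_jump \<omega> s" using ph_pos by (simp add: rel_jump_def)

text \<open>Integer horizons suffice by monotonicity in time, and countably many conditions keep the
  statement almost sure for all times at once.\<close>

definition good :: "(real \<Rightarrow> real) \<Rightarrow> bool" where
  "good \<omega> \<longleftrightarrow> (\<forall>n::nat. jump_sum \<omega> (real (Suc n)) (\<lambda>s. ennreal \<bar>rel_jump \<omega> s\<bar>) < \<infinity>)"

lemma AE_good: "AE \<omega> in P. good \<omega>"
  unfolding good_def
proof (rule AE_all_countable[THEN iffD2], rule allI)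
  fix n :: nat
  let ?T = "real (Suc n)"
  have m: "(\<lambda>\<omega>. jump_sum \<omega> ?T (\<lambda>s. ennreal \<bar>rel_jump \<omega> s\<bar>)) \<in> borel_measurable P"
    by (rule measurable_P, rule jump_sum_measurable[where w="\<lambda>\<omega>. \<omega>"]) (auto simp: case_prod_beta')
  have "(\<integral>\<^sup>+\<omega>. jump_sum \<omega> ?T (\<lambda>s. ennreal \<bar>rel_jump \<omega> s\<bar>) \<partial>P) =
    (\<integral>\<^sup>+s\<in>{0<..?T}. (\<integral>\<^sup>+\<omega>. 1 * (\<integral>\<^sup>+x. ennreal (gp x) * ennreal \<bar>ph s (left_lim \<omega> s) x - 1\<bar> \<partial>lborel) \<partial>P) \<partial>lborel)"
    using compensator[of ?T "\<lambda>_ _. 1" "\<lambda>s a x. \<bar>ph s a x - 1\<bar>"] by (simp add: rel_jump_def case_prod_beta')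
  also have "\<dots> \<le> (\<integral>\<^sup>+s\<in>{0<..?T}. (\<integral>\<^sup>+\<omega>. ennreal K \<partial>P) \<partial>lborel)"
    using nn_parts(3) by (intro nn_integral_mono mult_right_mono) auto
  also have "\<dots> < \<infinity>" by (simp add: emeasure_space_1 nn_integral_cmult_indicator ennreal_mult_less_top)
  finally have "(\<integral>\<^sup>+\<omega>. jump_sum \<omega> ?T (\<lambda>s. ennreal \<bar>rel_jump \<omega> s\<bar>) \<partial>P) \<noteq> \<infinity>" by simp
  from nn_integral_noteq_infinite[OF m this] show "AE \<omega> in P. jump_sum \<omega> ?T (\<lambda>s. ennreal \<bar>rel_jump \<omega> s\<bar>) < \<infinity>"
    by (simp add: top.not_eq_extremum)
qed

lemma good_integrable:
  assumes "good \<omega>" shows "integrable (count_space (jumps \<omega> t)) (rel_jump \<omega>)"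
proof (rule integrableI_bounded)
  obtain n where "t \<le> real n" using real_arch_simple by blast
  then have "jump_sum \<omega> t (\<lambda>s. ennreal \<bar>rel_jump \<omega> s\<bar>) \<le> jump_sum \<omega> (real (Suc n)) (\<lambda>s. ennreal \<bar>rel_jump \<omega> s\<bar>)"
    by (intro jump_sum_mono_time) auto
  also have "\<dots> < \<infinity>" using assms by (simp add: good_def)
  finally show "(\<integral>\<^sup>+s. ennreal (norm (rel_jump \<omega> s)) \<partial>count_space (jumps \<omega> t)) < \<infinity>" by (simp add: jump_sum_def)
qed simp

text \<open>A difference of positive and negative part, measurable on the whole path space; on good
  paths it is the absolutely convergent sum of the logarithms (\<open>log_sum_eq\<close>).\<close>

definition log_sum :: "real \<Rightarrow> (real \<Rightarrow> real) \<Rightarrow> real" where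
  "log_sum t \<omega> = enn2real (jump_sum \<omega> t (\<lambda>r. ennreal (ln (1 + rel_jump \<omega> r)))) - enn2real (jump_sum \<omega> t (\<lambda>r. ennreal (- ln (1 + rel_jump \<omega> r))))"

definition log_sum_left :: "real \<Rightarrow> (real \<Rightarrow> real) \<Rightarrow> real" where
  "log_sum_left t \<omega> = enn2real (jump_sum \<omega> t (\<lambda>r. ennreal (ln (1 + rel_jump \<omega> r)) * indicator {..<t} r)) -
     enn2real (jump_sum \<omega> t (\<lambda>r. ennreal (- ln (1 + rel_jump \<omega> r)) * indicator {..<t} r))"

definition comp_path :: "(real \<Rightarrow> real) \<Rightarrow> real \<Rightarrow> real" where "comp_path \<omega> s = comp_rate s (left_lim \<omega> s)"

definition exp_mart :: "real \<Rightarrow> (real \<Rightarrow> real) \<Rightarrow> real" where "exp_mart t \<omega> = exp (log_sum t \<omega> - cum (comp_path \<omega>) t)"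
definition exp_mart_left :: "real \<Rightarrow> (real \<Rightarrow> real) \<Rightarrow> real" where "exp_mart_left t \<omega> = exp (log_sum_left t \<omega> - cum (comp_path \<omega>) t)"
text \<open>Product of 1 + |u| over the jumps strictly before \<open>t\<close>. Up to the factor
  \<open>exp (K * t)\<close> it dominates \<open>exp_mart_left\<close>; on good paths it is also
  monotone in time and obeys an inequality whose terms are all nonnegative.\<close>

definition majorant :: "real \<Rightarrow> (real \<Rightarrow> real) \<Rightarrow> real" where
  "majorant t \<omega> = exp (enn2real (jump_sum \<omega> t (\<lambda>r. ennreal (ln (1 + \<bar>rel_jump \<omega> r\<bar>)) * indicator {..<t} r)))"

lemma comp_path_le: "\<bar>comp_path \<omega> s\<bar> \<le> K" by (simp add: comp_path_def comp_rate_le)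

lemma comp_path_path_measurable: "\<omega> \<in> paths \<Longrightarrow> comp_path \<omega> \<in> borel_measurable borel"
  unfolding comp_path_def[abs_def] using left_lim_paths_measurable by measurable

lemma log_sum_eq:
  assumes "good \<omega>" shows "log_sum t \<omega> = (LINT s|count_space (jumps \<omega> t). ln (1 + rel_jump \<omega> s))"
  using integrable_ln_one_plus[OF good_integrable[OF assms] rel_jump_gt, of t]
  by (simp add: log_sum_def jump_sum_def real_lebesgue_integral_def)

lemma ln_before_integrable:
  fixes f :: "real \<Rightarrow> real"
  assumes "integrable (count_space J) f" shows "integrable (count_space J) (\<lambda>s. indicator {..<r} s * f s)"
  by (rule Bochner_Integration.integrable_bound[OF assms]) (auto simp: indicator_def)

lemma log_sum_left_eq:
  assumes g: "good \<omega>" and rt: "r \<le> t"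
  shows "log_sum_left r \<omega> = (LINT s|count_space (jumps \<omega> t). indicator {..<r} s * ln (1 + rel_jump \<omega> s))"
proof -
  have i: "integrable (count_space (jumps \<omega> t)) (\<lambda>s. indicator {..<r} s * ln (1 + rel_jump \<omega> s))"
    by (rule ln_before_integrable[OF integrable_ln_one_plus[OF good_integrable[OF g] rel_jump_gt]])
  have "(\<integral>\<^sup>+s. ennreal (indicator {..<r} s * ln (1 + rel_jump \<omega> s)) \<partial>count_space (jumps \<omega> t)) = jump_sum \<omega> t (\<lambda>s. ennreal (ln (1 + rel_jump \<omega> s)) * indicator {..<r} s)"
    "(\<integral>\<^sup>+s. ennreal (- (indicator {..<r} s * ln (1 + rel_jump \<omega> s))) \<partial>count_space (jumps \<omega> t)) = jump_sum \<omega> t (\<lambda>s. ennreal (- ln (1 + rel_jump \<omega> s)) * indicator {..<r} s)"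
    unfolding jump_sum_def by (rule nn_integral_cong, simp add: indicator_def)+
  then show ?thesis using i unfolding log_sum_left_def real_lebesgue_integral_def[OF i]
    by (simp only: jump_sum_before[OF rt])
qed

lemma majorant_eq:
  assumes g: "good \<omega>" and rt: "r \<le> t"
  shows "majorant r \<omega> = exp (LINT s|count_space (jumps \<omega> t). indicator {..<r} s * ln (1 + \<bar>rel_jump \<omega> s\<bar>))"
proof -
  have "(\<integral>\<^sup>+s. ennreal (indicator {..<r} s * ln (1 + \<bar>rel_jump \<omega> s\<bar>)) \<partial>count_space (jumps \<omega> t)) = jump_sum \<omega> t (\<lambda>s. ennreal (ln (1 + \<bar>rel_jump \<omega> s\<bar>)) * indicator {..<r} s)"
    unfolding jump_sum_def by (rule nn_integral_cong) (simp add: indicator_def)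
  moreover have "(LINT s|count_space (jumps \<omega> t). indicator {..<r} s * ln (1 + \<bar>rel_jump \<omega> s\<bar>)) = enn2real (\<integral>\<^sup>+s. ennreal (indicator {..<r} s * ln (1 + \<bar>rel_jump \<omega> s\<bar>)) \<partial>count_space (jumps \<omega> t))"
    by (rule integral_eq_nn_integral) auto
  ultimately show ?thesis unfolding majorant_def by (simp only: jump_sum_before[OF rt])
qed

lemma ln_bar_integrable: "good \<omega> \<Longrightarrow> integrable (count_space (jumps \<omega> t)) (\<lambda>s. ln (1 + \<bar>rel_jump \<omega> s\<bar>))"
  by (rule integrable_ln_one_plus) (auto intro: integrable_abs good_integrable less_le_trans[of _ 0])

lemma majorant_mono:
  assumes g: "good \<omega>" and rs: "r \<le> s" shows "majorant r \<omega> \<le> majorant s \<omega>"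
  unfolding majorant_eq[OF g rs] majorant_eq[OF g order_refl[of s]] exp_le_cancel_iff
  by (intro integral_mono ln_before_integrable ln_bar_integrable g) (use rs in \<open>auto simp: indicator_def\<close>)

lemma exp_mart_left_le_majorant:
  assumes \<omega>: "\<omega> \<in> paths" and g: "good \<omega>" and t: "0 \<le> t"
  shows "exp_mart_left t \<omega> \<le> exp (K * t) * majorant t \<omega>"
proof -
  have "log_sum_left t \<omega> \<le> (LINT s|count_space (jumps \<omega> t). indicator {..<t} s * ln (1 + \<bar>rel_jump \<omega> s\<bar>))"
    unfolding log_sum_left_eq[OF g order_refl]
  proof (intro integral_mono ln_before_integrable ln_bar_integrable g integrable_ln_one_plus good_integrable rel_jump_gt)
    fix s
    have "ln (1 + rel_jump \<omega> s) \<le> ln (1 + \<bar>rel_jump \<omega> s\<bar>)" using rel_jump_gt[of \<omega> s] by (subst ln_le_cancel_iff) linarith+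
    then show "indicator {..<t} s * ln (1 + rel_jump \<omega> s) \<le> indicator {..<t} s * ln (1 + \<bar>rel_jump \<omega> s\<bar>)"
      by (auto simp: indicator_def)
  qed
  moreover have "- cum (comp_path \<omega>) t \<le> K * t"
    using cum_le[OF comp_path_path_measurable[OF \<omega>] comp_path_le t] by linarith
  ultimately show ?thesis unfolding exp_mart_left_def majorant_eq[OF g order_refl] exp_add[symmetric] by simp
qed

text \<open>The product formula for |u| with compensator 0, where the jump at \<open>t\<close>
  itself is set to 0 to stay with the left version.\<close>

lemma majorant_equation:
  assumes \<omega>: "\<omega> \<in> paths" and g: "good \<omega>" and t: "0 \<le> t"
  shows "ennreal (majorant t \<omega>) \<le> 1 + jump_sum \<omega> t (\<lambda>s. ennreal (majorant s \<omega>) * ennreal \<bar>rel_jump \<omega> s\<bar> * indicator {..<t} s)"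
proof -
  define J where "J = jumps \<omega> t"
  define v where "v s = indicator {..<t} s * \<bar>rel_jump \<omega> s\<bar>" for s
  have J: "countable J" "J \<subseteq> {0<..t}" using countable_jumps[OF \<omega>] by (auto simp: J_def jumps_def)
  have vi: "integrable (count_space J) v"
    unfolding v_def J_def by (intro ln_before_integrable integrable_abs good_integrable g)
  have v1: "-1 < v s" for s by (auto simp: v_def indicator_def)
  have lv: "ln (1 + v s) = indicator {..<t} s * ln (1 + \<bar>rel_jump \<omega> s\<bar>)" for s by (auto simp: v_def indicator_def)
  define V where "V r = exp ((LINT s|count_space J. indicator {..<r} s * ln (1 + v s)) - cum (\<lambda>_. 0) r)" for r
  note pf = countable_product_formula[OF J t vi v1 measurable_const[of 0 borel], of 0, folded V_def]
  have c0: "cum (\<lambda>_. 0) r = 0" for r by (simp add: cum_def)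
  have VVb: "V r = majorant r \<omega>" if "r \<le> t" for r
  proof -
    have "indicator {..<r} s * ln (1 + v s) = indicator {..<r} s * ln (1 + \<bar>rel_jump \<omega> s\<bar>)" for s
      using that by (auto simp: lv indicator_def)
    then show ?thesis by (simp only: V_def c0 majorant_eq[OF g that] J_def diff_zero)
  qed
  have "majorant t \<omega> = exp (LINT s|count_space J. ln (1 + v s))"
    unfolding majorant_eq[OF g order_refl] J_def lv ..
  also have "\<dots> = 1 + (LINT s|count_space J. V s * v s)" using pf(1) by (simp add: c0 set_lebesgue_integral_def)
  finally have e: "majorant t \<omega> = 1 + (LINT s|count_space J. V s * v s)" .
  have V0: "0 \<le> V s * v s" for s by (simp add: V_def v_def)
  have "ennreal (LINT s|count_space J. V s * v s) = (\<integral>\<^sup>+s. ennreal (V s * v s) \<partial>count_space J)"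
    using pf(2) V0 by (intro nn_integral_eq_integral[symmetric]) auto
  also have "\<dots> = jump_sum \<omega> t (\<lambda>s. ennreal (majorant s \<omega>) * ennreal \<bar>rel_jump \<omega> s\<bar> * indicator {..<t} s)"
    unfolding jump_sum_def J_def
  proof (rule nn_integral_cong)
    fix s assume "s \<in> space (count_space (jumps \<omega> t))"
    then have "s \<le> t" by (simp add: jumps_def)
    then show "ennreal (V s * v s) = ennreal (majorant s \<omega>) * ennreal \<bar>rel_jump \<omega> s\<bar> * indicator {..<t} s"
      by (auto simp: VVb v_def ennreal_mult indicator_def majorant_def)
  qed
  finally have "ennreal (LINT s|count_space J. V s * v s) = jump_sum \<omega> t (\<lambda>s. ennreal (majorant s \<omega>) * ennreal \<bar>rel_jump \<omega> s\<bar> * indicator {..<t} s)" .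
  moreover have "0 \<le> (LINT s|count_space J. V s * v s)" using V0 by (intro integral_nonneg_AE) auto
  ultimately show ?thesis unfolding e by simp
qed

text \<open>Splitting jumps and compensator into parts of either sign and moving the negative ones
  across turns the product formula into an identity between nonnegative quantities, whose means
  exist in \<open>ennreal\<close>.\<close>

lemma exp_mart_equation:
  assumes \<omega>: "\<omega> \<in> paths" and g: "good \<omega>" and t: "0 \<le> t"
  shows "ennreal (exp_mart t \<omega>) + jump_sum \<omega> t (\<lambda>s. ennreal (exp_mart_left s \<omega>) * ennreal (max 0 (- rel_jump \<omega> s))) +
      (\<integral>\<^sup>+r\<in>{0<..t}. (ennreal (exp_mart_left r \<omega>) * ennreal (comp_up r (left_lim \<omega> r))) \<partial>lborel) =
    1 + jump_sum \<omega> t (\<lambda>s. ennreal (exp_mart_left s \<omega>) * ennreal (max 0 (rel_jump \<omega> s))) +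
      (\<integral>\<^sup>+r\<in>{0<..t}. (ennreal (exp_mart_left r \<omega>) * ennreal (comp_down r (left_lim \<omega> r))) \<partial>lborel)"
proof -
  define J where "J = jumps \<omega> t"
  have J: "countable J" "J \<subseteq> {0<..t}" using countable_jumps[OF \<omega>] by (auto simp: J_def jumps_def)
  have ui: "integrable (count_space J) (rel_jump \<omega>)" unfolding J_def by (rule good_integrable[OF g])
  define V where "V r = exp ((LINT s|count_space J. indicator {..<r} s * ln (1 + rel_jump \<omega> s)) - cum (comp_path \<omega>) r)" for r
  note pf = countable_product_formula[OF J t ui rel_jump_gt comp_path_path_measurable[OF \<omega>] comp_path_le, folded V_def]
  have VVl: "V r = exp_mart_left r \<omega>" if "r \<le> t" for r
    by (simp add: V_def exp_mart_left_def log_sum_left_eq[OF g that] J_def)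
  have V0: "0 < V r" for r by (simp add: V_def)
  note Vm = pf(5)
  define Ap Am Bp Bm where "Ap = (LINT s|count_space J. V s * max 0 (rel_jump \<omega> s))" and "Am = (LINT s|count_space J. V s * max 0 (- rel_jump \<omega> s))"
    and "Bp = (LINT r:{0<..t}|lborel. V r * comp_up r (left_lim \<omega> r))" and "Bm = (LINT r:{0<..t}|lborel. V r * comp_down r (left_lim \<omega> r))"
  have iA: "integrable (count_space J) (\<lambda>s. V s * max 0 (rel_jump \<omega> s))" "integrable (count_space J) (\<lambda>s. V s * max 0 (- rel_jump \<omega> s))"
    by (rule Bochner_Integration.integrable_bound[OF pf(2)]; use V0 in \<open>auto simp: abs_mult less_imp_le intro!: mult_left_mono\<close>)+
  have A: "(LINT s|count_space J. V s * rel_jump \<omega> s) = Ap - Am"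
    unfolding Ap_def Am_def
    by (subst Bochner_Integration.integral_diff[symmetric, OF iA]) (auto intro!: Bochner_Integration.integral_cong simp: max_def algebra_simps)
  note [measurable] = Vm left_lim_paths_measurable[OF \<omega>]
  define MM where "MM = exp ((LINT s|count_space J. \<bar>ln (1 + rel_jump \<omega> s)\<bar>) + K * t)"
  have VM: "V r \<le> MM" if "r \<in> {0<..t}" for r using pf(4)[of r] that by (simp add: MM_def)
  have iB: "set_integrable lborel {0<..t} (\<lambda>r. V r * comp_up r (left_lim \<omega> r))" "set_integrable lborel {0<..t} (\<lambda>r. V r * comp_down r (left_lim \<omega> r))"
  proof -
    have "\<bar>V r * comp_up r (left_lim \<omega> r)\<bar> \<le> MM * K" "\<bar>V r * comp_down r (left_lim \<omega> r)\<bar> \<le> MM * K" if "r \<in> {0<..t}" for r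
      using VM[OF that] V0[of r] comp_up_comp_down_le[of r "left_lim \<omega> r"] comp_up_nonneg[of r "left_lim \<omega> r"] comp_down_nonneg[of r "left_lim \<omega> r"]
      by (auto simp: abs_mult intro!: mult_mono)
    then show "set_integrable lborel {0<..t} (\<lambda>r. V r * comp_up r (left_lim \<omega> r))" "set_integrable lborel {0<..t} (\<lambda>r. V r * comp_down r (left_lim \<omega> r))"
      by (intro bounded_set_integrable_lborel[where B="MM * K"]; simp)+
  qed
  have B: "(LINT r:{0<..t}|lborel. V r * comp_path \<omega> r) = Bp - Bm"
    unfolding Bp_def Bm_def set_integral_diff(2)[OF iB, symmetric] by (simp add: comp_path_def comp_rate_eq right_diff_distrib)
  have nn: "0 \<le> Ap" "0 \<le> Am" "0 \<le> Bp" "0 \<le> Bm"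
    unfolding Ap_def Am_def Bp_def Bm_def set_lebesgue_integral_def using V0
    by (auto intro!: integral_nonneg_AE AE_I2 mult_nonneg_nonneg comp_up_nonneg comp_down_nonneg simp: less_imp_le)
  have "exp_mart t \<omega> = 1 + (Ap - Am) - (Bp - Bm)"
    using pf(1) unfolding A B by (simp add: exp_mart_def log_sum_eq[OF g] J_def)
  then have eq: "exp_mart t \<omega> + Am + Bp = 1 + Ap + Bm" by simp
  have eA: "ennreal Ap = jump_sum \<omega> t (\<lambda>s. ennreal (exp_mart_left s \<omega>) * ennreal (max 0 (rel_jump \<omega> s)))"
    unfolding Ap_def jump_sum_def J_def[symmetric] using V0 J(2) VVl
    by (subst nn_integral_eq_integral[symmetric, OF iA(1)])
       (auto intro!: nn_integral_cong simp: ennreal_mult' less_imp_le subset_eq)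
  have eA': "ennreal Am = jump_sum \<omega> t (\<lambda>s. ennreal (exp_mart_left s \<omega>) * ennreal (max 0 (- rel_jump \<omega> s)))"
    unfolding Am_def jump_sum_def J_def[symmetric] using V0 J(2) VVl
    by (subst nn_integral_eq_integral[symmetric, OF iA(2)])
       (auto intro!: nn_integral_cong simp: ennreal_mult' less_imp_le subset_eq)
  have eB: "ennreal Bp = (\<integral>\<^sup>+r\<in>{0<..t}. (ennreal (exp_mart_left r \<omega>) * ennreal (comp_up r (left_lim \<omega> r))) \<partial>lborel)"
    unfolding Bp_def set_lebesgue_integral_def using V0 VVl comp_up_nonneg
    by (subst nn_integral_eq_integral[symmetric, OF iB(1)[unfolded set_integrable_def]])
       (auto intro!: nn_integral_cong simp: ennreal_mult' less_imp_le split: split_indicator)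
  have eB': "ennreal Bm = (\<integral>\<^sup>+r\<in>{0<..t}. (ennreal (exp_mart_left r \<omega>) * ennreal (comp_down r (left_lim \<omega> r))) \<partial>lborel)"
    unfolding Bm_def set_lebesgue_integral_def using V0 VVl comp_down_nonneg
    by (subst nn_integral_eq_integral[symmetric, OF iB(2)[unfolded set_integrable_def]])
       (auto intro!: nn_integral_cong simp: ennreal_mult' less_imp_le split: split_indicator)
  have "0 \<le> exp_mart t \<omega>" by (simp add: exp_mart_def)
  then have "ennreal (exp_mart t \<omega>) + ennreal Am + ennreal Bp = ennreal (exp_mart t \<omega> + Am + Bp)" using nn by (simp add: ennreal_plus)
  also have "\<dots> = 1 + ennreal Ap + ennreal Bm" unfolding eq using nn by (simp add: ennreal_plus)
  finally show ?thesis unfolding eA eA' eB eB' .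
qed

lemma cum_comp_path_joint: "(\<lambda>(s, \<omega>). cum (comp_path \<omega>) s) \<in> borel_measurable (borel \<Otimes>\<^sub>M canonical_space)"
proof -
  have "cum (comp_path \<omega>) s = (LINT r|lborel. (if 0 < r \<and> r \<le> s then comp_rate r (left_lim \<omega> r) else 0))" for s \<omega>
    unfolding cum_def set_lebesgue_integral_def by (intro Bochner_Integration.integral_cong) (auto simp: comp_path_def)
  moreover have "(\<lambda>y. LINT r|lborel. (if 0 < r \<and> r \<le> fst y then comp_rate r (left_lim (snd y) r) else 0)) \<in> borel_measurable (borel \<Otimes>\<^sub>M canonical_space)"
  proof (rule lborel.borel_measurable_lebesgue_integral)
    show "(\<lambda>(y, r). if 0 < r \<and> r \<le> fst y then comp_rate r (left_lim (snd y) r) else 0) \<in> borel_measurable ((borel \<Otimes>\<^sub>M canonical_space) \<Otimes>\<^sub>M lborel)"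
      unfolding case_prod_beta' by measurable
  qed
  ultimately show ?thesis by (simp add: case_prod_beta')
qed

lemma jump_sum_left_joint:
  assumes "k \<in> borel_measurable borel"
  shows "(\<lambda>(s, \<omega>). jump_sum \<omega> s (\<lambda>r. ennreal (k (rel_jump \<omega> r)) * indicator {..<s} r)) \<in> borel_measurable (borel \<Otimes>\<^sub>M canonical_space)"
proof -
  note [measurable] = assms
  have "(\<lambda>y. jump_sum (snd y) (fst y) (\<lambda>r. ennreal (k (rel_jump (snd y) r)) * (if r < fst y then 1 else 0))) \<in> borel_measurable (borel \<Otimes>\<^sub>M canonical_space)"
    by (rule jump_sum_measurable[where F="\<lambda>y r. ennreal (k (rel_jump (snd y) r)) * (if r < fst y then 1 else 0)"]) (auto simp: case_prod_beta')
  then show ?thesis by (simp add: case_prod_beta' indicator_def of_bool_def)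
qed

lemma majorant_joint: "(\<lambda>(s, \<omega>). majorant s \<omega>) \<in> borel_measurable (borel \<Otimes>\<^sub>M canonical_space)"
  using jump_sum_left_joint[of "\<lambda>u. ln (1 + \<bar>u\<bar>)"] unfolding majorant_def case_prod_beta' by measurable

lemma exp_mart_left_joint: "(\<lambda>(s, \<omega>). exp_mart_left s \<omega>) \<in> borel_measurable (borel \<Otimes>\<^sub>M canonical_space)"
  using jump_sum_left_joint[of "\<lambda>u. ln (1 + u)"] jump_sum_left_joint[of "\<lambda>u. - ln (1 + u)"] cum_comp_path_joint
  unfolding exp_mart_left_def log_sum_left_def case_prod_beta' by measurable

lemma exp_mart_measurable: "exp_mart t \<in> borel_measurable canonical_space"
proof -
  have m: "(\<lambda>\<omega>. jump_sum \<omega> t (\<lambda>r. ennreal (k (rel_jump \<omega> r)))) \<in> borel_measurable canonical_space"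
    if [measurable]: "k \<in> borel_measurable borel" for k :: "real \<Rightarrow> real"
    by (rule jump_sum_measurable[where w="\<lambda>\<omega>. \<omega>"]) (auto simp: case_prod_beta')
  have c: "(\<lambda>\<omega>. cum (comp_path \<omega>) t) \<in> borel_measurable canonical_space"
    using measurable_compose[OF measurable_Pair1'[of t borel canonical_space] cum_comp_path_joint] by simp
  show ?thesis
    using m[of "\<lambda>u. ln (1 + u)"] m[of "\<lambda>u. - ln (1 + u)"] c unfolding exp_mart_def[abs_def] log_sum_def by measurable
qed

lemma rel_jump_shift: "r < s \<Longrightarrow> rel_jump (shift_path s x \<omega>) r = rel_jump \<omega> r"
  by (simp add: rel_jump_def left_lim_shift_path jump_shift_path)

lemma majorant_shift: "majorant s (shift_path s x \<omega>) = majorant s \<omega>"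
  unfolding majorant_def
  by (subst jump_sum_shift[where h="\<lambda>r. ennreal (ln (1 + \<bar>rel_jump \<omega> r\<bar>))"]) (auto simp: rel_jump_shift)

lemma exp_mart_left_shift: "exp_mart_left s (shift_path s x \<omega>) = exp_mart_left s \<omega>"
proof -
  have "cum (comp_path (shift_path s x \<omega>)) s = cum (comp_path \<omega>) s"
    unfolding cum_def by (intro set_lebesgue_integral_cong) (auto simp: comp_path_def left_lim_shift_path)
  moreover have "log_sum_left s (shift_path s x \<omega>) = log_sum_left s \<omega>"
    unfolding log_sum_left_def
    by (subst (1 2) jump_sum_shift) (auto simp: rel_jump_shift)
  ultimately show ?thesis by (simp add: exp_mart_left_def)
qed

lemma nn_integral_exp_Ioc:
  assumes a: "0 < a" and t: "0 \<le> t"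
  shows "(\<integral>\<^sup>+s\<in>{0<..t}. ennreal (a * exp (a * s)) \<partial>lborel) \<le> ennreal (exp (a * t) - 1)"
proof -
  have "(\<integral>\<^sup>+s\<in>{0<..t}. ennreal (a * exp (a * s)) \<partial>lborel) \<le> (\<integral>\<^sup>+s\<in>{0..t}. ennreal (a * exp (a * s)) \<partial>lborel)"
    by (intro nn_integral_mono mult_left_mono) (auto simp: indicator_def)
  also have "\<dots> = ennreal (exp (a * t) - exp (a * 0))"
    by (rule nn_integral_FTC_Icc) (use a t in \<open>auto intro!: derivative_eq_intros\<close>)
  finally show ?thesis by simp
qed

text \<open>Set to 0 above the level \<open>k\<close>, so that the mean is at most \<open>k\<close>
  and the Gronwall argument starts from a finite quantity.\<close>

definition cut_majorant :: "real \<Rightarrow> real \<Rightarrow> (real \<Rightarrow> real) \<Rightarrow> ennreal" where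
  "cut_majorant k s \<omega> = ennreal (majorant s \<omega>) * indicator {..k} (majorant s \<omega>)"

lemma cut_majorant_joint: "(\<lambda>(s, \<omega>). cut_majorant k s \<omega>) \<in> borel_measurable (borel \<Otimes>\<^sub>M canonical_space)"
  using majorant_joint unfolding cut_majorant_def case_prod_beta' by measurable

lemma cut_majorant_le: "0 \<le> k \<Longrightarrow> (\<integral>\<^sup>+\<omega>. cut_majorant k t \<omega> \<partial>P) \<le> ennreal k"
proof -
  assume "0 \<le> k"
  then have "(\<integral>\<^sup>+\<omega>. cut_majorant k t \<omega> \<partial>P) \<le> (\<integral>\<^sup>+\<omega>. ennreal k \<partial>P)"
    by (intro nn_integral_mono) (auto simp: cut_majorant_def indicator_def intro!: ennreal_leI)
  then show ?thesis by (simp add: emeasure_space_1)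
qed

text \<open>Mean of the inequality for the majorant: the compensation formula replaces the sum over
  jumps by an integral over time with rate at most \<open>K\<close>.\<close>

lemma cut_majorant_step:
  assumes k: "0 \<le> k" and t: "0 < t"
  shows "(\<integral>\<^sup>+\<omega>. cut_majorant k t \<omega> \<partial>P) \<le> 1 + (\<integral>\<^sup>+s\<in>{0<..t}. (ennreal K * (\<integral>\<^sup>+\<omega>. cut_majorant k s \<omega> \<partial>P)) \<partial>lborel)"
proof -
  have mj: "(\<lambda>\<omega>. jump_sum \<omega> t (\<lambda>s. cut_majorant k s \<omega> * ennreal \<bar>rel_jump \<omega> s\<bar>)) \<in> borel_measurable P"
  proof (rule measurable_P, rule jump_sum_measurable[where w="\<lambda>\<omega>. \<omega>"])
    have "(\<lambda>y. cut_majorant k (snd y) (fst y)) \<in> borel_measurable (canonical_space \<Otimes>\<^sub>M borel)"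
      using measurable_compose[OF measurable_Pair[OF measurable_snd measurable_fst] cut_majorant_joint] by simp
    then show "(\<lambda>(\<omega>, s). cut_majorant k s \<omega> * ennreal \<bar>rel_jump \<omega> s\<bar>) \<in> borel_measurable (canonical_space \<Otimes>\<^sub>M borel)"
      unfolding case_prod_beta' by measurable
  qed auto
  have "(\<integral>\<^sup>+\<omega>. cut_majorant k t \<omega> \<partial>P) \<le> (\<integral>\<^sup>+\<omega>. 1 + jump_sum \<omega> t (\<lambda>s. cut_majorant k s \<omega> * ennreal \<bar>rel_jump \<omega> s\<bar>) \<partial>P)"
  proof (rule nn_integral_mono_AE)
    show "AE \<omega> in P. cut_majorant k t \<omega> \<le> 1 + jump_sum \<omega> t (\<lambda>s. cut_majorant k s \<omega> * ennreal \<bar>rel_jump \<omega> s\<bar>)"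
      using AE_good AE_space
    proof eventually_elim
      case (elim \<omega>)
      then have \<omega>: "\<omega> \<in> paths" by (simp add: space_P)
      show ?case
      proof (cases "majorant t \<omega> \<le> k")
        case True
        have "cut_majorant k t \<omega> = ennreal (majorant t \<omega>)" using True by (simp add: cut_majorant_def)
        also have "\<dots> \<le> 1 + jump_sum \<omega> t (\<lambda>s. ennreal (majorant s \<omega>) * ennreal \<bar>rel_jump \<omega> s\<bar> * indicator {..<t} s)"
          using t by (intro majorant_equation[OF \<omega> elim(1)]) simp
        also have "\<dots> \<le> 1 + jump_sum \<omega> t (\<lambda>s. cut_majorant k s \<omega> * ennreal \<bar>rel_jump \<omega> s\<bar>)"
        proof (intro add_left_mono jump_sum_mono)
          fix s assume "s \<in> jumps \<omega> t"
          \<comment> \<open>Monotonicity in time is what makes the truncation harmless: below the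
            level at \<open>t\<close> means below it at all earlier times.\<close>
          then have "majorant s \<omega> \<le> k" using majorant_mono[OF elim(1), of s t] True by (simp add: jumps_def)
          then show "ennreal (majorant s \<omega>) * ennreal \<bar>rel_jump \<omega> s\<bar> * indicator {..<t} s \<le> cut_majorant k s \<omega> * ennreal \<bar>rel_jump \<omega> s\<bar>"
            by (auto simp: cut_majorant_def indicator_def)
        qed
        finally show ?thesis .
      qed (simp add: cut_majorant_def)
    qed
  qed
  also have "\<dots> = 1 + (\<integral>\<^sup>+\<omega>. jump_sum \<omega> t (\<lambda>s. cut_majorant k s \<omega> * ennreal \<bar>rel_jump \<omega> s\<bar>) \<partial>P)"
    by (subst nn_integral_add[OF _ mj]) (auto simp: emeasure_space_1)
  also have "(\<integral>\<^sup>+\<omega>. jump_sum \<omega> t (\<lambda>s. cut_majorant k s \<omega> * ennreal \<bar>rel_jump \<omega> s\<bar>) \<partial>P) =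
    (\<integral>\<^sup>+s\<in>{0<..t}. (\<integral>\<^sup>+\<omega>. cut_majorant k s \<omega> * (\<integral>\<^sup>+x. ennreal (gp x) * ennreal \<bar>ph s (left_lim \<omega> s) x - 1\<bar> \<partial>lborel) \<partial>P) \<partial>lborel)"
    unfolding rel_jump_def
    by (rule compensator[OF t cut_majorant_joint, where v="\<lambda>s a x. \<bar>ph s a x - 1\<bar>"]) (auto simp: cut_majorant_def majorant_shift case_prod_beta')
  also have "\<dots> \<le> (\<integral>\<^sup>+s\<in>{0<..t}. (ennreal K * (\<integral>\<^sup>+\<omega>. cut_majorant k s \<omega> \<partial>P)) \<partial>lborel)"
  proof (intro nn_integral_mono mult_right_mono)
    fix s
    have m: "cut_majorant k s \<in> borel_measurable P"
      using measurable_P[OF measurable_compose[OF measurable_Pair1'[of s borel canonical_space] cut_majorant_joint]] by simp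
    have "(\<integral>\<^sup>+\<omega>. cut_majorant k s \<omega> * (\<integral>\<^sup>+x. ennreal (gp x) * ennreal \<bar>ph s (left_lim \<omega> s) x - 1\<bar> \<partial>lborel) \<partial>P) \<le> (\<integral>\<^sup>+\<omega>. ennreal K * cut_majorant k s \<omega> \<partial>P)"
      unfolding mult.commute[of "ennreal K"] by (intro nn_integral_mono mult_left_mono nn_parts(3)) simp
    also have "\<dots> = ennreal K * (\<integral>\<^sup>+\<omega>. cut_majorant k s \<omega> \<partial>P)" by (rule nn_integral_cmult[OF m])
    finally show "(\<integral>\<^sup>+\<omega>. cut_majorant k s \<omega> * (\<integral>\<^sup>+x. ennreal (gp x) * ennreal \<bar>ph s (left_lim \<omega> s) x - 1\<bar> \<partial>lborel) \<partial>P) \<le> ennreal K * (\<integral>\<^sup>+\<omega>. cut_majorant k s \<omega> \<partial>P)" .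
  qed auto
  finally show ?thesis by (simp add: add_left_mono)
qed

text \<open>Gronwall by self-improvement: the supremum of the weighted means is finite because of the
  truncation, and the inequality bounds it by half of itself plus one.\<close>

lemma cut_majorant_bound:
  assumes k: "0 \<le> k" and t: "0 < t"
  shows "(\<integral>\<^sup>+\<omega>. cut_majorant k t \<omega> \<partial>P) \<le> ennreal (2 * exp (2 * K * t))"
proof -
  define f where "f s = enn2real (\<integral>\<^sup>+\<omega>. cut_majorant k s \<omega> \<partial>P)" for s
  have f: "(\<integral>\<^sup>+\<omega>. cut_majorant k s \<omega> \<partial>P) = ennreal (f s)" for s
    unfolding f_def using cut_majorant_le[OF k, of s] by (simp add: le_less_trans[OF _ ennreal_less_top])
  have f0: "0 \<le> f s" for s by (simp add: f_def)
  have fk: "f s \<le> k" for s using cut_majorant_le[OF k, of s] k unfolding f by simp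
  \<comment> \<open>The exponent uses twice the rate \<open>K\<close> of the inequality, because
    integrating \<open>K * exp (2 * K * r)\<close> gives at most half of the exponential.\<close>
  define M where "M = (SUP s\<in>{0<..}. f s * exp (- (2 * K * s)))"
  have bdd: "bdd_above ((\<lambda>s. f s * exp (- (2 * K * s))) ` {0<..})"
  proof (rule bdd_aboveI2)
    fix s :: real assume "s \<in> {0<..}"
    then have "exp (- (2 * K * s)) \<le> 1" using K_pos by simp
    then have "f s * exp (- (2 * K * s)) \<le> k * 1" using fk[of s] f0[of s] k by (intro mult_mono) auto
    then show "f s * exp (- (2 * K * s)) \<le> k" by simp
  qed
  have fM: "f s \<le> M * exp (2 * K * s)" if "0 < s" for s
  proof -
    have "f s * exp (- (2 * K * s)) \<le> M" unfolding M_def using that by (intro cSUP_upper bdd) simp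
    then show ?thesis by (simp add: exp_minus field_simps)
  qed
  have M0: "0 \<le> M"
  proof -
    have "0 \<le> M * exp (2 * K * 1)" using fM[of 1] f0[of 1] by linarith
    then show ?thesis by (simp add: zero_le_mult_iff)
  qed
  have "f s * exp (- (2 * K * s)) \<le> 1 + M / 2" if s: "0 < s" for s
  proof -
    have "ennreal (f s) \<le> 1 + (\<integral>\<^sup>+r\<in>{0<..s}. (ennreal K * ennreal (f r)) \<partial>lborel)"
      using cut_majorant_step[OF k s] unfolding f .
    also have "\<dots> \<le> 1 + (\<integral>\<^sup>+r. ennreal (M / 2) * (ennreal (2 * K * exp (2 * K * r)) * indicator {0<..s} r) \<partial>lborel)"
    proof (intro add_left_mono nn_integral_mono)
      fix r
      show "ennreal K * ennreal (f r) * indicator {0<..s} r \<le> ennreal (M / 2) * (ennreal (2 * K * exp (2 * K * r)) * indicator {0<..s} r)"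
      proof (cases "r \<in> {0<..s}")
        case True
        have "K * f r \<le> K * (M * exp (2 * K * r))" using fM[of r] True K_pos by (intro mult_left_mono) auto
        then show ?thesis using True K_pos M0 f0[of r] by (simp add: ennreal_mult[symmetric] ennreal_leI algebra_simps)
      qed simp
    qed
    also have "\<dots> = 1 + ennreal (M / 2) * (\<integral>\<^sup>+r\<in>{0<..s}. ennreal (2 * K * exp (2 * K * r)) \<partial>lborel)"
      by (subst nn_integral_cmult) auto
    also have "\<dots> \<le> 1 + ennreal (M / 2) * ennreal (exp (2 * K * s) - 1)"
      using K_pos s by (intro add_left_mono mult_left_mono nn_integral_exp_Ioc) auto
    also have "\<dots> = ennreal (1 + M / 2 * (exp (2 * K * s) - 1))"
      using M0 K_pos s by (simp add: ennreal_mult'[symmetric] ennreal_plus[symmetric] del: ennreal_plus ennreal_1) (simp add: ennreal_1[symmetric] del: ennreal_1)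
    finally have "f s \<le> 1 + M / 2 * (exp (2 * K * s) - 1)"
      using M0 K_pos s by (subst (asm) ennreal_le_iff) auto
    also have "\<dots> \<le> (1 + M / 2) * exp (2 * K * s)"
    proof -
      have "1 \<le> exp (2 * K * s)" using K_pos s by simp
      then have "1 + M / 2 * (exp (2 * K * s) - 1) \<le> exp (2 * K * s) + M / 2 * exp (2 * K * s)"
        using M0 by (intro add_mono mult_left_mono) auto
      then show ?thesis by (simp add: algebra_simps)
    qed
    finally show ?thesis by (simp add: exp_minus field_simps)
  qed
  then have "M \<le> 1 + M / 2" unfolding M_def by (intro cSUP_least) auto
  then have "M \<le> 2" by simp
  then have "f t \<le> 2 * exp (2 * K * t)" using fM[OF t] by (meson exp_ge_zero mult_right_mono order_trans)
  then show ?thesis unfolding f by (rule ennreal_leI)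
qed

lemma majorant_mean:
  assumes t: "0 < t" shows "(\<integral>\<^sup>+\<omega>. ennreal (majorant t \<omega>) \<partial>P) \<le> ennreal (2 * exp (2 * K * t))"
proof -
  have "(\<integral>\<^sup>+\<omega>. ennreal (majorant t \<omega>) \<partial>P) = (\<integral>\<^sup>+\<omega>. (SUP k. cut_majorant (real k) t \<omega>) \<partial>P)"
  proof (rule nn_integral_cong, rule antisym)
    fix \<omega>
    obtain k where "majorant t \<omega> \<le> real k" using real_arch_simple by blast
    then show "ennreal (majorant t \<omega>) \<le> (SUP k. cut_majorant (real k) t \<omega>)" by (intro SUP_upper2[of k]) (auto simp: cut_majorant_def)
    show "(SUP k. cut_majorant (real k) t \<omega>) \<le> ennreal (majorant t \<omega>)" by (intro SUP_least) (auto simp: cut_majorant_def indicator_def)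
  qed
  also have "\<dots> = (SUP k. \<integral>\<^sup>+\<omega>. cut_majorant (real k) t \<omega> \<partial>P)"
  proof (rule nn_integral_monotone_convergence_SUP)
    show "incseq (\<lambda>k. cut_majorant (real k) t)"
      by (auto simp: incseq_def le_fun_def cut_majorant_def indicator_def intro: order_trans)
    show "cut_majorant (real k) t \<in> borel_measurable P" for k
      using measurable_P[OF measurable_compose[OF measurable_Pair1'[of t borel canonical_space] cut_majorant_joint]] by simp
  qed
  also have "\<dots> \<le> ennreal (2 * exp (2 * K * t))" by (intro SUP_least cut_majorant_bound t) simp
  finally show ?thesis .
qed

text \<open>The rate \<open>3 * K\<close> is \<open>2 * K\<close> from the majorant plus
  \<open>K\<close> from the compensator.\<close>

lemma exp_mart_left_mean:
  assumes t: "0 < t" shows "(\<integral>\<^sup>+\<omega>. ennreal (exp_mart_left t \<omega>) \<partial>P) \<le> ennreal (2 * exp (3 * K * t))"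
proof -
  have m: "majorant t \<in> borel_measurable P"
    using measurable_P[OF measurable_compose[OF measurable_Pair1'[of t borel canonical_space] majorant_joint]] by simp
  have "(\<integral>\<^sup>+\<omega>. ennreal (exp_mart_left t \<omega>) \<partial>P) \<le> (\<integral>\<^sup>+\<omega>. ennreal (exp (K * t)) * ennreal (majorant t \<omega>) \<partial>P)"
  proof (rule nn_integral_mono_AE)
    show "AE \<omega> in P. ennreal (exp_mart_left t \<omega>) \<le> ennreal (exp (K * t)) * ennreal (majorant t \<omega>)"
      using AE_good AE_space
    proof eventually_elim
      case (elim \<omega>)
      then show ?case using exp_mart_left_le_majorant[of \<omega> t] t by (simp add: space_P ennreal_mult'[symmetric] ennreal_leI)
    qed
  qed
  also have "\<dots> = ennreal (exp (K * t)) * (\<integral>\<^sup>+\<omega>. ennreal (majorant t \<omega>) \<partial>P)"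
    using m by (intro nn_integral_cmult) measurable
  also have "\<dots> \<le> ennreal (exp (K * t)) * ennreal (2 * exp (2 * K * t))"
    by (intro mult_left_mono majorant_mean t) simp
  also have "\<dots> = ennreal (2 * exp (3 * K * t))"
    by (simp add: ennreal_mult'[symmetric] exp_add[symmetric] algebra_simps)
  finally show ?thesis .
qed

text \<open>Taking means in \<open>exp_mart_equation\<close>, the compensation formula turns the
  upward jump sum into the same number \<open>A\<close> as the upward compensator integral, and the
  downward ones into \<open>B\<close>. Both numbers appear on either side and are finite by the
  bound on \<open>exp_mart_left\<close>, so they cancel and leave 1.\<close>

lemma mean_exp_mart_pos:
  assumes t: "0 < t" shows "(\<integral>\<^sup>+\<omega>. ennreal (exp_mart t \<omega>) \<partial>P) = 1"
proof -
  have Vlm: "(\<lambda>y. exp_mart_left (f y) (w y)) \<in> borel_measurable N" if "f \<in> borel_measurable N" "w \<in> measurable N canonical_space" for f w and N :: "'z measure"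
    using measurable_compose[OF measurable_Pair[OF that] exp_mart_left_joint] by simp
  have Vlm2: "(\<lambda>y. exp_mart_left (f y) (w y)) \<in> borel_measurable N" if "f \<in> borel_measurable N" "w \<in> measurable N canonical_space" for f w and N :: "'y measure"
    using measurable_compose[OF measurable_Pair[OF that] exp_mart_left_joint] by simp
  interpret pair_sigma_finite lborel P ..
  have sndP: "snd \<in> measurable (lborel \<Otimes>\<^sub>M P) canonical_space"
    using measurable_cong_sets[OF refl sets_P] measurable_snd[of lborel P] by blast
  \<comment> \<open>Stated for a general part \<open>v\<close> with rate \<open>cv\<close>, to be
    used for the upward and the downward part alike.\<close>
  have main: "(\<integral>\<^sup>+\<omega>. jump_sum \<omega> t (\<lambda>s. ennreal (exp_mart_left s \<omega>) * ennreal (v s (left_lim \<omega> s) (jump \<omega> s))) \<partial>P) =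
       (\<integral>\<^sup>+\<omega>. (\<integral>\<^sup>+s\<in>{0<..t}. (ennreal (exp_mart_left s \<omega>) * ennreal (cv s (left_lim \<omega> s))) \<partial>lborel) \<partial>P)"
    and fin: "(\<integral>\<^sup>+\<omega>. (\<integral>\<^sup>+s\<in>{0<..t}. (ennreal (exp_mart_left s \<omega>) * ennreal (cv s (left_lim \<omega> s))) \<partial>lborel) \<partial>P) < \<infinity>"
    and mJ: "(\<lambda>\<omega>. jump_sum \<omega> t (\<lambda>s. ennreal (exp_mart_left s \<omega>) * ennreal (v s (left_lim \<omega> s) (jump \<omega> s)))) \<in> borel_measurable P"
    and mI: "(\<lambda>\<omega>. \<integral>\<^sup>+s\<in>{0<..t}. (ennreal (exp_mart_left s \<omega>) * ennreal (cv s (left_lim \<omega> s))) \<partial>lborel) \<in> borel_measurable P"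
    if v: "(\<lambda>(s, a, x). v s a x) \<in> borel_measurable (borel \<Otimes>\<^sub>M borel \<Otimes>\<^sub>M borel)"
      and cv: "\<And>s a. (\<integral>\<^sup>+x. ennreal (gp x) * ennreal (v s a x) \<partial>lborel) = ennreal (cv s a)" "\<And>s a. 0 \<le> cv s a" "\<And>s a. cv s a \<le> K"
      and cvm: "(\<lambda>y. cv (fst y) (snd y)) \<in> borel_measurable (borel \<Otimes>\<^sub>M borel)" for v cv :: "real \<Rightarrow> real \<Rightarrow> _"
  proof -
    have lP: "(\<lambda>y. left_lim (snd y) (fst y)) \<in> borel_measurable (lborel \<Otimes>\<^sub>M P)"
      by (rule left_lim_measurable[OF _ sndP]) simp
    have VlP: "(\<lambda>y. exp_mart_left (fst y) (snd y)) \<in> borel_measurable (lborel \<Otimes>\<^sub>M P)"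
      by (rule Vlm[OF _ sndP]) simp
    have cP: "(\<lambda>y. cv (fst y) (left_lim (snd y) (fst y))) \<in> borel_measurable (lborel \<Otimes>\<^sub>M P)"
      using measurable_compose[OF measurable_Pair[OF _ lP] cvm, of fst] by simp
    have mf: "(\<lambda>(s, \<omega>). ennreal (exp_mart_left s \<omega>) * ennreal (cv s (left_lim \<omega> s)) * indicator {0<..t} s) \<in> borel_measurable (lborel \<Otimes>\<^sub>M P)"
      unfolding case_prod_beta' using VlP cP by measurable
    have "(\<integral>\<^sup>+\<omega>. jump_sum \<omega> t (\<lambda>s. ennreal (exp_mart_left s \<omega>) * ennreal (v s (left_lim \<omega> s) (jump \<omega> s))) \<partial>P) =
      (\<integral>\<^sup>+s\<in>{0<..t}. (\<integral>\<^sup>+\<omega>. ennreal (exp_mart_left s \<omega>) * (\<integral>\<^sup>+x. ennreal (gp x) * ennreal (v s (left_lim \<omega> s) x) \<partial>lborel) \<partial>P) \<partial>lborel)"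
      by (rule compensator[OF t _ _ v]) (use exp_mart_left_joint in \<open>auto simp: exp_mart_left_shift case_prod_beta'\<close>)
    also have "\<dots> = (\<integral>\<^sup>+s. (\<integral>\<^sup>+\<omega>. ennreal (exp_mart_left s \<omega>) * ennreal (cv s (left_lim \<omega> s)) * indicator {0<..t} s \<partial>P) \<partial>lborel)"
      unfolding cv(1) by (intro nn_integral_cong) (auto split: split_indicator)
    also have sw: "\<dots> = (\<integral>\<^sup>+\<omega>. (\<integral>\<^sup>+s\<in>{0<..t}. (ennreal (exp_mart_left s \<omega>) * ennreal (cv s (left_lim \<omega> s))) \<partial>lborel) \<partial>P)"
      by (rule Fubini'[OF mf, symmetric])
    finally show "(\<integral>\<^sup>+\<omega>. jump_sum \<omega> t (\<lambda>s. ennreal (exp_mart_left s \<omega>) * ennreal (v s (left_lim \<omega> s) (jump \<omega> s))) \<partial>P) =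
       (\<integral>\<^sup>+\<omega>. (\<integral>\<^sup>+s\<in>{0<..t}. (ennreal (exp_mart_left s \<omega>) * ennreal (cv s (left_lim \<omega> s))) \<partial>lborel) \<partial>P)" .
    have "(\<integral>\<^sup>+\<omega>. (\<integral>\<^sup>+s\<in>{0<..t}. (ennreal (exp_mart_left s \<omega>) * ennreal (cv s (left_lim \<omega> s))) \<partial>lborel) \<partial>P) =
      (\<integral>\<^sup>+s. (\<integral>\<^sup>+\<omega>. ennreal (exp_mart_left s \<omega>) * ennreal (cv s (left_lim \<omega> s)) * indicator {0<..t} s \<partial>P) \<partial>lborel)" by (rule sw[symmetric])
    also have "\<dots> \<le> (\<integral>\<^sup>+s. ennreal (K * (2 * exp (3 * K * t))) * indicator {0<..t} s \<partial>lborel)"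
    proof (rule nn_integral_mono)
      fix s
      show "(\<integral>\<^sup>+\<omega>. ennreal (exp_mart_left s \<omega>) * ennreal (cv s (left_lim \<omega> s)) * indicator {0<..t} s \<partial>P) \<le> ennreal (K * (2 * exp (3 * K * t))) * indicator {0<..t} s"
      proof (cases "s \<in> {0<..t}")
        case True
        have m: "exp_mart_left s \<in> borel_measurable P"
          using measurable_P[OF measurable_compose[OF measurable_Pair1'[of s borel canonical_space] exp_mart_left_joint]] by simp
        have "(\<integral>\<^sup>+\<omega>. ennreal (exp_mart_left s \<omega>) * ennreal (cv s (left_lim \<omega> s)) * indicator {0<..t} s \<partial>P) \<le> (\<integral>\<^sup>+\<omega>. ennreal K * ennreal (exp_mart_left s \<omega>) \<partial>P)"
          unfolding mult.commute[of "ennreal K"] using True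
          by (intro nn_integral_mono) (simp, intro mult_left_mono ennreal_leI cv(3), simp)
        also have "\<dots> = ennreal K * (\<integral>\<^sup>+\<omega>. ennreal (exp_mart_left s \<omega>) \<partial>P)" using m by (intro nn_integral_cmult) measurable
        also have "\<dots> \<le> ennreal K * ennreal (2 * exp (3 * K * s))" using True by (intro mult_left_mono exp_mart_left_mean) auto
        also have "\<dots> \<le> ennreal K * ennreal (2 * exp (3 * K * t))"
          using True K_pos by (intro mult_left_mono ennreal_leI) auto
        finally show ?thesis using True K_pos by (simp add: ennreal_mult')
      qed simp
    qed
    also have "\<dots> < \<infinity>" using t by (simp add: nn_integral_cmult_indicator ennreal_mult_less_top)
    finally show "(\<integral>\<^sup>+\<omega>. (\<integral>\<^sup>+s\<in>{0<..t}. (ennreal (exp_mart_left s \<omega>) * ennreal (cv s (left_lim \<omega> s))) \<partial>lborel) \<partial>P) < \<infinity>" .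
    show "(\<lambda>\<omega>. jump_sum \<omega> t (\<lambda>s. ennreal (exp_mart_left s \<omega>) * ennreal (v s (left_lim \<omega> s) (jump \<omega> s)))) \<in> borel_measurable P"
    proof (rule measurable_P, rule jump_sum_measurable[where w="\<lambda>\<omega>. \<omega>"])
      have l: "(\<lambda>y. left_lim (fst y) (snd y)) \<in> borel_measurable (canonical_space \<Otimes>\<^sub>M borel)"
        "(\<lambda>y. jump (fst y) (snd y)) \<in> borel_measurable (canonical_space \<Otimes>\<^sub>M borel)" by measurable
      have "(\<lambda>y. v (snd y) (left_lim (fst y) (snd y)) (jump (fst y) (snd y))) \<in> borel_measurable (canonical_space \<Otimes>\<^sub>M borel)"
        using measurable_compose[OF measurable_Pair[OF measurable_snd measurable_Pair[OF l]] v] by simp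
      moreover have "(\<lambda>y. exp_mart_left (snd y) (fst y)) \<in> borel_measurable (canonical_space \<Otimes>\<^sub>M borel)"
        by (rule Vlm2) auto
      ultimately show "(\<lambda>(\<omega>, s). ennreal (exp_mart_left s \<omega>) * ennreal (v s (left_lim \<omega> s) (jump \<omega> s))) \<in> borel_measurable (canonical_space \<Otimes>\<^sub>M borel)"
        unfolding case_prod_beta' by measurable
    qed auto
    have "(\<lambda>(\<omega>, s). ennreal (exp_mart_left s \<omega>) * ennreal (cv s (left_lim \<omega> s)) * indicator {0<..t} s) \<in> borel_measurable (P \<Otimes>\<^sub>M lborel)"
      using measurable_compose[OF measurable_Pair[OF measurable_snd measurable_fst] mf] by (simp add: case_prod_beta')
    then show "(\<lambda>\<omega>. \<integral>\<^sup>+s\<in>{0<..t}. (ennreal (exp_mart_left s \<omega>) * ennreal (cv s (left_lim \<omega> s))) \<partial>lborel) \<in> borel_measurable P"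
      by (rule lborel.borel_measurable_nn_integral)
  qed
  have v1: "(\<lambda>(s, a, x). max 0 (ph s a x - 1)) \<in> borel_measurable (borel \<Otimes>\<^sub>M borel \<Otimes>\<^sub>M borel)"
    and v2: "(\<lambda>(s, a, x). max 0 (1 - ph s a x)) \<in> borel_measurable (borel \<Otimes>\<^sub>M borel \<Otimes>\<^sub>M borel)"
    unfolding case_prod_beta' by measurable
  have K1: "comp_up s a \<le> K" "comp_down s a \<le> K" for s a using comp_up_comp_down_le[of s a] comp_up_nonneg[of s a] comp_down_nonneg[of s a] by auto
  have c1: "(\<lambda>y. comp_up (fst y) (snd y)) \<in> borel_measurable (borel \<Otimes>\<^sub>M borel)" "(\<lambda>y. comp_down (fst y) (snd y)) \<in> borel_measurable (borel \<Otimes>\<^sub>M borel)"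
    by measurable
  note p = main[OF v1 nn_parts(1) comp_up_nonneg K1(1) c1(1)] fin[OF v1 nn_parts(1) comp_up_nonneg K1(1) c1(1)] mJ[OF v1 nn_parts(1) comp_up_nonneg K1(1) c1(1)] mI[OF v1 nn_parts(1) comp_up_nonneg K1(1) c1(1)]
  note n = main[OF v2 nn_parts(2) comp_down_nonneg K1(2) c1(2)] fin[OF v2 nn_parts(2) comp_down_nonneg K1(2) c1(2)] mJ[OF v2 nn_parts(2) comp_down_nonneg K1(2) c1(2)] mI[OF v2 nn_parts(2) comp_down_nonneg K1(2) c1(2)]
  define A where "A = (\<integral>\<^sup>+\<omega>. (\<integral>\<^sup>+s\<in>{0<..t}. (ennreal (exp_mart_left s \<omega>) * ennreal (comp_up s (left_lim \<omega> s))) \<partial>lborel) \<partial>P)"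
  define B where "B = (\<integral>\<^sup>+\<omega>. (\<integral>\<^sup>+s\<in>{0<..t}. (ennreal (exp_mart_left s \<omega>) * ennreal (comp_down s (left_lim \<omega> s))) \<partial>lborel) \<partial>P)"
  have Vm: "(\<lambda>\<omega>. ennreal (exp_mart t \<omega>)) \<in> borel_measurable P" using measurable_P[OF exp_mart_measurable] by measurable
  have e: "max 0 (- rel_jump \<omega> s) = max 0 (1 - ph s (left_lim \<omega> s) (jump \<omega> s))" for \<omega> s by (simp add: rel_jump_def)
  have "(\<integral>\<^sup>+\<omega>. ennreal (exp_mart t \<omega>) \<partial>P) + B + A =
    (\<integral>\<^sup>+\<omega>. ennreal (exp_mart t \<omega>) + jump_sum \<omega> t (\<lambda>s. ennreal (exp_mart_left s \<omega>) * ennreal (max 0 (- rel_jump \<omega> s))) +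
      (\<integral>\<^sup>+r\<in>{0<..t}. (ennreal (exp_mart_left r \<omega>) * ennreal (comp_up r (left_lim \<omega> r))) \<partial>lborel) \<partial>P)"
    unfolding e A_def B_def n(1)[symmetric]
    using Vm n(3) p(4) by (subst nn_integral_add, measurable)+
  also have "\<dots> = (\<integral>\<^sup>+\<omega>. 1 + jump_sum \<omega> t (\<lambda>s. ennreal (exp_mart_left s \<omega>) * ennreal (max 0 (rel_jump \<omega> s))) +
      (\<integral>\<^sup>+r\<in>{0<..t}. (ennreal (exp_mart_left r \<omega>) * ennreal (comp_down r (left_lim \<omega> r))) \<partial>lborel) \<partial>P)"
  proof (rule nn_integral_cong_AE)
    show "AE \<omega> in P. ennreal (exp_mart t \<omega>) + jump_sum \<omega> t (\<lambda>s. ennreal (exp_mart_left s \<omega>) * ennreal (max 0 (- rel_jump \<omega> s))) +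
        (\<integral>\<^sup>+r\<in>{0<..t}. (ennreal (exp_mart_left r \<omega>) * ennreal (comp_up r (left_lim \<omega> r))) \<partial>lborel) =
      1 + jump_sum \<omega> t (\<lambda>s. ennreal (exp_mart_left s \<omega>) * ennreal (max 0 (rel_jump \<omega> s))) +
        (\<integral>\<^sup>+r\<in>{0<..t}. (ennreal (exp_mart_left r \<omega>) * ennreal (comp_down r (left_lim \<omega> r))) \<partial>lborel)"
      using AE_good AE_space
    proof eventually_elim
      case (elim \<omega>)
      then show ?case using t by (intro exp_mart_equation) (auto simp: space_P)
    qed
  qed
  also have "\<dots> = 1 + A + B"
    unfolding rel_jump_def A_def B_def p(1)[symmetric]
    using p(3) n(4) by (subst nn_integral_add, measurable)+ (simp add: emeasure_space_1)
  finally have eq: "(\<integral>\<^sup>+\<omega>. ennreal (exp_mart t \<omega>) \<partial>P) + (A + B) = 1 + (A + B)" by (simp add: ac_simps)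
  have "A + B \<noteq> \<top>" using p(2) n(2) by (simp add: A_def B_def top.not_eq_extremum)
  moreover have "(A + B) + (\<integral>\<^sup>+\<omega>. ennreal (exp_mart t \<omega>) \<partial>P) = (A + B) + 1" using eq by (simp add: add.commute)
  ultimately show ?thesis by (simp add: ennreal_add_left_cancel)
qed

theorem mean_exp_mart:
  assumes "0 \<le> t" shows "(\<integral>\<^sup>+\<omega>. ennreal (exp_mart t \<omega>) \<partial>P) = 1"
proof (cases "t = 0")
  case True
  have "exp_mart 0 \<omega> = 1" for \<omega> by (simp add: exp_mart_def log_sum_def jump_sum_def jumps_def nn_integral_count_space_finite)
  then show ?thesis using True by (simp add: emeasure_space_1)
qed (use assms mean_exp_mart_pos in simp)

end

section \<open>The Frullani integral and the scaling of the Levy density\<close>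

lemma inverse_integral_Ioc:
  fixes a b :: real
  assumes a: "0 < a" and ab: "a \<le> b"
  shows "integrable lborel (\<lambda>x. indicator {a<..b} x / x)" "(LINT x|lborel. indicator {a<..b} x / x) = ln b - ln a"
proof -
  have h: "has_bochner_integral lborel (\<lambda>x. (1 / x) * indicator {a..b} x) (ln b - ln a)"
    by (rule has_bochner_integral_FTC_Icc_real[OF ab])
       (use a in \<open>auto intro!: derivative_eq_intros continuous_intros simp: divide_inverse\<close>)
  have ae: "AE x in lborel. (1 / x) * indicator {a..b} x = indicator {a<..b} x / x"
    using AE_lborel_singleton[of a] by eventually_elim (auto simp: indicator_def)
  have "has_bochner_integral lborel (\<lambda>x. indicator {a<..b} x / x) (ln b - ln a)"
    using h by (subst has_bochner_integral_cong_AE[OF _ _ ae, symmetric]) auto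
  then show "integrable lborel (\<lambda>x. indicator {a<..b} x / x)" "(LINT x|lborel. indicator {a<..b} x / x) = ln b - ln a"
    by (auto simp: has_bochner_integral_iff)
qed

text \<open>The two truncated functions 1/x both diverge at 0 but coincide there: their difference
  is 1/x, with a fixed sign, between 1 and 1/h. This is the Frullani integral with cut-off
  indicators in place of smooth functions.\<close>

lemma inverse_window:
  fixes h :: real
  assumes h: "0 < h"
  defines "r \<equiv> \<lambda>x. indicator {0<..1} (h * x) / x - indicator {0<..1} x / x"
  shows "integrable lborel r" "(LINT x|lborel. r x) = - ln h" "(LINT x|lborel. \<bar>r x\<bar>) = \<bar>ln h\<bar>"
proof -
  have "integrable lborel r \<and> (LINT x|lborel. r x) = - ln h \<and> (LINT x|lborel. \<bar>r x\<bar>) = \<bar>ln h\<bar>"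
  proof (cases "h \<le> 1")
    case True
    then have r: "r = (\<lambda>x. indicator {1<..1/h} x / x)"
      using h by (auto simp: r_def fun_eq_iff indicator_def field_simps zero_less_mult_iff) (use mult_mono[of _ 1 h 1] in fastforce)+
    have "\<bar>r x\<bar> = r x" for x unfolding r by (auto simp: indicator_def)
    moreover have "ln h \<le> 0" using True h by simp
    moreover have "integrable lborel r" "(LINT x|lborel. r x) = - ln h"
      using inverse_integral_Ioc[of 1 "1/h"] True h by (simp_all add: r ln_div)
    ultimately show ?thesis by simp
  next
    case False
    then have h1: "1 \<le> h" by simp
    have r: "r = (\<lambda>x. - (indicator {1/h<..1} x / x))"
    proof
      fix x
      show "r x = - (indicator {1/h<..1} x / x)"
      proof (cases "0 < x")
        case True
        then have "x \<le> h * x" using h1 by (simp add: mult_le_cancel_right1)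
        then have "x \<le> 1 \<or> 1 < h * x" by linarith
        moreover have "1 / h < x \<longleftrightarrow> 1 < h * x" using h by (simp add: field_simps)
        ultimately show ?thesis using True h by (auto simp: r_def indicator_def)
      next
        case False
        moreover have "\<not> 1 / h < x" using False h less_trans[of 0 "1/h" x] by auto
        moreover have "\<not> 0 < h * x" using False h by (simp add: zero_less_mult_iff)
        ultimately show ?thesis by (simp add: r_def)
      qed
    qed
    have "\<bar>r x\<bar> = - r x" for x unfolding r using h less_trans[of 0 "1/h" x] by (auto simp: indicator_def)
    moreover have "0 \<le> ln h" using False by simp
    moreover have "integrable lborel r" "(LINT x|lborel. r x) = - ln h"
      using inverse_integral_Ioc[of "1/h" 1] False h by (simp_all add: r ln_div)
    ultimately show ?thesis by simp
  qed
  then show "integrable lborel r" "(LINT x|lborel. r x) = - ln h" "(LINT x|lborel. \<bar>r x\<bar>) = \<bar>ln h\<bar>" by auto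
qed

lemma lborel_scale:
  fixes F :: "real \<Rightarrow> real"
  assumes h: "0 < h" and F: "integrable lborel F"
  shows "integrable lborel (\<lambda>x. h * F (h * x))" "(LINT x|lborel. h * F (h * x)) = (LINT x|lborel. F x)"
  using lborel_integrable_real_affine[OF F, of h 0] lborel_integral_real_affine[of h F 0] h by auto

context levy_class_L
begin

text \<open>What remains of the Levy density after its singularity g0/x on \<open>{0<..1}\<close> is
  taken away; it is \<zeta> there and \<open>g\<close> beyond 1, hence integrable.\<close>

definition regular_part :: "real \<Rightarrow> real" where "regular_part x = gp x - g0 * (indicator {0<..1} x / x)"

lemma regular_part_integrable: "integrable lborel regular_part"
proof -
  obtain \<zeta> :: "real \<Rightarrow> real" where z: "set_integrable lborel {0..1} \<zeta>" "\<And>x. x \<in> {0<..1} \<Longrightarrow> g x = g0 / x + \<zeta> x"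
    and g1: "set_integrable lborel {1<..} g" using dens by (auto simp: class_L_density_def)
  have "set_integrable lborel {0<..1} \<zeta>" by (rule set_integrable_subset[OF z(1)]) auto
  then have "integrable lborel (\<lambda>x. indicator {0<..1} x *\<^sub>R \<zeta> x + indicator {1<..} x *\<^sub>R g x)"
    using g1 unfolding set_integrable_def by (rule Bochner_Integration.integrable_add)
  also have "(\<lambda>x. indicator {0<..1} x *\<^sub>R \<zeta> x + indicator {1<..} x *\<^sub>R g x) = regular_part"
    using z(2) by (auto simp: regular_part_def gp_def indicator_def fun_eq_iff)
  finally show ?thesis .
qed

definition regular_norm :: real where "regular_norm = (LINT x|lborel. \<bar>regular_part x\<bar>)"

text \<open>Three pieces make up \<open>f\<close>: the regular part cancels in the mean since
  scaling preserves its integral, the singular part leaves g0 times the window with integral - ln h,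
  and the exponential factor contributes \<open>- psi q\<close>, again by scaling.\<close>

lemma scaled_density:
  assumes h: "0 < h" and q: "0 \<le> q"
  defines "f \<equiv> \<lambda>x. h * gp (h * x) * exp (- q * (h * x)) - gp x"
  shows "integrable lborel f" "(LINT x|lborel. f x) = - psi q - g0 * ln h"
    "(LINT x|lborel. \<bar>f x\<bar>) \<le> psi q + g0 * \<bar>ln h\<bar> + 2 * regular_norm"
proof -
  define r :: "real \<Rightarrow> real" where "r x = indicator {0<..1} (h * x) / x - indicator {0<..1} x / x" for x
  note r = inverse_window[OF h, folded r_def]
  define G where "G x = gp x * (1 - exp (- q * x))" for x
  have G: "integrable lborel G" "(LINT x|lborel. G x) = psi q"
    using psi_integrable[OF q] by (auto simp: G_def[abs_def] psi_def)
  have G0: "0 \<le> G x" for x using q by (cases "0 < x") (auto simp: G_def gp_0 gp_nonneg)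
  note sG = lborel_scale[OF h G(1)] and sk = lborel_scale[OF h regular_part_integrable]
    and sa = lborel_scale[OF h integrable_abs[OF regular_part_integrable]]
  have g00: "0 \<le> g0" using dens by (simp add: class_L_density_def)
  have e: "f = (\<lambda>x. (h * regular_part (h * x) - regular_part x) + g0 * r x - h * G (h * x))"
    using h by (auto simp: fun_eq_iff f_def regular_part_def r_def G_def field_simps)
  show i: "integrable lborel f"
    unfolding e using sG sk r regular_part_integrable by (intro Bochner_Integration.integrable_add Bochner_Integration.integrable_diff integrable_mult_right) auto
  show "(LINT x|lborel. f x) = - psi q - g0 * ln h"
    unfolding e using sG sk r regular_part_integrable G(2) by simp
  have "(LINT x|lborel. \<bar>f x\<bar>) \<le> (LINT x|lborel. (h * \<bar>regular_part (h * x)\<bar> + \<bar>regular_part x\<bar>) + g0 * \<bar>r x\<bar> + h * G (h * x))"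
  proof (rule integral_mono)
    show "integrable lborel (\<lambda>x. (h * \<bar>regular_part (h * x)\<bar> + \<bar>regular_part x\<bar>) + g0 * \<bar>r x\<bar> + h * G (h * x))"
      using sG sa integrable_abs[OF r(1)] integrable_abs[OF regular_part_integrable] by simp
    fix x
    have "\<bar>h * regular_part (h * x)\<bar> = h * \<bar>regular_part (h * x)\<bar>" "\<bar>g0 * r x\<bar> = g0 * \<bar>r x\<bar>" "\<bar>h * G (h * x)\<bar> = h * G (h * x)"
      using h g00 G0[of "h * x"] by (auto simp: abs_mult)
    then show "\<bar>f x\<bar> \<le> (h * \<bar>regular_part (h * x)\<bar> + \<bar>regular_part x\<bar>) + g0 * \<bar>r x\<bar> + h * G (h * x)" unfolding e by linarith
  qed (use i in simp)
  also have "\<dots> = psi q + g0 * \<bar>ln h\<bar> + 2 * regular_norm"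
    using sG sa integrable_abs[OF r(1)] integrable_abs[OF regular_part_integrable] G(2) r(3) by (simp add: regular_norm_def)
  finally show "(LINT x|lborel. \<bar>f x\<bar>) \<le> psi q + g0 * \<bar>ln h\<bar> + 2 * regular_norm" .
qed

end

section \<open>The density field attached to the equation\<close>

locale sde_class_L = levy_class_L P g g0 + sde_coeff m C D L
  for P g g0 m C D L
begin

definition inv_m :: "real \<Rightarrow> real \<Rightarrow> real" where "inv_m s a = 1 / mp s a"

lemma inv_m_pos: "0 < inv_m s a" by (simp add: inv_m_def mp_pos)

lemma inv_m_measurable[measurable (raw)]:
  assumes [measurable]: "f \<in> borel_measurable N" "k \<in> borel_measurable N"
  shows "(\<lambda>y. inv_m (f y) (k y)) \<in> borel_measurable N"
  unfolding inv_m_def by measurable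

lemma abs_ln_inv_m_le: "\<bar>ln (inv_m s a)\<bar> \<le> \<bar>ln C\<bar> + \<bar>ln D\<bar>"
proof -
  have "ln (inv_m s a) \<le> ln D" using mp_inv_le[of s a] inv_m_pos[of s a] D_pos by (simp add: inv_m_def)
  moreover have "- ln (inv_m s a) \<le> ln C" using mp_le[of s a] mp_pos[of s a] C_pos by (simp add: inv_m_def ln_div)
  ultimately show ?thesis by linarith
qed

text \<open>Besides the density of \<open>P\<^sup>H\<close> the field carries the factor \<open>exp (- \<integral> level xs d\<xi>\<^sup>H)\<close>, so that the mean-one
  property for all \<open>xs\<close> yields the Laplace transform of \<open>\<xi>\<^sup>H\<close>.\<close>

definition ph :: "(real \<times> real) list \<Rightarrow> real \<Rightarrow> real \<Rightarrow> real \<Rightarrow> real" where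
  "ph xs s a x = (if 0 < x then inv_m s a * gp (inv_m s a * x) / gp x * exp (- level xs s * (inv_m s a * x)) else 1)"

text \<open>The bound of \<open>scaled_density\<close>, made uniform in time and state by the sum of
  all coefficients and by the bounds on \<open>m\<close> and \<open>1 / m\<close>; the summand 1
  makes it strictly positive.\<close>

definition field_bound :: "(real \<times> real) list \<Rightarrow> real" where
  "field_bound xs = psi (\<Sum>(c, u)\<leftarrow>xs. c) + g0 * (\<bar>ln C\<bar> + \<bar>ln D\<bar>) + 2 * regular_norm + 1"

lemma gp_ph: "gp x * (ph xs s a x - 1) = inv_m s a * gp (inv_m s a * x) * exp (- level xs s * (inv_m s a * x)) - gp x"
proof (cases "0 < x")
  case True then show ?thesis using gp_pos[OF True] by (simp add: ph_def field_simps)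
next
  case False
  then have "inv_m s a * x \<le> 0" using inv_m_pos[of s a] by (simp add: mult_nonneg_nonpos)
  then show ?thesis using False by (simp add: ph_def gp_0)
qed

lemma exp_field: assumes xs: "good_list xs" shows "exp_field P g g0 (ph xs) (field_bound xs)"
proof unfold_locales
  have [measurable]: "fst \<in> borel_measurable (borel \<Otimes>\<^sub>M borel \<Otimes>\<^sub>M borel)"
    "(\<lambda>y. fst (snd y)) \<in> borel_measurable (borel \<Otimes>\<^sub>M borel \<Otimes>\<^sub>M borel)"
    "(\<lambda>y. snd (snd y)) \<in> borel_measurable (borel \<Otimes>\<^sub>M borel \<Otimes>\<^sub>M borel)" for M by measurable
  show "(\<lambda>(s, a, x). ph xs s a x) \<in> borel_measurable (borel \<Otimes>\<^sub>M borel \<Otimes>\<^sub>M borel)"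
    unfolding ph_def case_prod_beta' by measurable
  show "0 < ph xs s a x" for s a x
    using gp_pos[of x] gp_pos[of "inv_m s a * x"] inv_m_pos[of s a] by (auto simp: ph_def)
  note d = scaled_density[OF inv_m_pos level_nonneg[OF xs]]
  show "integrable lborel (\<lambda>x. gp x * (ph xs s a x - 1))" for s a unfolding gp_ph using d(1) by simp
  have g00: "0 \<le> g0" using dens by (simp add: class_L_density_def)
  have "gp x * \<bar>ph xs s a x - 1\<bar> = \<bar>inv_m s a * gp (inv_m s a * x) * exp (- level xs s * (inv_m s a * x)) - gp x\<bar>" for s a x
    unfolding gp_ph[symmetric] by (simp add: abs_mult gp_nonneg)
  then have 1: "(LINT x|lborel. gp x * \<bar>ph xs s a x - 1\<bar>) \<le> psi (level xs s) + g0 * \<bar>ln (inv_m s a)\<bar> + 2 * regular_norm" for s a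
    using d(3)[of s a s] by simp
  have 2: "psi (level xs s) \<le> psi (\<Sum>(c, u)\<leftarrow>xs. c)" for s
    by (rule psi_mono[OF level_nonneg[OF xs] level_le[OF xs]])
  have 3: "g0 * \<bar>ln (inv_m s a)\<bar> \<le> g0 * (\<bar>ln C\<bar> + \<bar>ln D\<bar>)" for s a
    by (rule mult_left_mono[OF abs_ln_inv_m_le g00])
  show "(LINT x|lborel. gp x * \<bar>ph xs s a x - 1\<bar>) \<le> field_bound xs" for s a
    using 1[of s a] 2[of s] 3[of s a] unfolding field_bound_def by linarith
  have "0 \<le> regular_norm" by (simp add: regular_norm_def)
  moreover have "0 \<le> psi (\<Sum>(c, u)\<leftarrow>xs. c)"
    using psi_nonneg order_trans[OF level_nonneg[OF xs] level_le[OF xs]] by blast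
  moreover have "0 \<le> g0 * (\<bar>ln C\<bar> + \<bar>ln D\<bar>)" using g00 by (intro mult_nonneg_nonneg) auto
  ultimately show "0 < field_bound xs" by (simp add: field_bound_def)
qed

end

section \<open>Measures on path space and their restrictions to the filtration\<close>

lemma sets_filtration_mono: "s \<le> t \<Longrightarrow> sets (canonical_filtration s) \<subseteq> sets (canonical_filtration t)"
proof -
  assume st: "s \<le> t"
  have "(\<lambda>\<omega>. \<omega>) \<in> measurable (canonical_filtration t) (canonical_filtration s)"
    by (rule measurable_filtrationI) (use st in \<open>auto intro: filtration_eval_measurable\<close>)
  from measurable_sets[OF this] show ?thesis
    using sets.sets_into_space[of _ "canonical_filtration s"] by (auto simp: Int_absorb2)
qed

text \<open>Every generating set of the canonical space already belongs to some
  \<open>canonical_filtration t\<close>, and as these increase with \<open>t\<close> their union is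
  closed under intersections.\<close>

lemma canonical_space_measure_eqI:
  assumes s: "sets M = sets canonical_space" "sets N = sets canonical_space" and M: "prob_space M"
    and eq: "\<And>t A. 0 \<le> t \<Longrightarrow> A \<in> sets (canonical_filtration t) \<Longrightarrow> emeasure M A = emeasure N A"
  shows "M = N"
proof -
  interpret prob_space M by fact
  define E where "E = (\<Union>t\<in>{0..}. sets (canonical_filtration t))"
  have EP: "E \<subseteq> Pow paths" using sets.sets_into_space[of _ "canonical_filtration _"] by (fastforce simp: E_def)
  have gen: "sigma_sets paths E = sets canonical_space"
  proof
    show "sigma_sets paths E \<subseteq> sets canonical_space"
      using sets.sigma_sets_subset[of E canonical_space] sets_filtration_subset by (auto simp: E_def)
    have "{coord s -` A \<inter> paths | s A. 0 \<le> s \<and> A \<in> sets borel} \<subseteq> E"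
    proof clarify
      fix s :: real and A :: "real set" assume "0 \<le> s" "A \<in> sets borel"
      moreover from this have "coord s -` A \<inter> paths \<in> sets (canonical_filtration s)"
        unfolding canonical_filtration_def by (intro in_measure_of canonical_generator_subset) auto
      ultimately show "coord s -` A \<inter> paths \<in> E" by (auto simp: E_def)
    qed
    then have "sigma_sets paths {coord s -` A \<inter> paths | s A. 0 \<le> s \<and> A \<in> sets borel} \<subseteq> sigma_sets paths E"
      by (rule sigma_sets_mono')
    then show "sets canonical_space \<subseteq> sigma_sets paths E"
      unfolding canonical_space_def by (subst sets_measure_of[OF canonical_generator_subset(1)])
  qed
  show ?thesis
  proof (rule measure_eqI_generator_eq[where E=E and \<Omega>=paths and A="\<lambda>_. paths"])
    show "Int_stable E"
    proof (rule Int_stableI)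
      fix A B assume "A \<in> E" "B \<in> E"
      then obtain u v where uv: "0 \<le> u" "A \<in> sets (canonical_filtration u)" "0 \<le> v" "B \<in> sets (canonical_filtration v)"
        by (auto simp: E_def)
      then have "A \<inter> B \<in> sets (canonical_filtration (max u v))"
        using sets_filtration_mono[of u "max u v"] sets_filtration_mono[of v "max u v"] by auto
      then show "A \<inter> B \<in> E" using uv unfolding E_def by (intro UN_I[of "max u v"]) auto
    qed
    show "range (\<lambda>_. paths) \<subseteq> E"
      using sets.top[of "canonical_filtration 0"] by (auto simp: E_def)
    show "emeasure M paths \<noteq> \<infinity>" by (simp add: emeasure_finite)
  qed (use EP gen s eq in \<open>auto simp: E_def\<close>)
qed

definition exp_funs :: "real \<Rightarrow> ((real \<Rightarrow> real) \<Rightarrow> real) set" where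
  "exp_funs t = {\<lambda>\<omega>. exp (- lin_fun xs \<omega>) | xs. good_list xs \<and> (\<forall>(c, u)\<in>set xs. u \<le> t)}"

lemma exp_funs_measurable: "f \<in> exp_funs t \<Longrightarrow> f \<in> borel_measurable (canonical_filtration t)"
proof -
  have "(\<forall>(c, u)\<in>set xs. u \<le> t) \<Longrightarrow> good_list xs \<Longrightarrow> lin_fun xs \<in> borel_measurable (canonical_filtration t)" for xs
  proof (induction xs)
    case (Cons y xs)
    obtain c u where y: "y = (c, u)" by force
    have "(\<lambda>\<omega>. \<omega> u) \<in> borel_measurable (canonical_filtration t)"
      by (rule filtration_eval_measurable) (use Cons.prems y in auto)
    moreover have "lin_fun xs \<in> borel_measurable (canonical_filtration t)" using Cons by (simp add: y)
    ultimately have "(\<lambda>\<omega>. c * \<omega> u + lin_fun xs \<omega>) \<in> borel_measurable (canonical_filtration t)" by measurable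
    also have "(\<lambda>\<omega>. c * \<omega> u + lin_fun xs \<omega>) = lin_fun (y # xs)" by (simp add: y fun_eq_iff)
    finally show ?case .
  qed (simp add: lin_fun_def[abs_def])
  moreover assume "f \<in> exp_funs t"
  then obtain xs where "f = (\<lambda>\<omega>. exp (- lin_fun xs \<omega>))" "good_list xs" "\<forall>(c, u)\<in>set xs. u \<le> t"
    unfolding exp_funs_def by blast
  ultimately show ?thesis by simp
qed

lemma sets_filtration_generated:
  "sets (canonical_filtration t) = sigma_sets (space (canonical_filtration t))
     {{\<omega>\<in>space (canonical_filtration t). a < f \<omega>} | f a. f \<in> exp_funs t}"
proof -
  define G where "G = {{\<omega>\<in>paths. a < f \<omega>} | f a. f \<in> exp_funs t}"
  define S where "S = sigma paths G"
  have GP: "G \<subseteq> Pow paths" by (auto simp: G_def)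
  have sS: "space S = paths" "sets S = sigma_sets paths G" unfolding S_def using GP by auto
  have m: "f \<in> borel_measurable S" if "f \<in> exp_funs t" for f
  proof (rule borel_measurable_iff_greater[THEN iffD2], rule allI)
    fix a
    have "{\<omega>\<in>paths. a < f \<omega>} \<in> G" unfolding G_def using that by blast
    then show "{\<omega>\<in>space S. a < f \<omega>} \<in> sets S" unfolding sS by (rule sigma_sets.Basic)
  qed
  have "(\<lambda>\<omega>. \<omega>) \<in> measurable S (canonical_filtration t)"
  proof (rule measurable_filtrationI)
    fix u assume "0 \<le> u" "u \<le> t"
    then have "(\<lambda>\<omega>. exp (- lin_fun [(1, u)] \<omega>)) \<in> exp_funs t"
      unfolding exp_funs_def by (intro CollectI exI[of _ "[(1, u)]"]) auto
    from borel_measurable_uminus[OF borel_measurable_ln[OF m[OF this]]]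
    show "(\<lambda>\<omega>. \<omega> u) \<in> borel_measurable S" by simp
  qed (simp add: sS)
  from measurable_sets[OF this] have "sets (canonical_filtration t) \<subseteq> sets S"
    using sets.sets_into_space[of _ "canonical_filtration t"] by (auto simp: sS Int_absorb2)
  moreover have "sigma_sets paths G \<subseteq> sets (canonical_filtration t)"
  proof -
    have "G \<subseteq> sets (canonical_filtration t)"
    proof
      fix X assume "X \<in> G"
      then obtain f a where X: "f \<in> exp_funs t" "X = {\<omega>\<in>paths. a < f \<omega>}" unfolding G_def by blast
      have [measurable]: "f \<in> borel_measurable (canonical_filtration t)" by (rule exp_funs_measurable[OF X(1)])
      have "{\<omega>\<in>space (canonical_filtration t). a < f \<omega>} \<in> sets (canonical_filtration t)" by measurable
      then show "X \<in> sets (canonical_filtration t)" by (simp add: X(2))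
    qed
    then show ?thesis using sets.sigma_sets_subset[of G "canonical_filtration t"] by simp
  qed
  ultimately show ?thesis unfolding sS(2) G_def by auto
qed

section \<open>The laws of \<open>inv_int\<close> and \<open>sol\<close>\<close>

context sde_class_L
begin

text \<open>For the empty list the exponential factor is 1, so \<open>E0.exp_mart\<close> is the
  density process of \<open>P_H\<close> itself.\<close>

sublocale E0: exp_field P g g0 "ph []" "field_bound []" by (rule exp_field) simp

lemma inv_m_left_lim_measurable: "\<omega> \<in> paths \<Longrightarrow> (\<lambda>s. inv_m s (left_lim \<omega> s)) \<in> borel_measurable borel"
  using left_lim_paths_measurable by measurable

text \<open>Purity of the jumps enters here: the integral against \<omega> has no continuous part
  and becomes a sum over jump times, to be matched term by term with the factors of the
  product.\<close>

lemma lin_fun_inv_int: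
  assumes \<omega>: "\<omega> \<in> paths" and p: "pure_jump \<omega>" and xs: "good_list xs" "\<And>c u. (c, u) \<in> set xs \<Longrightarrow> u \<le> t"
  shows "lin_fun xs (inv_int \<omega>) = (LINT s|count_space (jumps \<omega> t). level xs s * jump (inv_int \<omega>) s)"
proof -
  note [measurable] = inv_m_left_lim_measurable[OF \<omega>]
  have l0: "0 \<le> inv_m s (left_lim \<omega> s) * level xs s" for s using inv_m_pos level_nonneg[OF xs(1)] by (simp add: less_imp_le)
  have "lin_fun xs (inv_int \<omega>) = stint (inv_int \<omega>) (level xs) t"
    by (rule lin_fun_eq_stint(2)[symmetric, OF inv_int_paths[OF \<omega>]]) (use xs in \<open>auto simp: good_list_def\<close>)
  also have "\<dots> = stint \<omega> (\<lambda>s. inv_m s (left_lim \<omega> s) * level xs s) t"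
    unfolding inv_int_def inv_m_def
    by (rule bounded_integrand.stint_stint[OF inv_mp_integrand[OF \<omega> left_lim_paths_measurable[OF \<omega>]]]) measurable
  also have "\<dots> = enn2real (\<integral>\<^sup>+s\<in>{0<..t}. ennreal (inv_m s (left_lim \<omega> s) * level xs s) \<partial>stieltjes \<omega>)"
    unfolding stint_def by (rule stieltjes_integral_eq_nn) (use l0 in measurable)
  also have "\<dots> = enn2real (jump_sum \<omega> t (\<lambda>s. ennreal (inv_m s (left_lim \<omega> s) * level xs s) * ennreal (jump \<omega> s)))"
    by (subst pure_jump_nn_integral[OF \<omega> p]) auto
  also have "\<dots> = (LINT s|count_space (jumps \<omega> t). level xs s * jump (inv_int \<omega>) s)"
    unfolding jump_sum_def
    by (subst integral_eq_nn_integral)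
       (auto intro!: arg_cong[where f=enn2real] nn_integral_cong AE_I2 mult_nonneg_nonneg
          simp: jump_nonneg[OF inv_int_paths[OF \<omega>]] level_nonneg[OF xs(1)] jump_inv_int[OF \<omega>] inv_m_def
            ennreal_mult'[symmetric] jump_nonneg[OF \<omega>] mult.commute less_imp_le[OF mp_pos] divide_nonneg_pos mp_pos)
  finally show ?thesis .
qed

lemma comp_rate_ph:
  assumes xs: "good_list xs" shows "exp_field.comp_rate g (ph xs) s a = - psi (level xs s) - g0 * ln (inv_m s a)"
proof -
  interpret E: exp_field P g g0 "ph xs" "field_bound xs" by (rule exp_field[OF xs])
  show ?thesis unfolding E.comp_rate_def gp_ph using scaled_density(2)[OF inv_m_pos level_nonneg[OF xs]] by simp
qed

text \<open>Jump by jump the two fields differ by the exponential of minus the level times the jump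
  of \<open>inv_int \<omega>\<close>, and the compensator rates by \<open>psi\<close> of the level,
  the terms with ln h being common to both. The first difference sums up to the Laplace functional,
  the second integrates to \<open>Psi xs t\<close>.\<close>

lemma exp_mart_ph:
  assumes \<omega>: "\<omega> \<in> paths" and p: "pure_jump \<omega>" and xs: "good_list xs" "\<And>c u. (c, u) \<in> set xs \<Longrightarrow> u \<le> t"
    and g0: "E0.good \<omega>" and gx: "exp_field.good (ph xs) \<omega>"
  shows "exp_field.exp_mart g (ph xs) t \<omega> = E0.exp_mart t \<omega> * exp (- lin_fun xs (inv_int \<omega>)) * exp (Psi xs t)"
proof -
  interpret E: exp_field P g g0 "ph xs" "field_bound xs" by (rule exp_field[OF xs(1)])
  have ln: "ln (1 + E.rel_jump \<omega> s) = ln (1 + E0.rel_jump \<omega> s) - level xs s * jump (inv_int \<omega>) s" if "s \<in> jumps \<omega> t" for s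
  proof -
    have j: "0 < jump \<omega> s" using that jump_nonneg[OF \<omega>, of s] by (auto simp: jumps_def)
    have "1 + E.rel_jump \<omega> s = (1 + E0.rel_jump \<omega> s) * exp (- (level xs s * jump (inv_int \<omega>) s))"
      using j by (simp add: E.rel_jump_def E0.rel_jump_def ph_def jump_inv_int[OF \<omega>] inv_m_def)
    then show ?thesis using E0.rel_jump_gt[of \<omega> s] by (simp add: ln_mult)
  qed
  note i0 = integrable_ln_one_plus[OF E0.good_integrable[OF g0, of t] E0.rel_jump_gt]
  note ix = integrable_ln_one_plus[OF E.good_integrable[OF gx, of t] E.rel_jump_gt]
  have "E0.log_sum t \<omega> - E.log_sum t \<omega> = (LINT s|count_space (jumps \<omega> t). ln (1 + E0.rel_jump \<omega> s) - ln (1 + E.rel_jump \<omega> s))"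
    unfolding E0.log_sum_eq[OF g0] E.log_sum_eq[OF gx] by (rule Bochner_Integration.integral_diff[symmetric, OF i0 ix])
  also have "\<dots> = (LINT s|count_space (jumps \<omega> t). level xs s * jump (inv_int \<omega>) s)"
    by (rule Bochner_Integration.integral_cong) (simp_all add: ln)
  finally have 1: "E.log_sum t \<omega> = E0.log_sum t \<omega> - lin_fun xs (inv_int \<omega>)"
    using lin_fun_inv_int[OF \<omega> p xs] by simp
  have "E.comp_path \<omega> = (\<lambda>s. E0.comp_path \<omega> s - psi (level xs s))"
    by (simp add: fun_eq_iff E.comp_path_def E0.comp_path_def comp_rate_ph[OF xs(1)] comp_rate_ph[of "[]"])
  moreover have "set_integrable lborel {0<..t} (E0.comp_path \<omega>)"
    by (rule bounded_set_integrable_lborel[OF E0.comp_path_path_measurable[OF \<omega>] E0.comp_path_le])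
  moreover have "set_integrable lborel {0<..t} (\<lambda>s. psi (level xs s))"
    using psi_level_integrable[OF xs(1) order_refl, of "{0<..t}" t] by simp
  ultimately have 2: "cum (E.comp_path \<omega>) t = cum (E0.comp_path \<omega>) t - Psi xs t"
    by (simp add: cum_def Psi_def set_integral_diff(2))
  show ?thesis unfolding E.exp_mart_def E0.exp_mart_def 1 2 exp_add[symmetric] by (simp add: algebra_simps)
qed

lemma mean_exp_inv_int:
  assumes t: "0 \<le> t" and xs: "good_list xs" "\<And>c u. (c, u) \<in> set xs \<Longrightarrow> u \<le> t"
  shows "(\<integral>\<^sup>+\<omega>. ennreal (E0.exp_mart t \<omega>) * ennreal (exp (- lin_fun xs (inv_int \<omega>))) \<partial>P) = ennreal (exp (- Psi xs t))"
proof -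
  interpret E: exp_field P g g0 "ph xs" "field_bound xs" by (rule exp_field[OF xs(1)])
  have "(\<integral>\<^sup>+\<omega>. ennreal (E0.exp_mart t \<omega>) * ennreal (exp (- lin_fun xs (inv_int \<omega>))) \<partial>P) =
    (\<integral>\<^sup>+\<omega>. ennreal (exp (- Psi xs t)) * ennreal (E.exp_mart t \<omega>) \<partial>P)"
  proof (rule nn_integral_cong_AE)
    show "AE \<omega> in P. ennreal (E0.exp_mart t \<omega>) * ennreal (exp (- lin_fun xs (inv_int \<omega>))) = ennreal (exp (- Psi xs t)) * ennreal (E.exp_mart t \<omega>)"
      using E0.AE_good E.AE_good AE_pure_jump AE_space
    proof eventually_elim
      case (elim \<omega>)
      have "E.exp_mart t \<omega> = E0.exp_mart t \<omega> * exp (- lin_fun xs (inv_int \<omega>)) * exp (Psi xs t)"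
        by (rule exp_mart_ph) (use elim xs in \<open>auto simp: space_P\<close>)
      then show ?case by (simp add: ennreal_mult'[symmetric] E0.exp_mart_def exp_add[symmetric])
    qed
  qed
  also have "\<dots> = ennreal (exp (- Psi xs t))"
    using measurable_P[OF E.exp_mart_measurable, of t] E.mean_exp_mart[OF t] by (subst nn_integral_cmult) auto
  finally show ?thesis .
qed

lemma id_filtration_measurable: "(\<lambda>\<omega>. \<omega>) \<in> measurable P (canonical_filtration t)"
  by (rule measurable_P, rule measurable_filtrationI) (auto intro: canonical_eval_measurable)

lemma inv_int_filtration_measurable: "inv_int \<in> measurable (density P f) (canonical_filtration t)"
proof -
  have "inv_int \<in> measurable P (canonical_filtration t)"
    by (rule measurable_P, rule measurable_filtrationI)
      (auto intro: inv_int_paths measurable_compose[OF inv_int_measurable canonical_eval_measurable])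
  then show ?thesis by simp
qed

text \<open>The Laplace functionals with times up to \<open>t\<close> form a multiplicative system
  generating \<open>canonical_filtration t\<close>. The weight is the density process at time
  \<open>t\<close>, hence the comparison on this sigma-algebra only.\<close>

lemma inv_int_law:
  assumes t: "0 \<le> t"
  shows "distr (density P (\<lambda>\<omega>. ennreal (E0.exp_mart t \<omega>))) (canonical_filtration t) inv_int = distr P (canonical_filtration t) (\<lambda>\<omega>. \<omega>)"
    (is "?M = ?N")
proof (rule mult_system_measure_eq[where H="exp_funs t"])
  have V[measurable]: "(\<lambda>\<omega>. ennreal (E0.exp_mart t \<omega>)) \<in> borel_measurable P" using measurable_P[OF E0.exp_mart_measurable] by measurable
  note id = id_filtration_measurable and inv = inv_int_filtration_measurable
  show "finite_measure ?N" using prob_space_distr[OF id] by (rule prob_space.finite_measure)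
  show "finite_measure ?M"
  proof (rule finite_measure.finite_measure_distr[OF _ inv], rule finite_measureI)
    show "emeasure (density P (\<lambda>\<omega>. ennreal (E0.exp_mart t \<omega>))) (space (density P (\<lambda>\<omega>. ennreal (E0.exp_mart t \<omega>)))) \<noteq> \<infinity>"
      using E0.mean_exp_mart[OF t] by (simp add: emeasure_density nn_integral_set_ennreal[symmetric] cong: nn_integral_cong_simp)
  qed
  show "sets ?N = sets ?M" by simp
  show "(\<lambda>_. 1) \<in> exp_funs t" unfolding exp_funs_def by (intro CollectI exI[of _ "[]"]) auto
  show "(\<lambda>x. f x * h x) \<in> exp_funs t" if fh: "f \<in> exp_funs t" "h \<in> exp_funs t" for f h
  proof -
    obtain xs ys where "f = (\<lambda>\<omega>. exp (- lin_fun xs \<omega>))" "good_list xs" "\<forall>(c, u)\<in>set xs. u \<le> t"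
      "h = (\<lambda>\<omega>. exp (- lin_fun ys \<omega>))" "good_list ys" "\<forall>(c, u)\<in>set ys. u \<le> t"
      using fh unfolding exp_funs_def by blast
    then show ?thesis unfolding exp_funs_def
      by (intro CollectI exI[of _ "xs @ ys"]) (auto simp: exp_add[symmetric])
  qed
  show "f \<in> borel_measurable ?M" if "f \<in> exp_funs t" for f
    using exp_funs_measurable[OF that] by simp
  have b: "f \<omega> \<in> {0..1}" if "f \<in> exp_funs t" "\<omega> \<in> paths" for f \<omega>
    using that lin_fun_nonneg by (auto simp: exp_funs_def)
  show "AE x in ?M. f x \<in> {0..1}" "AE x in ?N. f x \<in> {0..1}" if "f \<in> exp_funs t" for f
    using b[OF that] by (auto intro!: AE_I2)
  show "(LINT x|?M. f x) = (LINT x|?N. f x)" if f: "f \<in> exp_funs t" for f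
  proof -
    have [measurable]: "f \<in> borel_measurable (canonical_filtration t)" by (rule exp_funs_measurable[OF f])
    obtain xs where xs: "f = (\<lambda>\<omega>. exp (- lin_fun xs \<omega>))" "good_list xs" "\<And>c u. (c, u) \<in> set xs \<Longrightarrow> u \<le> t"
      using f unfolding exp_funs_def by blast
    have [measurable]: "(\<lambda>\<omega>. f (inv_int \<omega>)) \<in> borel_measurable P"
      using measurable_compose[OF inv exp_funs_measurable[OF f]] by simp
    have "(\<integral>\<^sup>+x. ennreal (f x) \<partial>?M) = (\<integral>\<^sup>+\<omega>. ennreal (E0.exp_mart t \<omega>) * ennreal (f (inv_int \<omega>)) \<partial>P)"
      by (subst nn_integral_distr'[OF inv]) (auto simp: nn_integral_density)
    also have "\<dots> = ennreal (exp (- Psi xs t))" unfolding xs(1) by (rule mean_exp_inv_int[OF t xs(2,3)])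
    finally have "(LINT x|?M. f x) = exp (- Psi xs t)"
      by (subst integral_eq_nn_integral) (use exp_funs_measurable[OF f] in \<open>auto simp: xs(1)\<close>)
    moreover have "(LINT x|?N. f x) = exp (- Psi xs t)"
      unfolding integral_distr[OF id \<open>f \<in> borel_measurable (canonical_filtration t)\<close>] unfolding xs(1)
      by (rule laplace_good[OF xs(2) t xs(3)])
    ultimately show ?thesis by simp
  qed
  show "sets ?M = sigma_sets (space ?M) {{x\<in>space ?M. a < f x} | f a. f \<in> exp_funs t}"
    using sets_filtration_generated[of t] by simp
qed

text \<open>Let B be the preimage of \<open>A\<close> under \<open>sol\<close>. Then
  \<open>P\<close> of B equals the weighted mass of the preimage of B under \<open>inv_int\<close>,
  and since \<open>sol\<close> after \<open>inv_int\<close> is the identity, that preimage is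
  \<open>A\<close> again. Adaptedness of \<open>sol\<close> ensures that B lies in
  \<open>canonical_filtration t\<close>, where the law of \<open>inv_int\<close> is known.\<close>

lemma sol_law:
  assumes t: "0 \<le> t" and A: "A \<in> sets (canonical_filtration t)"
  shows "emeasure (distr P canonical_space sol) A = (\<integral>\<^sup>+\<omega>\<in>A. ennreal (E0.exp_mart t \<omega>) \<partial>P)"
proof -
  define B where "B = sol -` A \<inter> paths"
  have B: "B \<in> sets (canonical_filtration t)" using measurable_sets[OF sol_adapted[OF t] A] by (simp add: B_def)
  have AB: "A \<in> sets P" "B \<in> sets P" using A B sets_filtration_subset sets_P by auto
  have V[measurable]: "(\<lambda>\<omega>. ennreal (E0.exp_mart t \<omega>)) \<in> borel_measurable P" using measurable_P[OF E0.exp_mart_measurable] by measurable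
  note id = id_filtration_measurable and inv = inv_int_filtration_measurable
  have AP: "A \<subseteq> paths" using sets.sets_into_space[OF A] by simp
  have "emeasure (distr P canonical_space sol) A = emeasure P B"
    using emeasure_distr[OF measurable_P[OF sol_measurable], of A] A sets_filtration_subset by (auto simp: B_def space_P)
  also have "\<dots> = emeasure (distr P (canonical_filtration t) (\<lambda>\<omega>. \<omega>)) B"
    using emeasure_distr[OF id B] sets.sets_into_space[OF AB(2)] by (simp add: Int_absorb2)
  also have "\<dots> = emeasure (density P (\<lambda>\<omega>. ennreal (E0.exp_mart t \<omega>))) (inv_int -` B \<inter> paths)"
    unfolding inv_int_law[OF t, symmetric] using emeasure_distr[OF inv B] by (simp add: space_P)
  also have "inv_int -` B \<inter> paths = A"
    using AP by (auto simp: B_def sol_inv_int inv_int_paths)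
  also have "emeasure (density P (\<lambda>\<omega>. ennreal (E0.exp_mart t \<omega>))) A = (\<integral>\<^sup>+\<omega>\<in>A. ennreal (E0.exp_mart t \<omega>) \<partial>P)"
    by (rule emeasure_density[OF V AB(1)])
  finally show ?thesis .
qed

end

section \<open>Identification of \<open>M_H\<close>, \<open>P_H\<close> and
  \<open>xi_H\<close>\<close>

lemma has_sum_count_space:
  fixes f :: "'a \<Rightarrow> real"
  assumes "integrable (count_space A) f"
  shows "(f has_sum (LINT x|count_space A. f x)) A"
proof -
  have a: "Infinite_Set_Sum.abs_summable_on f A" using assms by (simp add: Infinite_Set_Sum.abs_summable_on_def)
  then have "f summable_on A" using abs_summable_equivalent abs_summable_summable by blast
  moreover have "infsum f A = (LINT x|count_space A. f x)"
    using infsetsum_infsum[OF a] by (simp add: infsetsum_def)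
  ultimately show ?thesis using has_sum_infsum by metis
qed

context sde_class_L
begin

text \<open>The unordered product is the exponential of the unordered sum of logarithms, which
  converges on good paths; and for the empty list the compensator rate is - g0 ln h, as
  \<open>psi 0 = 0\<close>, which gives the exponential in front.\<close>

lemma M_H_eq:
  assumes \<omega>: "\<omega> \<in> paths" and g: "E0.good \<omega>" and t: "0 \<le> t"
  shows "M_H g g0 (sde_h m) (sde_H m) t \<omega> = E0.exp_mart t \<omega>"
proof -
  note [measurable] = inv_m_left_lim_measurable[OF \<omega>]
  have hm: "inv_m s (left_lim \<omega> s) = 1 / m s (left_lim \<omega> s)" if "0 \<le> s" for s
    using mp_eq[OF that left_lim_nonneg[OF \<omega>]] by (simp add: inv_m_def)
  have "(LINT s:{0..t}|lborel. ln (sde_h m \<omega> s 0)) = (LINT s|lborel. indicator {0..t} s *\<^sub>R ln (inv_m s (left_lim \<omega> s)))"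
    unfolding set_lebesgue_integral_def
    by (intro Bochner_Integration.integral_cong) (auto simp: sde_h_def hm split: split_indicator)
  also have "\<dots> = (LINT s|lborel. indicator {0<..t} s *\<^sub>R ln (inv_m s (left_lim \<omega> s)))"
  proof (rule integral_cong_AE)
    show "AE s in lborel. indicator {0..t} s *\<^sub>R ln (inv_m s (left_lim \<omega> s)) = indicator {0<..t} s *\<^sub>R ln (inv_m s (left_lim \<omega> s))"
      using AE_lborel_singleton[of 0] by eventually_elim (auto simp: indicator_def)
  qed measurable
  finally have I: "g0 * (LINT s:{0..t}|lborel. ln (sde_h m \<omega> s 0)) = - cum (E0.comp_path \<omega>) t"
    by (simp add: cum_def set_lebesgue_integral_def E0.comp_path_def[abs_def] comp_rate_ph algebra_simps)
  define w where "w s = (if jump \<omega> s = 0 then 0 else ln (1 + E0.rel_jump \<omega> s))" for s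
  define F where "F s = (if jump \<omega> s = 0 then 1 else sde_h m \<omega> s (jump \<omega> s) * (g (sde_H m \<omega> s (jump \<omega> s)) / g (jump \<omega> s)))" for s
  have F: "F s = exp (w s)" if "s \<in> {0..t}" for s
  proof (cases "jump \<omega> s = 0")
    case False
    then have j: "0 < jump \<omega> s" using jump_nonneg[OF \<omega>, of s] by simp
    have "F s = 1 + E0.rel_jump \<omega> s"
      using j that inv_m_pos[of s "left_lim \<omega> s"] hm[of s]
      by (simp add: F_def E0.rel_jump_def ph_def sde_h_def sde_H_def gp_eq zero_less_divide_iff)
    then show ?thesis using E0.rel_jump_gt[of \<omega> s] False by (simp add: w_def)
  qed (simp add: F_def w_def)
  have "((\<lambda>s. ln (1 + E0.rel_jump \<omega> s)) has_sum E0.log_sum t \<omega>) (jumps \<omega> t)"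
    unfolding E0.log_sum_eq[OF g]
    by (rule has_sum_count_space[OF integrable_ln_one_plus[OF E0.good_integrable[OF g] E0.rel_jump_gt]])
  also have "?this \<longleftrightarrow> (w has_sum E0.log_sum t \<omega>) {0..t}"
    by (rule has_sum_cong_neutral) (use jump_nonpos_time[OF \<omega>, of 0] in \<open>auto simp: w_def jumps_def less_le\<close>)
  finally have "((\<lambda>J. exp (\<Sum>s\<in>J. w s)) \<longlongrightarrow> exp (E0.log_sum t \<omega>)) (finite_subsets_at_top {0..t})"
    unfolding has_sum_def by (rule tendsto_exp)
  also have "?this \<longleftrightarrow> ((\<lambda>J. \<Prod>s\<in>J. F s) \<longlongrightarrow> exp (E0.log_sum t \<omega>)) (finite_subsets_at_top {0..t})"
    by (rule filterlim_cong[OF refl refl], rule eventually_finite_subsets_at_top_weakI)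
       (use F in \<open>auto simp: exp_sum subset_iff intro!: prod.cong\<close>)
  finally have "unordered_prod F {0..t} = exp (E0.log_sum t \<omega>)"
    unfolding unordered_prod_def by (intro tendsto_Lim) auto
  then show ?thesis
    unfolding M_H_def I F_def E0.exp_mart_def by (simp add: exp_diff exp_minus field_simps)
qed

text \<open>The description behind \<open>THE\<close> is met by the law of \<open>sol\<close>, and
  two measures meeting it agree on every \<open>canonical_filtration t\<close>, hence
  everywhere.\<close>

lemma P_H_eq: "P_H P g g0 (sde_h m) (sde_H m) = distr P canonical_space sol"
proof -
  let ?Q = "distr P canonical_space sol"
  let ?dens = "\<lambda>Q. \<forall>t\<ge>0. \<forall>A\<in>sets (canonical_filtration t). emeasure Q A = (\<integral>\<^sup>+\<omega>\<in>A. ennreal (M_H g g0 (sde_h m) (sde_H m) t \<omega>) \<partial>P)"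
  have Q: "prob_space ?Q" by (rule prob_space_distr[OF measurable_P[OF sol_measurable]])
  have d: "?dens ?Q"
  proof (intro allI impI ballI)
    fix t A assume t: "0 \<le> (t::real)" and A: "A \<in> sets (canonical_filtration t)"
    show "emeasure ?Q A = (\<integral>\<^sup>+\<omega>\<in>A. ennreal (M_H g g0 (sde_h m) (sde_H m) t \<omega>) \<partial>P)"
      unfolding sol_law[OF t A]
    proof (rule nn_integral_cong_AE)
      show "AE \<omega> in P. ennreal (E0.exp_mart t \<omega>) * indicator A \<omega> = ennreal (M_H g g0 (sde_h m) (sde_H m) t \<omega>) * indicator A \<omega>"
        using E0.AE_good AE_space by eventually_elim (simp add: M_H_eq t space_P)
    qed
  qed
  show ?thesis unfolding P_H_def
  proof (rule the_equality)
    show "prob_space ?Q \<and> sets ?Q = sets canonical_space \<and> ?dens ?Q" using Q d by simp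
    fix Q assume Q': "prob_space Q \<and> sets Q = sets canonical_space \<and> ?dens Q"
    show "Q = ?Q"
      by (rule canonical_space_measure_eqI) (use Q' d in auto)
  qed
qed

text \<open>Passes from the unordered sum to \<open>jump_sum\<close>, whose measurability in the
  path is known. The sum is finite because \<open>1 / m\<close> is bounded by \<open>D\<close> and
  the Stieltjes measure of \<open>{0<..t}\<close> is finite.\<close>

lemma xi_H_eq:
  assumes \<omega>: "\<omega> \<in> paths"
  shows "xi_H (sde_H m) t \<omega> = enn2real (jump_sum \<omega> t (\<lambda>s. ennreal (inv_m s (left_lim \<omega> s) * jump \<omega> s)))"
proof -
  note [measurable] = inv_m_left_lim_measurable[OF \<omega>]
  define k where "k s = inv_m s (left_lim \<omega> s) * jump \<omega> s" for s
  have k0: "0 \<le> k s" for s using inv_m_pos jump_nonneg[OF \<omega>] by (simp add: k_def less_imp_le)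
  have "jump_sum \<omega> t (\<lambda>s. ennreal (k s)) = (\<integral>\<^sup>+s\<in>{0<..t}. (if jump \<omega> s = 0 then 0 else ennreal (inv_m s (left_lim \<omega> s))) \<partial>stieltjes \<omega>)"
    by (subst jump_sum_eq_stieltjes[OF \<omega>]) (auto simp: k_def ennreal_mult' inv_m_pos less_imp_le jump_nonneg[OF \<omega>])
  also have "\<dots> \<le> (\<integral>\<^sup>+s. ennreal D * indicator {0<..t} s \<partial>stieltjes \<omega>)"
    using mp_inv_le D_pos by (intro nn_integral_mono) (auto simp: inv_m_def ennreal_leI split: split_indicator)
  also have "\<dots> < \<infinity>"
    by (cases "0 \<le> t") (simp_all add: nn_integral_cmult_indicator emeasure_stieltjes[OF \<omega>] ennreal_mult_less_top)
  finally have fin: "jump_sum \<omega> t (\<lambda>s. ennreal (k s)) < \<infinity>" .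
  have i: "integrable (count_space (jumps \<omega> t)) k"
    by (rule integrableI_nonneg) (use k0 fin in \<open>auto simp: jump_sum_def\<close>)
  have "xi_H (sde_H m) t \<omega> = infsum k (jumps \<omega> t)"
    unfolding xi_H_def
    by (rule infsum_cong_neutral)
       (use jump_nonpos_time[OF \<omega>, of 0] mp_eq[OF _ left_lim_nonneg[OF \<omega>]] in \<open>auto simp: k_def jumps_def sde_H_def inv_m_def less_le\<close>)
  also have "\<dots> = (LINT s|count_space (jumps \<omega> t). k s)" by (rule infsumI[OF has_sum_count_space[OF i]])
  also have "\<dots> = enn2real (jump_sum \<omega> t (\<lambda>s. ennreal (k s)))"
    unfolding jump_sum_def by (rule integral_eq_nn_integral) (auto simp: k0)
  finally show ?thesis by (simp add: k_def)
qed

lemma xi_H_measurable: "xi_H (sde_H m) t \<in> borel_measurable canonical_space"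
proof -
  have "(\<lambda>\<omega>. jump_sum \<omega> t (\<lambda>s. ennreal (inv_m s (left_lim \<omega> s) * jump \<omega> s))) \<in> borel_measurable canonical_space"
    by (rule jump_sum_measurable[where w="\<lambda>\<omega>. \<omega>"]) (auto simp: case_prod_beta')
  then have "(\<lambda>\<omega>. enn2real (jump_sum \<omega> t (\<lambda>s. ennreal (inv_m s (left_lim \<omega> s) * jump \<omega> s)))) \<in> borel_measurable canonical_space"
    by measurable
  also have "?this \<longleftrightarrow> ?thesis" by (rule measurable_cong) (simp add: xi_H_eq)
  finally show ?thesis .
qed

text \<open>A jump of \<open>sol \<omega>\<close> is that of \<omega> times \<open>mp\<close> at the
  left limit of \<open>sol \<omega>\<close>, so the division in \<open>sde_H\<close> restores the
  jump of \<omega>; on a pure jump path the jumps add up to the value.\<close>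

lemma xi_H_sol:
  assumes \<omega>: "\<omega> \<in> paths" and p: "pure_jump \<omega>" and t: "0 \<le> t"
  shows "xi_H (sde_H m) t (sol \<omega>) = \<omega> t"
proof -
  have j: "inv_m s (left_lim (sol \<omega>) s) * jump (sol \<omega>) s = jump \<omega> s" for s
    using mp_pos[of s "left_lim (sol \<omega>) s"] by (subst jump_sol[OF \<omega>]) (simp add: inv_m_def)
  have J: "jumps (sol \<omega>) t = jumps \<omega> t"
    using mp_pos by (auto simp: jumps_def jump_sol[OF \<omega>] less_imp_neq[THEN not_sym])
  have "jump_sum \<omega> t (\<lambda>s. 1 * ennreal (jump \<omega> s)) = (\<integral>\<^sup>+s\<in>{0<..t}. 1 \<partial>stieltjes \<omega>)"
    by (rule pure_jump_nn_integral[OF \<omega> p, symmetric]) simp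
  then have "jump_sum \<omega> t (\<lambda>s. ennreal (jump \<omega> s)) = ennreal (\<omega> t)"
    using t by (simp add: emeasure_stieltjes[OF \<omega>] paths_0[OF \<omega>])
  then show ?thesis
    unfolding xi_H_eq[OF sol_paths[OF \<omega>]] j unfolding jump_sum_def J
    by (simp add: paths_nonneg[OF \<omega>])
qed

text \<open>By \<open>xi_H_sol\<close>, the pair of solution and driver at \<omega> is almost surely
  the pair of coordinate process and \<open>xi_H\<close> evaluated at \<open>sol \<omega>\<close>,
  and the law of \<open>sol\<close> is \<open>P_H\<close>.\<close>

lemma sol_process_law:
  "process_law P (\<lambda>t \<omega>. (sol \<omega> t, coord t \<omega>)) =
    process_law (P_H P g g0 (sde_h m) (sde_H m)) (\<lambda>t \<omega>. (coord t \<omega>, xi_H (sde_H m) t \<omega>))"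
proof -
  let ?N = "\<Pi>\<^sub>M t\<in>{0..}. borel :: (real \<times> real) measure"
  let ?f = "\<lambda>\<omega>. \<lambda>t\<in>{0..}. (coord t \<omega>, xi_H (sde_H m) t \<omega>)"
  have f: "?f \<in> measurable canonical_space ?N"
    unfolding coord_def
    by (intro measurable_restrict borel_measurable_Pair canonical_eval_measurable xi_H_measurable)
  have s: "sol \<in> measurable P canonical_space" by (rule measurable_P[OF sol_measurable])
  have "distr P ?N (\<lambda>\<omega>. \<lambda>t\<in>{0..}. (sol \<omega> t, coord t \<omega>)) = distr P ?N (?f \<circ> sol)"
  proof (rule distr_cong_AE)
    show "AE \<omega> in P. (\<lambda>t\<in>{0..}. (sol \<omega> t, coord t \<omega>)) = (?f \<circ> sol) \<omega>"
      using AE_pure_jump AE_space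
      by eventually_elim (auto simp: space_P coord_def xi_H_sol restrict_def fun_eq_iff)
    show "(\<lambda>\<omega>. \<lambda>t\<in>{0..}. (sol \<omega> t, coord t \<omega>)) \<in> measurable P ?N"
      unfolding coord_def
      by (intro measurable_restrict borel_measurable_Pair measurable_P[OF canonical_eval_measurable] measurable_compose[OF s canonical_eval_measurable])
    show "?f \<circ> sol \<in> measurable P ?N" by (rule measurable_comp[OF s f])
  qed auto
  then show ?thesis unfolding process_law_def P_H_eq using distr_distr[OF f s] by simp
qed

end

theorem theorem5p1:
  fixes P :: "(real \<Rightarrow> real) measure"
    and g :: "real \<Rightarrow> real" and g0 :: real
    and m :: "real \<Rightarrow> real \<Rightarrow> real"
  assumes "sets P = sets canonical_space"
    and "subordinator_class_L P coord g g0"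
    and "(\<lambda>(s, a). m s a) \<in> borel_measurable (restrict_space borel ({0..} \<times> {0..}))"
    and "\<And>s a. 0 \<le> s \<Longrightarrow> 0 \<le> a \<Longrightarrow> 0 < m s a"
    and "\<exists>C. \<forall>s\<ge>0. \<forall>a\<ge>0. m s a \<le> C"
    and "\<exists>C. \<forall>s\<ge>0. \<forall>a\<ge>0. 1 / m s a \<le> C"
    and "\<exists>L. \<forall>s\<ge>0. L-lipschitz_on {0..} (m s)"
  shows "\<exists>X :: real \<Rightarrow> (real \<Rightarrow> real) \<Rightarrow> real.
     (\<forall>t\<ge>0. X t \<in> borel_measurable (canonical_filtration t)) \<and>
     sde_solution P m coord X \<and>
     (\<forall>Y. sde_solution P m coord Y \<longrightarrow> (AE \<omega> in P. \<forall>t\<ge>0. Y t \<omega> = X t \<omega>)) \<and>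
     process_law P (\<lambda>t \<omega>. (X t \<omega>, coord t \<omega>)) =
       process_law (P_H P g g0 (sde_h m) (sde_H m)) (\<lambda>t \<omega>. (coord t \<omega>, xi_H (sde_H m) t \<omega>))"
proof -
  obtain C where C: "\<forall>s\<ge>0. \<forall>a\<ge>0. m s a \<le> C" using assms(5) by blast
  obtain D where D: "\<forall>s\<ge>0. \<forall>a\<ge>0. 1 / m s a \<le> D" using assms(6) by blast
  obtain L where L: "\<forall>s\<ge>0. L-lipschitz_on {0..} (m s)" using assms(7) by blast
  \<comment> \<open>The maximum with 1 makes the Lipschitz constant positive, as the constant
    \<open>C / (2 * L)\<close> of the fixed-point argument divides by it.\<close>
  interpret sde_class_L P g g0 m C D "max L 1"
  proof unfold_locales
    show "(max L 1)-lipschitz_on {0..} (m s)" if "0 \<le> s" for s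
      using lipschitz_on_le[of L "{0..}" "m s" "max L 1"] L that by auto
  qed (use assms C D in auto)
  show ?thesis
    using sol_component_adapted sol_is_sde_solution[OF assms(1)] sol_process_law
    by (intro exI[of _ "\<lambda>t \<omega>. sol \<omega> t"]) blast
qed

end
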